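(* Let $\beta\in(0,2)$ and $d\in\mathbb{R}\setminus\mathbb{Z}$ with $d<1-2/\beta$. Let $p,q\in\mathbb{N}$, and let $\Phi_p(z)=1-\phi_1z-\dots-\phi_pz^p$ and $\Theta_q(z)=1+\theta_1z+\dots+\theta_qz^q$ be polynomials with real coefficients having no common roots, such that $\Phi_p$ has no roots in the closed unit disk $\{z\in\mathbb{C}:|z|\le1\}$. Let $(X_n)$ be the stable fractional ARIMA$(p,d,q)$ process, i.e. the solution of $$\Phi_p(B)X_n=\Theta_q(B)(1-B)^{-d}\epsilon_n,$$ where $(\epsilon_n)$ are independent and identically distributed symmetric $\beta$-stable random variables and $B$ is the backshift operator. Let $f\in C_b^2(\mathbb{R})$, $V_n=n^{-1/2}\sum_{t=1}^n(f(X_t)-\mathbb{E}[f(X_1)])$, $v_n=\sqrt{\mathrm{var}(V_n)}$, suppose that $v^2=\sum_{j\in\mathbb{Z}}\mathrm{cov}(f(X_0),f(X_j))$ satisfies $v^2>0$, and let $Z\sim\mathcal{N}(0,1)$. Then, for each $n\in\mathbb{N}$, $$d_W(v_n^{-1}V_n,Z)\le C\begin{cases}n^{-1/2} & \text{if }d<1-3/\beta,\\ n^{-1/2}\log(n) & \text{if }d=1-3/\beta,\\ n^{1-(1-d)\beta/2} & \text{if }d\in(1-3/\beta,1-2/\beta),\end{cases}$$ and $$d_K(v_n^{-1}V_n,Z)\le C\begin{cases}n^{-1/2} & \text{if }d<1-4/\beta,\\ n^{-1/2}\log(n) & \text{if }d=1-4/\beta,\\ n^{(1-(1-d)\beta/2)/2}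 & \text{if }d\in(1-4/\beta,1-2/\beta),\end{cases}$$ where $C>0$ is a constant not depending on $n$.
   Context: $C_b^2(\mathbb{R})$ is the space of twice continuously differentiable $f:\mathbb{R}\to\mathbb{R}$ with $f,f',f''$ bounded. The innovations $\epsilon_j$ and the process $X_n$ are indexed by $\mathbb{Z}$. The ARIMA equation is understood in the sense of Kokoszka and Taqqu: for $d<1-1/\beta$ its unique solution is the moving average $X_n=\sum_{j=-\infty}^n b_{n-j}\epsilon_j$, where $(b_j)_{j\ge0}$ are the coefficients of the power series $\sum_{j\ge0}b_jz^j=\Theta_q(z)(1-z)^{-d}/\Phi_p(z)$, $|z|<1$, and the series converges a.s. The Wasserstein distance is $d_W(F,G)=\sup_h|\mathbb{E}[h(F)]-\mathbb{E}[h(G)]|$, the supremum being over all functions $h:\mathbb{R}\to\mathbb{R}$ that are Lipschitz with constant at most $1$. The Kolmogorov distance is $d_K(F,G)=\sup_{x\in\mathbb{R}}|\mathbb{P}(F\le x)-\mathbb{P}(G\le x)|$.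
   Formalization: In the critical cases d=1-3/β (for d_W) and d=1-4/β (for d_K), the bound is claimed only for n≥2, because at n=1 the printed bound C n^{-1/2} log(n) is 0 while the bounded variable V_1/v_1 is not Gaussian. *)

theory Defs
  imports
    "HOL-Probability.Probability"
    "HOL-Complex_Analysis.Complex_Analysis"
    "HOL-Computational_Algebra.Computational_Algebra"
begin

definition C_b2 :: "(real \<Rightarrow> real) set" where
  "C_b2 = {f. bounded (range f) \<and>
     (\<exists>f' f''. (\<forall>x. (f has_real_derivative f' x) (at x)) \<and>
               (\<forall>x. (f' has_real_derivative f'' x) (at x)) \<and>
               continuous_on UNIV f'' \<and> bounded (range f') \<and> bounded (range f''))}"

text \<open>
  The scale \<open>\<sigma>\<close> is arbitrary but nonzero: point masses are not counted as stable laws.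
\<close>
definition symmetric_stable :: "real \<Rightarrow> real measure \<Rightarrow> bool" where
  "symmetric_stable \<beta> \<mu> \<longleftrightarrow> real_distribution \<mu> \<and>
     (\<exists>\<sigma>>0. \<forall>t. char \<mu> t = complex_of_real (exp (- ((\<sigma> * \<bar>t\<bar>) powr \<beta>))))"

definition iid_symmetric_stable ::
  "'a measure \<Rightarrow> real \<Rightarrow> (int \<Rightarrow> 'a \<Rightarrow> real) \<Rightarrow> bool" where
  "iid_symmetric_stable M \<beta> \<epsilon> \<longleftrightarrow>
     prob_space.indep_vars M (\<lambda>_. borel) \<epsilon> UNIV \<and>
     (\<forall>i j. distr M borel (\<epsilon> i) = distr M borel (\<epsilon> j)) \<and>
     (\<forall>i. symmetric_stable \<beta> (distr M borel (\<epsilon> i)))"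

definition ar_poly :: "nat \<Rightarrow> (nat \<Rightarrow> real) \<Rightarrow> real poly" where
  "ar_poly p \<phi> = 1 - (\<Sum>k=1..p. monom (\<phi> k) k)"

definition ma_poly :: "nat \<Rightarrow> (nat \<Rightarrow> real) \<Rightarrow> real poly" where
  "ma_poly q \<theta> = 1 + (\<Sum>k=1..q. monom (\<theta> k) k)"

abbreviation cpoly :: "real poly \<Rightarrow> complex \<Rightarrow> complex" where
  "cpoly P \<equiv> poly (map_poly complex_of_real P)"

text \<open>
  Since \<open>fps_binomial a\<close> is the series of \<open>(1 + z)\<^sup>a\<close>, the composition below is the series
  of \<open>(1 - z)\<^sup>-\<^sup>d\<close>. The lemma \<open>arima_coeff_sums\<close> identifies the coefficients
  with those of the analytic function on the unit disk.
\<close>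
definition arima_coeff :: "real poly \<Rightarrow> real poly \<Rightarrow> real \<Rightarrow> nat \<Rightarrow> real" where
  "arima_coeff \<Phi> \<Theta> d =
     fps_nth (fps_of_poly \<Theta> * (fps_binomial (- d) oo (- fps_X)) / fps_of_poly \<Phi>)"

definition fps_cor :: "real fps \<Rightarrow> complex fps" where
  "fps_cor F = Abs_fps (\<lambda>n. complex_of_real (fps_nth F n))"

lemma fps_cor_nth [simp]: "fps_nth (fps_cor F) n = complex_of_real (fps_nth F n)"
  by (simp add: fps_cor_def)

lemma fps_cor_mult: "fps_cor (F * G) = fps_cor F * fps_cor G"
  by (rule fps_ext) (simp add: fps_mult_nth)

lemma fps_cor_of_poly: "fps_cor (fps_of_poly P) = fps_of_poly (map_poly complex_of_real P)"
  by (rule fps_ext) (simp add: coeff_map_poly)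

lemma has_fps_expansion_cpoly: "cpoly P has_fps_expansion fps_cor (fps_of_poly P)"
proof -
  have "(\<lambda>z. \<Sum>i\<le>degree P. of_real (coeff P i) * z ^ i) has_fps_expansion
          (\<Sum>i\<le>degree P. fps_const (complex_of_real (coeff P i)) * fps_X ^ i)"
    by (intro fps_expansion_intros)
  also have "(\<lambda>z. \<Sum>i\<le>degree P. of_real (coeff P i) * z ^ i) = cpoly P"
    by (simp add: poly_altdef coeff_map_poly degree_map_poly fun_eq_iff)
  also have "(\<Sum>i\<le>degree P. fps_const (complex_of_real (coeff P i)) * fps_X ^ i)
               = fps_cor (fps_of_poly P)"
    by (rule fps_ext) (auto simp: fps_sum_nth if_distrib coeff_eq_0 cong: if_cong)
  finally show ?thesis .
qed

lemma arima_coeff_sums: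
  assumes \<Phi>: "\<And>z. cmod z \<le> 1 \<Longrightarrow> cpoly \<Phi> z \<noteq> 0" and z: "cmod z < 1"
  shows "(\<lambda>j. of_real (arima_coeff \<Phi> \<Theta> d j) * z ^ j) sums
           (cpoly \<Theta> z * (1 - z) powr (- of_real d) / cpoly \<Phi> z)"
proof -
  let ?g = "fps_binomial (- d) oo (- fps_X) :: real fps"
  let ?F = "\<lambda>z. cpoly \<Theta> z * (1 - z) powr (- of_real d) / cpoly \<Phi> z"
  have nz: "coeff \<Phi> 0 \<noteq> 0"
    using \<Phi>[of 0] by (simp add: poly_0_coeff_0 coeff_map_poly)
  have bin: "fps_cor ?g = fps_binomial (- of_real d) oo (- fps_X)"
  proof -
    have nth: "fps_nth (fps_binomial a oo (- fps_X)) n = (-1) ^ n * (a gchoose n)"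
      for a :: "'b::field_char_0" and n
    proof -
      have X: "- fps_X = (fps_const (- 1) * fps_X :: 'b fps)"
        by (rule fps_ext) simp
      show ?thesis
        unfolding X fps_compose_linear by simp
    qed
    show ?thesis
      by (rule fps_ext) (simp add: nth gbinomial_prod_rev)
  qed
  have "((\<lambda>z. (1 + z) powr (- of_real d)) \<circ> (\<lambda>z. - z)) has_fps_expansion
          (fps_binomial (- complex_of_real d) oo (- fps_X))"
    by (intro fps_expansion_intros) auto
  hence 1: "(\<lambda>z. (1 - z) powr (- of_real d)) has_fps_expansion fps_cor ?g"
    by (simp add: bin o_def)
  have "(\<lambda>z. cpoly \<Theta> z * (1 - z) powr (- of_real d) / cpoly \<Phi> z) has_fps_expansion
          fps_cor (fps_of_poly \<Theta>) * fps_cor ?g / fps_cor (fps_of_poly \<Phi>)"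
    by (intro has_fps_expansion_divide' has_fps_expansion_mult 1 has_fps_expansion_cpoly)
       (use nz in auto)
  also have "fps_cor (fps_of_poly \<Theta>) * fps_cor ?g / fps_cor (fps_of_poly \<Phi>)
               = fps_cor (fps_of_poly \<Theta> * ?g / fps_of_poly \<Phi>)"
  proof -
    have unit: "fps_of_poly \<Phi> \<noteq> 0" "fps_nth (fps_of_poly \<Phi>) 0 \<noteq> 0"
      using nz by auto
    have "(fps_of_poly \<Theta> * ?g / fps_of_poly \<Phi>) * fps_of_poly \<Phi> = fps_of_poly \<Theta> * ?g"
      using unit by (simp add: fps_divide_unit inverse_mult_eq_1 mult.assoc)
    hence "fps_cor (fps_of_poly \<Theta> * ?g / fps_of_poly \<Phi>) * fps_cor (fps_of_poly \<Phi>)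
             = fps_cor (fps_of_poly \<Theta>) * fps_cor ?g"
      by (metis fps_cor_mult)
    moreover have "fps_cor (fps_of_poly \<Phi>) \<noteq> 0"
      using nz by (metis fps_cor_nth fps_of_poly_nth fps_zero_nth of_real_eq_0_iff)
    ultimately show ?thesis
      by (metis nonzero_mult_div_cancel_right)
  qed
  finally have exp: "?F has_fps_expansion fps_cor (fps_of_poly \<Theta> * ?g / fps_of_poly \<Phi>)" .
  have nonpos: "1 - w \<notin> \<real>\<^sub>\<le>\<^sub>0" if "cmod w < 1" for w
    using that abs_Re_le_cmod[of w] by (auto simp: complex_nonpos_Reals_iff)
  have hol: "?F holomorphic_on eball 0 1"
    using \<Phi> nonpos by (intro holomorphic_intros) (auto simp: in_eball_iff less_imp_le)
  show ?thesis
    using has_fps_expansion_imp_sums_complex[OF exp hol, of z] z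
    by (simp add: arima_coeff_def)
qed

text \<open>
  The equation \<open>\<Phi>(B) X\<^sub>n = \<Theta>(B) (1 - B)\<^sup>-\<^sup>d \<epsilon>\<^sub>n\<close> is understood
  in the sense of Kokoszka and Taqqu, i.e. as the causal moving average
  \<open>X\<^sub>n = (\<Sum>j\<le>n. b\<^sub>n\<^sub>-\<^sub>j \<epsilon>\<^sub>j)\<close>, reindexed here by the lag.
\<close>
definition fractional_arima ::
  "'a measure \<Rightarrow> real poly \<Rightarrow> real poly \<Rightarrow> real \<Rightarrow>
     (int \<Rightarrow> 'a \<Rightarrow> real) \<Rightarrow> (int \<Rightarrow> 'a \<Rightarrow> real) \<Rightarrow> bool" where
  "fractional_arima M \<Phi> \<Theta> d \<epsilon> X \<longleftrightarrow>
     (\<forall>n. X n \<in> borel_measurable M \<and>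
          (AE \<omega> in M. (\<lambda>j. arima_coeff \<Phi> \<Theta> d j * \<epsilon> (n - int j) \<omega>) sums X n \<omega>))"

definition cov :: "'a measure \<Rightarrow> ('a \<Rightarrow> real) \<Rightarrow> ('a \<Rightarrow> real) \<Rightarrow> real" where
  "cov M F G = (\<integral>\<omega>. (F \<omega> - (\<integral>\<omega>'. F \<omega>' \<partial>M)) * (G \<omega> - (\<integral>\<omega>'. G \<omega>' \<partial>M)) \<partial>M)"

text \<open>
  The supremum is taken in the extended reals, so that it is never a default value. As
  non-integrable functions have Bochner integral \<open>0\<close>, the definition is only meaningful
  for integrable \<open>F\<close> and \<open>G\<close>.
\<close>
definition wasserstein_dist ::
  "'a measure \<Rightarrow> ('a \<Rightarrow> real) \<Rightarrow> 'b measure \<Rightarrow> ('b \<Rightarrow> real) \<Rightarrow> ereal" where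
  "wasserstein_dist M F N G =
     (SUP h \<in> {h. 1-lipschitz_on UNIV h}.
        ereal \<bar>(\<integral>\<omega>. h (F \<omega>) \<partial>M) - (\<integral>\<omega>. h (G \<omega>) \<partial>N)\<bar>)"

definition kolmogorov_dist ::
  "'a measure \<Rightarrow> ('a \<Rightarrow> real) \<Rightarrow> 'b measure \<Rightarrow> ('b \<Rightarrow> real) \<Rightarrow> ereal" where
  "kolmogorov_dist M F N G =
     (SUP x. ereal \<bar>measure M {\<omega> \<in> space M. F \<omega> \<le> x} - measure N {\<omega> \<in> space N. G \<omega> \<le> x}\<bar>)"

text \<open>
  In the critical cases the rates vanish at \<open>n = 1\<close>, where no bound by a multiple
  of them can hold: \<open>f(X\<^sub>1)\<close> is bounded and hence not Gaussian.
\<close>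
definition wasserstein_rate :: "real \<Rightarrow> real \<Rightarrow> nat \<Rightarrow> real" where
  "wasserstein_rate \<beta> d n =
     (if d < 1 - 3 / \<beta> then real n powr (- 1 / 2)
      else if d = 1 - 3 / \<beta> then real n powr (- 1 / 2) * ln (real n)
      else real n powr (1 - (1 - d) * \<beta> / 2))"

definition kolmogorov_rate :: "real \<Rightarrow> real \<Rightarrow> nat \<Rightarrow> real" where
  "kolmogorov_rate \<beta> d n =
     (if d < 1 - 4 / \<beta> then real n powr (- 1 / 2)
      else if d = 1 - 4 / \<beta> then real n powr (- 1 / 2) * ln (real n)
      else real n powr ((1 - (1 - d) * \<beta> / 2) / 2))"

end

theory Submission
  imports Defs "HOL-Real_Asymp.Real_Asymp"
begin

text \<open>
  The bounds follow from Stein's method for functions of many independent variables. The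
  innovations enter only through the tail \<open>P(\<bar>\<epsilon>\<bar> \<ge> u) \<le> K u\<^sup>-\<^sup>\<beta>\<close> (\<open>stable_tail\<close>) and
  the process only through the decay \<open>\<bar>b\<^sub>k\<bar> \<le> K k\<^sup>-\<^sup>\<gamma>\<close>, \<open>\<gamma> = 1 - d\<close>, of its coefficients
  (\<open>arima_coeff_decay\<close>).

  Replacing the innovation \<open>\<epsilon>\<^sub>j\<close> by an independent copy changes \<open>f(X\<^sub>t)\<close> by at most a constant
  times \<open>min(1, \<bar>b\<^sub>t\<^sub>-\<^sub>j\<bar> u)\<close>, where \<open>u\<close> is the sum of the sizes of the old and the new value.
  Since \<open>f\<close> has two bounded derivatives, replacing two innovations changes it to second order by
  at most the product of two such terms. Summed over \<open>t\<close>, the effect of one innovation is at most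
  a multiple of \<open>R = 1 + u\<^bsup>1/\<gamma>\<^esup>\<close>, as a jump is noticed at about that many times (\<open>sum_clip_le\<close>).
  This variable has tails \<open>P(R > s) = O(s\<^sup>-\<^sup>\<alpha>)\<close> with \<open>\<alpha> = (1 - d) \<beta>\<close>. The assumption \<open>d < 1 - 2/\<beta>\<close>
  says that \<open>\<alpha> > 2\<close>, so that \<open>R\<close> is square integrable, and the regimes of the two rates are those
  of the truncated third and fourth moments of \<open>R\<close> (\<open>truncated_moment\<close>).

  Let \<open>W\<close> be the normalised sum, \<open>W'\<^sub>j\<close> the sum with the \<open>j\<close>th innovation replaced, and
  \<open>\<Delta>\<^sub>j = W - W'\<^sub>j\<close>. If the innovations are replaced one after the other, \<open>W\<close> is changed in steps
  \<open>\<delta>\<^sub>j\<close>, and \<open>2 E[W g(W)] = \<Sum>\<^sub>j E[\<delta>\<^sub>j (g(W) - g(W'\<^sub>j))]\<close> (\<open>stein_identity\<close>). With the solution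
  \<open>g\<close> of Stein's equation this has to be compared with \<open>2 E[g'(W)]\<close>.

  For a Lipschitz test function, \<open>g'\<close> is Lipschitz. The derivative can be taken at a point that
  does not depend on the \<open>j\<close>th innovation, and \<open>\<delta>\<^sub>j \<Delta>\<^sub>j\<close> may be averaged over it. The sum of the
  averaged products has variance \<open>O(1/n)\<close> by the Efron--Stein inequality, although the products
  themselves need not be square integrable (\<open>averaged_variance\<close>). The remainder is a multiple of
  \<open>E[R\<^sup>2 min(1, R/\<surd>n)]\<close>; the outcome is \<open>normal_approx_smooth\<close>.

  For a half-line, \<open>g'\<close> jumps. The products are truncated at \<open>R \<le> \<surd>n\<close>, and the variance of
  their sum is at most of order \<open>(1 + E[R\<^sup>4; R \<le> \<surd>n])/n\<close> (\<open>sum_variance\<close>); the other jumps cost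
  \<open>E[R\<^sup>2; R > \<surd>n]\<close>. The Taylor error is estimated without any concentration inequality: it
  consists of increments of monotone functions, and by symmetry under the exchange of both copies
  of an innovation its sum is bounded by the standard deviation of \<open>\<Sum>\<^sub>j \<bar>\<delta>\<^sub>j\<bar> \<Delta>\<^sub>j\<close>, truncated in the same
  way (\<open>normal_approx_halfline\<close>).

  All this is done for moving averages with finitely many coefficients, with constants that do
  not depend on their number (\<open>uniform_bounds\<close>), so that the number can tend to infinity
  (\<open>normal_approximation\<close>). Positivity of the long-run variance makes the variance of the sum
  grow at least linearly, for large \<open>n\<close>; the finitely many other \<open>n\<close> only affect the constant.
\<close>

section \<open>Stein's equation for the standard normal law\<close>

text \<open>
  A comparison argument for solutions of \<open>K' = x K + k\<close> that are of smaller order than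
  \<open>exp (x\<^sup>2 / 2)\<close>: both \<open>\<plusminus> K x exp (- x\<^sup>2 / 2) - (a / x + b) exp (- x\<^sup>2 / 2)\<close> increase
  on the positive half-line, since the derivative of the second term dominates
  \<open>\<bar>k\<bar> exp (- x\<^sup>2 / 2)\<close>, and they tend to \<open>0\<close>. Hence they are at most \<open>0\<close>.
\<close>
lemma gauss_sandwich_at_top:
  fixes K k :: "real \<Rightarrow> real"
  assumes K: "\<And>x. (K has_real_derivative x * K x + k x) (at x)"
    and k: "\<And>x. \<bar>k x\<bar> \<le> a + b * \<bar>x\<bar>" and ab: "0 \<le> a" "0 \<le> b"
    and lim: "((\<lambda>x. K x * exp (- x\<^sup>2 / 2)) \<longlongrightarrow> 0) at_top"
    and x: "x > 0"
  shows "\<bar>K x\<bar> \<le> a / x + b"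
proof -
  define e where "e = (\<lambda>x::real. exp (- x\<^sup>2 / 2))"
  have upper: "s * K x \<le> a / x + b" if s: "s = 1 \<or> s = -1" for s :: real
  proof -
    define F where "F = (\<lambda>x. s * (K x * e x) - (a / x + b) * e x)"
    have F': "(F has_real_derivative (s * k t + a + a / t\<^sup>2 + b * t) * e t) (at t)" if "t > 0" for t
      unfolding F_def e_def using that
      by (auto intro!: derivative_eq_intros K simp: field_simps power2_eq_square)
    have pos: "0 \<le> (s * k t + a + a / t\<^sup>2 + b * t) * e t" if "t > 0" for t
    proof -
      have "s * k t \<ge> - (a + b * t)" using s k[of t] that by auto
      moreover have "a / t\<^sup>2 \<ge> 0" using ab by simp
      ultimately show ?thesis by (simp add: e_def)
    qed
    have mono: "F x \<le> F y" if "x \<le> y" for y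
      using that
    proof (rule DERIV_nonneg_imp_nondecreasing)
      fix t assume "x \<le> t" "t \<le> y"
      thus "\<exists>y. (F has_real_derivative y) (at t) \<and> 0 \<le> y" using F'[of t] pos[of t] x by auto
    qed
    have limF: "(F \<longlongrightarrow> s * 0 - 0) at_top"
      unfolding F_def
    proof (intro tendsto_intros)
      show "((\<lambda>x. K x * e x) \<longlongrightarrow> 0) at_top" using lim by (simp add: e_def)
      show "((\<lambda>x. (a / x + b) * e x) \<longlongrightarrow> 0) at_top" unfolding e_def by real_asymp
    qed
    have "F x \<le> 0"
      by (rule tendsto_lowerbound[where F = at_top and f = F])
         (use limF mono in \<open>auto intro: eventually_mono[OF eventually_ge_at_top[of x]]\<close>)
    hence "(s * K x) * e x \<le> (a / x + b) * e x" by (simp add: F_def)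
    thus ?thesis by (simp add: e_def)
  qed
  show ?thesis using upper[of 1] upper[of "-1"] by auto
qed

text \<open>
  For \<open>\<bar>x\<bar> \<ge> 1\<close> this is the comparison bound and its mirror image. In between, the mean
  value theorem for \<open>K x exp (- x\<^sup>2 / 2)\<close> carries the bound at \<open>1\<close> inwards: the
  values there are at most \<open>3 (a + b)\<close>, and \<open>exp (1 / 2) \<le> 2\<close>.
\<close>
lemma gauss_sandwich:
  fixes K k :: "real \<Rightarrow> real"
  assumes K: "\<And>x. (K has_real_derivative x * K x + k x) (at x)"
    and k: "\<And>x. \<bar>k x\<bar> \<le> a + b * \<bar>x\<bar>" and ab: "0 \<le> a" "0 \<le> b"
    and lim: "((\<lambda>x. K x * exp (- x\<^sup>2 / 2)) \<longlongrightarrow> 0) at_top"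
             "((\<lambda>x. K x * exp (- x\<^sup>2 / 2)) \<longlongrightarrow> 0) at_bot"
  shows "\<bar>x * K x\<bar> \<le> a + b * \<bar>x\<bar>" "\<bar>K x\<bar> \<le> 6 * (a + b)"
proof -
  have large: "\<bar>K x\<bar> \<le> a / \<bar>x\<bar> + b" if "x \<noteq> 0" for x
  proof (cases "x > 0")
    case True
    thus ?thesis using gauss_sandwich_at_top[OF K k ab lim(1) True] by simp
  next
    case False
    \<comment> \<open>reflection: \<open>- K (- x)\<close> solves the equation with right-hand side \<open>k (- x)\<close>\<close>
    have "\<bar>- K (- (- x))\<bar> \<le> a / (- x) + b"
    proof (rule gauss_sandwich_at_top[of "\<lambda>x. - K (- x)" "\<lambda>x. k (- x)" a b "- x"])
      show "((\<lambda>x. - K (- x)) has_real_derivative y * - K (- y) + k (- y)) (at y)" for y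
        by (rule derivative_eq_intros DERIV_chain2[OF K] refl | simp)+
      show "\<bar>k (- y)\<bar> \<le> a + b * \<bar>y\<bar>" for y using k[of "- y"] by simp
      have "((\<lambda>x. - (K (- x) * exp (- (- x)\<^sup>2 / 2))) \<longlongrightarrow> - 0) at_top"
        by (intro tendsto_minus filterlim_compose[OF lim(2) filterlim_uminus_at_bot_at_top])
      thus "((\<lambda>x. - K (- x) * exp (- x\<^sup>2 / 2)) \<longlongrightarrow> 0) at_top" by simp
    qed (use ab False that in auto)
    thus ?thesis using False that by simp
  qed
  show "\<bar>x * K x\<bar> \<le> a + b * \<bar>x\<bar>"
  proof (cases "x = 0")
    case False
    have "\<bar>x * K x\<bar> \<le> \<bar>x\<bar> * (a / \<bar>x\<bar> + b)"
      unfolding abs_mult by (intro mult_left_mono large False) auto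
    also have "\<dots> = a + b * \<bar>x\<bar>" using False by (simp add: field_simps)
    finally show ?thesis .
  qed (use ab in auto)
  show "\<bar>K x\<bar> \<le> 6 * (a + b)"
  proof (cases "\<bar>x\<bar> \<ge> 1")
    case True
    have "\<bar>K x\<bar> \<le> a / \<bar>x\<bar> + b" using True by (intro large) auto
    also have "a / \<bar>x\<bar> \<le> a / 1" using True ab by (intro divide_left_mono) auto
    finally show ?thesis using ab by simp
  next
    case False
    define e where "e = (\<lambda>x::real. exp (- x\<^sup>2 / 2))"
    have D: "((\<lambda>x. K x * e x) has_real_derivative k t * e t) (at t)" for t
      unfolding e_def by (auto intro!: derivative_eq_intros K simp: algebra_simps)
    have "x < 1" using False by auto
    then obtain t where t: "x < t" "t < 1" "K 1 * e 1 - K x * e x = (1 - x) * (k t * e t)"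
      using MVT2[OF \<open>x < 1\<close> D] by blast
    have e1: "e s \<le> 1" "e s > 0" for s by (simp_all add: e_def)
    have "\<bar>k t\<bar> \<le> a + b * \<bar>t\<bar>" by (rule k)
    also have "\<dots> \<le> a + b * 1" using t False ab by (intro add_left_mono mult_left_mono) auto
    finally have kt: "\<bar>k t\<bar> \<le> a + b" by simp
    have "\<bar>K x * e x\<bar> \<le> \<bar>K 1 * e 1\<bar> + \<bar>(1 - x) * (k t * e t)\<bar>" using t(3) by linarith
    also have "\<bar>K 1 * e 1\<bar> \<le> (a + b) * 1" unfolding abs_mult
      using large[of 1] e1[of 1] ab by (intro mult_mono) auto
    also have "\<bar>(1 - x) * (k t * e t)\<bar> \<le> 2 * ((a + b) * 1)" unfolding abs_mult
      using kt e1[of t] False ab by (intro mult_mono) auto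
    finally have *: "\<bar>K x\<bar> * e x \<le> 3 * (a + b)" using e1(2)[of x] by (simp add: abs_mult)
    have "x\<^sup>2 \<le> 1" using False by (simp add: abs_square_le_1)
    hence "exp (- (1/2)) \<le> e x" by (simp add: e_def)
    moreover have "1 / 2 \<le> exp (- (1/2) :: real)"
      using exp_ge_add_one_self[of "- (1/2) :: real"] by simp
    ultimately have "1 / 2 \<le> e x" by linarith
    hence "\<bar>K x\<bar> * (1/2) \<le> \<bar>K x\<bar> * e x" by (intro mult_left_mono) auto
    thus ?thesis using * by simp
  qed
qed

text \<open>
  The fundamental theorem of calculus for Lebesgue integrals over half-lines. It gives the
  distribution function of the standard normal law as well as the solution of Stein's equation.
\<close>
lemma lborel_FTC:
  fixes w :: "real \<Rightarrow> real"
  assumes w: "integrable lborel w" and c: "continuous_on UNIV w"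
  defines "H \<equiv> (\<lambda>x. \<integral>t. indicator {..x} t * w t \<partial>lborel)"
  shows "(H has_real_derivative w x) (at x)"
    and "(H \<longlongrightarrow> (\<integral>t. w t \<partial>lborel)) at_top" and "(H \<longlongrightarrow> 0) at_bot"
proof -
  have int: "integrable lborel (\<lambda>t. indicator A t * w t)" if "A \<in> sets borel" for A
    using integrable_mult_indicator[OF _ w, of A] that by simp
  have int_eq: "(\<integral>t. indicator A t * w t \<partial>lborel) = (\<integral>t. indicator B t * w t \<partial>lborel)"
    if "A \<in> sets borel" "B \<in> sets borel" "A - {c} = B - {c}" for A B c
  proof (rule integral_cong_AE)
    show "AE t in lborel. indicator A t * w t = indicator B t * w t"
      using AE_lborel_singleton[of c]
    proof eventually_elim
      case (elim t)
      hence "t \<in> A \<longleftrightarrow> t \<in> B" using that(3) by blast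
      thus ?case by (simp add: indicator_def)
    qed
  qed (use int[OF that(1)] int[OF that(2)] in auto)
  have split: "H y = H (x - 1) + integral {x - 1..y} w" if "x - 1 \<le> y" for x y
  proof -
    have "set_integrable lborel {x - 1..y} w"
      unfolding set_integrable_def by (intro borel_integrable_compact continuous_on_subset[OF c]) auto
    hence "integral {x - 1..y} w = (LINT t:{x-1..y}|lborel. w t)"
      by (simp add: set_borel_integral_eq_integral)
    also have "\<dots> = (\<integral>t. indicator {x-1..y} t * w t \<partial>lborel)"
      by (simp add: set_lebesgue_integral_def)
    also have "\<dots> = (\<integral>t. indicator {x-1<..y} t * w t \<partial>lborel)"
      by (rule int_eq[where c = "x-1"]) auto
    finally have eq: "integral {x - 1..y} w = (\<integral>t. indicator {x-1<..y} t * w t \<partial>lborel)" .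
    have "H (x - 1) + (\<integral>t. indicator {x-1<..y} t * w t \<partial>lborel)
        = (\<integral>t. indicator {..x-1} t * w t + indicator {x-1<..y} t * w t \<partial>lborel)"
      unfolding H_def by (rule Bochner_Integration.integral_add[symmetric]) (rule int, simp)+
    also have "\<dots> = H y" unfolding H_def using that
      by (intro Bochner_Integration.integral_cong) (auto simp: indicator_def)
    finally show ?thesis by (simp add: eq)
  qed
  have "((\<lambda>y. integral {x - 1..y} w) has_real_derivative w x) (at x within {x-1..x+1})"
    by (rule integral_has_real_derivative) (auto intro: continuous_on_subset[OF c])
  hence "((\<lambda>y. integral {x - 1..y} w) has_real_derivative w x) (at x)"
    by (subst (asm) at_within_Icc_at) auto
  hence "((\<lambda>y. H (x - 1) + integral {x - 1..y} w) has_real_derivative w x) (at x)"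
    by (auto intro!: derivative_eq_intros)
  thus "(H has_real_derivative w x) (at x)"
    by (rule has_field_derivative_transform_within_open[where S = "{x-1<..}"]) (auto simp: split[symmetric])
  show top: "(H \<longlongrightarrow> (\<integral>t. w t \<partial>lborel)) at_top"
    using tendsto_integral_at_top[OF sets_lborel w] by (simp add: H_def)
  have w': "integrable lborel (\<lambda>t. w (- t))"
    using lborel_integrable_real_affine[OF w, of "-1" 0] by simp
  have "((\<lambda>x. (\<integral>t. w t \<partial>lborel) - (\<integral>t. indicator {..x} t * w (- t) \<partial>lborel)) \<longlongrightarrow> (\<integral>t. w t \<partial>lborel) - (\<integral>t. w (- t) \<partial>lborel)) at_top"
    using tendsto_integral_at_top[OF sets_lborel w'] by (intro tendsto_intros) simp
  moreover have "(\<integral>t. w t \<partial>lborel) = (\<integral>t. w (- t) \<partial>lborel)"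
    using lborel_integral_real_affine[of "-1" w 0] by simp
  moreover have "(\<integral>t. w t \<partial>lborel) - (\<integral>t. indicator {..x} t * w (- t) \<partial>lborel) = H (- x)" for x
  proof -
    have "(\<integral>t. indicator {..x} t * w (- t) \<partial>lborel) = (\<integral>t. indicator {..x} (- t) * w t \<partial>lborel)"
      using lborel_integral_real_affine[of "-1" "\<lambda>t. indicator {..x} (- t) * w t" 0] by simp
    also have "(\<lambda>t. indicator {..x} (- t) * w t) = (\<lambda>t. indicator {- x..} t * w t)"
      by (auto simp: indicator_def)
    also have "(\<integral>t. w t \<partial>lborel) - (\<integral>t. indicator {- x..} t * w t \<partial>lborel) = (\<integral>t. indicator {..< -x} t * w t \<partial>lborel)"
    proof -
      have "(\<integral>t. w t \<partial>lborel) - (\<integral>t. indicator {- x..} t * w t \<partial>lborel)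
          = (\<integral>t. w t - indicator {- x..} t * w t \<partial>lborel)"
        by (rule Bochner_Integration.integral_diff[symmetric]) (rule w int, simp?)+
      also have "\<dots> = (\<integral>t. indicator {..< -x} t * w t \<partial>lborel)"
        by (intro Bochner_Integration.integral_cong) (auto simp: indicator_def)
      finally show ?thesis .
    qed
    also have "\<dots> = H (- x)" unfolding H_def
      by (rule int_eq[where c = "-x"]) auto
    finally show ?thesis .
  qed
  ultimately have "((\<lambda>x. H (- x)) \<longlongrightarrow> 0) at_top" by simp
  from filterlim_compose[OF this filterlim_uminus_at_top_at_bot] show "(H \<longlongrightarrow> 0) at_bot" by simp
qed

definition std_normal_cdf :: "real \<Rightarrow> real" where
  "std_normal_cdf x = (\<integral>t. indicator {..x} t * std_normal_density t \<partial>lborel)"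

lemma std_normal_density_deriv:
  "(std_normal_density has_real_derivative - x * std_normal_density x) (at x)"
proof -
  have "((\<lambda>x. 1 / sqrt (2 * pi) * exp (- x\<^sup>2 / 2)) has_real_derivative
      1 / sqrt (2 * pi) * (exp (- x\<^sup>2 / 2) * - x)) (at x)"
    by (intro DERIV_cmult DERIV_fun_exp) (auto intro!: derivative_eq_intros)
  thus ?thesis by (simp add: std_normal_density_def[abs_def] mult.commute)
qed

lemma std_normal_cdf:
  shows std_normal_cdf_deriv: "(std_normal_cdf has_real_derivative std_normal_density x) (at x)"
    and std_normal_cdf_at_top: "(std_normal_cdf \<longlongrightarrow> 1) at_top"
    and std_normal_cdf_at_bot: "(std_normal_cdf \<longlongrightarrow> 0) at_bot"
proof -
  have i: "integrable lborel std_normal_density" by simp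
  have c: "continuous_on UNIV std_normal_density"
    using std_normal_density_deriv by (intro DERIV_continuous_on) auto
  have eq: "std_normal_cdf = (\<lambda>x. \<integral>t. indicator {..x} t * std_normal_density t \<partial>lborel)"
    by (simp add: std_normal_cdf_def fun_eq_iff)
  show "(std_normal_cdf has_real_derivative std_normal_density x) (at x)"
       "(std_normal_cdf \<longlongrightarrow> 0) at_bot"
    unfolding eq by (rule lborel_FTC[OF i c])+
  have "(\<integral>t. std_normal_density t \<partial>lborel) = 1" by simp
  with lborel_FTC(2)[OF i c] show "(std_normal_cdf \<longlongrightarrow> 1) at_top" unfolding eq by simp
qed

lemma std_normal_cdf_minus: "std_normal_cdf (- x) = 1 - std_normal_cdf x"
proof -
  let ?s = "\<lambda>x. std_normal_cdf x + std_normal_cdf (- x)"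
  have "(?s has_real_derivative 0) (at t)" for t
  proof -
    have "((\<lambda>x. std_normal_cdf (- x)) has_real_derivative std_normal_density (- t) * - 1) (at t)"
      by (rule DERIV_chain2[OF std_normal_cdf_deriv]) (auto intro!: derivative_eq_intros)
    from DERIV_add[OF std_normal_cdf_deriv this] show ?thesis by (simp add: std_normal_density_def)
  qed
  hence const: "?s t = ?s x" for t using DERIV_isconst_all[of ?s t x] by blast
  have "(?s \<longlongrightarrow> 1 + 0) at_top"
    by (intro tendsto_add std_normal_cdf_at_top
        filterlim_compose[OF std_normal_cdf_at_bot filterlim_uminus_at_bot_at_top])
  moreover have "(?s \<longlongrightarrow> ?s x) at_top" by (rule tendsto_eventually) (intro always_eventually allI const)
  ultimately have "?s x = 1 + 0" by (intro tendsto_unique) auto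
  thus ?thesis by simp
qed

lemma std_normal_cdf_bounds: "0 \<le> std_normal_cdf x" "std_normal_cdf x \<le> 1"
proof -
  show nonneg: "0 \<le> std_normal_cdf x" for x unfolding std_normal_cdf_def
    by (intro Bochner_Integration.integral_nonneg) auto
  show "std_normal_cdf x \<le> 1" using nonneg[of "- x"] std_normal_cdf_minus[of x] by simp
qed

text \<open>
  Up to the reflection \<open>x \<mapsto> - x\<close> this is the classical Mills ratio. It is the solution of
  \<open>K' = x K + 1\<close> that decays at \<open>- \<infinity>\<close>, and so the building block of the solution of
  Stein's equation for half-lines.
\<close>
definition mills :: "real \<Rightarrow> real" where
  "mills x = std_normal_cdf x / std_normal_density x"

lemma std_normal_density_positive: "std_normal_density x > 0" by (simp add: std_normal_density_def)

lemma mills_deriv: "(mills has_real_derivative x * mills x + 1) (at x)"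
proof -
  have "std_normal_density x \<noteq> 0" using std_normal_density_positive[of x] by linarith
  thus ?thesis unfolding mills_def[abs_def]
    by (auto intro!: derivative_eq_intros std_normal_cdf_deriv std_normal_density_deriv simp: field_simps)
qed

lemma mills_nonneg: "mills x \<ge> 0"
  unfolding mills_def using std_normal_cdf_bounds std_normal_density_positive[of x] by simp

text \<open>
  Only negative \<open>x\<close> matter. There, this is the classical lower bound for the Gaussian tail:
  \<open>std_normal_cdf x + x / (1 + x\<^sup>2) * std_normal_density x\<close> vanishes at \<open>- \<infinity>\<close> and has
  a positive derivative. The inequality says that \<open>x * mills x\<close> has a nonnegative derivative.
\<close>
lemma mills_lower: "(1 + x\<^sup>2) * mills x + x \<ge> 0"
proof (cases "x \<ge> 0")
  case False
  define F where "F = (\<lambda>x. std_normal_cdf x + x / (1 + x\<^sup>2) * std_normal_density x)"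
  have nz: "1 + t\<^sup>2 \<noteq> 0" for t :: real using zero_le_power2[of t] by linarith
  have F': "(F has_real_derivative 2 / (1 + t\<^sup>2)\<^sup>2 * std_normal_density t) (at t)" for t
  proof -
    have "(F has_real_derivative std_normal_density t + ((1 * (1 + t\<^sup>2) - t * (2 * t)) / ((1 + t\<^sup>2) * (1 + t\<^sup>2))
        * std_normal_density t + (- t * std_normal_density t) * (t / (1 + t\<^sup>2)))) (at t)"
      unfolding F_def
      by (rule derivative_eq_intros std_normal_cdf_deriv std_normal_density_deriv nz refl | simp)+
    also have "std_normal_density t + ((1 * (1 + t\<^sup>2) - t * (2 * t)) / ((1 + t\<^sup>2) * (1 + t\<^sup>2))
        * std_normal_density t + (- t * std_normal_density t) * (t / (1 + t\<^sup>2))) =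
        (1 + (1 * (1 + t\<^sup>2) - t * (2 * t)) / ((1 + t\<^sup>2) * (1 + t\<^sup>2)) - t * (t / (1 + t\<^sup>2))) * std_normal_density t"
      by (simp add: algebra_simps)
    also have "1 + (1 * (1 + t\<^sup>2) - t * (2 * t)) / ((1 + t\<^sup>2) * (1 + t\<^sup>2)) - t * (t / (1 + t\<^sup>2)) = 2 / (1 + t\<^sup>2)\<^sup>2"
    proof -
      define q where "q = 1 + t\<^sup>2"
      have "1 * q - t * (2 * t) = 2 - q" "t * (t / q) = (q - 1) / q"
        by (simp_all add: q_def power2_eq_square)
      moreover have "q \<noteq> 0" using nz[of t] by (simp add: q_def)
      hence "1 + (2 - q) / (q * q) - (q - 1) / q = 2 / q\<^sup>2"
        by (simp add: field_simps power2_eq_square)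
      ultimately show ?thesis unfolding q_def[symmetric] by (simp only:)
    qed
    finally show ?thesis .
  qed
  have mono: "F y \<le> F x" if "y \<le> x" for y
    using that
  proof (rule DERIV_nonneg_imp_nondecreasing)
    fix t show "\<exists>y. (F has_real_derivative y) (at t) \<and> 0 \<le> y"
    proof (intro exI conjI)
      show "(F has_real_derivative 2 / (1 + t\<^sup>2)\<^sup>2 * std_normal_density t) (at t)" by (rule F')
      show "0 \<le> 2 / (1 + t\<^sup>2)\<^sup>2 * std_normal_density t"
        by (intro mult_nonneg_nonneg divide_nonneg_nonneg) simp_all
    qed
  qed
  have "((\<lambda>x. x / (1 + x\<^sup>2) * std_normal_density x) \<longlongrightarrow> 0) at_bot"
    unfolding std_normal_density_def by real_asymp
  hence "(F \<longlongrightarrow> 0 + 0) at_bot" unfolding F_def by (intro tendsto_add std_normal_cdf_at_bot)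
  hence "0 \<le> F x"
    using mono by (intro tendsto_upperbound[where F = at_bot and f = F])
      (auto intro: eventually_mono[OF eventually_le_at_bot[of x]])
  hence "0 \<le> F x / std_normal_density x * (1 + x\<^sup>2)" using std_normal_density_positive[of x] by auto
  also have "\<dots> = (1 + x\<^sup>2) * mills x + x"
  proof -
    have "(c + x / q * e) / e * q = q * (c / e) + x" if "q \<noteq> 0" "e \<noteq> 0" for c e q :: real
      using that by (simp add: field_simps)
    from this[OF nz[of x], of "std_normal_density x"] show ?thesis
      using std_normal_density_positive[of x] by (simp only: F_def mills_def)
  qed
  finally show ?thesis .
qed (use mills_nonneg in auto)

lemma mono_x_mills: "mono (\<lambda>x. x * mills x)"
proof (rule monoI)
  fix x y :: real assume "x \<le> y"
  thus "x * mills x \<le> y * mills y"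
  proof (rule DERIV_nonneg_imp_nondecreasing)
    fix t
    have "((\<lambda>x. x * mills x) has_real_derivative ((1 + t\<^sup>2) * mills t + t)) (at t)"
      by (auto intro!: derivative_eq_intros mills_deriv simp: algebra_simps power2_eq_square)
    with mills_lower[of t]
    show "\<exists>y. ((\<lambda>x. x * mills x) has_real_derivative y) (at t) \<and> 0 \<le> y" by blast
  qed
qed

text \<open>
  The upper companion: \<open>- std_normal_density x / x - std_normal_cdf x\<close> vanishes at
  \<open>- \<infinity>\<close> and increases on the negative half-line.
\<close>
lemma x_mills_ge: "x * mills x \<ge> -1"
proof (cases "x < 0")
  case True
  define F where "F = (\<lambda>x. - (std_normal_density x / x) - std_normal_cdf x)"
  have F': "(F has_real_derivative std_normal_density t / t\<^sup>2) (at t)" if "t < 0" for t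
    unfolding F_def using that
    by (auto intro!: derivative_eq_intros std_normal_cdf_deriv std_normal_density_deriv simp: field_simps power2_eq_square)
  have mono: "F y \<le> F x" if "y \<le> x" for y
    using that
  proof (rule DERIV_nonneg_imp_nondecreasing)
    fix t assume "y \<le> t" "t \<le> x"
    thus "\<exists>y. (F has_real_derivative y) (at t) \<and> 0 \<le> y"
      using F'[of t] std_normal_density_positive[of t] True by (intro exI conjI) auto
  qed
  have "((\<lambda>x. - (std_normal_density x / x)) \<longlongrightarrow> 0) at_bot"
    unfolding std_normal_density_def by real_asymp
  hence "(F \<longlongrightarrow> 0 - 0) at_bot" unfolding F_def by (intro tendsto_diff std_normal_cdf_at_bot)
  hence "0 \<le> F x"
    using mono by (intro tendsto_upperbound[where F = at_bot and f = F])
      (auto intro: eventually_mono[OF eventually_le_at_bot[of x]])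
  thus ?thesis using True std_normal_density_positive[of x]
    by (simp add: F_def mills_def field_simps)
next
  case False
  hence "0 \<le> x * mills x" using mills_nonneg[of x] by simp
  thus ?thesis by linarith
qed

text \<open>
  Stein's equation \<open>g' x - x g x = indicator {..z} x - std_normal_cdf z\<close>. The right-hand side
  jumps at \<open>z\<close>, so \<open>g'\<close> is not continuous and there is no quadratic Taylor estimate. But
  \<open>g'\<close> is \<open>\<phi> x = x g x\<close>, which is increasing, plus a decreasing indicator, plus a constant;
  the first-order error is therefore bounded by increments of two monotone functions.
\<close>
lemma stein_halfline:
  obtains g \<phi> :: "real \<Rightarrow> real"
  where "continuous_on UNIV g" "mono \<phi>" "\<And>x. \<bar>\<phi> x\<bar> \<le> 1" "\<And>x. \<phi> x = x * g x"
    "\<And>a b. \<bar>g b - g a - (\<phi> a + indicator {..z} a - std_normal_cdf z) * (b - a)\<bar>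
        \<le> \<bar>b - a\<bar> * (\<bar>\<phi> b - \<phi> a\<bar> + \<bar>indicator {..z} b - indicator {..z} a\<bar>)"
proof -
  define p where "p = std_normal_cdf z"
  have p: "0 \<le> p" "p \<le> 1" by (simp_all add: p_def std_normal_cdf_bounds)
  \<comment> \<open>the two branches solve the equation on either side of \<open>z\<close> and agree at \<open>z\<close>\<close>
  define gl where "gl = (\<lambda>x. (1 - p) * mills x)"
  define gr where "gr = (\<lambda>x. p * mills (- x))"
  define g where "g = (\<lambda>x. if x \<le> z then gl x else gr x)"
  define \<phi> where "\<phi> = (\<lambda>x. x * g x)"
  have glr: "gl z = gr z"
    by (simp add: gl_def gr_def mills_def p_def std_normal_cdf_minus) (simp add: std_normal_density_def)
  have gl': "(gl has_real_derivative x * gl x + 1 - p) (at x)" for x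
    unfolding gl_def by (auto intro!: derivative_eq_intros mills_deriv simp: algebra_simps)
  have gr': "(gr has_real_derivative x * gr x - p) (at x)" for x
  proof -
    have "((\<lambda>x. mills (- x)) has_real_derivative (- x * mills (- x) + 1) * - 1) (at x)"
      by (rule DERIV_chain2[OF mills_deriv]) (auto intro!: derivative_eq_intros)
    from DERIV_cmult[OF this, of p] show ?thesis unfolding gr_def by (simp add: algebra_simps)
  qed
  have cont: "continuous_on UNIV g"
  proof -
    have "continuous_on ({..z} \<union> {z..}) g" unfolding g_def
    proof (rule continuous_on_cases)
      show "continuous_on {..z} gl"
        by (rule DERIV_continuous_on) (rule has_field_derivative_at_within[OF gl'])
      show "continuous_on {z..} gr"
        by (rule DERIV_continuous_on) (rule has_field_derivative_at_within[OF gr'])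
    qed (use glr in auto)
    also have "{..z} \<union> {z..} = UNIV" by auto
    finally show ?thesis .
  qed
  have ml: "x * gl x \<le> y * gl y" if "x \<le> y" for x y
  proof -
    have "t * gl t = (1 - p) * (t * mills t)" for t by (simp add: gl_def)
    moreover have "(1 - p) * (x * mills x) \<le> (1 - p) * (y * mills y)"
      using monoD[OF mono_x_mills that] p by (intro mult_left_mono) auto
    ultimately show ?thesis by (simp only:)
  qed
  have mr: "x * gr x \<le> y * gr y" if "x \<le> y" for x y
  proof -
    have "t * gr t = - (p * (- t * mills (- t)))" for t by (simp add: gr_def)
    moreover have "p * (- y * mills (- y)) \<le> p * (- x * mills (- x))"
      using monoD[OF mono_x_mills, of "-y" "-x"] that p by (intro mult_left_mono) auto
    ultimately show ?thesis by (simp only: neg_le_iff_le)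
  qed
  have mono: "mono \<phi>"
  proof (rule monoI)
    fix x y :: real assume xy: "x \<le> y"
    show "\<phi> x \<le> \<phi> y"
      using ml[of x y] mr[of x y] ml[of x z] mr[of z y] glr xy unfolding \<phi>_def g_def by auto
  qed
  have bound: "\<bar>\<phi> x\<bar> \<le> 1" for x
  proof -
    have l: "\<phi> t \<ge> -1" if "t \<le> z" for t
    proof -
      have "t * gl t = (1 - p) * (t * mills t)" by (simp add: gl_def)
      also have "\<dots> \<ge> (1 - p) * (-1)" using p x_mills_ge by (intro mult_left_mono) auto
      finally show ?thesis using p that by (simp add: \<phi>_def g_def)
    qed
    have r: "\<phi> t \<le> 1" if "t \<ge> z" for t
    proof -
      have "t * gr t = p * - ((- t) * mills (- t))" by (simp add: gr_def)
      also have "\<dots> \<le> p * 1" using p x_mills_ge[of "- t"] by (intro mult_left_mono) auto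
      finally show ?thesis using p that glr by (auto simp: \<phi>_def g_def)
    qed
    show ?thesis using l[of "min x z"] r[of "max x z"] monoD[OF mono, of "min x z" x] monoD[OF mono, of x "max x z"]
      by auto
  qed
  define \<psi> where "\<psi> = (\<lambda>x. \<phi> x + indicator {..z} x - p)"
  let ?D = "\<lambda>a b. \<bar>\<phi> b - \<phi> a\<bar> + \<bar>indicator {..z} b - indicator {..z} a :: real\<bar>"
  have mvtl: "\<exists>\<xi>. a < \<xi> \<and> \<xi> < b \<and> g b - g a = (b - a) * \<psi> \<xi>" if "a < b" "b \<le> z" for a b
  proof -
    obtain \<xi> where "a < \<xi>" "\<xi> < b" "gl b - gl a = (b - a) * (\<xi> * gl \<xi> + 1 - p)"
      using MVT2[OF \<open>a < b\<close> gl'] by blast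
    thus ?thesis using that by (intro exI[of _ \<xi>]) (auto simp: g_def \<psi>_def \<phi>_def)
  qed
  have mvtr: "\<exists>\<xi>. a < \<xi> \<and> \<xi> < b \<and> g b - g a = (b - a) * \<psi> \<xi>" if "a < b" "z \<le> a" for a b
  proof -
    obtain \<xi> where \<xi>: "a < \<xi>" "\<xi> < b" "gr b - gr a = (b - a) * (\<xi> * gr \<xi> - p)"
      using MVT2[OF \<open>a < b\<close> gr'] by blast
    have "g a = gr a" using that glr by (cases "a = z") (auto simp: g_def)
    with \<xi> show ?thesis using that by (intro exI[of _ \<xi>]) (auto simp: g_def \<psi>_def \<phi>_def)
  qed
  have close: "\<bar>\<psi> \<xi> - \<psi> c\<bar> \<le> ?D a b" if "a \<le> \<xi>" "\<xi> \<le> b" "c = a \<or> c = b" for a b c \<xi>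
    using monoD[OF mono that(1)] monoD[OF mono that(2)] that
    unfolding \<psi>_def by (auto simp: indicator_def)
  \<comment> \<open>if \<open>z\<close> lies between the two points, the increment is split there\<close>
  have main: "\<exists>r1 r2 u v. g b - g a = r1 * u + r2 * v \<and> r1 \<ge> 0 \<and> r2 \<ge> 0 \<and> r1 + r2 = b - a \<and>
      \<bar>u - \<psi> c\<bar> \<le> ?D a b \<and> \<bar>v - \<psi> c\<bar> \<le> ?D a b" if ab: "a < b" "c = a \<or> c = b" for a b c
  proof -
    consider "b \<le> z" | "z \<le> a" | "a < z" "z < b" by linarith
    thus ?thesis
    proof cases
      case 1
      then obtain \<xi> where "a < \<xi>" "\<xi> < b" "g b - g a = (b - a) * \<psi> \<xi>" using mvtl ab by blast
      thus ?thesis using close[of a \<xi> b c] ab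
        by (intro exI[of _ "b - a"] exI[of _ 0] exI[of _ "\<psi> \<xi>"]) auto
    next
      case 2
      then obtain \<xi> where "a < \<xi>" "\<xi> < b" "g b - g a = (b - a) * \<psi> \<xi>" using mvtr ab by blast
      thus ?thesis using close[of a \<xi> b c] ab
        by (intro exI[of _ "b - a"] exI[of _ 0] exI[of _ "\<psi> \<xi>"]) auto
    next
      case 3
      obtain \<xi> where \<xi>: "a < \<xi>" "\<xi> < z" "g z - g a = (z - a) * \<psi> \<xi>" using mvtl 3 by blast
      obtain \<eta> where \<eta>: "z < \<eta>" "\<eta> < b" "g b - g z = (b - z) * \<psi> \<eta>" using mvtr 3 by blast
      have "g b - g a = (z - a) * \<psi> \<xi> + (b - z) * \<psi> \<eta>" using \<xi> \<eta> by linarith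
      moreover have "\<bar>\<psi> \<xi> - \<psi> c\<bar> \<le> ?D a b" by (rule close) (use ab 3 \<xi> in linarith)+
      moreover have "\<bar>\<psi> \<eta> - \<psi> c\<bar> \<le> ?D a b" by (rule close) (use ab 3 \<eta> in linarith)+
      ultimately show ?thesis using 3
        by (intro exI[of _ "z - a"] exI[of _ "b - z"] exI[of _ "\<psi> \<xi>"] exI[of _ "\<psi> \<eta>"] conjI; linarith)
    qed
  qed
  have final: "\<bar>g b - g a - \<psi> c * (b - a)\<bar> \<le> (b - a) * ?D a b" if ab: "a < b" "c = a \<or> c = b" for a b c
  proof -
    obtain r1 r2 u v where r: "g b - g a = r1 * u + r2 * v" "r1 \<ge> 0" "r2 \<ge> 0" "r1 + r2 = b - a"
      "\<bar>u - \<psi> c\<bar> \<le> ?D a b" "\<bar>v - \<psi> c\<bar> \<le> ?D a b" using main[OF ab] by blast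
    have "g b - g a - \<psi> c * (b - a) = r1 * (u - \<psi> c) + r2 * (v - \<psi> c)"
      unfolding r(1) r(4)[symmetric] by (simp add: algebra_simps)
    also have "\<bar>\<dots>\<bar> \<le> r1 * ?D a b + r2 * ?D a b"
      using r by (intro order_trans[OF abs_triangle_ineq] add_mono) (auto simp: abs_mult intro!: mult_left_mono)
    also have "\<dots> = (b - a) * ?D a b" using r(4) by (simp add: algebra_simps flip: r(4))
    finally show ?thesis .
  qed
  show ?thesis
  proof (rule that[OF cont mono bound])
    show "\<phi> x = x * g x" for x by (simp add: \<phi>_def)
    fix a b :: real
    show "\<bar>g b - g a - (\<phi> a + indicator {..z} a - std_normal_cdf z) * (b - a)\<bar>
        \<le> \<bar>b - a\<bar> * (\<bar>\<phi> b - \<phi> a\<bar> + \<bar>indicator {..z} b - indicator {..z} a\<bar>)"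
    proof (cases a b rule: linorder_cases)
      case less
      thus ?thesis using final[of a b a] by (simp add: \<psi>_def p_def)
    next
      case greater
      have "\<bar>g b - g a - \<psi> a * (b - a)\<bar> = \<bar>g a - g b - \<psi> a * (a - b)\<bar>"
        by (subst abs_minus_cancel[symmetric]) (simp add: algebra_simps)
      thus ?thesis using final[of b a a] greater by (simp add: \<psi>_def p_def abs_minus_commute)
    qed simp
  qed
qed

lemma lipschitz_growth:
  fixes h :: "real \<Rightarrow> real"
  assumes "1-lipschitz_on UNIV h"
  shows "\<bar>h x - h y\<bar> \<le> \<bar>x - y\<bar>"
  using lipschitz_onD[OF assms, of x y] by (simp add: dist_real_def)

lemma std_normal_abs_le:
  "integrable lborel (\<lambda>t. std_normal_density t * \<bar>t\<bar>)"
  "(\<integral>t. std_normal_density t * \<bar>t\<bar> \<partial>lborel) \<le> 1"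
proof -
  have i2: "integrable lborel (\<lambda>t. std_normal_density t * t\<^sup>2)"
    using integrable_std_normal_moment[of 2] by simp
  have v: "(\<integral>t. std_normal_density t * t\<^sup>2 \<partial>lborel) = 1"
    using integral_std_normal_moment_even[of 1] by (simp add: fact_numeral)
  show i1: "integrable lborel (\<lambda>t. std_normal_density t * \<bar>t\<bar>)"
    using integrable_std_normal_moment_abs[of 1] by simp
  have "(\<integral>t. std_normal_density t * \<bar>t\<bar> \<partial>lborel)
      \<le> (\<integral>t. (std_normal_density t + std_normal_density t * t\<^sup>2) / 2 \<partial>lborel)"
  proof (rule integral_mono)
    fix t :: real
    have "2 * \<bar>t\<bar> \<le> 1 + t\<^sup>2" using sum_squares_bound[of 1 "\<bar>t\<bar>"] by simp
    hence "std_normal_density t * (2 * \<bar>t\<bar>) \<le> std_normal_density t * (1 + t\<^sup>2)"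
      by (intro mult_left_mono) auto
    thus "std_normal_density t * \<bar>t\<bar> \<le> (std_normal_density t + std_normal_density t * t\<^sup>2) / 2"
      by (simp add: algebra_simps)
  qed (use i1 i2 in auto)
  also have "\<dots> = 1" using i2 v by simp
  finally show "(\<integral>t. std_normal_density t * \<bar>t\<bar> \<partial>lborel) \<le> 1" .
qed

abbreviation std_normal_mean :: "(real \<Rightarrow> real) \<Rightarrow> real" where
  "std_normal_mean h \<equiv> (\<integral>x. std_normal_density x * h x \<partial>lborel)"

lemma lipschitz_integrable_std_normal:
  fixes h :: "real \<Rightarrow> real"
  assumes h: "1-lipschitz_on UNIV h"
  shows "integrable lborel (\<lambda>t. std_normal_density t * h t)"
    and "\<bar>h x - std_normal_mean h\<bar> \<le> \<bar>x\<bar> + 1"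
proof -
  have c: "continuous_on UNIV h" using h lipschitz_on_continuous_on by blast
  hence m[measurable]: "h \<in> borel_measurable borel" by (rule borel_measurable_continuous_onI)
  note i1 = std_normal_abs_le(1)
  have ib: "integrable lborel (\<lambda>t. std_normal_density t * (b + \<bar>t\<bar>))" for b
    using i1 by (simp add: distrib_left)
  show i: "integrable lborel (\<lambda>t. std_normal_density t * h t)"
  proof (rule Bochner_Integration.integrable_bound[OF ib[of "\<bar>h 0\<bar>"]])
    show "AE t in lborel. norm (std_normal_density t * h t) \<le> norm (std_normal_density t * (\<bar>h 0\<bar> + \<bar>t\<bar>))"
    proof (intro AE_I2)
      fix t
      have "\<bar>h t\<bar> \<le> \<bar>h 0\<bar> + \<bar>t\<bar>" using lipschitz_growth[OF h, of t 0] by linarith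
      thus "norm (std_normal_density t * h t) \<le> norm (std_normal_density t * (\<bar>h 0\<bar> + \<bar>t\<bar>))"
        by (auto simp: abs_mult intro!: mult_left_mono)
    qed
  qed measurable
  have "h x - std_normal_mean h = (\<integral>t. std_normal_density t * (h x - h t) \<partial>lborel)"
    using i by (simp add: right_diff_distrib)
  also have "\<bar>\<dots>\<bar> \<le> (\<integral>t. std_normal_density t * (\<bar>x\<bar> + \<bar>t\<bar>) \<partial>lborel)"
  proof (rule order_trans[OF integral_abs_bound], rule integral_mono)
    show "integrable lborel (\<lambda>t. \<bar>std_normal_density t * (h x - h t)\<bar>)"
      using i by (intro integrable_abs) (simp add: right_diff_distrib)
    fix t
    have "\<bar>h x - h t\<bar> \<le> \<bar>x\<bar> + \<bar>t\<bar>" using lipschitz_growth[OF h, of x t] by linarith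
    thus "\<bar>std_normal_density t * (h x - h t)\<bar> \<le> std_normal_density t * (\<bar>x\<bar> + \<bar>t\<bar>)"
      by (auto simp: abs_mult intro!: mult_left_mono)
  qed (rule ib)
  also have "\<dots> = \<bar>x\<bar> + (\<integral>t. std_normal_density t * \<bar>t\<bar> \<partial>lborel)"
    using i1 by (simp add: distrib_left)
  also have "\<dots> \<le> \<bar>x\<bar> + 1" using std_normal_abs_le(2) by simp
  finally show "\<bar>h x - std_normal_mean h\<bar> \<le> \<bar>x\<bar> + 1" .
qed

text \<open>
  The solution \<open>g\<close> satisfies \<open>g' = x g + k\<close> with a centred \<open>k\<close> of linear growth, and its
  derivative satisfies an equation of the same form with \<open>g + h'\<close> in place of \<open>k\<close>. The
  comparison bound applies to both; this explains the constants \<open>12 = 6 * (1 + 1)\<close> and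
  \<open>78 = 6 * (12 + 1)\<close>.
\<close>
lemma stein_lipschitz:
  fixes h h' :: "real \<Rightarrow> real"
  assumes h: "1-lipschitz_on UNIV h" and h': "\<And>x. (h has_real_derivative h' x) (at x)"
  obtains g G where "\<And>x. (g has_real_derivative G x) (at x)" "\<And>x. \<bar>G x\<bar> \<le> 78"
    "\<And>x y. \<bar>G x - G y\<bar> \<le> 78 * \<bar>x - y\<bar>"
    "\<And>x. G x - x * g x = h x - std_normal_mean h"
proof -
  define k where "k = (\<lambda>x. h x - std_normal_mean h)"
  define w where "w = (\<lambda>x. std_normal_density x * k x)"
  define H where "H = (\<lambda>x. \<integral>t. indicator {..x} t * w t \<partial>lborel)"
  have k: "\<bar>k x\<bar> \<le> 1 + 1 * \<bar>x\<bar>" for x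
    using lipschitz_integrable_std_normal(2)[OF h, of x] by (simp add: k_def)
  have k': "(k has_real_derivative h' x) (at x)" for x
    unfolding k_def using h' by (auto intro!: derivative_eq_intros)
  have h1: "\<bar>h' x\<bar> \<le> 1" for x
  proof -
    have "((\<lambda>y. \<bar>(h y - h x) / (y - x)\<bar>) \<longlongrightarrow> \<bar>h' x\<bar>) (at x)"
      using h'[of x] by (intro tendsto_rabs) (simp add: has_field_derivative_iff)
    moreover have "\<bar>(h y - h x) / (y - x)\<bar> \<le> 1" for y
      using lipschitz_growth[OF h, of y x] by (cases "y = x") (auto simp: divide_le_eq)
    ultimately show ?thesis by (intro tendsto_upperbound[where F = "at x"]) auto
  qed
  have iw: "integrable lborel w" "(\<integral>t. w t \<partial>lborel) = 0"
    using lipschitz_integrable_std_normal(1)[OF h] by (simp_all add: w_def k_def right_diff_distrib)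
  have cw: "continuous_on UNIV w" unfolding w_def
    using std_normal_density_deriv k' by (intro continuous_intros DERIV_continuous_on) blast+
  note H = lborel_FTC[OF iw(1) cw, folded H_def]
  define g where "g = (\<lambda>x. H x / std_normal_density x)"
  have nz: "std_normal_density x \<noteq> 0" for x using std_normal_density_positive[of x] by simp
  have g': "(g has_real_derivative x * g x + k x) (at x)" for x
    unfolding g_def using nz[of x]
    by (auto intro!: derivative_eq_intros H(1) std_normal_density_deriv simp: w_def field_simps)
  have e: "exp (- x\<^sup>2 / 2) = sqrt (2 * pi) * std_normal_density x" for x :: real
    by (simp add: std_normal_density_def)
  have ge: "g x * exp (- x\<^sup>2 / 2) = sqrt (2 * pi) * H x" for x
    unfolding e g_def using nz[of x] by simp
  have gt: "((\<lambda>x. g x * exp (- x\<^sup>2 / 2)) \<longlongrightarrow> 0) at_top"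
    using tendsto_mult_left[OF H(2), of "sqrt (2 * pi)"] unfolding ge iw(2) by simp
  have gb: "((\<lambda>x. g x * exp (- x\<^sup>2 / 2)) \<longlongrightarrow> 0) at_bot"
    using tendsto_mult_left[OF H(3), of "sqrt (2 * pi)"] unfolding ge by simp
  have bg: "\<bar>g x\<bar> \<le> 12" for x
    using gauss_sandwich(2)[OF g' k _ _ gt gb, of x] by simp
  define G where "G = (\<lambda>x. x * g x + k x)"
  have G': "(G has_real_derivative x * G x + (g x + h' x)) (at x)" for x
    unfolding G_def by (auto intro!: derivative_eq_intros g' k')
  have bk: "\<bar>g x + h' x\<bar> \<le> 13 + 0 * \<bar>x\<bar>" for x using bg[of x] h1[of x] by simp
  have Ge: "\<bar>G x * exp (- x\<^sup>2 / 2)\<bar> \<le> (13 * \<bar>x\<bar> + 1) * exp (- x\<^sup>2 / 2)" for x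
  proof -
    have "\<bar>G x\<bar> \<le> \<bar>x\<bar> * \<bar>g x\<bar> + \<bar>k x\<bar>" unfolding G_def by (simp add: abs_mult order_trans[OF abs_triangle_ineq])
    also have "\<dots> \<le> \<bar>x\<bar> * 12 + (1 + 1 * \<bar>x\<bar>)" using bg k by (intro add_mono mult_left_mono) auto
    finally show ?thesis by (simp add: abs_mult)
  qed
  have Gt: "((\<lambda>x. G x * exp (- x\<^sup>2 / 2)) \<longlongrightarrow> 0) at_top"
  proof (rule Lim_null_comparison[where g = "\<lambda>x. (13 * \<bar>x\<bar> + 1) * exp (- x\<^sup>2 / 2)"])
    show "((\<lambda>x::real. (13 * \<bar>x\<bar> + 1) * exp (- x\<^sup>2 / 2)) \<longlongrightarrow> 0) at_top" by real_asymp
  qed (use Ge in auto)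
  have Gb: "((\<lambda>x. G x * exp (- x\<^sup>2 / 2)) \<longlongrightarrow> 0) at_bot"
  proof (rule Lim_null_comparison[where g = "\<lambda>x. (13 * \<bar>x\<bar> + 1) * exp (- x\<^sup>2 / 2)"])
    show "((\<lambda>x::real. (13 * \<bar>x\<bar> + 1) * exp (- x\<^sup>2 / 2)) \<longlongrightarrow> 0) at_bot" by real_asymp
  qed (use Ge in auto)
  have bG: "\<bar>G x\<bar> \<le> 78" "\<bar>x * G x\<bar> \<le> 13" for x
    using gauss_sandwich[OF G' bk _ _ Gt Gb, of x] by simp_all
  have lip: "\<bar>G x - G y\<bar> \<le> 78 * \<bar>x - y\<bar>" for x y
  proof -
    have *: "\<bar>G b - G a\<bar> \<le> 78 * (b - a)" if ab: "a < b" for a b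
    proof -
      obtain t where t: "G b - G a = (b - a) * (t * G t + (g t + h' t))"
        using MVT2[OF ab G'] by blast
      have "\<bar>t * G t + (g t + h' t)\<bar> \<le> 78" using bG(2)[of t] bk[of t] by simp
      hence "(b - a) * \<bar>t * G t + (g t + h' t)\<bar> \<le> (b - a) * 78" using ab by (intro mult_left_mono) auto
      thus ?thesis unfolding t using ab by (simp add: abs_mult)
    qed
    show ?thesis using *[of x y] *[of y x] by (cases x y rule: linorder_cases) (auto simp: abs_minus_commute)
  qed
  show ?thesis
    by (rule that[of g G]) (use g' bG lip in \<open>auto simp: G_def k_def\<close>)
qed

text \<open>
  The average of \<open>h\<close> over \<open>[x, x + \<eta>]\<close> is differentiable and close to \<open>h x\<close>.
\<close>
lemma lipschitz_smoothing:
  fixes h :: "real \<Rightarrow> real"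
  assumes h: "1-lipschitz_on UNIV h" and \<eta>: "\<eta> > 0"
  obtains k k' where "1-lipschitz_on UNIV k" "\<And>x. (k has_real_derivative k' x) (at x)"
    "\<And>x. \<bar>k x - h x\<bar> \<le> \<eta>"
proof -
  have "isCont h x" for x
    using lipschitz_on_continuous_on[OF h] by (simp add: continuous_on_eq_continuous_at)
  then obtain F where F: "(F has_real_derivative h x) (at x)" for x
    using einterval_antiderivative[of "-\<infinity>" "\<infinity>" h] by (auto simp: has_real_derivative_iff_has_vector_derivative)
  define k where "k = (\<lambda>x. (F (x + \<eta>) - F x) / \<eta>)"
  define k' where "k' = (\<lambda>x. (h (x + \<eta>) - h x) / \<eta>)"
  have deriv: "(k has_real_derivative k' x) (at x)" for x
  proof -
    have "((\<lambda>y. F (y + \<eta>)) has_real_derivative h (x + \<eta>)) (at x)"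
      using F[of "x + \<eta>"] by (simp only: DERIV_shift)
    thus ?thesis unfolding k_def k'_def by (intro DERIV_cdivide DERIV_diff F)
  qed
  have k1: "\<bar>k' x\<bar> \<le> 1" for x
    using lipschitz_growth[OF h, of "x + \<eta>" x] \<eta> by (simp add: k'_def divide_le_eq)
  have lip: "\<bar>k x - k y\<bar> \<le> \<bar>x - y\<bar>" for x y
  proof -
    have *: "\<bar>k b - k a\<bar> \<le> b - a" if ab: "a < b" for a b
    proof -
      obtain t where t: "k b - k a = (b - a) * k' t" using MVT2[OF ab deriv] by blast
      have "(b - a) * \<bar>k' t\<bar> \<le> (b - a) * 1" using ab k1 by (intro mult_left_mono) auto
      thus ?thesis unfolding t using ab by (simp add: abs_mult)
    qed
    show ?thesis using *[of x y] *[of y x] by (cases x y rule: linorder_cases) (auto simp: abs_minus_commute)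
  qed
  have close: "\<bar>k x - h x\<bar> \<le> \<eta>" for x
  proof -
    have "x < x + \<eta>" using \<eta> by simp
    then obtain t where t: "x < t" "t < x + \<eta>" "F (x + \<eta>) - F x = (x + \<eta> - x) * h t"
      using MVT2[OF _ F] by blast
    hence "k x = h t" using \<eta> by (simp add: k_def)
    thus ?thesis using lipschitz_growth[OF h, of t x] t by simp
  qed
  show ?thesis
    by (rule that[of k]) (use lip close deriv in \<open>auto simp: lipschitz_on_def dist_real_def\<close>)
qed

section \<open>Resampling a coordinate of a product measure\<close>

definition depends_on :: "'i set \<Rightarrow> (('i \<Rightarrow> 'b) \<Rightarrow> 'c) \<Rightarrow> bool" where
  "depends_on S G \<longleftrightarrow> (\<forall>z z'. (\<forall>i\<in>S. z i = z' i) \<longrightarrow> G z = G z')"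

lemma depends_onD: "depends_on S G \<Longrightarrow> (\<And>i. i \<in> S \<Longrightarrow> z i = z' i) \<Longrightarrow> G z = G z'"
  by (auto simp: depends_on_def)

lemma (in prob_space) integrable_bounded:
  fixes F :: "'a \<Rightarrow> real"
  assumes "F \<in> borel_measurable M" "\<And>z. \<bar>F z\<bar> \<le> c"
  shows "integrable M F"
  using assms by (intro integrable_const_bound[of F c]) auto

lemma (in prob_space) integral_abs_bounded:
  fixes F :: "'a \<Rightarrow> real"
  assumes "\<And>z. \<bar>F z\<bar> \<le> c"
  shows "\<bar>\<integral>z. F z \<partial>M\<bar> \<le> c"
proof (cases "integrable M F")
  case True
  have "\<bar>\<integral>z. F z \<partial>M\<bar> \<le> (\<integral>z. \<bar>F z\<bar> \<partial>M)" by (rule integral_abs_bound)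
  also have "\<dots> \<le> (\<integral>z. c \<partial>M)" using assms True by (intro integral_mono) auto
  finally show ?thesis by (simp add: prob_space)
next
  case False
  \<comment> \<open>the integral of a non-integrable function is \<open>0\<close>\<close>
  thus ?thesis using assms[of undefined] by (simp add: not_integrable_integral_eq)
qed

lemma (in prob_space) square_integral_le:
  fixes F :: "'a \<Rightarrow> real"
  assumes "F \<in> borel_measurable M" "\<And>z. \<bar>F z\<bar> \<le> c"
  shows "(\<integral>z. F z \<partial>M)\<^sup>2 \<le> (\<integral>z. (F z)\<^sup>2 \<partial>M)"
proof -
  have "integrable M F" by (rule integrable_bounded[OF assms])
  moreover have "integrable M (\<lambda>z. (F z)\<^sup>2)"
  proof (rule integrable_bounded)
    show "\<bar>(F z)\<^sup>2\<bar> \<le> c\<^sup>2" for z using power_mono[OF assms(2)[of z], of 2] by simp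
  qed (use assms(1) in measurable)
  ultimately have "variance F = (\<integral>z. (F z)\<^sup>2 \<partial>M) - (\<integral>z. F z \<partial>M)\<^sup>2" by (rule variance_eq)
  thus ?thesis using variance_positive[of F] by simp
qed

lemma (in prob_space) integral_abs_le_sqrt:
  fixes F :: "'a \<Rightarrow> real"
  assumes [measurable]: "F \<in> borel_measurable M" and F: "\<And>z. \<bar>F z\<bar> \<le> c"
  shows "(\<integral>z. \<bar>F z\<bar> \<partial>M) \<le> sqrt (\<integral>z. (F z)\<^sup>2 \<partial>M)"
  using square_integral_le[of "\<lambda>z. \<bar>F z\<bar>" c] F by (intro real_le_rsqrt) auto

text \<open>
  When every point is in the space, so is every configuration of points, and changing one
  coordinate of a configuration needs no side conditions.
\<close>
locale full_prob_space = prob_space +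
  assumes space_full [simp]: "space M = UNIV"
begin

abbreviation config :: "('i \<Rightarrow> 'a) measure" where
  "config \<equiv> Pi\<^sub>M UNIV (\<lambda>_. M)"

lemma space_config [simp]: "space (config :: ('i \<Rightarrow> 'a) measure) = UNIV"
  by (simp add: space_PiM)

lemma prob_space_config: "prob_space config"
  by (intro prob_space_PiM prob_space_axioms)

lemma prob_full [simp]: "prob UNIV = 1"
  using prob_space by simp

lemma config_full [simp]: "measure (config :: ('i \<Rightarrow> 'a) measure) UNIV = 1"
  using prob_space.prob_space[OF prob_space_config[where 'b = 'i]] by simp

lemma config_update_measurable [measurable (raw)]:
  assumes "f \<in> measurable N (config :: ('i \<Rightarrow> 'a) measure)" "h \<in> measurable N M"
  shows "(\<lambda>x. (f x)(i := h x)) \<in> measurable N config"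
  using measurable_fun_upd[of UNIV UNIV i f N "\<lambda>_. M" h] assms by simp

lemma config_component_measurable [measurable (raw)]:
  assumes "f \<in> measurable N (config :: ('i \<Rightarrow> 'a) measure)"
  shows "(\<lambda>x. f x i) \<in> measurable N M"
  by (rule measurable_compose[OF assms measurable_component_singleton]) simp

lemma config_resample:
  fixes F :: "('i \<Rightarrow> 'a) \<Rightarrow> real"
  assumes F[measurable]: "F \<in> borel_measurable config" and b: "\<And>z. \<bar>F z\<bar> \<le> c"
  shows "(\<integral>z. (\<integral>\<zeta>. F (z(i := \<zeta>)) \<partial>M) \<partial>config) = (\<integral>z. F z \<partial>config)"
proof -
  interpret P: prob_space "config :: ('i \<Rightarrow> 'a) measure" by (rule prob_space_config)
  interpret pair: pair_prob_space M "config :: ('i \<Rightarrow> 'a) measure" ..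
  have "config = distr (M \<Otimes>\<^sub>M config) (Pi\<^sub>M (insert i UNIV) (\<lambda>_. M)) (\<lambda>(x, X). X(i := x))"
    by (subst distr_pair_PiM_eq_PiM) (simp_all add: prob_space_axioms)
  hence eq: "config = distr (M \<Otimes>\<^sub>M config) config (\<lambda>(x, X). X(i := x))" by simp
  have "(\<integral>z. F z \<partial>config) = (\<integral>w. F (case w of (x, X) \<Rightarrow> X(i := x)) \<partial>(M \<Otimes>\<^sub>M config))"
    by (subst eq) (rule integral_distr; measurable)
  also have "(\<lambda>w. F (case w of (x, X) \<Rightarrow> X(i := x))) = (\<lambda>(x, X). F (X(i := x)))" by auto
  also have "integral\<^sup>L (M \<Otimes>\<^sub>M config) \<dots> = (\<integral>X. (\<integral>x. F (X(i := x)) \<partial>M) \<partial>config)"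
  proof (rule pair.integral_snd[symmetric])
    show "integrable (M \<Otimes>\<^sub>M config) (\<lambda>(x, X). F (X(i := x)))"
      by (rule pair.integrable_bounded[of _ c]) (use b in auto)
  qed
  finally show ?thesis by simp
qed

text \<open>
  Once the coordinate \<open>i\<close> is resampled, it and \<open>\<zeta>\<close> are integrated against the same measure, and
  Fubini's theorem interchanges them.
\<close>
lemma config_exchange:
  fixes H :: "('i \<Rightarrow> 'a) \<Rightarrow> 'a \<Rightarrow> real"
  assumes [measurable]: "(\<lambda>(z, \<zeta>). H z \<zeta>) \<in> borel_measurable (config \<Otimes>\<^sub>M M)" and b: "\<And>z \<zeta>. \<bar>H z \<zeta>\<bar> \<le> c"
  shows "(\<integral>z. (\<integral>\<zeta>. H z \<zeta> \<partial>M) \<partial>config) = (\<integral>z. (\<integral>\<zeta>. H (z(i := \<zeta>)) (z i) \<partial>M) \<partial>config)"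
proof -
  interpret P: prob_space "config :: ('i \<Rightarrow> 'a) measure" by (rule prob_space_config)
  interpret pair: pair_prob_space M M ..
  have "(\<integral>z. (\<integral>\<zeta>. H z \<zeta> \<partial>M) \<partial>config) = (\<integral>z. (\<integral>\<eta>. (\<integral>\<zeta>. H (z(i := \<eta>)) \<zeta> \<partial>M) \<partial>M) \<partial>config)"
    by (rule config_resample[symmetric, where c = c]) (use b in \<open>auto intro!: integral_abs_bounded\<close>)
  also have "\<dots> = (\<integral>z. (\<integral>\<zeta>. (\<integral>\<eta>. H (z(i := \<eta>)) \<zeta> \<partial>M) \<partial>M) \<partial>config)"
  proof (rule Bochner_Integration.integral_cong[OF refl], rule pair.Fubini_integral)
    fix z :: "'i \<Rightarrow> 'a"
    have [measurable]: "(\<lambda>_. z) \<in> measurable (M \<Otimes>\<^sub>M M) config" by simp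
    show "integrable (M \<Otimes>\<^sub>M M) (\<lambda>(\<zeta>, \<eta>). H (z(i := \<eta>)) \<zeta>)"
      by (rule pair.integrable_bounded[of _ c]) (use b in auto)
  qed
  also have "\<dots> = (\<integral>z. (\<integral>\<zeta>. (\<integral>\<eta>. H (z(i := \<zeta>, i := \<eta>)) ((z(i := \<zeta>)) i) \<partial>M) \<partial>M) \<partial>config)" by simp
  also have "\<dots> = (\<integral>z. (\<integral>\<zeta>. H (z(i := \<zeta>)) (z i) \<partial>M) \<partial>config)"
    by (rule config_resample[where c = c and F = "\<lambda>z. \<integral>\<eta>. H (z(i := \<eta>)) (z i) \<partial>M"])
       (use b in \<open>auto intro!: integral_abs_bounded\<close>)
  finally show ?thesis .
qed

text \<open>
  The Efron--Stein inequality, by induction on the number of coordinates. Integrating out the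
  coordinate \<open>i\<close> is a projection, and by Jensen's inequality the second moment that is lost is
  at most the term with index \<open>i\<close>. Again by Jensen's inequality, the terms of the projected
  function do not exceed those of \<open>G\<close>.
\<close>
lemma efron_stein:
  fixes G :: "('i \<Rightarrow> 'a) \<Rightarrow> real"
  assumes "finite S" "G \<in> borel_measurable config" "\<And>z. \<bar>G z\<bar> \<le> c" "depends_on S G"
  shows "(\<integral>z. (G z)\<^sup>2 \<partial>config) - (\<integral>z. G z \<partial>config)\<^sup>2
       \<le> (\<Sum>i\<in>S. \<integral>z. (\<integral>\<zeta>. (G z - G (z(i := \<zeta>)))\<^sup>2 \<partial>M) \<partial>config)"
  using assms
proof (induction S arbitrary: G rule: finite_induct)
  case empty
  interpret P: prob_space "config :: ('i \<Rightarrow> 'a) measure" by (rule prob_space_config)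
  have "G z = G undefined" for z using depends_onD[OF empty.prems(3), of z undefined] by simp
  hence "G = (\<lambda>_. G undefined)" by auto
  then obtain a where "G = (\<lambda>_. a)" by blast
  thus ?case by (simp add: P.prob_space)
next
  case (insert i S)
  interpret P: prob_space "config :: ('i \<Rightarrow> 'a) measure" by (rule prob_space_config)
  note [measurable] = insert.prems(1)
  note b = insert.prems(2)
  have c0: "0 \<le> c" using b[of undefined] by linarith
  define H where "H = (\<lambda>z. \<integral>\<zeta>. G (z(i := \<zeta>)) \<partial>M)"
  have Hm[measurable]: "H \<in> borel_measurable config" unfolding H_def by measurable
  have Hb: "\<bar>H z\<bar> \<le> c" for z unfolding H_def by (intro integral_abs_bounded b)
  have Hd: "depends_on S H" unfolding depends_on_def H_def
  proof (intro allI impI Bochner_Integration.integral_cong[OF refl])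
    fix z z' :: "'i \<Rightarrow> 'a" and \<zeta> assume "\<forall>i\<in>S. z i = z' i"
    thus "G (z(i := \<zeta>)) = G (z'(i := \<zeta>))" by (intro depends_onD[OF insert.prems(3)]) auto
  qed
  have sq: "x\<^sup>2 \<le> (2 * c)\<^sup>2" if "\<bar>x\<bar> \<le> 2 * c" for x :: real
    using power_mono[OF that, of 2] by simp
  have d2: "\<bar>(x - y)\<^sup>2\<bar> \<le> (2 * c)\<^sup>2" if "\<bar>x\<bar> \<le> c" "\<bar>y\<bar> \<le> c" for x y :: real
    using sq[of "x - y"] that by auto
  have s2: "\<bar>x\<^sup>2\<bar> \<le> c\<^sup>2" if "\<bar>x\<bar> \<le> c" for x :: real
    using power_mono[OF that, of 2] by simp
  have mz[measurable]: "(\<lambda>_. z) \<in> measurable N config" for z :: "'i \<Rightarrow> 'a" and N :: "'x measure" by simp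
  have EH: "(\<integral>z. H z \<partial>config) = (\<integral>z. G z \<partial>config)"
    unfolding H_def by (rule config_resample[OF _ b]) measurable
  \<comment> \<open>resampling \<open>i\<close> conditions on the other coordinates, so \<open>H\<close> is an orthogonal projection of \<open>G\<close>\<close>
  have EGH: "(\<integral>z. G z * H z \<partial>config) = (\<integral>z. (H z)\<^sup>2 \<partial>config)"
  proof -
    have Hi: "H (z(i := \<zeta>)) = H z" for z \<zeta> by (simp add: H_def)
    have "(\<integral>z. G z * H z \<partial>config) = (\<integral>z. (\<integral>\<zeta>. G (z(i := \<zeta>)) * H (z(i := \<zeta>)) \<partial>M) \<partial>config)"
      by (rule config_resample[symmetric, where c = "c * c"]) (use b Hb in \<open>auto simp: abs_mult intro!: mult_mono c0\<close>)
    also have "\<dots> = (\<integral>z. (H z)\<^sup>2 \<partial>config)" unfolding Hi by (simp add: H_def power2_eq_square)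
    finally show ?thesis .
  qed
  have i1: "integrable config (\<lambda>z. (G z)\<^sup>2)" "integrable config (\<lambda>z. (H z)\<^sup>2)"
    by (rule P.integrable_bounded[OF _ s2]; use b Hb in measurable)+
  have i2: "integrable config (\<lambda>z. G z * H z)"
    by (rule P.integrable_bounded[where c = "c * c"]) (use b Hb in \<open>auto simp: abs_mult intro!: mult_mono c0\<close>)
  have "(\<integral>z. (G z)\<^sup>2 \<partial>config) - (\<integral>z. (H z)\<^sup>2 \<partial>config)
      = (\<integral>z. (G z)\<^sup>2 - 2 * (G z * H z) + (H z)\<^sup>2 \<partial>config)"
    using i1 i2 by (simp add: EGH)
  also have "\<dots> = (\<integral>z. (G z - H z)\<^sup>2 \<partial>config)"
    by (intro Bochner_Integration.integral_cong) (simp_all add: power2_eq_square algebra_simps)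
  also have "\<dots> \<le> (\<integral>z. (\<integral>\<zeta>. (G z - G (z(i := \<zeta>)))\<^sup>2 \<partial>M) \<partial>config)"
  proof (rule integral_mono)
    show "integrable config (\<lambda>z. (G z - H z)\<^sup>2)"
      by (rule P.integrable_bounded[OF _ d2]) (use b Hb in measurable)
    show "integrable config (\<lambda>z. \<integral>\<zeta>. (G z - G (z(i := \<zeta>)))\<^sup>2 \<partial>M)"
      by (rule P.integrable_bounded[OF _ integral_abs_bounded[OF d2]]) (use b in measurable)
    fix z
    have "integrable M (\<lambda>\<zeta>. G (z(i := \<zeta>)))" by (rule integrable_bounded[OF _ b]) measurable
    hence "G z - H z = (\<integral>\<zeta>. G z - G (z(i := \<zeta>)) \<partial>M)"
      by (simp add: H_def prob_space)
    also have "\<dots>\<^sup>2 \<le> (\<integral>\<zeta>. (G z - G (z(i := \<zeta>)))\<^sup>2 \<partial>M)"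
    proof (rule square_integral_le[where c = "2 * c"])
      show "\<bar>G z - G (z(i := \<zeta>))\<bar> \<le> 2 * c" for \<zeta> using b[of z] b[of "z(i := \<zeta>)"] by linarith
    qed measurable
    finally show "(G z - H z)\<^sup>2 \<le> (\<integral>\<zeta>. (G z - G (z(i := \<zeta>)))\<^sup>2 \<partial>M)" .
  qed
  finally have 1: "(\<integral>z. (G z)\<^sup>2 \<partial>config) - (\<integral>z. (H z)\<^sup>2 \<partial>config) \<le> \<dots>" .
  have "(\<integral>z. (H z)\<^sup>2 \<partial>config) - (\<integral>z. H z \<partial>config)\<^sup>2
       \<le> (\<Sum>j\<in>S. \<integral>z. (\<integral>\<zeta>. (H z - H (z(j := \<zeta>)))\<^sup>2 \<partial>M) \<partial>config)"
    by (rule insert.IH[OF Hm Hb Hd])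
  also have "\<dots> \<le> (\<Sum>j\<in>S. \<integral>z. (\<integral>\<zeta>. (G z - G (z(j := \<zeta>)))\<^sup>2 \<partial>M) \<partial>config)"
  proof (rule sum_mono)
    fix j assume "j \<in> S"
    hence ij: "i \<noteq> j" using insert.hyps by auto
    let ?F = "\<lambda>z. \<integral>\<zeta>. (G z - G (z(j := \<zeta>)))\<^sup>2 \<partial>M"
    have "(\<integral>z. (\<integral>\<zeta>. (H z - H (z(j := \<zeta>)))\<^sup>2 \<partial>M) \<partial>config) \<le> (\<integral>z. (\<integral>\<eta>. ?F (z(i := \<eta>)) \<partial>M) \<partial>config)"
    proof (rule integral_mono)
      show "integrable config (\<lambda>z. \<integral>\<zeta>. (H z - H (z(j := \<zeta>)))\<^sup>2 \<partial>M)"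
        by (rule P.integrable_bounded[OF _ integral_abs_bounded[OF d2]]) (use Hb in measurable)
      show "integrable config (\<lambda>z. \<integral>\<eta>. ?F (z(i := \<eta>)) \<partial>M)"
        by (rule P.integrable_bounded[OF _ integral_abs_bounded[OF integral_abs_bounded[OF d2]]]) (use b in measurable)
      fix z
      interpret pair: pair_prob_space M M ..
      have int: "integrable M (\<lambda>\<eta>. (G (z(i := \<eta>)) - G (z(i := \<eta>, j := \<zeta>)))\<^sup>2)" for \<zeta>
        by (rule integrable_bounded[OF _ d2]) (use b in measurable)
      have "(\<integral>\<zeta>. (H z - H (z(j := \<zeta>)))\<^sup>2 \<partial>M) \<le> (\<integral>\<zeta>. (\<integral>\<eta>. (G (z(i := \<eta>)) - G (z(i := \<eta>, j := \<zeta>)))\<^sup>2 \<partial>M) \<partial>M)"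
      proof (rule integral_mono)
        show "integrable M (\<lambda>\<zeta>. (H z - H (z(j := \<zeta>)))\<^sup>2)"
          by (rule integrable_bounded[OF _ d2]) (use Hb in measurable)
        show "integrable M (\<lambda>\<zeta>. \<integral>\<eta>. (G (z(i := \<eta>)) - G (z(i := \<eta>, j := \<zeta>)))\<^sup>2 \<partial>M)"
          by (rule integrable_bounded[OF _ integral_abs_bounded[OF d2]]) (use b in measurable)
        fix \<zeta>
        have "integrable M (\<lambda>\<eta>. G (z(i := \<eta>)))" "integrable M (\<lambda>\<eta>. G (z(i := \<eta>, j := \<zeta>)))"
          by (rule integrable_bounded[OF _ b]; measurable)+
        hence "H z - H (z(j := \<zeta>)) = (\<integral>\<eta>. G (z(i := \<eta>)) - G (z(i := \<eta>, j := \<zeta>)) \<partial>M)"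
          using ij by (simp add: H_def fun_upd_twist)
        also have "\<dots>\<^sup>2 \<le> (\<integral>\<eta>. (G (z(i := \<eta>)) - G (z(i := \<eta>, j := \<zeta>)))\<^sup>2 \<partial>M)"
        proof (rule square_integral_le[where c = "2 * c"])
          show "\<bar>G (z(i := \<eta>)) - G (z(i := \<eta>, j := \<zeta>))\<bar> \<le> 2 * c" for \<eta>
            using b[of "z(i := \<eta>)"] b[of "z(i := \<eta>, j := \<zeta>)"] by linarith
        qed measurable
        finally show "(H z - H (z(j := \<zeta>)))\<^sup>2 \<le> (\<integral>\<eta>. (G (z(i := \<eta>)) - G (z(i := \<eta>, j := \<zeta>)))\<^sup>2 \<partial>M)" .
      qed
      also have "\<dots> = (\<integral>\<eta>. ?F (z(i := \<eta>)) \<partial>M)"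
      proof (rule pair.Fubini_integral)
        show "integrable (M \<Otimes>\<^sub>M M) (\<lambda>(\<eta>, \<zeta>). (G (z(i := \<eta>)) - G (z(i := \<eta>, j := \<zeta>)))\<^sup>2)"
          by (rule pair.integrable_bounded[where c = "(2 * c)\<^sup>2"]) (use b d2 in auto)
      qed
      finally show "(\<integral>\<zeta>. (H z - H (z(j := \<zeta>)))\<^sup>2 \<partial>M) \<le> (\<integral>\<eta>. ?F (z(i := \<eta>)) \<partial>M)" .
    qed
    also have "\<dots> = (\<integral>z. ?F z \<partial>config)"
      by (rule config_resample[OF _ integral_abs_bounded[OF d2]]) (use b in measurable)
    finally show "(\<integral>z. (\<integral>\<zeta>. (H z - H (z(j := \<zeta>)))\<^sup>2 \<partial>M) \<partial>config) \<le> (\<integral>z. ?F z \<partial>config)" .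
  qed
  finally show ?case using 1 unfolding sum.insert[OF insert.hyps] EH by linarith
qed

end

section \<open>Tails of symmetric stable laws and truncated moments\<close>

text \<open>
  A pair holds the value of a coordinate and a possible replacement. The sum bounds their
  difference as well as each of them, and does not change when the two are exchanged.
\<close>
definition jump_size :: "real \<times> real \<Rightarrow> real" where
  "jump_size \<zeta> = \<bar>fst \<zeta>\<bar> + \<bar>snd \<zeta>\<bar>"

text \<open>
  The tail of a law is governed by its characteristic function near the origin. Here that
  function is integrated against the normal law with standard deviation \<open>1 / u\<close>. By Fubini's
  theorem, the mean of \<open>1 - exp (- (x / u)\<^sup>2 / 2)\<close>, which is at least \<open>1 / 3\<close> where
  \<open>u \<le> \<bar>x\<bar>\<close>, is the normal mean of \<open>1 - exp (- (\<sigma> \<bar>t\<bar> / u) powr \<beta>)\<close>, and this is of order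
  \<open>u powr (- \<beta>)\<close>.
\<close>
lemma stable_tail:
  assumes "symmetric_stable \<beta> \<mu>" and \<beta>: "0 < \<beta>" "\<beta> < 2"
  obtains K where "K \<ge> 0" "\<And>u. u > 0 \<Longrightarrow> measure \<mu> {x. u \<le> \<bar>x\<bar>} \<le> K * u powr (- \<beta>)"
proof -
  from assms obtain \<sigma> where \<mu>: "real_distribution \<mu>" and \<sigma>: "\<sigma> > 0"
    and char: "\<And>t. char \<mu> t = complex_of_real (exp (- ((\<sigma> * \<bar>t\<bar>) powr \<beta>)))"
    unfolding symmetric_stable_def by blast
  interpret real_distribution \<mu> by (rule \<mu>)
  let ?N = "std_normal_distribution"
  interpret N: real_distribution ?N by (rule real_dist_normal_dist)
  interpret pair: pair_prob_space \<mu> ?N ..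
  have tail: "measure \<mu> {x. u \<le> \<bar>x\<bar>} \<le> 6 * (\<sigma> / u) powr \<beta>" if u: "u > 0" for u
  proof -
    define \<delta> where "\<delta> = 1 / u"
    have \<delta>: "\<delta> > 0" using u by (simp add: \<delta>_def)
    have int: "integrable (\<mu> \<Otimes>\<^sub>M ?N) (\<lambda>(x, t). iexp (\<delta> * t * x))"
      by (intro pair.P.integrable_const_bound[where B = 1]) auto
    have "(\<integral>x. complex_of_real (exp (- (\<delta> * x)\<^sup>2 / 2)) \<partial>\<mu>) = (\<integral>x. (\<integral>t. iexp (\<delta> * t * x) \<partial>?N) \<partial>\<mu>)"
    proof (rule Bochner_Integration.integral_cong[OF refl])
      fix x
      have "complex_of_real (exp (- (\<delta> * x)\<^sup>2 / 2)) = char ?N (\<delta> * x)"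
        using fun_cong[OF char_std_normal_distribution, of "\<delta> * x"] by simp
      thus "complex_of_real (exp (- (\<delta> * x)\<^sup>2 / 2)) = (\<integral>t. iexp (\<delta> * t * x) \<partial>?N)"
        by (simp add: char_def mult_ac)
    qed
    also have "\<dots> = (\<integral>t. (\<integral>x. iexp (\<delta> * t * x) \<partial>\<mu>) \<partial>?N)"
      using pair.Fubini_integral[OF int] by simp
    also have "\<dots> = (\<integral>t. complex_of_real (exp (- ((\<sigma> * \<bar>\<delta> * t\<bar>) powr \<beta>))) \<partial>?N)"
      by (simp add: char[symmetric] char_def)
    finally have "complex_of_real (\<integral>x. exp (- (\<delta> * x)\<^sup>2 / 2) \<partial>\<mu>) = complex_of_real (\<integral>t. exp (- ((\<sigma> * \<bar>\<delta> * t\<bar>) powr \<beta>)) \<partial>?N)"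
      by (simp only: integral_complex_of_real)
    hence eq: "(\<integral>x. exp (- (\<delta> * x)\<^sup>2 / 2) \<partial>\<mu>) = (\<integral>t. exp (- ((\<sigma> * \<bar>\<delta> * t\<bar>) powr \<beta>)) \<partial>?N)"
      by (simp only: of_real_eq_iff)
    have i1: "integrable \<mu> (\<lambda>x. exp (- (\<delta> * x)\<^sup>2 / 2))"
      by (intro integrable_const_bound[where B = 1]) auto
    have i2: "integrable ?N (\<lambda>t. exp (- ((\<sigma> * \<bar>\<delta> * t\<bar>) powr \<beta>)))"
      by (intro N.integrable_const_bound[where B = 1]) auto
    have i3: "integrable ?N (\<lambda>t. t\<^sup>2)" "(\<integral>t. t\<^sup>2 \<partial>?N) = 1"
    proof -
      have "integrable lborel (\<lambda>t. std_normal_density t * t\<^sup>2)"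
        using integrable_std_normal_moment[of 2] by simp
      thus "integrable ?N (\<lambda>t. t\<^sup>2)" by (subst integrable_density) auto
      have "(\<integral>t. std_normal_density t * t\<^sup>2 \<partial>lborel) = 1"
        using integral_std_normal_moment_even[of 1] by (simp add: fact_numeral)
      thus "(\<integral>t. t\<^sup>2 \<partial>?N) = 1" by (subst integral_density) auto
    qed
    have "1 / 3 * measure \<mu> {x. u \<le> \<bar>x\<bar>} = (\<integral>x. 1 / 3 * indicator {x. u \<le> \<bar>x\<bar>} x \<partial>\<mu>)" by simp
    also have "\<dots> \<le> (\<integral>x. 1 - exp (- (\<delta> * x)\<^sup>2 / 2) \<partial>\<mu>)"
    proof (rule integral_mono)
      show "integrable \<mu> (\<lambda>x. 1 / 3 * indicator {x. u \<le> \<bar>x\<bar>} x :: real)" by (intro integrable_const_bound[where B = 1]) (auto simp: indicator_def)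
      fix x
      show "1 / 3 * indicator {x. u \<le> \<bar>x\<bar>} x \<le> 1 - exp (- (\<delta> * x)\<^sup>2 / 2)"
      proof (cases "u \<le> \<bar>x\<bar>")
        case True
        hence "1 \<le> \<bar>\<delta> * x\<bar>" using u by (simp add: \<delta>_def abs_mult)
        hence "1 \<le> (\<delta> * x)\<^sup>2" using power_mono[of 1 "\<bar>\<delta> * x\<bar>" 2] by simp
        hence "exp (- (\<delta> * x)\<^sup>2 / 2) \<le> exp (- (1 / 2))" by simp
        also have "\<dots> \<le> 2 / 3"
        proof -
          have "3 / 2 \<le> exp (1 / 2 :: real)" using exp_ge_add_one_self[of "1/2 :: real"] by simp
          thus ?thesis by (simp add: exp_minus field_simps)
        qed
        finally show ?thesis using True by simp
      qed auto
    qed (use i1 in auto)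
    also have "\<dots> = (\<integral>t. 1 - exp (- ((\<sigma> * \<bar>\<delta> * t\<bar>) powr \<beta>)) \<partial>?N)" using i1 i2 eq prob_space N.prob_space by simp
    also have "\<dots> \<le> (\<integral>t. (\<sigma> / u) powr \<beta> * (1 + t\<^sup>2) \<partial>?N)"
    proof (rule integral_mono)
      fix t :: real
      have "1 - exp (- ((\<sigma> * \<bar>\<delta> * t\<bar>) powr \<beta>)) \<le> (\<sigma> * \<bar>\<delta> * t\<bar>) powr \<beta>"
        using exp_ge_add_one_self[of "- ((\<sigma> * \<bar>\<delta> * t\<bar>) powr \<beta>)"] by linarith
      also have "(\<sigma> * \<bar>\<delta> * t\<bar>) powr \<beta> = (\<sigma> / u) powr \<beta> * \<bar>t\<bar> powr \<beta>"
        using \<sigma> u by (subst powr_mult[symmetric]) (auto simp: \<delta>_def abs_mult)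
      also have "\<dots> \<le> (\<sigma> / u) powr \<beta> * (1 + t\<^sup>2)"
      proof (rule mult_left_mono)
        show "\<bar>t\<bar> powr \<beta> \<le> 1 + t\<^sup>2"
        proof (cases "\<bar>t\<bar> \<le> 1")
          case True
          hence "\<bar>t\<bar> powr \<beta> \<le> 1 powr \<beta>" using \<beta> by (intro powr_mono2) auto
          also have "\<dots> \<le> 1 + t\<^sup>2" by simp
          finally show ?thesis .
        next
          case False
          hence "\<bar>t\<bar> powr \<beta> \<le> \<bar>t\<bar> powr 2" using \<beta> by (intro powr_mono) auto
          also have "\<dots> = t\<^sup>2" using False by simp
          finally show ?thesis by simp
        qed
      qed simp
      finally show "1 - exp (- ((\<sigma> * \<bar>\<delta> * t\<bar>) powr \<beta>)) \<le> (\<sigma> / u) powr \<beta> * (1 + t\<^sup>2)" .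
    qed (use i2 i3 in auto)
    also have "\<dots> = 2 * (\<sigma> / u) powr \<beta>" using i3 N.prob_space by simp
    finally show ?thesis by simp
  qed
  show ?thesis
  proof (rule that[of "6 * \<sigma> powr \<beta>"])
    show "measure \<mu> {x. u \<le> \<bar>x\<bar>} \<le> 6 * \<sigma> powr \<beta> * u powr (- \<beta>)" if "u > 0" for u
      using tail[OF that] \<sigma> that by (simp add: powr_divide powr_minus field_simps)
  qed simp
qed

text \<open>
  About \<open>p\<close> terms are bounded by \<open>1\<close>; the others are compared with the integral of the power.
\<close>
lemma sum_tail_powr:
  fixes \<gamma> p :: real
  assumes \<gamma>: "\<gamma> > 1" and p: "p > 0"
  shows "(\<Sum>k<n. min 1 ((p / real (k + 1)) powr \<gamma>)) \<le> (p + 1) + p / (\<gamma> - 1)"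
proof -
  define q where "q = nat \<lceil>p\<rceil>"
  have q: "p \<le> real q" "real q \<le> p + 1" "q \<ge> 1" using p unfolding q_def by linarith+
  define f where "f = (\<lambda>s::real. - (s powr (1 - \<gamma>)) / (\<gamma> - 1))"
  have step: "real (k + 1) powr (- \<gamma>) \<le> f (real (k + 1)) - f (real k)" if "k \<ge> 1" for k
  proof -
    have "real k < real k + 1" by simp
    moreover have "(f has_real_derivative x powr (- \<gamma>)) (at x)" if "real k \<le> x" "x \<le> real k + 1" for x
    proof -
      have "x > 0" using that \<open>k \<ge> 1\<close> by linarith
      hence "(f has_real_derivative - ((1 - \<gamma>) * x powr (1 - \<gamma> - 1)) / (\<gamma> - 1)) (at x)"
        unfolding f_def using \<gamma> by (auto intro!: derivative_eq_intros)
      also have "- ((1 - \<gamma>) * x powr (1 - \<gamma> - 1)) / (\<gamma> - 1) = x powr (- \<gamma>)" using \<gamma> by (simp add: field_simps)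
      finally show ?thesis .
    qed
    ultimately obtain x where x: "real k < x" "x < real k + 1" "f (real k + 1) - f (real k) = (real k + 1 - real k) * x powr (- \<gamma>)"
      using MVT2[of "real k" "real k + 1" f "\<lambda>x. x powr (- \<gamma>)"] by blast
    have "(real k + 1) powr (- \<gamma>) \<le> x powr (- \<gamma>)" using x \<gamma> that by (intro powr_mono2') auto
    thus ?thesis using x(3) by (simp add: add.commute)
  qed
  have tail: "(\<Sum>k=q..<q + m. real (k + 1) powr (- \<gamma>)) \<le> f (real (q + m)) - f (real q)" for m
  proof (induction m)
    case (Suc m)
    have "real (q + m + 1) powr (- \<gamma>) \<le> f (real (q + m + 1)) - f (real (q + m))" using q by (intro step) auto
    with Suc show ?case by (simp add: add.commute)
  qed simp
  have fneg: "f s \<le> 0" for s using \<gamma> by (simp add: f_def divide_le_0_iff)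
  have "(\<Sum>k<n. min 1 ((p / real (k + 1)) powr \<gamma>)) \<le> (\<Sum>k<q + n. min 1 ((p / real (k + 1)) powr \<gamma>))"
    by (intro sum_mono2) auto
  also have "\<dots> = (\<Sum>k<q. min 1 ((p / real (k + 1)) powr \<gamma>)) + (\<Sum>k=q..<q + n. min 1 ((p / real (k + 1)) powr \<gamma>))"
    by (simp add: lessThan_atLeast0 sum.atLeastLessThan_concat)
  also have "\<dots> \<le> (\<Sum>k<q. 1) + (\<Sum>k=q..<q + n. p powr \<gamma> * real (k + 1) powr (- \<gamma>))"
  proof (intro add_mono sum_mono)
    fix k
    have "(p / real (k + 1)) powr \<gamma> = p powr \<gamma> * real (k + 1) powr (- \<gamma>)"
      using p by (simp add: powr_divide powr_minus field_simps)
    thus "min 1 ((p / real (k + 1)) powr \<gamma>) \<le> p powr \<gamma> * real (k + 1) powr (- \<gamma>)" by simp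
  qed simp
  also have "\<dots> = real q + p powr \<gamma> * (\<Sum>k=q..<q + n. real (k + 1) powr (- \<gamma>))" by (simp add: sum_distrib_left)
  also have "\<dots> \<le> (p + 1) + p powr \<gamma> * (- f (real q))"
    using tail[of n] fneg[of "real (q + n)"] q by (intro add_mono mult_left_mono) auto
  also have "p powr \<gamma> * (- f (real q)) \<le> p powr \<gamma> * (p powr (1 - \<gamma>) / (\<gamma> - 1))"
  proof (rule mult_left_mono)
    have "real q powr (1 - \<gamma>) \<le> p powr (1 - \<gamma>)" using q p \<gamma> by (intro powr_mono2') auto
    thus "- f (real q) \<le> p powr (1 - \<gamma>) / (\<gamma> - 1)" using \<gamma> by (simp add: f_def divide_right_mono)
  qed simp
  also have "\<dots> = p / (\<gamma> - 1)" using p by (simp add: powr_add[symmetric])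
  finally show ?thesis by simp
qed

text \<open>
  An innovation of size \<open>u\<close> can change the values of a bounded Lipschitz function by
  \<open>min 1 (b k * u)\<close> at lag \<open>k\<close>. Only \<open>(K * u) powr (1 / \<gamma>)\<close> lags matter, because
  \<open>K * u * (k + 1) powr (- \<gamma>)\<close> is the power \<open>\<gamma>\<close> of the ratio of that number and \<open>k + 1\<close>.
\<close>
lemma sum_clip_le:
  fixes \<gamma> K :: real and b :: "int \<Rightarrow> real"
  assumes \<gamma>: "\<gamma> > 1" and K: "K > 0"
    and b: "\<And>k. k \<ge> 0 \<Longrightarrow> b k \<le> K * (real_of_int k + 1) powr (- \<gamma>)" "\<And>k. k < 0 \<Longrightarrow> b k = 0"
  obtains C where "C > 0"
    "\<And>D u. finite D \<Longrightarrow> u \<ge> 0 \<Longrightarrow> (\<Sum>k\<in>D. min 1 (b k * u)) \<le> C * (1 + u powr (1 / \<gamma>))"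
proof -
  define C where "C = 1 + K powr (1 / \<gamma>) * (1 + 1 / (\<gamma> - 1))"
  have C: "C > 0" unfolding C_def using \<gamma> by (intro add_pos_nonneg mult_nonneg_nonneg) auto
  have bound: "(\<Sum>k\<in>D. min 1 (b k * u)) \<le> C * (1 + u powr (1 / \<gamma>))" if D: "finite D" and u: "u \<ge> 0" for D u
  proof (cases "u = 0")
    case True
    thus ?thesis using C by simp
  next
    case False
    hence u: "u > 0" using u by simp
    define p where "p = (K * u) powr (1 / \<gamma>)"
    have p: "p > 0" "p powr \<gamma> = K * u" unfolding p_def using K u \<gamma> by (simp_all add: powr_powr)
    define n where "n = nat (Max (insert 0 D) + 1)"
    have sub: "D \<inter> {0..} \<subseteq> int ` {..<n}"
    proof
      fix k assume k: "k \<in> D \<inter> {0..}"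
      hence "k \<le> Max (insert 0 D)" using D by (intro Max_ge) auto
      hence "k = int (nat k)" "nat k < n" using k unfolding n_def by auto
      thus "k \<in> int ` {..<n}" by blast
    qed
    let ?m = "\<lambda>k::nat. min 1 ((p / real (k + 1)) powr \<gamma>)"
    have m0: "0 \<le> ?m k" for k by simp
    have "(\<Sum>k\<in>D. min 1 (b k * u)) = (\<Sum>k\<in>D \<inter> {0..}. min 1 (b k * u))"
    proof (rule sum.mono_neutral_right)
      show "\<forall>k\<in>D - D \<inter> {0..}. min 1 (b k * u) = 0"
      proof
        fix k assume "k \<in> D - D \<inter> {0..}"
        hence "k < 0" by auto
        thus "min 1 (b k * u) = 0" by (simp add: b(2))
      qed
    qed (use D in auto)
    also have "\<dots> \<le> (\<Sum>k\<in>D \<inter> {0..}. ?m (nat k))"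
    proof (rule sum_mono)
      fix k assume "k \<in> D \<inter> {0..}"
      hence k: "k \<ge> 0" by simp
      have "b k * u \<le> K * (real_of_int k + 1) powr (- \<gamma>) * u" using b(1)[OF k] u by (intro mult_right_mono) auto
      also have "\<dots> = (p / real (nat k + 1)) powr \<gamma>"
        using p k by (simp add: powr_divide powr_minus field_simps)
      finally show "min 1 (b k * u) \<le> ?m (nat k)" by (intro min.mono) auto
    qed
    also have "\<dots> \<le> (\<Sum>k\<in>int ` {..<n}. ?m (nat k))" by (intro sum_mono2 sub) auto
    also have "\<dots> = (\<Sum>k<n. ?m k)" by (subst sum.reindex) (auto simp: inj_on_def)
    also have "\<dots> \<le> (p + 1) + p / (\<gamma> - 1)" by (rule sum_tail_powr[OF \<gamma> p(1)])
    also have "\<dots> = 1 + (K powr (1 / \<gamma>) * (1 + 1 / (\<gamma> - 1))) * u powr (1 / \<gamma>)"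
      using K u by (simp add: p_def powr_mult algebra_simps)
    also have "\<dots> \<le> C * 1 + C * u powr (1 / \<gamma>)"
    proof (intro add_mono mult_right_mono)
      have "0 \<le> K powr (1 / \<gamma>) * (1 + 1 / (\<gamma> - 1))" using \<gamma> by (intro mult_nonneg_nonneg add_nonneg_nonneg) auto
      thus "1 \<le> C * 1" "K powr (1 / \<gamma>) * (1 + 1 / (\<gamma> - 1)) \<le> C" by (simp_all add: C_def)
    qed simp
    finally show ?thesis by (simp add: distrib_left)
  qed
  show ?thesis using that[OF C bound] .
qed

lemma dyadic_scale:
  fixes x :: real assumes "x \<ge> 1"
  obtains k :: nat where "2 ^ k \<le> x" "x < 2 ^ (k + 1)"
proof -
  define k where "k = nat \<lfloor>log 2 x\<rfloor>"
  have l: "log 2 x \<ge> 0" using assms by simp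
  have "real k \<le> log 2 x" "log 2 x < real k + 1" unfolding k_def using l by linarith+
  hence "2 powr real k \<le> x" "x < 2 powr (real k + 1)"
    using assms by (simp_all add: le_log_iff log_less_iff)
  thus ?thesis using that[of k] by (simp add: powr_realpow powr_add mult.commute)
qed

lemma le_suminf_ennreal: "f k \<le> (\<Sum>k. f k)" for f :: "nat \<Rightarrow> ennreal"
  using sum_le_suminf[of f "{k}"] by simp

context prob_space
begin

text \<open>
  On \<open>2 ^ k \<le> R < 2 ^ (k + 1)\<close> the power is at most \<open>2 ^ p * 2 ^ (p * k)\<close>, and the
  tail gives a factor \<open>2 powr (- \<alpha> * k)\<close>.
\<close>
lemma dyadic_moment:
  fixes R :: "'a \<Rightarrow> real"
  assumes R[measurable]: "R \<in> borel_measurable M" and R1: "\<And>x. 1 \<le> R x"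
    and tail: "\<And>s. s > 0 \<Longrightarrow> prob {x \<in> space M. s \<le> R x} \<le> K * s powr (- \<alpha>)" and m: "2 ^ m > N"
  shows "expectation (\<lambda>x. R x ^ p * indicator {x. R x \<le> N} x) \<le> (\<Sum>k<m. 2 ^ p * K * (2 powr (real p - \<alpha>)) ^ k)"
proof -
  have ev[measurable]: "{x \<in> space M. 2 ^ k \<le> R x} \<in> events" for k :: nat by measurable
  have ik: "integrable M (\<lambda>x. (2 ^ (k + 1)) ^ p * indicator {x \<in> space M. 2 ^ k \<le> R x} x :: real)" for k :: nat
    by (intro integrable_mult_right integrable_real_indicator) (auto simp: emeasure_eq_measure)
  have "expectation (\<lambda>x. R x ^ p * indicator {x. R x \<le> N} x)
      \<le> expectation (\<lambda>x. \<Sum>k<m. (2 ^ (k + 1)) ^ p * indicator {x \<in> space M. 2 ^ k \<le> R x} x)"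
  proof (rule integral_mono)
    show "integrable M (\<lambda>x. \<Sum>k<m. (2 ^ (k + 1)) ^ p * indicator {x \<in> space M. 2 ^ k \<le> R x} x :: real)"
      using ik by (intro Bochner_Integration.integrable_sum)
    show "integrable M (\<lambda>x. R x ^ p * indicator {x. R x \<le> N} x)"
    proof (rule integrable_const_bound[where B = "\<bar>N\<bar> ^ p"])
      show "AE x in M. norm (R x ^ p * indicator {x. R x \<le> N} x) \<le> \<bar>N\<bar> ^ p"
      proof (intro AE_I2)
        fix x show "norm (R x ^ p * indicator {x. R x \<le> N} x) \<le> \<bar>N\<bar> ^ p"
          using R1[of x] by (auto simp: indicator_def abs_mult intro!: power_mono)
      qed
    qed (unfold indicator_def, measurable)
    fix x assume x: "x \<in> space M"
    show "R x ^ p * indicator {x. R x \<le> N} x \<le> (\<Sum>k<m. (2 ^ (k + 1)) ^ p * indicator {x \<in> space M. 2 ^ k \<le> R x} x)"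
    proof (cases "R x \<le> N")
      case True
      obtain k where k: "2 ^ k \<le> R x" "R x < 2 ^ (k + 1)" using dyadic_scale[OF R1[of x]] .
      have "(2::real) ^ k < 2 ^ m" using k True m by linarith
      hence "k < m" by simp
      have "R x ^ p \<le> (2 ^ (k + 1)) ^ p" using k R1[of x] by (intro power_mono) auto
      also have "\<dots> = (2 ^ (k + 1)) ^ p * indicator {x \<in> space M. 2 ^ k \<le> R x} x" using k x by simp
      also have "\<dots> \<le> (\<Sum>k<m. (2 ^ (k + 1)) ^ p * indicator {x \<in> space M. 2 ^ k \<le> R x} x)"
        using \<open>k < m\<close> by (intro member_le_sum) auto
      finally show ?thesis using True by simp
    qed (auto intro: sum_nonneg)
  qed
  also have "\<dots> = (\<Sum>k<m. (2 ^ (k + 1)) ^ p * prob {x \<in> space M. 2 ^ k \<le> R x})"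
    by (subst Bochner_Integration.integral_sum) (rule ik, simp)
  also have "\<dots> \<le> (\<Sum>k<m. 2 ^ p * K * (2 powr (real p - \<alpha>)) ^ k)"
  proof (rule sum_mono)
    fix k
    have "(2 ^ (k + 1)) ^ p * prob {x \<in> space M. 2 ^ k \<le> R x} \<le> (2 ^ (k + 1)) ^ p * (K * (2 ^ k) powr (- \<alpha>))"
      by (intro mult_left_mono tail) auto
    also have "\<dots> = 2 ^ p * K * (2 powr (real p - \<alpha>)) ^ k"
    proof -
      have "((2::real) ^ (k + 1)) ^ p = 2 ^ p * 2 powr (real p * real k)"
        by (simp add: powr_realpow[symmetric] power_mult_distrib powr_powr mult.commute)
      moreover have "((2::real) ^ k) powr (- \<alpha>) = 2 powr (- \<alpha> * real k)"
        by (simp add: powr_realpow[symmetric] powr_powr mult.commute)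
      moreover have "(2 powr (real p - \<alpha>)) ^ k = 2 powr (real p * real k) * 2 powr (- \<alpha> * real k)"
        by (simp add: powr_realpow[symmetric] powr_powr powr_add[symmetric] algebra_simps)
      ultimately show ?thesis by (simp only: mult_ac)
    qed
    finally show "(2 ^ (k + 1)) ^ p * prob {x \<in> space M. 2 ^ k \<le> R x} \<le> 2 ^ p * K * (2 powr (real p - \<alpha>)) ^ k" .
  qed
  finally show ?thesis .
qed

text \<open>
  The geometric sum over the dyadic scales up to \<open>N\<close> is bounded, counts the scales, or is
  dominated by the last scale, according to whether its ratio \<open>2 powr (p - \<alpha>)\<close> is smaller
  than, equal to, or larger than \<open>1\<close>. These are the three regimes of the rates.
\<close>
lemma truncated_moment:
  fixes R :: "'a \<Rightarrow> real"
  assumes R[measurable]: "R \<in> borel_measurable M" and R1: "\<And>x. 1 \<le> R x"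
    and tail: "\<And>s. s > 0 \<Longrightarrow> prob {x \<in> space M. s \<le> R x} \<le> K * s powr (- \<alpha>)" and K: "K \<ge> 0"
  obtains C where "C > 0" "\<And>N. N \<ge> 1 \<Longrightarrow> expectation (\<lambda>x. R x ^ p * indicator {x. R x \<le> N} x)
    \<le> C * (if p < \<alpha> then 1 else if p = \<alpha> then 1 + ln N else N powr (p - \<alpha>))"
proof -
  define \<theta> where "\<theta> = 2 powr (real p - \<alpha>)"
  have \<theta>: "\<theta> > 0" by (simp add: \<theta>_def)
  define C where "C = 1 + 2 ^ p * K * (if p < \<alpha> then 1 / (1 - \<theta>) else if p = \<alpha> then 1 / ln 2 + 1 else \<theta> / (\<theta> - 1))"
  have C1: "0 \<le> (if p < \<alpha> then 1 / (1 - \<theta>) else if p = \<alpha> then 1 / ln 2 + 1 else \<theta> / (\<theta> - 1))"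
  proof -
    have "p < \<alpha> \<Longrightarrow> \<theta> < 1" "p > \<alpha> \<Longrightarrow> \<theta> > 1" unfolding \<theta>_def by (simp_all add: powr_less_one gr_one_powr)
    thus ?thesis using \<theta> by auto
  qed
  have C: "C > 0" unfolding C_def by (rule add_pos_nonneg[OF zero_less_one]) (intro mult_nonneg_nonneg K C1, simp)
  have "expectation (\<lambda>x. R x ^ p * indicator {x. R x \<le> N} x)
    \<le> C * (if p < \<alpha> then 1 else if p = \<alpha> then 1 + ln N else N powr (p - \<alpha>))" if N: "N \<ge> 1" for N
  proof -
    obtain k where k: "2 ^ k \<le> N" "N < 2 ^ (k + 1)" using dyadic_scale[OF N] .
    have "expectation (\<lambda>x. R x ^ p * indicator {x. R x \<le> N} x) \<le> (\<Sum>j<k + 1. 2 ^ p * K * \<theta> ^ j)"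
      unfolding \<theta>_def by (rule dyadic_moment[OF R R1 tail k(2)])
    also have "\<dots> = 2 ^ p * K * (\<Sum>j<k + 1. \<theta> ^ j)" by (simp only: sum_distrib_left)
    also have "\<dots> \<le> C * (if p < \<alpha> then 1 else if p = \<alpha> then 1 + ln N else N powr (p - \<alpha>))"
    proof -
      consider "p < \<alpha>" | "p = \<alpha>" | "p > \<alpha>" by linarith
      hence "(\<Sum>j<k + 1. \<theta> ^ j) \<le> (if p < \<alpha> then 1 / (1 - \<theta>) else if p = \<alpha> then 1 / ln 2 + 1 else \<theta> / (\<theta> - 1))
          * (if p < \<alpha> then 1 else if p = \<alpha> then 1 + ln N else N powr (p - \<alpha>))"
      proof cases
        case 1
        hence "\<theta> < 1" unfolding \<theta>_def by (simp add: powr_less_one)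
        have "(\<Sum>j<k + 1. \<theta> ^ j) = (1 - \<theta> ^ (k + 1)) / (1 - \<theta>)" using \<open>\<theta> < 1\<close> by (subst sum_gp_strict) auto
        also have "\<dots> \<le> 1 / (1 - \<theta>)" using \<open>\<theta> < 1\<close> \<theta> by (intro divide_right_mono) auto
        finally show ?thesis using 1 by simp
      next
        case 2
        hence "\<theta> = 1" by (simp add: \<theta>_def)
        have lnN: "ln N \<ge> 0" using N by simp
        have "real k * ln 2 \<le> ln N"
        proof -
          have "ln (2 ^ k) \<le> ln N" using k(1) N by (subst ln_le_cancel_iff) auto
          thus ?thesis by (simp add: ln_realpow)
        qed
        hence "real k \<le> ln N / ln 2" by (simp add: pos_le_divide_eq)
        hence "real (k + 1) \<le> ln N / ln 2 + 1" by simp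
        also have "\<dots> \<le> (1 / ln 2 + 1) * (1 + ln N)" using lnN by (simp add: field_simps)
        finally show ?thesis using 2 \<open>\<theta> = 1\<close> by simp
      next
        case 3
        hence "\<theta> > 1" unfolding \<theta>_def by (simp add: gr_one_powr)
        have "(\<Sum>j<k + 1. \<theta> ^ j) = (\<theta> ^ (k + 1) - 1) / (\<theta> - 1)" using \<open>\<theta> > 1\<close>
          by (subst sum_gp_strict) (auto simp: field_simps)
        also have "\<dots> \<le> \<theta> * \<theta> ^ k / (\<theta> - 1)" using \<open>\<theta> > 1\<close> by (intro divide_right_mono) auto
        also have "\<theta> ^ k \<le> N powr (p - \<alpha>)"
        proof -
          have "\<theta> ^ k = (2 ^ k) powr (p - \<alpha>)"
            by (simp add: \<theta>_def powr_realpow[symmetric] powr_powr mult.commute)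
          also have "\<dots> \<le> N powr (p - \<alpha>)" using 3 k by (intro powr_mono2) auto
          finally show ?thesis .
        qed
        finally show ?thesis using 3 \<open>\<theta> > 1\<close> by (simp add: mult_left_mono divide_right_mono)
      qed
      hence "2 ^ p * K * (\<Sum>j<k + 1. \<theta> ^ j) \<le> (C - 1) * (if p < \<alpha> then 1 else if p = \<alpha> then 1 + ln N else N powr (p - \<alpha>))"
        unfolding C_def using K by (simp add: mult.assoc mult_left_mono)
      also have "\<dots> \<le> C * (if p < \<alpha> then 1 else if p = \<alpha> then 1 + ln N else N powr (p - \<alpha>))"
        using N by (intro mult_right_mono) auto
      finally show ?thesis .
    qed
    finally show ?thesis .
  qed
  thus ?thesis using that[OF C] by blast
qed

text \<open>
  The same decomposition with scales \<open>2 ^ k * N\<close>; the ratio \<open>2 powr (2 - \<alpha>)\<close> is less than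
  \<open>1\<close>.
\<close>
lemma tail_second_moment:
  fixes R :: "'a \<Rightarrow> real"
  assumes R[measurable]: "R \<in> borel_measurable M" and R1: "\<And>x. 1 \<le> R x"
    and tail: "\<And>s. s > 0 \<Longrightarrow> prob {x \<in> space M. s \<le> R x} \<le> K * s powr (- \<alpha>)" and K: "K \<ge> 0" and \<alpha>: "\<alpha> > 2"
  obtains C where "C > 0" "\<And>N. N \<ge> 1 \<Longrightarrow> integrable M (\<lambda>x. (R x)\<^sup>2 * indicator {x. N < R x} x)"
    "\<And>N. N \<ge> 1 \<Longrightarrow> expectation (\<lambda>x. (R x)\<^sup>2 * indicator {x. N < R x} x) \<le> C * N powr (2 - \<alpha>)"
proof -
  define \<theta> where "\<theta> = 2 powr (2 - \<alpha>)"
  have \<theta>: "\<theta> > 0" "\<theta> < 1" using \<alpha> by (simp_all add: \<theta>_def powr_less_one)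
  define C where "C = 1 + 4 * K / (1 - \<theta>)"
  have C: "C > 0" unfolding C_def using K \<theta> by (intro add_pos_nonneg) auto
  have main: "(\<integral>\<^sup>+ x. ennreal ((R x)\<^sup>2 * indicator {x. N < R x} x) \<partial>M) \<le> ennreal (C * N powr (2 - \<alpha>))" if N: "N \<ge> 1" for N
  proof -
    let ?t = "\<lambda>k x. (2 ^ (k + 1) * N)\<^sup>2 * indicator {x \<in> space M. 2 ^ k * N \<le> R x} x :: real"
    have ev[measurable]: "{x \<in> space M. 2 ^ k * N \<le> R x} \<in> events" for k :: nat by measurable
    have "(\<integral>\<^sup>+ x. ennreal ((R x)\<^sup>2 * indicator {x. N < R x} x) \<partial>M) \<le> (\<integral>\<^sup>+ x. (\<Sum>k. ennreal (?t k x)) \<partial>M)"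
    proof (rule nn_integral_mono)
      fix x assume x: "x \<in> space M"
      show "ennreal ((R x)\<^sup>2 * indicator {x. N < R x} x) \<le> (\<Sum>k. ennreal (?t k x))"
      proof (cases "N < R x")
        case True
        have "R x / N \<ge> 1" using True N by simp
        then obtain k where "2 ^ k \<le> R x / N" "R x / N < 2 ^ (k + 1)" by (rule dyadic_scale)
        hence k: "2 ^ k * N \<le> R x" "R x \<le> 2 ^ (k + 1) * N" using N by (simp_all add: field_simps)
        have "(R x)\<^sup>2 \<le> (2 ^ (k + 1) * N)\<^sup>2" using k(2) R1[of x] by (intro power_mono) auto
        also have "\<dots> = ?t k x" using k x by simp
        finally have "ennreal ((R x)\<^sup>2 * indicator {x. N < R x} x) \<le> ennreal (?t k x)" using True by (intro ennreal_leI) simp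
        also have "\<dots> \<le> (\<Sum>k. ennreal (?t k x))" by (rule le_suminf_ennreal)
        finally show ?thesis .
      qed simp
    qed
    also have "\<dots> = (\<Sum>k. \<integral>\<^sup>+ x. ennreal (?t k x) \<partial>M)" by (rule nn_integral_suminf) measurable
    also have "\<dots> \<le> (\<Sum>k. ennreal (4 * K * N powr (2 - \<alpha>) * \<theta> ^ k))"
    proof (rule suminf_le)
      fix k :: nat
      have "(\<integral>\<^sup>+ x. ennreal (?t k x) \<partial>M) = ennreal ((2 ^ (k + 1) * N)\<^sup>2 * prob {x \<in> space M. 2 ^ k * N \<le> R x})"
      proof -
        have "ennreal (?t k x) = ennreal ((2 ^ (k + 1) * N)\<^sup>2) * indicator {x \<in> space M. 2 ^ k * N \<le> R x} x" for x
          by (simp split: split_indicator)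
        thus ?thesis by (simp only: nn_integral_cmult_indicator[OF ev] emeasure_eq_measure) (simp add: ennreal_mult')
      qed
      also have "\<dots> \<le> ennreal (4 * K * N powr (2 - \<alpha>) * \<theta> ^ k)"
      proof (rule ennreal_leI)
        have "(2 ^ (k + 1) * N)\<^sup>2 * prob {x \<in> space M. 2 ^ k * N \<le> R x} \<le> (2 ^ (k + 1) * N)\<^sup>2 * (K * (2 ^ k * N) powr (- \<alpha>))"
          using N by (intro mult_left_mono tail) auto
        also have "\<dots> = 4 * K * ((2 ^ k * N) powr 2 * (2 ^ k * N) powr (- \<alpha>))"
          using N by (simp add: power_mult_distrib)
        also have "\<dots> = 4 * K * (2 ^ k * N) powr (2 - \<alpha>)" by (simp only: powr_add[symmetric]) simp
        also have "(2 ^ k * N) powr (2 - \<alpha>) = N powr (2 - \<alpha>) * \<theta> ^ k"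
          using N by (simp add: powr_mult \<theta>_def powr_realpow[symmetric] powr_powr mult.commute)
        finally show "(2 ^ (k + 1) * N)\<^sup>2 * prob {x \<in> space M. 2 ^ k * N \<le> R x} \<le> 4 * K * N powr (2 - \<alpha>) * \<theta> ^ k" by (simp add: mult.assoc)
      qed
      finally show "(\<integral>\<^sup>+ x. ennreal (?t k x) \<partial>M) \<le> ennreal (4 * K * N powr (2 - \<alpha>) * \<theta> ^ k)" .
    qed auto
    also have "\<dots> = ennreal (\<Sum>k. 4 * K * N powr (2 - \<alpha>) * \<theta> ^ k)"
      using K \<theta> N by (intro suminf_ennreal2 summable_mult summable_geometric) auto
    also have "(\<Sum>k. 4 * K * N powr (2 - \<alpha>) * \<theta> ^ k) = 4 * K / (1 - \<theta>) * N powr (2 - \<alpha>)"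
      using \<theta> by (subst suminf_mult) (auto simp: suminf_geometric summable_geometric)
    also have "ennreal \<dots> \<le> ennreal (C * N powr (2 - \<alpha>))"
      by (intro ennreal_leI mult_right_mono) (auto simp: C_def)
    finally show ?thesis .
  qed
  have nn: "0 \<le> (R x)\<^sup>2 * indicator {x. N < R x} x" for x N by simp
  have ms: "(\<lambda>x. (R x)\<^sup>2 * indicator {x. N < R x} x) \<in> borel_measurable M" for N
    unfolding indicator_def by measurable
  have int: "integrable M (\<lambda>x. (R x)\<^sup>2 * indicator {x. N < R x} x)" if "N \<ge> 1" for N
  proof (rule integrableI_bounded[OF ms])
    have "(\<integral>\<^sup>+ x. ennreal (norm ((R x)\<^sup>2 * indicator {x. N < R x} x)) \<partial>M) \<le> ennreal (C * N powr (2 - \<alpha>))"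
      using main[OF that] by simp
    also have "\<dots> < \<infinity>" by simp
    finally show "(\<integral>\<^sup>+ x. ennreal (norm ((R x)\<^sup>2 * indicator {x. N < R x} x)) \<partial>M) < \<infinity>" .
  qed
  have "expectation (\<lambda>x. (R x)\<^sup>2 * indicator {x. N < R x} x) \<le> C * N powr (2 - \<alpha>)" if "N \<ge> 1" for N
  proof -
    have "ennreal (expectation (\<lambda>x. (R x)\<^sup>2 * indicator {x. N < R x} x)) \<le> ennreal (C * N powr (2 - \<alpha>))"
      using main[OF that] by (subst nn_integral_eq_integral[symmetric, OF int[OF that]]) auto
    thus ?thesis using C by (subst (asm) ennreal_le_iff) auto
  qed
  thus ?thesis using that[OF C int] by blast
qed

end

text \<open>
  If \<open>s > 2\<close> and \<open>1 + jump_size \<zeta> powr (1 / \<gamma>) \<ge> s\<close>, then one of the two coordinates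
  has at least half the size \<open>(s / 2) powr \<gamma>\<close>. For \<open>s \<le> 2\<close> the bound is at least \<open>1\<close>.
\<close>
lemma pair_tail:
  fixes \<mu> :: "real measure" and \<beta> \<gamma> K :: real
  assumes "prob_space \<mu>" and sets: "sets \<mu> = sets borel" and tail: "\<And>u. u > 0 \<Longrightarrow> measure \<mu> {x. u \<le> \<bar>x\<bar>} \<le> K * u powr (- \<beta>)"
    and K: "K \<ge> 0" and \<beta>: "\<beta> > 0" and \<gamma>: "\<gamma> > 0"
  obtains K' where "K' \<ge> 0"
    "\<And>s. s > 0 \<Longrightarrow> measure (\<mu> \<Otimes>\<^sub>M \<mu>) {\<zeta> \<in> space (\<mu> \<Otimes>\<^sub>M \<mu>). s \<le> 1 + jump_size \<zeta> powr (1 / \<gamma>)} \<le> K' * s powr (- (\<gamma> * \<beta>))"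
proof -
  interpret prob_space \<mu> by fact
  interpret pair: pair_prob_space \<mu> \<mu> ..
  let ?\<nu> = "\<mu> \<Otimes>\<^sub>M \<mu>"
  have [measurable_cong]: "sets \<mu> = sets borel" by (rule sets)
  have sp: "space \<mu> = UNIV" using sets_eq_imp_space_eq[OF sets] by simp
  have marg: "measure ?\<nu> {\<zeta>. u \<le> \<bar>fst \<zeta>\<bar>} = measure \<mu> {x. u \<le> \<bar>x\<bar>}" "measure ?\<nu> {\<zeta>. u \<le> \<bar>snd \<zeta>\<bar>} = measure \<mu> {x. u \<le> \<bar>x\<bar>}" for u
  proof -
    have A: "{x. u \<le> \<bar>x\<bar>} \<in> sets \<mu>" by (simp add: sets)
    have e: "{\<zeta>. u \<le> \<bar>fst \<zeta>\<bar>} = {x. u \<le> \<bar>x\<bar>} \<times> space \<mu>" "{\<zeta>. u \<le> \<bar>snd \<zeta>\<bar>} = space \<mu> \<times> {x. u \<le> \<bar>x\<bar>}"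
      by (auto simp: sp)
    show "measure ?\<nu> {\<zeta>. u \<le> \<bar>fst \<zeta>\<bar>} = measure \<mu> {x. u \<le> \<bar>x\<bar>}"
      unfolding e(1) measure_def using A by (subst emeasure_pair_measure_Times) (simp_all add: emeasure_space_1)
    show "measure ?\<nu> {\<zeta>. u \<le> \<bar>snd \<zeta>\<bar>} = measure \<mu> {x. u \<le> \<bar>x\<bar>}"
      unfolding e(2) measure_def using A by (subst emeasure_pair_measure_Times) (simp_all add: emeasure_space_1)
  qed
  define K' where "K' = 2 powr (\<gamma> * \<beta>) + 2 * K * 2 powr \<beta> * 2 powr (\<gamma> * \<beta>)"
  have K': "K' \<ge> 0" unfolding K'_def using K by simp
  have "measure ?\<nu> {\<zeta> \<in> space ?\<nu>. s \<le> 1 + jump_size \<zeta> powr (1 / \<gamma>)} \<le> K' * s powr (- (\<gamma> * \<beta>))" if s: "s > 0" for s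
  proof (cases "s \<le> 2")
    case True
    have "1 = 2 powr (\<gamma> * \<beta>) * 2 powr (- (\<gamma> * \<beta>))" by (simp add: powr_minus)
    also have "\<dots> \<le> 2 powr (\<gamma> * \<beta>) * s powr (- (\<gamma> * \<beta>))" using True s \<beta> \<gamma> by (intro mult_left_mono powr_mono2') auto
    also have "\<dots> \<le> K' * s powr (- (\<gamma> * \<beta>))" unfolding K'_def using K by (intro mult_right_mono) auto
    finally show ?thesis using pair.P.prob_le_1 order_trans by blast
  next
    case False
    define u where "u = (s / 2) powr \<gamma> / 2"
    have u: "u > 0" using s by (simp add: u_def)
    have sub: "{\<zeta> \<in> space ?\<nu>. s \<le> 1 + jump_size \<zeta> powr (1 / \<gamma>)} \<subseteq> {\<zeta>. u \<le> \<bar>fst \<zeta>\<bar>} \<union> {\<zeta>. u \<le> \<bar>snd \<zeta>\<bar>}"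
    proof
      fix \<zeta> assume "\<zeta> \<in> {\<zeta> \<in> space ?\<nu>. s \<le> 1 + jump_size \<zeta> powr (1 / \<gamma>)}"
      hence h: "s / 2 \<le> jump_size \<zeta> powr (1 / \<gamma>)" using False by auto
      have "jump_size \<zeta> \<noteq> 0" using h s by auto
      moreover have "jump_size \<zeta> \<ge> 0" by (simp add: jump_size_def)
      ultimately have j0: "jump_size \<zeta> > 0" by simp
      have "(s / 2) powr \<gamma> \<le> (jump_size \<zeta> powr (1 / \<gamma>)) powr \<gamma>" using h s \<gamma> by (intro powr_mono2) auto
      also have "\<dots> = jump_size \<zeta>" using j0 \<gamma> by (simp add: powr_powr)
      finally have "2 * u \<le> \<bar>fst \<zeta>\<bar> + \<bar>snd \<zeta>\<bar>" by (simp add: u_def jump_size_def)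
      hence "u \<le> \<bar>fst \<zeta>\<bar> \<or> u \<le> \<bar>snd \<zeta>\<bar>" by linarith
      thus "\<zeta> \<in> {\<zeta>. u \<le> \<bar>fst \<zeta>\<bar>} \<union> {\<zeta>. u \<le> \<bar>snd \<zeta>\<bar>}" by auto
    qed
    have ev: "{\<zeta>. u \<le> \<bar>fst \<zeta>\<bar>} \<in> sets ?\<nu>" "{\<zeta>. u \<le> \<bar>snd \<zeta>\<bar>} \<in> sets ?\<nu>"
    proof -
      have "{\<zeta> \<in> space ?\<nu>. u \<le> \<bar>fst \<zeta>\<bar>} \<in> sets ?\<nu>" "{\<zeta> \<in> space ?\<nu>. u \<le> \<bar>snd \<zeta>\<bar>} \<in> sets ?\<nu>" by measurable
      thus "{\<zeta>. u \<le> \<bar>fst \<zeta>\<bar>} \<in> sets ?\<nu>" "{\<zeta>. u \<le> \<bar>snd \<zeta>\<bar>} \<in> sets ?\<nu>" by (simp_all add: space_pair_measure sp)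
    qed
    have "measure ?\<nu> {\<zeta> \<in> space ?\<nu>. s \<le> 1 + jump_size \<zeta> powr (1 / \<gamma>)} \<le> measure ?\<nu> ({\<zeta>. u \<le> \<bar>fst \<zeta>\<bar>} \<union> {\<zeta>. u \<le> \<bar>snd \<zeta>\<bar>})"
      by (rule pair.P.finite_measure_mono[OF sub]) (use ev in auto)
    also have "\<dots> \<le> measure ?\<nu> {\<zeta>. u \<le> \<bar>fst \<zeta>\<bar>} + measure ?\<nu> {\<zeta>. u \<le> \<bar>snd \<zeta>\<bar>}"
      by (rule measure_Un_le) (use ev in auto)
    also have "\<dots> \<le> 2 * (K * u powr (- \<beta>))" unfolding marg using tail[OF u] by simp
    also have "u powr (- \<beta>) = 2 powr \<beta> * 2 powr (\<gamma> * \<beta>) * s powr (- (\<gamma> * \<beta>))"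
      using s by (simp add: u_def powr_divide powr_mult powr_powr powr_minus field_simps)
    also have "2 * (K * (2 powr \<beta> * 2 powr (\<gamma> * \<beta>) * s powr (- (\<gamma> * \<beta>)))) \<le> K' * s powr (- (\<gamma> * \<beta>))"
      unfolding K'_def by (simp add: algebra_simps)
    finally show ?thesis .
  qed
  thus ?thesis using that[OF K'] by blast
qed

lemma one_le_ln: "n \<ge> 2 \<Longrightarrow> 1 \<le> ln (real n) / ln 2"
  by simp

lemma rate_threshold:
  fixes d \<beta> a :: real
  assumes "\<beta> > 0"
  shows "d < 1 - a / \<beta> \<longleftrightarrow> a < (1 - d) * \<beta>" "d = 1 - a / \<beta> \<longleftrightarrow> a = (1 - d) * \<beta>"
proof -
  have "d < 1 - a / \<beta> \<longleftrightarrow> a / \<beta> < 1 - d" "d = 1 - a / \<beta> \<longleftrightarrow> a / \<beta> = 1 - d" by auto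
  thus "d < 1 - a / \<beta> \<longleftrightarrow> a < (1 - d) * \<beta>" "d = 1 - a / \<beta> \<longleftrightarrow> a = (1 - d) * \<beta>"
    using assms by (simp_all add: pos_divide_less_eq divide_eq_eq)
qed

text \<open>
  The two summands are the truncated third moment divided by the truncation level \<open>N\<close> and the
  second moment above that level. For \<open>\<alpha> < 3\<close> they are of the same order; in the critical
  case the terms without a logarithm are multiplied by \<open>ln n / ln 2 \<ge> 1\<close>.
\<close>
lemma wasserstein_rate_bound:
  assumes \<beta>: "\<beta> > 0" and \<alpha>: "\<alpha> = (1 - d) * \<beta>" "\<alpha> > 2" and C: "C2 \<ge> 0" "C3 \<ge> 0"
    and n: "n \<ge> 1" and crit: "n \<ge> 2 \<or> d \<noteq> 1 - 3 / \<beta>"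
  defines "N \<equiv> sqrt (real n)"
  shows "C3 * (if real 3 < \<alpha> then 1 else if real 3 = \<alpha> then 1 + ln N else N powr (real 3 - \<alpha>)) / N + C2 * N powr (2 - \<alpha>)
    \<le> (C3 * (1 / ln 2 + 1) + C2 / ln 2 + C2) * wasserstein_rate \<beta> d n"
    and "real n powr (- 1 / 2) \<le> (1 / ln 2 + 1) * wasserstein_rate \<beta> d n"
proof -
  have N: "N \<ge> 1" "N > 0" using n by (simp_all add: N_def)
  have Np: "N powr a = real n powr (a / 2)" for a
  proof -
    have "N = real n powr (1 / 2)" by (simp add: N_def powr_half_sqrt)
    thus ?thesis by (simp only: powr_powr) simp
  qed
  have Ninv: "1 / N = real n powr (- 1 / 2)"
  proof -
    have "1 / N = N powr (- 1)" using N by (simp add: powr_minus divide_inverse)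
    thus ?thesis by (simp only: Np)
  qed
  have l2: "ln 2 > (0::real)" "ln 2 \<le> (1::real)" using ln_le_minus_one[of "2::real"] by simp_all
  have L: "(1::real) \<le> 1 / ln 2 + 1" using l2 by simp
  have c3: "d < 1 - 3 / \<beta> \<longleftrightarrow> 3 < \<alpha>" "d = 1 - 3 / \<beta> \<longleftrightarrow> 3 = \<alpha>" unfolding \<alpha>(1) by (rule rate_threshold[OF \<beta>])+
  let ?r = "wasserstein_rate \<beta> d n"
  let ?L = "C3 * (1 / ln 2 + 1) + C2 / ln 2 + C2"
  have LC: "C3 + C2 \<le> ?L" using C l2 by (simp add: distrib_left)
  consider "3 < \<alpha>" | "3 = \<alpha>" | "\<alpha> < 3" by linarith
  hence "C3 * (if real 3 < \<alpha> then 1 else if real 3 = \<alpha> then 1 + ln N else N powr (real 3 - \<alpha>)) / N + C2 * N powr (2 - \<alpha>) \<le> ?L * ?r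
    \<and> real n powr (- 1 / 2) \<le> (1 / ln 2 + 1) * ?r"
  proof cases
    case 1
    have r: "?r = real n powr (- 1 / 2)" using 1 c3 by (simp add: wasserstein_rate_def)
    have "N powr (2 - \<alpha>) \<le> N powr (- 1)" using 1 N by (intro powr_mono) auto
    also have "\<dots> = ?r" unfolding Np r by simp
    finally have "C3 * 1 / N + C2 * N powr (2 - \<alpha>) \<le> C3 * ?r + C2 * ?r"
    proof (intro add_mono mult_left_mono)
      have "C3 * 1 / N = C3 * (1 / N)" by simp
      thus "C3 * 1 / N \<le> C3 * ?r" unfolding Ninv r by (simp only: order_refl)
    qed (use C in simp_all)
    also have "\<dots> = (C3 + C2) * ?r" by (simp add: distrib_right)
    also have "\<dots> \<le> ?L * ?r" by (intro mult_right_mono LC) (simp add: r)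
    finally show ?thesis using 1 r mult_right_mono[OF L, of ?r] by simp
  next
    case 2
    hence n2: "n \<ge> 2" using crit c3 by auto
    have ln1: "1 \<le> ln (real n) / ln 2" by (rule one_le_ln[OF n2])
    have r: "?r = real n powr (- 1 / 2) * ln (real n)" using 2 c3 by (simp add: wasserstein_rate_def)
    have lnN: "ln N = ln (real n) / 2" using n by (simp add: N_def ln_sqrt)
    have p: "0 \<le> real n powr (- 1 / 2)" by simp
    have a: "real n powr (- 1 / 2) \<le> 1 / ln 2 * ?r" using mult_left_mono[OF ln1 p] by (simp add: r mult_ac)
    have "N powr (2 - \<alpha>) = real n powr (- 1 / 2)"
    proof -
      have "2 - \<alpha> = - 1" using 2 by simp
      thus ?thesis by (simp only: Np)
    qed
    hence "C2 * N powr (2 - \<alpha>) \<le> C2 * (1 / ln 2 * ?r)" using a C by (intro mult_left_mono) auto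
    moreover have "C3 * (1 + ln N) / N \<le> C3 * ((1 / ln 2 + 1) * ?r)"
    proof -
      have "(1 + ln N) / N = real n powr (- 1 / 2) + ln (real n) / 2 * real n powr (- 1 / 2)"
      proof -
        have "(1 + ln N) / N = 1 / N + ln N * (1 / N)" by (simp add: add_divide_distrib)
        thus ?thesis unfolding Ninv lnN .
      qed
      also have "\<dots> \<le> 1 / ln 2 * ?r + ?r"
        using a n2 by (intro add_mono) (simp_all add: r)
      finally have "(1 + ln N) / N \<le> (1 / ln 2 + 1) * ?r" by (simp add: distrib_right)
      from mult_left_mono[OF this C(2)] show ?thesis by simp
    qed
    moreover have "0 \<le> C2 * ?r" using C n2 by (simp add: r)
    ultimately have "C3 * (1 + ln N) / N + C2 * N powr (2 - \<alpha>) \<le> ?L * ?r" by (simp add: distrib_right mult.assoc)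
    moreover have "0 \<le> ?r" using n2 by (simp add: r)
    ultimately show ?thesis using 2 a by (simp add: distrib_right)
  next
    case 3
    have r: "?r = real n powr (1 - \<alpha> / 2)" using 3 c3 by (auto simp: wasserstein_rate_def \<alpha>)
    have "N powr (3 - \<alpha>) / N = N powr (2 - \<alpha>)"
      using N powr_diff[of N "3 - \<alpha>" 1] by simp
    moreover have "N powr (2 - \<alpha>) = ?r" unfolding Np r by (simp add: diff_divide_distrib)
    ultimately have q: "N powr (3 - \<alpha>) / N = ?r" "N powr (2 - \<alpha>) = ?r" by simp_all
    have "C3 * N powr (3 - \<alpha>) / N + C2 * N powr (2 - \<alpha>) = (C3 + C2) * ?r"
      unfolding times_divide_eq_right[symmetric] q by (simp only: distrib_right)
    also have "\<dots> \<le> ?L * ?r" by (intro mult_right_mono LC) (simp add: r)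
    finally have 1: "C3 * N powr (3 - \<alpha>) / N + C2 * N powr (2 - \<alpha>) \<le> ?L * ?r" .
    have "real n powr (- 1 / 2) \<le> ?r" unfolding r using 3 n by (intro powr_mono) auto
    also have "\<dots> \<le> (1 / ln 2 + 1) * ?r" using mult_right_mono[OF L, of ?r] by (simp add: r)
    finally show ?thesis using 1 3 by simp
  qed
  thus "C3 * (if real 3 < \<alpha> then 1 else if real 3 = \<alpha> then 1 + ln N else N powr (real 3 - \<alpha>)) / N + C2 * N powr (2 - \<alpha>) \<le> ?L * ?r"
    "real n powr (- 1 / 2) \<le> (1 / ln 2 + 1) * ?r" by blast+
qed

text \<open>
  The first summand dominates: \<open>N powr (2 - \<alpha>)\<close> is the square of the rate
  \<open>N powr (1 - \<alpha> / 2)\<close> for \<open>\<alpha> < 4\<close>, and at most \<open>1 / N\<close> otherwise.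
\<close>
lemma kolmogorov_rate_bound:
  assumes \<beta>: "\<beta> > 0" and \<alpha>: "\<alpha> = (1 - d) * \<beta>" "\<alpha> > 2" and C: "C2 \<ge> 0" "C4 \<ge> 0"
    and n: "n \<ge> 1" and crit: "n \<ge> 2 \<or> d \<noteq> 1 - 4 / \<beta>"
  defines "N \<equiv> sqrt (real n)"
  shows "sqrt ((1 + C4 * (if real 4 < \<alpha> then 1 else if real 4 = \<alpha> then 1 + ln N else N powr (real 4 - \<alpha>))) / real n) + C2 * N powr (2 - \<alpha>)
    \<le> (sqrt (1 + C4) * (1 / ln 2 + 1) + C2 / ln 2 + C2) * kolmogorov_rate \<beta> d n"
proof -
  have N: "N \<ge> 1" "N > 0" using n by (simp_all add: N_def)
  have Np: "N powr a = real n powr (a / 2)" for a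
  proof -
    have "N = real n powr (1 / 2)" by (simp add: N_def powr_half_sqrt)
    thus ?thesis by (simp only: powr_powr) simp
  qed
  have sq: "sqrt (1 / real n) = real n powr (- 1 / 2)"
  proof -
    have "real n powr (- 1 / 2) = inverse (real n powr (1 / 2))" by (simp only: powr_minus[symmetric]) simp
    also have "real n powr (1 / 2) = sqrt (real n)" by (rule powr_half_sqrt) simp
    finally show ?thesis by (simp add: real_sqrt_divide inverse_eq_divide)
  qed
  have l2: "ln 2 > (0::real)" "ln 2 \<le> (1::real)" using ln_le_minus_one[of "2::real"] by simp_all
  have c4: "d < 1 - 4 / \<beta> \<longleftrightarrow> 4 < \<alpha>" "d = 1 - 4 / \<beta> \<longleftrightarrow> 4 = \<alpha>" unfolding \<alpha>(1) by (rule rate_threshold[OF \<beta>])+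
  let ?r = "kolmogorov_rate \<beta> d n"
  let ?L = "sqrt (1 + C4) * (1 / ln 2 + 1) + C2 / ln 2 + C2"
  have S0: "0 \<le> sqrt (1 + C4)" using C by simp
  have LC: "sqrt (1 + C4) + C2 \<le> ?L" using C l2 by (simp add: distrib_left)
  have scale: "sqrt ((1 + C4 * x) / real n) \<le> sqrt (1 + C4) * sqrt (x / real n)" if "x \<ge> 1" for x
  proof -
    have "1 + C4 * x \<le> (1 + C4) * x" using that by (simp add: distrib_right)
    hence "(1 + C4 * x) / real n \<le> (1 + C4) * (x / real n)" by (simp add: divide_right_mono)
    thus ?thesis by (simp add: real_sqrt_mult[symmetric] del: real_sqrt_divide)
  qed
  consider "4 < \<alpha>" | "4 = \<alpha>" | "\<alpha> < 4" by linarith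
  thus ?thesis
  proof cases
    case 1
    have r: "?r = real n powr (- 1 / 2)" using 1 c4 by (simp add: kolmogorov_rate_def)
    have "N powr (2 - \<alpha>) \<le> N powr (- 1)" using 1 N by (intro powr_mono) auto
    also have "\<dots> = ?r" unfolding Np r by simp
    finally have "sqrt ((1 + C4 * 1) / real n) + C2 * N powr (2 - \<alpha>) \<le> sqrt (1 + C4) * ?r + C2 * ?r"
    proof (intro add_mono mult_left_mono)
      show "sqrt ((1 + C4 * 1) / real n) \<le> sqrt (1 + C4) * ?r" using scale[of 1] unfolding sq r by simp
    qed (use C in simp_all)
    also have "\<dots> = (sqrt (1 + C4) + C2) * ?r" by (simp add: distrib_right)
    also have "\<dots> \<le> ?L * ?r" by (intro mult_right_mono LC) (simp add: r)
    finally show ?thesis using 1 by simp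
  next
    case 2
    hence n2: "n \<ge> 2" using crit c4 by auto
    have ln1: "1 \<le> ln (real n) / ln 2" by (rule one_le_ln[OF n2])
    have ln0: "0 \<le> ln (real n)" using n2 by simp
    have r: "?r = real n powr (- 1 / 2) * ln (real n)" using 2 c4 by (simp add: kolmogorov_rate_def)
    have r0: "0 \<le> ?r" using ln0 by (simp add: r)
    have lnN: "ln N = ln (real n) / 2" using n by (simp add: N_def ln_sqrt)
    have p: "0 \<le> real n powr (- 1 / 2)" by simp
    have a: "real n powr (- 1 / 2) \<le> 1 / ln 2 * ?r" using mult_left_mono[OF ln1 p] by (simp add: r mult_ac)
    have "N powr (2 - \<alpha>) \<le> N powr (- 1)" using 2 N by (intro powr_mono) auto
    also have "\<dots> = real n powr (- 1 / 2)" by (simp only: Np)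
    finally have b: "C2 * N powr (2 - \<alpha>) \<le> C2 * (1 / ln 2 * ?r)" using a C by (intro mult_left_mono) auto
    have x1: "1 \<le> 1 + ln N" using ln0 by (simp add: lnN)
    have "sqrt ((1 + ln N) / real n) \<le> (1 + ln N) * sqrt (1 / real n)"
    proof -
      have "sqrt (1 + ln N) \<le> sqrt ((1 + ln N)\<^sup>2)" using x1 by (intro real_sqrt_le_mono self_le_power) auto
      also have "\<dots> = 1 + ln N" using x1 by simp
      finally show ?thesis using mult_right_mono[of "sqrt (1 + ln N)" "1 + ln N" "sqrt (1 / real n)"]
        by (simp add: real_sqrt_divide)
    qed
    also have "\<dots> = real n powr (- 1 / 2) + ln (real n) / 2 * real n powr (- 1 / 2)"
      unfolding sq lnN by (simp add: distrib_right)
    also have "\<dots> \<le> 1 / ln 2 * ?r + ?r" using a n2 by (intro add_mono) (simp_all add: r)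
    finally have "sqrt ((1 + ln N) / real n) \<le> (1 / ln 2 + 1) * ?r" by (simp add: distrib_right)
    from order_trans[OF scale[OF x1] mult_left_mono[OF this S0]]
    have "sqrt ((1 + C4 * (1 + ln N)) / real n) \<le> sqrt (1 + C4) * ((1 / ln 2 + 1) * ?r)" .
    moreover have "0 \<le> C2 * ?r" using C r0 by simp
    ultimately have "sqrt ((1 + C4 * (1 + ln N)) / real n) + C2 * N powr (2 - \<alpha>) \<le> sqrt (1 + C4) * ((1 / ln 2 + 1) * ?r) + C2 * (1 / ln 2 * ?r) + C2 * ?r"
      using b by linarith
    also have "\<dots> = ?L * ?r" by (simp add: distrib_right mult.assoc)
    finally show ?thesis using 2 by simp
  next
    case 3
    have r: "?r = real n powr ((1 - \<alpha> / 2) / 2)" using 3 c4 by (auto simp: kolmogorov_rate_def \<alpha>)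
    have x1: "1 \<le> N powr (4 - \<alpha>)" using N 3 by (intro ge_one_powr_ge_zero) auto
    have "N powr (4 - \<alpha>) / real n = real n powr (1 - \<alpha> / 2)"
    proof -
      have "real n powr ((4 - \<alpha>) / 2) / real n powr 1 = real n powr ((4 - \<alpha>) / 2 - 1)" by (rule powr_diff[symmetric])
      moreover have "(4 - \<alpha>) / 2 - 1 = 1 - \<alpha> / 2" by (simp add: field_simps)
      ultimately show ?thesis unfolding Np using n by simp
    qed
    hence "sqrt (N powr (4 - \<alpha>) / real n) = (real n powr (1 - \<alpha> / 2)) powr (1 / 2)" by (simp add: powr_half_sqrt)
    hence "sqrt (N powr (4 - \<alpha>) / real n) = ?r" unfolding r powr_powr by simp
    hence s: "sqrt ((1 + C4 * N powr (4 - \<alpha>)) / real n) \<le> sqrt (1 + C4) * ?r" using scale[OF x1] by simp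
    have "N powr (2 - \<alpha>) \<le> N powr (1 - \<alpha> / 2)" using N \<alpha>(2) by (intro powr_mono) auto
    also have "\<dots> = ?r" unfolding Np r ..
    finally have "sqrt ((1 + C4 * N powr (4 - \<alpha>)) / real n) + C2 * N powr (2 - \<alpha>) \<le> sqrt (1 + C4) * ?r + C2 * ?r"
      using s C by (intro add_mono mult_left_mono) auto
    also have "\<dots> = (sqrt (1 + C4) + C2) * ?r" by (simp add: distrib_right)
    also have "\<dots> \<le> ?L * ?r" by (intro mult_right_mono LC) (simp add: r)
    finally show ?thesis using 3 by simp
  qed
qed

section \<open>Local functionals of independent variables\<close>

definition clip :: "real \<Rightarrow> real \<Rightarrow> real" where
  "clip b u = min 1 (b * u)"

lemma clip_bounds: "b \<ge> 0 \<Longrightarrow> u \<ge> 0 \<Longrightarrow> 0 \<le> clip b u" "clip b u \<le> 1"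
  by (auto simp: clip_def)

lemma clip_subadd:
  assumes "b \<ge> 0" "0 \<le> s" "0 \<le> t" "u \<le> s + t"
  shows "clip b u \<le> clip b s + clip b t"
proof -
  have "b * u \<le> b * s + b * t" using mult_left_mono[OF assms(4,1)] by (simp add: distrib_left)
  moreover have "0 \<le> b * s" "0 \<le> b * t" using assms by auto
  ultimately show ?thesis unfolding clip_def by (simp add: min_def)
qed

lemma clip_mono: "b \<ge> 0 \<Longrightarrow> u \<le> v \<Longrightarrow> clip b u \<le> clip b v"
  unfolding clip_def by (intro min.mono mult_left_mono) auto

text \<open>
  A function \<open>W\<close> of independent variables with law \<open>\<mu>\<close> which reacts to a change of the
  coordinate \<open>j\<close> like a sum over times \<open>t \<in> T\<close> of clipped linear terms with coefficients
  \<open>B (t - j)\<close>, and to the change of two coordinates like the sum of the products. The scale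
  \<open>\<kappa>\<close> is of order \<open>card T powr (- 1 / 2)\<close> in the application. The variable \<open>Y\<close> bounds the total
  effect of one jump over all times, and the total effect at one time of a jump that is
  inserted in all places; \<open>A\<close> bounds its second moment. It is the finiteness of this
  moment that makes the sum behave like a sum of independent square integrable variables.
\<close>
locale local_functional = prob_space \<mu> for \<mu> :: "real measure" +
  fixes W :: "(int \<Rightarrow> real) \<Rightarrow> real" and lo hi :: int and T :: "int set"
    and B :: "int \<Rightarrow> real" and \<kappa> c A :: real and Y :: "real \<times> real \<Rightarrow> real"
  assumes sets_\<mu> [measurable_cong]: "sets \<mu> = sets borel"
    and W_measurable [measurable]: "W \<in> borel_measurable (Pi\<^sub>M UNIV (\<lambda>_. borel))"
    and W_bounded: "\<bar>W x\<bar> \<le> c"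
    and W_depends: "depends_on {lo..hi} W"
    and finite_T: "finite T" and B_nonneg: "B k \<ge> 0" and kappa_nonneg: "\<kappa> \<ge> 0"
    and W_first: "\<bar>W x - W (x(j := a))\<bar> \<le> \<kappa> * (\<Sum>t\<in>T. clip (B (t - j)) \<bar>x j - a\<bar>)"
    and W_second: "i \<noteq> j \<Longrightarrow> \<bar>W x - W (x(j := a)) - (W (x(i := b)) - W (x(i := b, j := a)))\<bar>
        \<le> \<kappa> * (\<Sum>t\<in>T. clip (B (t - j)) \<bar>x j - a\<bar> * clip (B (t - i)) \<bar>x i - b\<bar>)"
    and Y_measurable [measurable]: "Y \<in> borel_measurable (\<mu> \<Otimes>\<^sub>M \<mu>)"
    and Y_ge: "1 \<le> Y \<zeta>"
    and Y_sum: "(\<Sum>t\<in>T. clip (B (t - j)) (jump_size \<zeta>)) \<le> Y \<zeta>"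
    and Y_sum': "(\<Sum>j=lo..hi. clip (B (t - j)) (jump_size \<zeta>)) \<le> Y \<zeta>"
    and Y_sq: "integrable (\<mu> \<Otimes>\<^sub>M \<mu>) (\<lambda>\<zeta>. (Y \<zeta>)\<^sup>2)" "(\<integral>\<zeta>. (Y \<zeta>)\<^sup>2 \<partial>(\<mu> \<Otimes>\<^sub>M \<mu>)) \<le> A"
begin

abbreviation pair_law ("\<nu>") where "\<nu> \<equiv> \<mu> \<Otimes>\<^sub>M \<mu>"

lemma space_mu [simp]: "space \<mu> = UNIV"
  using sets_eq_imp_space_eq[OF sets_\<mu>] by simp

lemma prob_mu [simp]: "prob UNIV = 1"
  using prob_space by simp

sublocale pair: full_prob_space \<nu>
proof -
  interpret pair_prob_space \<mu> \<mu> ..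
  show "full_prob_space \<nu>" by unfold_locales (simp add: space_pair_measure)
qed

abbreviation P :: "(int \<Rightarrow> real \<times> real) measure" where "P \<equiv> Pi\<^sub>M UNIV (\<lambda>_. \<nu>)"

sublocale P: full_prob_space P
proof -
  interpret p: prob_space P by (rule pair.prob_space_config)
  show "full_prob_space P" by unfold_locales simp
qed

text \<open>
  The effect at time \<open>t\<close> of a jump in the coordinate \<open>j\<close>, and the total over all times. A
  configuration \<open>z\<close> carries two independent copies of the variables, and \<open>z j\<close> is both
  copies of the coordinate \<open>j\<close>.
\<close>
definition env :: "int \<Rightarrow> int \<Rightarrow> real \<times> real \<Rightarrow> real" where
  "env t j \<zeta> = clip (B (t - j)) (jump_size \<zeta>)"

definition load :: "int \<Rightarrow> real \<times> real \<Rightarrow> real" where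
  "load j \<zeta> = (\<Sum>t\<in>T. env t j \<zeta>)"

definition first :: "(int \<Rightarrow> real \<times> real) \<Rightarrow> int \<Rightarrow> real" where
  "first z = (\<lambda>i. fst (z i))"

text \<open>
  The hybrid of the two copies that interpolates between them as \<open>j\<close> runs through the window.
\<close>
definition mixed :: "int \<Rightarrow> (int \<Rightarrow> real \<times> real) \<Rightarrow> int \<Rightarrow> real" where
  "mixed j z = (\<lambda>i. if i \<le> j then fst (z i) else snd (z i))"

text \<open>
  Two ways of replacing the coordinate \<open>j\<close> by its copy: in the hybrid, where the differences
  telescope, and in the first copy.
\<close>
definition \<delta> :: "int \<Rightarrow> (int \<Rightarrow> real \<times> real) \<Rightarrow> real" where
  "\<delta> j z = W (mixed j z) - W ((mixed j z)(j := snd (z j)))"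

definition W' :: "int \<Rightarrow> (int \<Rightarrow> real \<times> real) \<Rightarrow> real" where
  "W' j z = W ((first z)(j := snd (z j)))"

abbreviation F :: "(int \<Rightarrow> real \<times> real) \<Rightarrow> real" where
  "F z \<equiv> W (first z)"

definition \<Delta> :: "int \<Rightarrow> (int \<Rightarrow> real \<times> real) \<Rightarrow> real" where
  "\<Delta> j z = F z - W' j z"

lemma config_fun_measurable:
  assumes "\<And>i. (\<lambda>z. f z i) \<in> borel_measurable N"
  shows "(\<lambda>z. W (\<lambda>i. f z i)) \<in> borel_measurable N"
proof -
  have "(\<lambda>z i. f z i) \<in> measurable N (Pi\<^sub>M UNIV (\<lambda>_. borel))"
    by (rule measurable_PiM_single') (use assms in auto)
  thus ?thesis by measurable
qed

lemma F_measurable [measurable]: "F \<in> borel_measurable P"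
  unfolding first_def by (rule config_fun_measurable) measurable

lemma W'_measurable [measurable]: "W' j \<in> borel_measurable P"
  unfolding W'_def first_def fun_upd_def
  by (rule config_fun_measurable) measurable

lemma \<delta>_measurable [measurable]: "\<delta> j \<in> borel_measurable P"
proof -
  have "(\<lambda>z. W (mixed j z)) \<in> borel_measurable P"
    unfolding mixed_def by (rule config_fun_measurable) measurable
  moreover have "(\<lambda>z. W ((mixed j z)(j := snd (z j)))) \<in> borel_measurable P"
    unfolding mixed_def fun_upd_def by (rule config_fun_measurable) measurable
  ultimately show ?thesis unfolding \<delta>_def by measurable
qed

lemma \<Delta>_measurable [measurable]: "\<Delta> j \<in> borel_measurable P"
  unfolding \<Delta>_def by measurable

lemma env_measurable [measurable]: "env t j \<in> borel_measurable \<nu>"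
  unfolding env_def clip_def jump_size_def by measurable

lemma load_measurable [measurable]: "load j \<in> borel_measurable \<nu>"
  unfolding load_def by measurable

lemma jump_size_nonneg: "jump_size \<zeta> \<ge> 0" by (simp add: jump_size_def)

lemma env_bounds: "0 \<le> env t j \<zeta>" "env t j \<zeta> \<le> 1"
  using clip_bounds B_nonneg jump_size_nonneg by (auto simp: env_def)

lemma load_nonneg: "0 \<le> load j \<zeta>" unfolding load_def by (intro sum_nonneg env_bounds)

lemma load_le_Y: "load j \<zeta> \<le> Y \<zeta>" using Y_sum by (simp add: load_def env_def)

lemma load_le_card: "load j \<zeta> \<le> card T"
  unfolding load_def using sum_bounded_above[of T "\<lambda>t. env t j \<zeta>" 1] env_bounds by simp

lemma sum_env_le: "(\<Sum>j=lo..hi. env t j \<zeta>) \<le> Y \<zeta>" using Y_sum' by (simp add: env_def)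

lemma sum_load_le: "(\<Sum>j=lo..hi. load j \<zeta>) \<le> card T * Y \<zeta>"
proof -
  have "(\<Sum>j=lo..hi. load j \<zeta>) = (\<Sum>t\<in>T. \<Sum>j=lo..hi. env t j \<zeta>)"
    unfolding load_def by (rule sum.swap)
  also have "\<dots> \<le> (\<Sum>t\<in>T. Y \<zeta>)" by (intro sum_mono sum_env_le)
  finally show ?thesis by simp
qed

lemma clip_le_env1: "\<bar>a - b\<bar> \<le> jump_size \<zeta> \<Longrightarrow> clip (B (t - j)) \<bar>a - b\<bar> \<le> env t j \<zeta>"
  unfolding env_def by (intro clip_mono B_nonneg)

lemma clip_le_env2:
  assumes "\<bar>a\<bar> \<le> jump_size \<zeta>" "\<bar>b\<bar> \<le> jump_size \<zeta>'"
  shows "clip (B (t - j)) \<bar>a - b\<bar> \<le> env t j \<zeta> + env t j \<zeta>'"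
  unfolding env_def using assms by (intro clip_subadd B_nonneg jump_size_nonneg) linarith

lemma W_first_env:
  assumes "\<bar>x j - a\<bar> \<le> jump_size \<zeta>"
  shows "\<bar>W x - W (x(j := a))\<bar> \<le> \<kappa> * load j \<zeta>"
proof (rule order_trans[OF W_first])
  show "\<kappa> * (\<Sum>t\<in>T. clip (B (t - j)) \<bar>x j - a\<bar>) \<le> \<kappa> * load j \<zeta>"
    unfolding load_def by (intro mult_left_mono sum_mono clip_le_env1 assms kappa_nonneg)
qed

lemma W_first_env2:
  assumes "\<bar>x j\<bar> \<le> jump_size \<zeta>" "\<bar>a\<bar> \<le> jump_size \<zeta>'"
  shows "\<bar>W x - W (x(j := a))\<bar> \<le> \<kappa> * (load j \<zeta> + load j \<zeta>')"
proof (rule order_trans[OF W_first])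
  show "\<kappa> * (\<Sum>t\<in>T. clip (B (t - j)) \<bar>x j - a\<bar>) \<le> \<kappa> * (load j \<zeta> + load j \<zeta>')"
    unfolding load_def sum.distrib[symmetric] by (intro mult_left_mono sum_mono clip_le_env2 assms kappa_nonneg)
qed

text \<open>
  A bound for the second-order effect: the change of the response to a jump \<open>\<zeta>\<close> at \<open>j\<close>
  when the coordinate \<open>i\<close> changes from a copy in \<open>\<xi>\<close> to one in \<open>\<xi>'\<close>.
\<close>
definition sens :: "int \<Rightarrow> int \<Rightarrow> real \<times> real \<Rightarrow> real \<times> real \<Rightarrow> real \<times> real \<Rightarrow> real" where
  "sens j i \<zeta> \<xi> \<xi>' = (\<Sum>t\<in>T. env t j \<zeta> * (env t i \<xi> + env t i \<xi>'))"

lemma W_second_env: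
  assumes "i \<noteq> j" "\<bar>x j - a\<bar> \<le> jump_size \<zeta>" "\<bar>x i\<bar> \<le> jump_size \<xi>" "\<bar>b\<bar> \<le> jump_size \<xi>'"
  shows "\<bar>W x - W (x(j := a)) - (W (x(i := b)) - W (x(i := b, j := a)))\<bar> \<le> \<kappa> * sens j i \<zeta> \<xi> \<xi>'"
proof (rule order_trans[OF W_second[OF assms(1)]])
  show "\<kappa> * (\<Sum>t\<in>T. clip (B (t - j)) \<bar>x j - a\<bar> * clip (B (t - i)) \<bar>x i - b\<bar>) \<le> \<kappa> * sens j i \<zeta> \<xi> \<xi>'"
    unfolding sens_def
    by (intro mult_left_mono sum_mono mult_mono clip_le_env1 clip_le_env2 assms kappa_nonneg env_bounds clip_bounds B_nonneg) auto
qed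

lemma fst_snd_le: "\<bar>fst \<zeta>\<bar> \<le> jump_size \<zeta>" "\<bar>snd \<zeta>\<bar> \<le> jump_size \<zeta>" "\<bar>fst \<zeta> - snd \<zeta>\<bar> \<le> jump_size \<zeta>"
  by (auto simp: jump_size_def)

lemma \<delta>_le: "\<bar>\<delta> j z\<bar> \<le> \<kappa> * load j (z j)"
  unfolding \<delta>_def by (rule W_first_env) (simp add: mixed_def fst_snd_le)

lemma \<Delta>_le: "\<bar>\<Delta> j z\<bar> \<le> \<kappa> * load j (z j)"
  unfolding \<Delta>_def W'_def by (rule W_first_env) (simp add: first_def fst_snd_le)

lemma \<delta>_mixed:
  assumes "i \<noteq> j" shows "\<bar>\<delta> j z - \<delta> j (z(i := \<zeta>))\<bar> \<le> \<kappa> * sens j i (z j) (z i) \<zeta>"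
proof -
  define b where "b = (if i \<le> j then fst \<zeta> else snd \<zeta>)"
  have eq: "mixed j (z(i := \<zeta>)) = (mixed j z)(i := b)" by (auto simp: mixed_def b_def)
  have "\<bar>\<delta> j z - \<delta> j (z(i := \<zeta>))\<bar> = \<bar>W (mixed j z) - W ((mixed j z)(j := snd (z j)))
      - (W ((mixed j z)(i := b)) - W ((mixed j z)(i := b, j := snd (z j))))\<bar>"
    using assms by (simp add: \<delta>_def eq)
  also have "\<dots> \<le> \<kappa> * sens j i (z j) (z i) \<zeta>"
    by (rule W_second_env[OF assms]) (auto simp: mixed_def b_def fst_snd_le)
  finally show ?thesis .
qed

lemma \<Delta>_mixed:
  assumes "i \<noteq> j" shows "\<bar>\<Delta> j z - \<Delta> j (z(i := \<zeta>))\<bar> \<le> \<kappa> * sens j i (z j) (z i) \<zeta>"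
proof -
  have eq: "first (z(i := \<zeta>)) = (first z)(i := fst \<zeta>)" by (auto simp: first_def)
  have "\<bar>\<Delta> j z - \<Delta> j (z(i := \<zeta>))\<bar> = \<bar>W (first z) - W ((first z)(j := snd (z j)))
      - (W ((first z)(i := fst \<zeta>)) - W ((first z)(i := fst \<zeta>, j := snd (z j))))\<bar>"
    using assms by (simp add: \<Delta>_def W'_def eq)
  also have "\<dots> \<le> \<kappa> * sens j i (z j) (z i) \<zeta>"
    by (rule W_second_env[OF assms]) (auto simp: first_def fst_snd_le)
  finally show ?thesis .
qed

lemma \<delta>_depends: "depends_on {lo..hi} (\<delta> j)"
  unfolding depends_on_def
proof (intro allI impI)
  fix z z' :: "int \<Rightarrow> real \<times> real" assume *: "\<forall>i\<in>{lo..hi}. z i = z' i"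
  have "W (mixed j z) = W (mixed j z')"
    by (rule depends_onD[OF W_depends]) (use * in \<open>auto simp: mixed_def\<close>)
  moreover have "W ((mixed j z)(j := snd (z j))) = W ((mixed j z')(j := snd (z' j)))"
    by (rule depends_onD[OF W_depends]) (use * in \<open>auto simp: mixed_def\<close>)
  ultimately show "\<delta> j z = \<delta> j z'" by (simp add: \<delta>_def)
qed

lemma \<Delta>_depends: "depends_on {lo..hi} (\<Delta> j)"
  unfolding depends_on_def
proof (intro allI impI)
  fix z z' :: "int \<Rightarrow> real \<times> real" assume *: "\<forall>i\<in>{lo..hi}. z i = z' i"
  have "W (first z) = W (first z')"
    by (rule depends_onD[OF W_depends]) (use * in \<open>auto simp: first_def\<close>)
  moreover have "W ((first z)(j := snd (z j))) = W ((first z')(j := snd (z' j)))"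
    by (rule depends_onD[OF W_depends]) (use * in \<open>auto simp: first_def\<close>)
  ultimately show "\<Delta> j z = \<Delta> j z'" by (simp add: \<Delta>_def W'_def)
qed

definition flip :: "int \<Rightarrow> (int \<Rightarrow> real \<times> real) \<Rightarrow> int \<Rightarrow> real \<times> real" where
  "flip j z = z(j := (snd (z j), fst (z j)))"

lemma flip_measurable [measurable]: "flip j \<in> measurable P P"
  unfolding flip_def by measurable

text \<open>
  Resampling the coordinate \<open>j\<close> reduces this to the symmetry of the law \<open>\<nu>\<close> of a pair of
  independent copies.
\<close>
lemma integral_flip:
  fixes H :: "(int \<Rightarrow> real \<times> real) \<Rightarrow> real"
  assumes [measurable]: "H \<in> borel_measurable P" and b: "\<And>z. \<bar>H z\<bar> \<le> b"
  shows "(\<integral>z. H (flip j z) \<partial>P) = (\<integral>z. H z \<partial>P)"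
proof -
  interpret p: pair_prob_space \<mu> \<mu> ..
  have bij: "(\<integral>\<zeta>. h (snd \<zeta>, fst \<zeta>) \<partial>\<nu>) = (\<integral>\<zeta>. h \<zeta> \<partial>\<nu>)" if [measurable]: "h \<in> borel_measurable \<nu>" for h :: "real \<times> real \<Rightarrow> real"
  proof -
    have "(\<integral>\<zeta>. h \<zeta> \<partial>\<nu>) = (\<integral>\<zeta>. h \<zeta> \<partial>distr \<nu> \<nu> (\<lambda>(s, t). (t, s)))" by (simp flip: p.distr_pair_swap)
    also have "\<dots> = (\<integral>\<zeta>. h (case \<zeta> of (s, t) \<Rightarrow> (t, s)) \<partial>\<nu>)" by (rule integral_distr) measurable
    finally show ?thesis by (simp add: case_prod_beta)
  qed
  have mz[measurable]: "(\<lambda>_. z) \<in> measurable N P" for z and N :: "'x measure" by simp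
  have "(\<integral>z. H (flip j z) \<partial>P) = (\<integral>z. (\<integral>\<zeta>. H (flip j (z(j := \<zeta>))) \<partial>\<nu>) \<partial>P)"
    by (rule pair.config_resample[symmetric, where F = "\<lambda>z. H (flip j z)" and c = b]) (use b in measurable)
  also have "\<dots> = (\<integral>z. (\<integral>\<zeta>. H (z(j := (snd \<zeta>, fst \<zeta>))) \<partial>\<nu>) \<partial>P)" by (simp add: flip_def)
  also have "\<dots> = (\<integral>z. (\<integral>\<zeta>. H (z(j := \<zeta>)) \<partial>\<nu>) \<partial>P)"
  proof (rule Bochner_Integration.integral_cong[OF refl])
    fix z
    have "(\<lambda>\<zeta>. H (z(j := \<zeta>))) \<in> borel_measurable \<nu>" by measurable
    from bij[OF this] show "(\<integral>\<zeta>. H (z(j := (snd \<zeta>, fst \<zeta>))) \<partial>\<nu>) = (\<integral>\<zeta>. H (z(j := \<zeta>)) \<partial>\<nu>)" .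
  qed
  also have "\<dots> = (\<integral>z. H z \<partial>P)" by (rule pair.config_resample[where F = H and c = b]) (use b in measurable)
  finally show ?thesis .
qed

lemma F_flip: "F (flip j z) = W' j z" "W' j (flip j z) = F z"
proof -
  have "first (flip j z) = (first z)(j := snd (z j))" by (auto simp: first_def flip_def)
  thus "F (flip j z) = W' j z" by (simp add: W'_def)
  have "(first (flip j z))(j := snd (flip j z j)) = first z" by (auto simp: first_def flip_def)
  thus "W' j (flip j z) = F z" by (simp add: W'_def)
qed

lemma \<Delta>_flip: "\<Delta> j (flip j z) = - \<Delta> j z" by (simp add: \<Delta>_def F_flip)

lemma \<delta>_flip: "\<delta> j (flip j z) = - \<delta> j z"
proof -
  have "mixed j (flip j z) = (mixed j z)(j := snd (z j))" "(mixed j (flip j z))(j := snd (flip j z j)) = mixed j z"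
    by (auto simp: mixed_def flip_def)
  thus ?thesis by (simp add: \<delta>_def)
qed

text \<open>
  The coordinates on which \<open>G\<close> depends are integrated out one at a time, simultaneously in
  both factors.
\<close>
lemma independent_copies:
  fixes G H :: "(int \<Rightarrow> real) \<Rightarrow> real"
  assumes "finite S" and "G \<in> borel_measurable (Pi\<^sub>M UNIV (\<lambda>_. borel))" "\<And>x. \<bar>G x\<bar> \<le> a" "depends_on S G"
    and "H \<in> borel_measurable (Pi\<^sub>M UNIV (\<lambda>_. borel))" "\<And>x. \<bar>H x\<bar> \<le> b"
  shows "(\<integral>z. G (\<lambda>i. fst (z i)) * H (\<lambda>i. snd (z i)) \<partial>P)
       = (\<integral>z. G (\<lambda>i. fst (z i)) \<partial>P) * (\<integral>z. H (\<lambda>i. snd (z i)) \<partial>P)"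
  using assms
proof (induction S arbitrary: G H rule: finite_induct)
  case empty
  have "G z = G undefined" for z using depends_onD[OF empty.prems(3), of z undefined] by simp
  hence "G = (\<lambda>_. G undefined)" by auto
  then obtain a where "G = (\<lambda>_. a)" by blast
  thus ?case by simp
next
  case (insert i S)
  interpret p: pair_prob_space \<mu> \<mu> ..
  note m[measurable] = insert.prems(1,4)
  note bd = insert.prems(2,5)
  have a0: "0 \<le> a" using bd(1)[of undefined] by linarith
  have m1: "(\<lambda>z i. fst (z i)) \<in> measurable P (Pi\<^sub>M UNIV (\<lambda>_. borel))"
           "(\<lambda>z i. snd (z i)) \<in> measurable P (Pi\<^sub>M UNIV (\<lambda>_. borel))"
    by (rule measurable_PiM_single'; measurable)+
  note [measurable] = m1
  have mu: "(\<lambda>(x, s). x(i := s)) \<in> measurable (Pi\<^sub>M UNIV (\<lambda>_::int. borel) \<Otimes>\<^sub>M \<mu>) (Pi\<^sub>M UNIV (\<lambda>_. borel :: real measure))"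
    unfolding fun_upd_def case_prod_beta by (rule measurable_PiM_single'; measurable)
  define G' where "G' = (\<lambda>x. \<integral>s. G (x(i := s)) \<partial>\<mu>)"
  define H' where "H' = (\<lambda>x. \<integral>s. H (x(i := s)) \<partial>\<mu>)"
  have GHm[measurable]: "(\<lambda>(x, s). G (x(i := s))) \<in> borel_measurable (Pi\<^sub>M UNIV (\<lambda>_::int. borel) \<Otimes>\<^sub>M \<mu>)"
     "(\<lambda>(x, s). H (x(i := s))) \<in> borel_measurable (Pi\<^sub>M UNIV (\<lambda>_::int. borel) \<Otimes>\<^sub>M \<mu>)"
    using measurable_compose[OF mu m(1)] measurable_compose[OF mu m(2)] by (simp_all add: case_prod_beta del: fun_upd_apply)
  have G'm[measurable]: "G' \<in> borel_measurable (Pi\<^sub>M UNIV (\<lambda>_. borel))"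
    and H'm[measurable]: "H' \<in> borel_measurable (Pi\<^sub>M UNIV (\<lambda>_. borel))"
    unfolding G'_def H'_def by measurable
  have G'b: "\<bar>G' x\<bar> \<le> a" and H'b: "\<bar>H' x\<bar> \<le> b" for x
    unfolding G'_def H'_def by (intro integral_abs_bounded bd)+
  have G'd: "depends_on S G'" unfolding depends_on_def G'_def
  proof (intro allI impI Bochner_Integration.integral_cong[OF refl])
    fix z z' :: "int \<Rightarrow> real" and s assume "\<forall>i\<in>S. z i = z' i"
    thus "G (z(i := s)) = G (z'(i := s))" by (intro depends_onD[OF insert.prems(3)]) auto
  qed
  have mG: "(\<lambda>s. G (x(i := s))) \<in> borel_measurable \<mu>" "(\<lambda>s. H (x(i := s))) \<in> borel_measurable \<mu>" for x
  proof -
    have "(\<lambda>s. x(i := s)) \<in> measurable \<mu> (Pi\<^sub>M UNIV (\<lambda>_. borel))"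
      unfolding fun_upd_def by (rule measurable_PiM_single'; measurable)
    thus "(\<lambda>s. G (x(i := s))) \<in> borel_measurable \<mu>" "(\<lambda>s. H (x(i := s))) \<in> borel_measurable \<mu>"
      using m by (auto intro: measurable_compose)
  qed
  have upd: "(\<lambda>k. fst ((z(i := \<zeta>)) k)) = (\<lambda>k. fst (z k))(i := fst \<zeta>)"
            "(\<lambda>k. snd ((z(i := \<zeta>)) k)) = (\<lambda>k. snd (z k))(i := snd \<zeta>)" for z :: "int \<Rightarrow> real \<times> real" and \<zeta>
    by auto
  have fs: "(\<integral>\<zeta>. g (fst \<zeta>) * h (snd \<zeta>) \<partial>\<nu>) = (\<integral>s. g s \<partial>\<mu>) * (\<integral>s. h s \<partial>\<mu>)"
    if [measurable]: "g \<in> borel_measurable \<mu>" "h \<in> borel_measurable \<mu>" and gb: "\<And>s. \<bar>g s\<bar> \<le> a'" "\<And>s. \<bar>h s\<bar> \<le> b'"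
    for g h :: "real \<Rightarrow> real" and a' b'
  proof -
    have "0 \<le> a'" using gb(1)[of 0] by linarith
    hence "integrable \<nu> (\<lambda>(s, t). g s * h t)"
      by (intro pair.integrable_bounded[where c = "a' * b'"]) (auto simp: abs_mult gb intro!: mult_mono)
    from p.integral_fst[OF this] show ?thesis by (simp add: case_prod_beta')
  qed
  have "(\<integral>z. G (\<lambda>i. fst (z i)) * H (\<lambda>i. snd (z i)) \<partial>P)
      = (\<integral>z. (\<integral>\<zeta>. G (\<lambda>k. fst ((z(i := \<zeta>)) k)) * H (\<lambda>k. snd ((z(i := \<zeta>)) k)) \<partial>\<nu>) \<partial>P)"
    by (rule pair.config_resample[symmetric, where c = "a * b"])
       (use bd in \<open>auto simp: abs_mult intro!: mult_mono a0\<close>)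
  also have "\<dots> = (\<integral>z. G' (\<lambda>i. fst (z i)) * H' (\<lambda>i. snd (z i)) \<partial>P)"
    unfolding upd G'_def H'_def
    by (rule Bochner_Integration.integral_cong[OF refl], rule fs[OF mG bd])
  also have "\<dots> = (\<integral>z. G' (\<lambda>i. fst (z i)) \<partial>P) * (\<integral>z. H' (\<lambda>i. snd (z i)) \<partial>P)"
    by (rule insert.IH[OF G'm G'b G'd H'm H'b])
  also have "(\<integral>z. G' (\<lambda>i. fst (z i)) \<partial>P) = (\<integral>z. G (\<lambda>i. fst (z i)) \<partial>P)"
  proof -
    have "(\<integral>z. G (\<lambda>i. fst (z i)) \<partial>P) = (\<integral>z. (\<integral>\<zeta>. G (\<lambda>k. fst ((z(i := \<zeta>)) k)) \<partial>\<nu>) \<partial>P)"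
      by (rule pair.config_resample[symmetric, OF _ bd(1)]) measurable
    also have "\<dots> = (\<integral>z. G' (\<lambda>i. fst (z i)) \<partial>P)"
      unfolding upd G'_def using fs[OF mG(1) measurable_const bd(1), of 1 1] by (simp del: fun_upd_apply)
    finally show ?thesis by simp
  qed
  also have "(\<integral>z. H' (\<lambda>i. snd (z i)) \<partial>P) = (\<integral>z. H (\<lambda>i. snd (z i)) \<partial>P)"
  proof -
    have "(\<integral>z. H (\<lambda>i. snd (z i)) \<partial>P) = (\<integral>z. (\<integral>\<zeta>. H (\<lambda>k. snd ((z(i := \<zeta>)) k)) \<partial>\<nu>) \<partial>P)"
      by (rule pair.config_resample[symmetric, OF _ bd(2)]) measurable
    also have "\<dots> = (\<integral>z. H' (\<lambda>i. snd (z i)) \<partial>P)"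
      unfolding upd H'_def using fs[OF measurable_const mG(2) _ bd(2), of 1 1] by (simp del: fun_upd_apply)
    finally show ?thesis by simp
  qed
  finally show ?case .
qed

end

context local_functional begin

lemma \<kappa>load_le: "\<kappa> * load j \<zeta> \<le> \<kappa> * card T"
  by (intro mult_left_mono load_le_card kappa_nonneg)

lemma \<delta>_bounded: "\<bar>\<delta> j z\<bar> \<le> \<kappa> * card T" using \<delta>_le \<kappa>load_le order_trans by blast
lemma \<Delta>_bounded: "\<bar>\<Delta> j z\<bar> \<le> \<kappa> * card T" using \<Delta>_le \<kappa>load_le order_trans by blast

lemma component_integral:
  fixes h :: "real \<times> real \<Rightarrow> real"
  assumes [measurable]: "h \<in> borel_measurable \<nu>" and "\<And>\<zeta>. \<bar>h \<zeta>\<bar> \<le> b"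
  shows "(\<integral>z. h (z j) \<partial>P) = (\<integral>\<zeta>. h \<zeta> \<partial>\<nu>)"
proof -
  have "(\<integral>z. h (z j) \<partial>P) = (\<integral>z. (\<integral>\<zeta>. h ((z(j := \<zeta>)) j) \<partial>\<nu>) \<partial>P)"
    by (rule pair.config_resample[symmetric, OF _ assms(2)]) measurable
  thus ?thesis by simp
qed

lemma telescope: "(\<Sum>j=lo..hi. \<delta> j z) = F z - W (\<lambda>i. snd (z i))"
proof -
  have step: "(mixed j z)(j := snd (z j)) = mixed (j - 1) z" for j
    by (auto simp: mixed_def)
  have tele: "(\<Sum>j=lo..k. \<delta> j z) = W (mixed k z) - W (mixed (lo - 1) z)" if "lo - 1 \<le> k" for k
    using that
  proof (induction k rule: int_ge_induct)
    case base
    show ?case by simp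
  next
    case (step k)
    hence "{lo..k + 1} = insert (k + 1) {lo..k}" by auto
    thus ?case using step.IH step by (simp add: \<delta>_def \<open>\<And>j. (mixed j z)(j := snd (z j)) = mixed (j - 1) z\<close>)
  qed
  moreover have "W (mixed hi z) = F z"
    by (rule depends_onD[OF W_depends]) (auto simp: mixed_def first_def)
  moreover have "W (mixed (lo - 1) z) = W (\<lambda>i. snd (z i))"
    by (rule depends_onD[OF W_depends]) (auto simp: mixed_def)
  moreover have "W (mixed hi z) = W (mixed (lo - 1) z)" if "\<not> lo - 1 \<le> hi"
    by (rule depends_onD[OF W_depends]) (use that in auto)
  ultimately show ?thesis using tele[of hi] by (cases "lo - 1 \<le> hi") auto
qed

text \<open>
  An integration by parts. Replacing all variables by their copies makes the product with
  \<open>g (F z)\<close> centred, so \<open>F\<close> may be replaced by the sum of the telescoping differences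
  \<open>\<delta> j\<close>. Exchanging the copies of the coordinate \<open>j\<close> reverses the sign of \<open>\<delta> j\<close> and turns
  \<open>F\<close> into \<open>W' j\<close>; averaging both expressions gives the factor \<open>1 / 2\<close>.
\<close>
lemma stein_identity:
  fixes g :: "real \<Rightarrow> real"
  assumes [measurable]: "g \<in> borel_measurable borel" and g: "\<And>x. \<bar>g (W x)\<bar> \<le> b"
    and mean: "(\<integral>z. F z \<partial>P) = 0"
  shows "(\<integral>z. F z * g (F z) \<partial>P) = (\<Sum>j=lo..hi. (\<integral>z. \<delta> j z * (g (F z) - g (W' j z)) \<partial>P)) / 2"
proof -
  have b0: "0 \<le> b" using g[of undefined] by linarith
  have k0: "0 \<le> \<kappa> * card T" using kappa_nonneg by simp
  have c0: "0 \<le> c" using W_bounded[of undefined] by linarith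
  have [measurable]: "(\<lambda>z. W (\<lambda>i. snd (z i))) \<in> borel_measurable P" by (rule config_fun_measurable) measurable
  have gW': "\<bar>g (W' j z)\<bar> \<le> b" for j z unfolding W'_def by (rule g)
  have i1: "integrable P (\<lambda>z. \<delta> j z * g (F z))" for j
    by (rule P.integrable_bounded[where c = "\<kappa> * card T * b"])
       (use \<delta>_bounded g k0 in \<open>auto simp: abs_mult intro!: mult_mono\<close>)
  have i2: "integrable P (\<lambda>z. \<delta> j z * g (W' j z))" for j
    by (rule P.integrable_bounded[where c = "\<kappa> * card T * b"])
       (use \<delta>_bounded gW' k0 in \<open>auto simp: abs_mult intro!: mult_mono\<close>)
  have zero: "(\<integral>z. W (\<lambda>i. snd (z i)) * g (F z) \<partial>P) = 0"
  proof -
    have mswap: "(\<integral>z. W (\<lambda>i. snd (z i)) \<partial>P) = (\<integral>z. F z \<partial>P)"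
    proof -
      \<comment> \<open>flipping all coordinates of the window one after the other exchanges the two copies\<close>
      have "(\<integral>z. W (\<lambda>i. if i \<in> {lo..k} then fst (z i) else snd (z i)) \<partial>P) = (\<integral>z. W (\<lambda>i. snd (z i)) \<partial>P)"
        if "lo - 1 \<le> k" for k using that
      proof (induction k rule: int_ge_induct)
        case base show ?case by simp
      next
        case (step k)
        let ?H = "\<lambda>z. W (\<lambda>i. if i \<in> {lo..k} then fst (z i) else snd (z i))"
        have "?H (flip (k + 1) z) = W (\<lambda>i. if i \<in> {lo..k + 1} then fst (z i) else snd (z i))" for z
          using step.hyps by (intro arg_cong[of _ _ W]) (auto simp: flip_def fun_eq_iff)
        moreover have "(\<integral>z. ?H (flip (k + 1) z) \<partial>P) = (\<integral>z. ?H z \<partial>P)"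
          by (rule integral_flip[OF config_fun_measurable W_bounded]) measurable
        ultimately show ?case using step.IH by simp
      qed
      from this[of "max hi (lo - 1)"] have "(\<integral>z. W (\<lambda>i. snd (z i)) \<partial>P) =
        (\<integral>z. W (\<lambda>i. if i \<in> {lo..max hi (lo - 1)} then fst (z i) else snd (z i)) \<partial>P)" by simp
      also have "\<dots> = (\<integral>z. F z \<partial>P)"
        by (intro Bochner_Integration.integral_cong refl depends_onD[OF W_depends]) (auto simp: first_def)
      finally show ?thesis .
    qed
    show ?thesis
    proof -
      have "(\<integral>z. g (W (\<lambda>i. fst (z i))) * W (\<lambda>i. snd (z i)) \<partial>P)
         = (\<integral>z. g (W (\<lambda>i. fst (z i))) \<partial>P) * (\<integral>z. W (\<lambda>i. snd (z i)) \<partial>P)"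
      proof (rule independent_copies[where S = "{lo..hi}"])
        show "depends_on {lo..hi} (\<lambda>x. g (W x))" unfolding depends_on_def
        proof (intro allI impI)
          fix z z' :: "int \<Rightarrow> real" assume "\<forall>i\<in>{lo..hi}. z i = z' i"
          hence "W z = W z'" by (intro depends_onD[OF W_depends]) auto
          thus "g (W z) = g (W z')" by simp
        qed
      qed (use g W_bounded in auto)
      thus ?thesis using mswap mean by (simp add: first_def mult.commute)
    qed
  qed
  have "(\<integral>z. F z * g (F z) \<partial>P) = (\<integral>z. (F z - W (\<lambda>i. snd (z i))) * g (F z) \<partial>P)"
  proof -
    have "integrable P (\<lambda>z. F z * g (F z))" "integrable P (\<lambda>z. W (\<lambda>i. snd (z i)) * g (F z))"
      by (rule P.integrable_bounded[where c = "c * b"];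
          use W_bounded g c0 in \<open>auto simp: abs_mult intro!: mult_mono\<close>)+
    thus ?thesis using zero by (simp add: left_diff_distrib)
  qed
  also have "\<dots> = (\<Sum>j=lo..hi. (\<integral>z. \<delta> j z * g (F z) \<partial>P))"
    unfolding telescope[symmetric] using i1 by (simp add: sum_distrib_right)
  also have "\<dots> = (\<Sum>j=lo..hi. (\<integral>z. \<delta> j z * (g (F z) - g (W' j z)) \<partial>P) / 2)"
  proof (rule sum.cong[OF refl])
    fix j
    have "(\<integral>z. \<delta> j z * g (F z) \<partial>P) = (\<integral>z. \<delta> j (flip j z) * g (F (flip j z)) \<partial>P)"
      by (rule integral_flip[symmetric, where b = "\<kappa> * card T * b"])
         (use \<delta>_bounded g k0 in \<open>auto simp: abs_mult intro!: mult_mono\<close>)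
    also have "\<dots> = - (\<integral>z. \<delta> j z * g (W' j z) \<partial>P)" by (simp add: \<delta>_flip F_flip)
    finally show "(\<integral>z. \<delta> j z * g (F z) \<partial>P) = (\<integral>z. \<delta> j z * (g (F z) - g (W' j z)) \<partial>P) / 2"
      using i1[of j] i2[of j] by (simp add: right_diff_distrib)
  qed
  finally show ?thesis by (simp add: sum_divide_distrib)
qed

end

section \<open>Lipschitz test functions\<close>

context local_functional begin

lemma iterated_mono:
  fixes H K :: "(int \<Rightarrow> real \<times> real) \<Rightarrow> real \<times> real \<Rightarrow> real"
  assumes [measurable]: "(\<lambda>(z, \<zeta>). H z \<zeta>) \<in> borel_measurable (P \<Otimes>\<^sub>M \<nu>)" "(\<lambda>(z, \<zeta>). K z \<zeta>) \<in> borel_measurable (P \<Otimes>\<^sub>M \<nu>)"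
    and "\<And>z \<zeta>. \<bar>H z \<zeta>\<bar> \<le> a" "\<And>z \<zeta>. \<bar>K z \<zeta>\<bar> \<le> b" "\<And>z \<zeta>. H z \<zeta> \<le> K z \<zeta>"
  shows "(\<integral>z. (\<integral>\<zeta>. H z \<zeta> \<partial>\<nu>) \<partial>P) \<le> (\<integral>z. (\<integral>\<zeta>. K z \<zeta> \<partial>\<nu>) \<partial>P)"
proof (rule integral_mono)
  show "integrable P (\<lambda>z. \<integral>\<zeta>. H z \<zeta> \<partial>\<nu>)" "integrable P (\<lambda>z. \<integral>\<zeta>. K z \<zeta> \<partial>\<nu>)"
    using assms(3,4) by (auto intro!: P.integrable_bounded pair.integral_abs_bounded)
  fix z
  have "(\<lambda>\<zeta>. H z \<zeta>) \<in> borel_measurable \<nu>" "(\<lambda>\<zeta>. K z \<zeta>) \<in> borel_measurable \<nu>"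
    using measurable_compose[OF measurable_Pair1' assms(1), of z] measurable_compose[OF measurable_Pair1' assms(2), of z]
    by (simp_all add: space_pair_measure)
  thus "(\<integral>\<zeta>. H z \<zeta> \<partial>\<nu>) \<le> (\<integral>\<zeta>. K z \<zeta> \<partial>\<nu>)"
    using assms(3-5) by (intro integral_mono pair.integrable_bounded) auto
qed

lemma iterated_component:
  fixes h k :: "real \<times> real \<Rightarrow> real"
  assumes [measurable]: "h \<in> borel_measurable \<nu>" "k \<in> borel_measurable \<nu>"
    and h: "\<And>\<zeta>. \<bar>h \<zeta>\<bar> \<le> a" and k: "\<And>\<zeta>. \<bar>k \<zeta>\<bar> \<le> b"
  shows "(\<integral>z. (\<integral>\<zeta>. h (z i) + k \<zeta> \<partial>\<nu>) \<partial>P) = (\<integral>\<zeta>. h \<zeta> \<partial>\<nu>) + (\<integral>\<zeta>. k \<zeta> \<partial>\<nu>)"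
proof -
  have ik: "integrable \<nu> k" by (rule pair.integrable_bounded[OF _ k]) measurable
  have ih: "integrable P (\<lambda>z. h (z i))" by (rule P.integrable_bounded[OF _ h]) measurable
  have "(\<integral>\<zeta>. h (z i) + k \<zeta> \<partial>\<nu>) = h (z i) + (\<integral>\<zeta>. k \<zeta> \<partial>\<nu>)" for z
    using ik by simp
  thus ?thesis using ih component_integral[OF assms(1) h, of i] by simp
qed

lemma square_add_le: "(a + b)\<^sup>2 \<le> 2 * a\<^sup>2 + 2 * (b::real)\<^sup>2"
  using sum_squares_bound[of a b] by (simp add: power2_sum)

lemma load_sq_le: "(load j \<zeta>)\<^sup>2 \<le> (card T)\<^sup>2"
  using power_mono[OF load_le_card load_nonneg, of j \<zeta> 2] by simp

lemma A_ge: "1 \<le> A"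
proof -
  have "(\<integral>\<zeta>. 1 \<partial>\<nu>) \<le> (\<integral>\<zeta>. (Y \<zeta>)\<^sup>2 \<partial>\<nu>)"
    by (rule integral_mono) (use Y_sq Y_ge power_mono[of 1 "Y _" 2] in auto)
  thus ?thesis using Y_sq by simp
qed

lemma sum_load_sq: "(\<Sum>j=lo..hi. (\<integral>\<zeta>. (load j \<zeta>)\<^sup>2 \<partial>\<nu>)) \<le> card T * A"
proof -
  have i: "integrable \<nu> (\<lambda>\<zeta>. (load j \<zeta>)\<^sup>2)" for j
    by (rule pair.integrable_bounded[where c = "(card T)\<^sup>2"]) (use load_sq_le in auto)
  have "(\<Sum>j=lo..hi. (\<integral>\<zeta>. (load j \<zeta>)\<^sup>2 \<partial>\<nu>)) = (\<integral>\<zeta>. (\<Sum>j=lo..hi. (load j \<zeta>)\<^sup>2) \<partial>\<nu>)"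
    using i by simp
  also have "\<dots> \<le> (\<integral>\<zeta>. card T * (Y \<zeta>)\<^sup>2 \<partial>\<nu>)"
  proof (rule integral_mono)
    fix \<zeta>
    have "(\<Sum>j=lo..hi. (load j \<zeta>)\<^sup>2) \<le> (\<Sum>j=lo..hi. Y \<zeta> * load j \<zeta>)"
      unfolding power2_eq_square by (intro sum_mono mult_right_mono load_le_Y load_nonneg)
    also have "\<dots> \<le> Y \<zeta> * (card T * Y \<zeta>)"
      unfolding sum_distrib_left[symmetric] using sum_load_le Y_ge[of \<zeta>] by (intro mult_left_mono) auto
    finally show "(\<Sum>j=lo..hi. (load j \<zeta>)\<^sup>2) \<le> card T * (Y \<zeta>)\<^sup>2" by (simp add: power2_eq_square mult_ac)
  qed (use i Y_sq in auto)
  also have "\<dots> \<le> card T * A" using Y_sq by (simp add: mult_left_mono)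
  finally show ?thesis .
qed

lemma sens_le_card: "sens j i \<zeta> \<xi> \<xi>' \<le> 2 * card T" "0 \<le> sens j i \<zeta> \<xi> \<xi>'"
proof -
  have "env t j \<zeta> * (env t i \<xi> + env t i \<xi>') \<le> 1 * 2" for t
  proof (rule mult_mono)
    show "env t i \<xi> + env t i \<xi>' \<le> 2" using env_bounds(2)[of t i \<xi>] env_bounds(2)[of t i \<xi>'] by linarith
  qed (use env_bounds in \<open>auto intro: add_nonneg_nonneg\<close>)
  hence "sens j i \<zeta> \<xi> \<xi>' \<le> of_nat (card T) * 2"
    unfolding sens_def by (intro sum_bounded_above) auto
  thus "sens j i \<zeta> \<xi> \<xi>' \<le> 2 * card T" by simp
  show "0 \<le> sens j i \<zeta> \<xi> \<xi>'" unfolding sens_def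
    by (intro sum_nonneg mult_nonneg_nonneg add_nonneg_nonneg env_bounds)
qed

text \<open>
  The discrete product rule. The variant with the absolute value is used for the
  antisymmetric products in the half-line case.
\<close>
lemma product_mixed:
  assumes "i \<noteq> j"
  shows "\<bar>\<delta> j z * \<Delta> j z - \<delta> j (z(i := \<zeta>)) * \<Delta> j (z(i := \<zeta>))\<bar> \<le> 2 * \<kappa>\<^sup>2 * load j (z j) * sens j i (z j) (z i) \<zeta>"
    and "\<bar>\<bar>\<delta> j z\<bar> * \<Delta> j z - \<bar>\<delta> j (z(i := \<zeta>))\<bar> * \<Delta> j (z(i := \<zeta>))\<bar> \<le> 2 * \<kappa>\<^sup>2 * load j (z j) * sens j i (z j) (z i) \<zeta>"
proof -
  let ?s = "sens j i (z j) (z i) \<zeta>" and ?z = "z(i := \<zeta>)"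
  have *: "\<bar>d * D - d' * D'\<bar> \<le> 2 * \<kappa>\<^sup>2 * load j (z j) * ?s"
    if "\<bar>d\<bar> \<le> \<kappa> * load j (z j)" "\<bar>D'\<bar> \<le> \<kappa> * load j (z j)" "\<bar>d - d'\<bar> \<le> \<kappa> * ?s" "\<bar>D - D'\<bar> \<le> \<kappa> * ?s" for d d' D D'
  proof -
    have "d * D - d' * D' = d * (D - D') + (d - d') * D'" by (simp add: algebra_simps)
    also have "\<bar>\<dots>\<bar> \<le> \<bar>d\<bar> * \<bar>D - D'\<bar> + \<bar>d - d'\<bar> * \<bar>D'\<bar>"
      by (rule order_trans[OF abs_triangle_ineq]) (simp add: abs_mult)
    also have "\<dots> \<le> (\<kappa> * load j (z j)) * (\<kappa> * ?s) + (\<kappa> * ?s) * (\<kappa> * load j (z j))"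
      using that kappa_nonneg load_nonneg sens_le_card(2)
      by (intro add_mono mult_mono) auto
    finally show ?thesis by (simp add: power2_eq_square mult_ac)
  qed
  have D': "\<bar>\<Delta> j ?z\<bar> \<le> \<kappa> * load j (z j)" using \<Delta>_le[of j ?z] assms by simp
  show "\<bar>\<delta> j z * \<Delta> j z - \<delta> j ?z * \<Delta> j ?z\<bar> \<le> 2 * \<kappa>\<^sup>2 * load j (z j) * ?s"
    by (rule *[OF \<delta>_le D' \<delta>_mixed[OF assms] \<Delta>_mixed[OF assms]])
  show "\<bar>\<bar>\<delta> j z\<bar> * \<Delta> j z - \<bar>\<delta> j ?z\<bar> * \<Delta> j ?z\<bar> \<le> 2 * \<kappa>\<^sup>2 * load j (z j) * ?s"
  proof (rule *[OF _ D' _ \<Delta>_mixed[OF assms]])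
    show "\<bar>\<bar>\<delta> j z\<bar> - \<bar>\<delta> j ?z\<bar>\<bar> \<le> \<kappa> * ?s" using \<delta>_mixed[OF assms, of z \<zeta>] by linarith
  qed (use \<delta>_le in auto)
qed

lemma product_le: "\<bar>\<delta> j z * \<Delta> j z\<bar> \<le> \<kappa>\<^sup>2 * (load j (z j))\<^sup>2"
proof -
  have "\<bar>\<delta> j z * \<Delta> j z\<bar> \<le> (\<kappa> * load j (z j)) * (\<kappa> * load j (z j))"
    unfolding abs_mult using \<delta>_le \<Delta>_le kappa_nonneg load_nonneg by (intro mult_mono) auto
  thus ?thesis by (simp add: power2_eq_square mult_ac)
qed

lemma product_bounded: "\<bar>\<delta> j z * \<Delta> j z\<bar> \<le> \<kappa>\<^sup>2 * (card T)\<^sup>2"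
  by (rule order_trans[OF product_le]) (intro mult_left_mono load_sq_le, simp)

text \<open>
  The coefficient of the derivative in the Stein identity, with the coordinate \<open>j\<close> of the
  summand with index \<open>j\<close> integrated out. The second moments of the products themselves are
  controlled by the fourth moment of \<open>Y\<close> only, which may be infinite; after the integration one
  square of \<open>Y\<close> has become the constant \<open>A\<close>.
\<close>
definition averaged :: "(int \<Rightarrow> real \<times> real) \<Rightarrow> real" where
  "averaged z = (\<Sum>j=lo..hi. (\<integral>\<zeta>. \<delta> j (z(j := \<zeta>)) * \<Delta> j (z(j := \<zeta>)) \<partial>\<nu>) / 2)"

lemma averaged_measurable [measurable]: "averaged \<in> borel_measurable P"
  unfolding averaged_def by measurable

lemma averaged_bounded: "\<bar>averaged z\<bar> \<le> (\<Sum>j=lo..hi. \<kappa>\<^sup>2 * (card T)\<^sup>2 / 2)"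
proof -
  have "\<bar>\<integral>\<zeta>. \<delta> j (z(j := \<zeta>)) * \<Delta> j (z(j := \<zeta>)) \<partial>\<nu>\<bar> \<le> \<kappa>\<^sup>2 * (card T)\<^sup>2" for j
    by (intro pair.integral_abs_bounded product_bounded)
  thus ?thesis unfolding averaged_def
    by (intro order_trans[OF sum_abs] sum_mono) (simp add: divide_right_mono)
qed

lemma averaged_mean:
  "(\<integral>z. averaged z \<partial>P) = (\<Sum>j=lo..hi. \<integral>z. \<delta> j z * \<Delta> j z \<partial>P) / 2"
proof -
  have "integrable P (\<lambda>z. (\<integral>\<zeta>. \<delta> j (z(j := \<zeta>)) * \<Delta> j (z(j := \<zeta>)) \<partial>\<nu>) / 2)" for j
    by (intro integrable_divide P.integrable_bounded[OF _ pair.integral_abs_bounded[OF product_bounded]]) measurable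
  moreover have "(\<integral>z. (\<integral>\<zeta>. \<delta> j (z(j := \<zeta>)) * \<Delta> j (z(j := \<zeta>)) \<partial>\<nu>) \<partial>P) = (\<integral>z. \<delta> j z * \<Delta> j z \<partial>P)" for j
    by (rule pair.config_resample[OF _ product_bounded]) measurable
  ultimately show ?thesis by (simp add: averaged_def sum_divide_distrib)
qed

text \<open>
  Interchanging the sums over \<open>j\<close> and \<open>t\<close>, the inner sum is the mean of
  \<open>load j * env t j\<close>, summed over \<open>j\<close>, which is at most the mean of \<open>Y\<^sup>2\<close>. The
  change is thus linear in the load of the jump.
\<close>
lemma averaged_difference:
  assumes i: "i \<in> {lo..hi}"
  shows "\<bar>averaged z - averaged (z(i := \<zeta>))\<bar> \<le> \<kappa>\<^sup>2 * A * (load i (z i) + load i \<zeta>)"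
proof -
  let ?q = "\<lambda>j z. \<delta> j z * \<Delta> j z"
  let ?c = "\<lambda>t. env t i (z i) + env t i \<zeta>"
  have mz[measurable]: "(\<lambda>_. z) \<in> measurable N P" for z and N :: "'x measure" by simp
  have iq: "integrable \<nu> (\<lambda>\<eta>. ?q j (z(j := \<eta>)))" for j z
    by (rule pair.integrable_bounded[OF _ product_bounded]) measurable
  have c0: "0 \<le> ?c t" for t by (intro add_nonneg_nonneg env_bounds)
  have mle: "load j \<eta> * env t j \<eta> \<le> (card T)" "0 \<le> load j \<eta> * env t j \<eta>" for j t \<eta>
    using mult_mono[OF load_le_card[of j \<eta>] env_bounds(2)[of t j \<eta>]] load_nonneg[of j \<eta>] env_bounds(1)[of t j \<eta>] by auto
  have ile: "integrable \<nu> (\<lambda>\<eta>. load j \<eta> * env t j \<eta>)" for j t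
    by (rule pair.integrable_bounded[where c = "card T"]) (use mle in auto)
  have summand: "\<bar>(\<integral>\<eta>. ?q j (z(j := \<eta>)) \<partial>\<nu>) - (\<integral>\<eta>. ?q j (z(i := \<zeta>, j := \<eta>)) \<partial>\<nu>)\<bar>
      \<le> 2 * \<kappa>\<^sup>2 * (\<Sum>t\<in>T. ?c t * (\<integral>\<eta>. load j \<eta> * env t j \<eta> \<partial>\<nu>))" for j
  proof (cases "i = j")
    case True
    have "0 \<le> 2 * \<kappa>\<^sup>2 * (\<Sum>t\<in>T. ?c t * (\<integral>\<eta>. load j \<eta> * env t j \<eta> \<partial>\<nu>))"
      by (intro mult_nonneg_nonneg sum_nonneg Bochner_Integration.integral_nonneg c0 load_nonneg env_bounds) auto
    thus ?thesis using True by simp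
  next
    case False
    have pointwise: "\<bar>?q j (z(j := \<eta>)) - ?q j (z(i := \<zeta>, j := \<eta>))\<bar>
        \<le> 2 * \<kappa>\<^sup>2 * (\<Sum>t\<in>T. ?c t * (load j \<eta> * env t j \<eta>))" for \<eta>
    proof -
      have twist: "z(i := \<zeta>, j := \<eta>) = z(j := \<eta>, i := \<zeta>)" using False by (intro fun_upd_twist) simp
      have "\<bar>?q j (z(j := \<eta>)) - ?q j (z(i := \<zeta>, j := \<eta>))\<bar> \<le> 2 * \<kappa>\<^sup>2 * load j \<eta> * sens j i \<eta> (z i) \<zeta>"
        unfolding twist using product_mixed(1)[OF False, of "z(j := \<eta>)" \<zeta>] False by (simp del: fun_upd_apply add: fun_upd_same fun_upd_other)
      also have "2 * \<kappa>\<^sup>2 * load j \<eta> * sens j i \<eta> (z i) \<zeta> = 2 * \<kappa>\<^sup>2 * (\<Sum>t\<in>T. ?c t * (load j \<eta> * env t j \<eta>))"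
        by (simp add: sens_def sum_distrib_left mult_ac)
      finally show ?thesis .
    qed
    have int: "integrable \<nu> (\<lambda>\<eta>. 2 * \<kappa>\<^sup>2 * (\<Sum>t\<in>T. ?c t * (load j \<eta> * env t j \<eta>)))"
      using ile by (intro integrable_mult_right Bochner_Integration.integrable_sum) auto
    have diff: "(\<integral>\<eta>. ?q j (z(j := \<eta>)) \<partial>\<nu>) - (\<integral>\<eta>. ?q j (z(i := \<zeta>, j := \<eta>)) \<partial>\<nu>)
        = (\<integral>\<eta>. ?q j (z(j := \<eta>)) - ?q j (z(i := \<zeta>, j := \<eta>)) \<partial>\<nu>)"
      by (rule Bochner_Integration.integral_diff[symmetric]) (rule iq)+
    have "\<bar>(\<integral>\<eta>. ?q j (z(j := \<eta>)) \<partial>\<nu>) - (\<integral>\<eta>. ?q j (z(i := \<zeta>, j := \<eta>)) \<partial>\<nu>)\<bar>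
        \<le> (\<integral>\<eta>. \<bar>?q j (z(j := \<eta>)) - ?q j (z(i := \<zeta>, j := \<eta>))\<bar> \<partial>\<nu>)"
      unfolding diff by (rule integral_abs_bound)
    also have "\<dots> \<le> (\<integral>\<eta>. 2 * \<kappa>\<^sup>2 * (\<Sum>t\<in>T. ?c t * (load j \<eta> * env t j \<eta>)) \<partial>\<nu>)"
      by (rule integral_mono[OF _ int pointwise]) (intro integrable_abs Bochner_Integration.integrable_diff iq)
    also have "\<dots> = 2 * \<kappa>\<^sup>2 * (\<Sum>t\<in>T. ?c t * (\<integral>\<eta>. load j \<eta> * env t j \<eta> \<partial>\<nu>))"
    proof -
      have "(\<integral>\<eta>. (\<Sum>t\<in>T. ?c t * (load j \<eta> * env t j \<eta>)) \<partial>\<nu>)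
          = (\<Sum>t\<in>T. ?c t * (\<integral>\<eta>. load j \<eta> * env t j \<eta> \<partial>\<nu>))"
        by (subst Bochner_Integration.integral_sum) (simp_all add: ile)
      thus ?thesis by (subst integral_mult_right_zero) (rule arg_cong)
    qed
    finally show ?thesis .
  qed
  have "\<bar>averaged z - averaged (z(i := \<zeta>))\<bar>
      \<le> (\<Sum>j=lo..hi. \<bar>(\<integral>\<eta>. ?q j (z(j := \<eta>)) \<partial>\<nu>) - (\<integral>\<eta>. ?q j (z(i := \<zeta>, j := \<eta>)) \<partial>\<nu>)\<bar> / 2)"
    unfolding averaged_def sum_subtractf[symmetric]
    by (rule order_trans[OF sum_abs]) (simp add: diff_divide_distrib[symmetric] del: fun_upd_apply)
  also have "\<dots> \<le> (\<Sum>j=lo..hi. \<kappa>\<^sup>2 * (\<Sum>t\<in>T. ?c t * (\<integral>\<eta>. load j \<eta> * env t j \<eta> \<partial>\<nu>)))"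
  proof (rule sum_mono)
    fix j
    show "\<bar>(\<integral>\<eta>. ?q j (z(j := \<eta>)) \<partial>\<nu>) - (\<integral>\<eta>. ?q j (z(i := \<zeta>, j := \<eta>)) \<partial>\<nu>)\<bar> / 2
      \<le> \<kappa>\<^sup>2 * (\<Sum>t\<in>T. ?c t * (\<integral>\<eta>. load j \<eta> * env t j \<eta> \<partial>\<nu>))"
    proof -
      have half: "x / 2 \<le> k * s" if "x \<le> 2 * k * s" for x k s :: real using that by simp
      show ?thesis by (rule half[OF summand])
    qed
  qed
  also have "\<dots> = \<kappa>\<^sup>2 * (\<Sum>t\<in>T. ?c t * (\<Sum>j=lo..hi. \<integral>\<eta>. load j \<eta> * env t j \<eta> \<partial>\<nu>))"
    unfolding sum_distrib_left by (rule sum.swap)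
  also have "\<dots> \<le> \<kappa>\<^sup>2 * (\<Sum>t\<in>T. ?c t * A)"
  proof (intro mult_left_mono sum_mono c0)
    fix t
    have "(\<Sum>j=lo..hi. \<integral>\<eta>. load j \<eta> * env t j \<eta> \<partial>\<nu>) = (\<integral>\<eta>. (\<Sum>j=lo..hi. load j \<eta> * env t j \<eta>) \<partial>\<nu>)"
      using ile by simp
    also have "\<dots> \<le> (\<integral>\<eta>. (Y \<eta>)\<^sup>2 \<partial>\<nu>)"
    proof (rule integral_mono)
      fix \<eta>
      have "(\<Sum>j=lo..hi. load j \<eta> * env t j \<eta>) \<le> (\<Sum>j=lo..hi. Y \<eta> * env t j \<eta>)"
        by (intro sum_mono mult_right_mono load_le_Y env_bounds)
      also have "\<dots> \<le> Y \<eta> * Y \<eta>" unfolding sum_distrib_left[symmetric]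
        using Y_ge[of \<eta>] by (intro mult_left_mono sum_env_le) auto
      finally show "(\<Sum>j=lo..hi. load j \<eta> * env t j \<eta>) \<le> (Y \<eta>)\<^sup>2" by (simp add: power2_eq_square)
    qed (use ile Y_sq in auto)
    finally show "(\<Sum>j=lo..hi. \<integral>\<eta>. load j \<eta> * env t j \<eta> \<partial>\<nu>) \<le> A" using Y_sq by simp
  qed simp
  also have "\<dots> = \<kappa>\<^sup>2 * A * (load i (z i) + load i \<zeta>)"
    unfolding sum_distrib_right[symmetric] sum.distrib load_def by (simp only: mult_ac)
  finally show ?thesis .
qed

lemma averaged_depends: "depends_on {lo..hi} averaged"
  unfolding depends_on_def
proof (intro allI impI)
  fix z z' :: "int \<Rightarrow> real \<times> real" assume *: "\<forall>i\<in>{lo..hi}. z i = z' i"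
  have "\<delta> j (z(j := \<zeta>)) = \<delta> j (z'(j := \<zeta>))" "\<Delta> j (z(j := \<zeta>)) = \<Delta> j (z'(j := \<zeta>))" for j \<zeta>
    using * by (auto intro!: depends_onD[OF \<delta>_depends] depends_onD[OF \<Delta>_depends])
  thus "averaged z = averaged z'" by (simp only: averaged_def)
qed

text \<open>
  By the Efron--Stein inequality; the squares of the loads add up to at most \<open>card T * A\<close>.
\<close>
lemma averaged_variance:
  "(\<integral>z. (averaged z - (\<integral>z. averaged z \<partial>P))\<^sup>2 \<partial>P) \<le> 4 * \<kappa>^4 * A^3 * card T"
proof -
  define b where "b = (\<Sum>j=lo..hi. \<kappa>\<^sup>2 * (card T)\<^sup>2 / 2)"
  have b: "\<bar>averaged z\<bar> \<le> b" for z unfolding b_def by (rule averaged_bounded)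
  have sqb: "\<bar>x\<^sup>2\<bar> \<le> d\<^sup>2" if "\<bar>x\<bar> \<le> d" for x d :: real using power_mono[OF that, of 2] by simp
  have i: "integrable P averaged" "integrable P (\<lambda>z. (averaged z)\<^sup>2)"
    by (rule P.integrable_bounded[OF _ b], measurable) (rule P.integrable_bounded[OF _ sqb[OF b]], measurable)
  have "(\<integral>z. (averaged z - (\<integral>z. averaged z \<partial>P))\<^sup>2 \<partial>P) = (\<integral>z. (averaged z)\<^sup>2 \<partial>P) - (\<integral>z. averaged z \<partial>P)\<^sup>2"
    by (rule P.variance_eq[OF i])
  also have "\<dots> \<le> (\<Sum>i=lo..hi. \<integral>z. (\<integral>\<zeta>. (averaged z - averaged (z(i := \<zeta>)))\<^sup>2 \<partial>\<nu>) \<partial>P)"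
    by (rule pair.efron_stein[OF _ averaged_measurable b averaged_depends]) simp
  also have "\<dots> \<le> (\<Sum>i=lo..hi. 4 * \<kappa>^4 * A\<^sup>2 * (\<integral>\<zeta>. (load i \<zeta>)\<^sup>2 \<partial>\<nu>))"
  proof (rule sum_mono)
    fix i assume i: "i \<in> {lo..hi}"
    let ?h = "\<lambda>\<zeta>. 2 * \<kappa>^4 * A\<^sup>2 * (load i \<zeta>)\<^sup>2"
    have hb: "\<bar>?h \<zeta>\<bar> \<le> 2 * \<kappa>^4 * A\<^sup>2 * (card T)\<^sup>2" for \<zeta>
      using load_sq_le[of i \<zeta>] by (simp add: abs_mult mult_left_mono)
    have "(\<integral>z. (\<integral>\<zeta>. (averaged z - averaged (z(i := \<zeta>)))\<^sup>2 \<partial>\<nu>) \<partial>P) \<le> (\<integral>z. (\<integral>\<zeta>. ?h (z i) + ?h \<zeta> \<partial>\<nu>) \<partial>P)"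
    proof (rule iterated_mono)
      show "\<bar>(averaged z - averaged (z(i := \<zeta>)))\<^sup>2\<bar> \<le> (2 * b)\<^sup>2" for z \<zeta>
        using b[of z] b[of "z(i := \<zeta>)"] by (intro sqb) linarith
      show "\<bar>?h (z i) + ?h \<zeta>\<bar> \<le> 2 * (2 * \<kappa>^4 * A\<^sup>2 * (card T)\<^sup>2)" for z \<zeta>
        using hb[of "z i"] hb[of \<zeta>] by linarith
      fix z \<zeta>
      have "(averaged z - averaged (z(i := \<zeta>)))\<^sup>2 \<le> (\<kappa>\<^sup>2 * A * (load i (z i) + load i \<zeta>))\<^sup>2"
        using sqb[OF averaged_difference[OF i, of z \<zeta>]] by simp
      also have "\<dots> = \<kappa>^4 * A\<^sup>2 * (load i (z i) + load i \<zeta>)\<^sup>2" by (simp add: power_mult_distrib)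
      also have "\<dots> \<le> \<kappa>^4 * A\<^sup>2 * (2 * (load i (z i))\<^sup>2 + 2 * (load i \<zeta>)\<^sup>2)"
        by (intro mult_left_mono square_add_le) auto
      finally show "(averaged z - averaged (z(i := \<zeta>)))\<^sup>2 \<le> ?h (z i) + ?h \<zeta>" by (simp add: algebra_simps)
    qed measurable
    also have "\<dots> = (\<integral>\<zeta>. ?h \<zeta> \<partial>\<nu>) + (\<integral>\<zeta>. ?h \<zeta> \<partial>\<nu>)"
      by (rule iterated_component[OF _ _ hb hb]) measurable
    finally show "(\<integral>z. (\<integral>\<zeta>. (averaged z - averaged (z(i := \<zeta>)))\<^sup>2 \<partial>\<nu>) \<partial>P)
        \<le> 4 * \<kappa>^4 * A\<^sup>2 * (\<integral>\<zeta>. (load i \<zeta>)\<^sup>2 \<partial>\<nu>)" by (simp add: mult_ac)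
  qed
  also have "\<dots> = 4 * \<kappa>^4 * A\<^sup>2 * (\<Sum>i=lo..hi. \<integral>\<zeta>. (load i \<zeta>)\<^sup>2 \<partial>\<nu>)" by (simp add: sum_distrib_left)
  also have "\<dots> \<le> 4 * \<kappa>^4 * A\<^sup>2 * (card T * A)" by (intro mult_left_mono sum_load_sq) auto
  finally show ?thesis by (simp add: power2_eq_square power3_eq_cube mult_ac)
qed

end

lemma abs_half_diff_le: "\<bar>s - t\<bar> \<le> 2 * b \<Longrightarrow> \<bar>s / 2 - t / 2\<bar> \<le> (b :: real)"
  by linarith

lemma abs_combine_le: "\<bar>s\<bar> \<le> a \<Longrightarrow> \<bar>u - t\<bar> \<le> b \<Longrightarrow> \<bar>s + (t - u)\<bar> \<le> a + (b :: real)"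
  by linarith

context local_functional begin

lemma W_range: "W x \<in> {-c..c}" using W_bounded[of x] by auto

lemma continuous_bounded_on_range:
  fixes g :: "real \<Rightarrow> real"
  assumes "continuous_on UNIV g"
  obtains b where "\<And>x. \<bar>g (W x)\<bar> \<le> b"
proof -
  have "compact (g ` {-c..c})"
    by (intro compact_continuous_image continuous_on_subset[OF assms]) auto
  hence "bounded (g ` {-c..c})" by (rule compact_imp_bounded)
  then obtain b where b: "\<forall>x\<in>g ` {-c..c}. norm x \<le> b" unfolding bounded_iff by blast
  have "\<bar>g (W x)\<bar> \<le> b" for x using b W_range[of x] by (auto simp del: atLeastAtMost_iff)
  thus ?thesis by (rule that)
qed

lemma Y_le_sq: "Y \<zeta> \<le> (Y \<zeta>)\<^sup>2"
  using mult_left_mono[OF Y_ge[of \<zeta>], of "Y \<zeta>"] Y_ge[of \<zeta>] by (simp add: power2_eq_square)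

lemma Y_integrable [simp]: "integrable \<nu> Y"
proof (rule Bochner_Integration.integrable_bound[OF Y_sq(1)])
  show "AE \<zeta> in \<nu>. norm (Y \<zeta>) \<le> norm ((Y \<zeta>)\<^sup>2)"
  proof (intro AE_I2)
    fix \<zeta> show "norm (Y \<zeta>) \<le> norm ((Y \<zeta>)\<^sup>2)" using Y_le_sq[of \<zeta>] Y_ge[of \<zeta>] by simp
  qed
qed measurable

lemma Y_mean: "(\<integral>\<zeta>. Y \<zeta> \<partial>\<nu>) \<le> A"
proof -
  have "(\<integral>\<zeta>. Y \<zeta> \<partial>\<nu>) \<le> (\<integral>\<zeta>. (Y \<zeta>)\<^sup>2 \<partial>\<nu>)"
    by (rule integral_mono) (simp_all add: Y_sq Y_le_sq)
  thus ?thesis using Y_sq by simp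
qed

text \<open>
  The first-order expansion of \<open>g\<close>, with the derivative taken at a configuration whose
  coordinate \<open>j\<close> is an independent \<open>\<zeta>\<close> instead of at \<open>z\<close> itself. Then the derivative
  does not depend on \<open>z j\<close>, and the factor in front of it can be averaged over \<open>z j\<close>. The
  price is of the same order as the usual remainder.
\<close>
lemma taylor_remainder:
  assumes g: "\<And>x. (g has_real_derivative G x) (at x)" and G: "\<And>x. \<bar>G x\<bar> \<le> K"
    "\<And>x y. \<bar>G x - G y\<bar> \<le> K * \<bar>x - y\<bar>" and K: "K \<ge> 0"
  shows "\<bar>g (F z) - g (W' j z) - \<Delta> j z * G (F (z(j := \<zeta>)))\<bar>
    \<le> 2 * K * \<bar>\<Delta> j z\<bar> * min 1 (\<kappa> * (load j (z j) + load j \<zeta>))"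
proof -
  define u where "u = F (z(j := \<zeta>))"
  let ?m = "\<kappa> * (load j (z j) + load j \<zeta>)"
  have u: "u = W ((first z)(j := fst \<zeta>))" unfolding u_def by (rule arg_cong[of _ _ W]) (auto simp: first_def)
  have d1: "\<bar>F z - u\<bar> \<le> ?m" unfolding u by (rule W_first_env2) (simp_all add: first_def fst_snd_le)
  have d2: "\<bar>W' j z - u\<bar> \<le> ?m"
    using W_first_env2[of "(first z)(j := snd (z j))" j "z j" "fst \<zeta>" \<zeta>]
    by (simp add: fst_snd_le u W'_def)
  have "\<exists>s. \<bar>s - u\<bar> \<le> ?m \<and> g (F z) - g (W' j z) = \<Delta> j z * G s"
  proof (cases "F z" "W' j z" rule: linorder_cases)
    case less
    then obtain s where "F z < s" "s < W' j z" "g (W' j z) - g (F z) = (W' j z - F z) * G s"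
      using MVT2[OF less g] by blast
    thus ?thesis using d1 d2 by (intro exI[of _ s]) (auto simp: \<Delta>_def algebra_simps)
  next
    case greater
    then obtain s where "W' j z < s" "s < F z" "g (F z) - g (W' j z) = (F z - W' j z) * G s"
      using MVT2[OF greater g] by blast
    thus ?thesis using d1 d2 by (intro exI[of _ s]) (auto simp: \<Delta>_def algebra_simps)
  qed (use d1 in \<open>auto simp: \<Delta>_def\<close>)
  then obtain s where s: "\<bar>s - u\<bar> \<le> ?m" "g (F z) - g (W' j z) = \<Delta> j z * G s" by blast
  have "\<bar>G s - G u\<bar> \<le> 2 * K" using G(1)[of s] G(1)[of u] by linarith
  moreover have "\<bar>G s - G u\<bar> \<le> 2 * K * ?m"
  proof -
    have "\<bar>G s - G u\<bar> \<le> K * ?m" using G(2)[of s u] mult_left_mono[OF s(1) K] by linarith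
    moreover have "0 \<le> K * ?m" using K kappa_nonneg load_nonneg by (intro mult_nonneg_nonneg add_nonneg_nonneg) auto
    ultimately show ?thesis by linarith
  qed
  ultimately have "\<bar>G s - G u\<bar> \<le> 2 * K * min 1 ?m" using K by (auto simp: min_def)
  hence "\<bar>\<Delta> j z\<bar> * \<bar>G s - G u\<bar> \<le> \<bar>\<Delta> j z\<bar> * (2 * K * min 1 ?m)" by (intro mult_left_mono) auto
  moreover have "g (F z) - g (W' j z) - \<Delta> j z * G u = \<Delta> j z * (G s - G u)"
    using s(2) by (simp add: right_diff_distrib)
  ultimately show ?thesis unfolding u_def by (simp add: abs_mult mult_ac)
qed

text \<open>
  Exchanging \<open>z j\<close> with \<open>\<zeta>\<close> in the leading term produces the averaged coefficient.
\<close>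
lemma stein_term_wasserstein:
  assumes g: "\<And>x. (g has_real_derivative G x) (at x)" and G: "\<And>x. \<bar>G x\<bar> \<le> K"
    "\<And>x y. \<bar>G x - G y\<bar> \<le> K * \<bar>x - y\<bar>" and K: "K \<ge> 0"
  shows "\<bar>(\<integral>z. \<delta> j z * (g (F z) - g (W' j z)) \<partial>P)
      - (\<integral>z. G (F z) * (\<integral>\<zeta>. \<delta> j (z(j := \<zeta>)) * \<Delta> j (z(j := \<zeta>)) \<partial>\<nu>) \<partial>P)\<bar>
    \<le> 2 * K * \<kappa>\<^sup>2 * ((\<integral>\<zeta>. (load j \<zeta>)\<^sup>2 * min 1 (\<kappa> * load j \<zeta>) \<partial>\<nu>)
        + (\<integral>\<zeta>. (load j \<zeta>)\<^sup>2 \<partial>\<nu>) * (\<kappa> * A))"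
proof -
  let ?n = "real (card T)"
  have cg: "continuous_on UNIV g" using g by (intro DERIV_continuous_on) auto
  have [measurable]: "g \<in> borel_measurable borel" by (rule borel_measurable_continuous_onI[OF cg])
  have "K-lipschitz_on UNIV G" using G(2) K by (auto simp: lipschitz_on_def dist_real_def)
  hence [measurable]: "G \<in> borel_measurable borel"
    using lipschitz_on_continuous_on borel_measurable_continuous_onI by blast
  obtain b where b: "\<And>x. \<bar>g (W x)\<bar> \<le> b" using continuous_bounded_on_range[OF cg] by blast
  let ?L = "\<lambda>z. \<delta> j z * (g (F z) - g (W' j z))"
  let ?M = "\<lambda>z \<zeta>. \<delta> j z * \<Delta> j z * G (F (z(j := \<zeta>)))"
  let ?m = "\<lambda>\<zeta>. min 1 (\<kappa> * load j \<zeta>)"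
  let ?R = "\<lambda>z \<zeta>. 2 * K * \<kappa>\<^sup>2 * ((load j (z j))\<^sup>2 * ?m (z j) + (load j (z j))\<^sup>2 * ?m \<zeta>)"
  have m01: "0 \<le> ?m \<zeta>" "?m \<zeta> \<le> 1" "?m \<zeta> \<le> \<kappa> * Y \<zeta>" for \<zeta>
  proof -
    have "0 \<le> \<kappa> * load j \<zeta>" using kappa_nonneg load_nonneg by simp
    thus "0 \<le> ?m \<zeta>" "?m \<zeta> \<le> 1" by auto
    have "\<kappa> * load j \<zeta> \<le> \<kappa> * Y \<zeta>" by (intro mult_left_mono load_le_Y kappa_nonneg)
    thus "?m \<zeta> \<le> \<kappa> * Y \<zeta>" by linarith
  qed
  have Lb: "\<bar>?L z\<bar> \<le> \<kappa> * ?n * (2 * b)" for z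
    unfolding abs_mult W'_def
    by (intro mult_mono \<delta>_bounded order_trans[OF abs_triangle_ineq4]) (use b[of "first z"] b[of "(first z)(j := snd (z j))"] kappa_nonneg in auto)
  have ls: "(load j \<zeta>)\<^sup>2 \<le> ?n\<^sup>2" for \<zeta> using load_sq_le[of j \<zeta>] by simp
  have lm: "(load j \<zeta>)\<^sup>2 * ?m \<zeta>' \<le> ?n\<^sup>2 * 1" "0 \<le> (load j \<zeta>)\<^sup>2 * ?m \<zeta>'" for \<zeta> \<zeta>'
    using m01[of \<zeta>'] ls[of \<zeta>] by (intro mult_mono mult_nonneg_nonneg; simp)+
  have pb: "\<bar>\<delta> j z * \<Delta> j z\<bar> \<le> \<kappa>\<^sup>2 * ?n\<^sup>2" for z using product_bounded[of j z] by simp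
  have Mb: "\<bar>?M z \<zeta>\<bar> \<le> \<kappa>\<^sup>2 * ?n\<^sup>2 * K" for z \<zeta>
    unfolding abs_mult[of "\<delta> j z * \<Delta> j z"] by (intro mult_mono pb G(1)) auto
  have Rb: "\<bar>?R z \<zeta>\<bar> \<le> 2 * K * \<kappa>\<^sup>2 * (?n\<^sup>2 + ?n\<^sup>2)" for z \<zeta>
  proof -
    have "\<bar>(load j (z j))\<^sup>2 * ?m (z j) + (load j (z j))\<^sup>2 * ?m \<zeta>\<bar> \<le> ?n\<^sup>2 + ?n\<^sup>2"
      using lm[of "z j" "z j"] lm[of "z j" \<zeta>] by linarith
    hence "\<bar>2 * K * \<kappa>\<^sup>2\<bar> * \<bar>(load j (z j))\<^sup>2 * ?m (z j) + (load j (z j))\<^sup>2 * ?m \<zeta>\<bar> \<le> \<bar>2 * K * \<kappa>\<^sup>2\<bar> * (?n\<^sup>2 + ?n\<^sup>2)"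
      by (intro mult_left_mono) auto
    thus ?thesis using K by (simp only: abs_mult[symmetric]) simp
  qed
  have pw: "\<bar>?L z - ?M z \<zeta>\<bar> \<le> ?R z \<zeta>" for z \<zeta>
  proof -
    have "?L z - ?M z \<zeta> = \<delta> j z * (g (F z) - g (W' j z) - \<Delta> j z * G (F (z(j := \<zeta>))))"
      by (simp add: algebra_simps)
    hence "\<bar>?L z - ?M z \<zeta>\<bar> \<le> \<bar>\<delta> j z\<bar> * (2 * K * \<bar>\<Delta> j z\<bar> * min 1 (\<kappa> * (load j (z j) + load j \<zeta>)))"
      using taylor_remainder[OF g G K, of z j \<zeta>] by (simp add: abs_mult mult_left_mono)
    also have "\<dots> = 2 * K * (\<bar>\<delta> j z * \<Delta> j z\<bar> * min 1 (\<kappa> * (load j (z j) + load j \<zeta>)))"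
      by (simp add: abs_mult mult_ac)
    also have "\<dots> \<le> 2 * K * ((\<kappa>\<^sup>2 * (load j (z j))\<^sup>2) * (?m (z j) + ?m \<zeta>))"
    proof (intro mult_left_mono mult_mono product_le)
      show "min 1 (\<kappa> * (load j (z j) + load j \<zeta>)) \<le> ?m (z j) + ?m \<zeta>"
        using m01(1)[of "z j"] m01(1)[of \<zeta>] by (auto simp: distrib_left min_def)
      show "0 \<le> min 1 (\<kappa> * (load j (z j) + load j \<zeta>))"
        using kappa_nonneg load_nonneg by (auto intro!: mult_nonneg_nonneg add_nonneg_nonneg)
    qed (use K in auto)
    finally show ?thesis by (simp add: algebra_simps)
  qed
  have EM: "(\<integral>z. G (F z) * (\<integral>\<zeta>. \<delta> j (z(j := \<zeta>)) * \<Delta> j (z(j := \<zeta>)) \<partial>\<nu>) \<partial>P) = (\<integral>z. (\<integral>\<zeta>. ?M z \<zeta> \<partial>\<nu>) \<partial>P)"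
  proof -
    have "(\<integral>z. (\<integral>\<zeta>. ?M z \<zeta> \<partial>\<nu>) \<partial>P) = (\<integral>z. (\<integral>\<zeta>. ?M (z(j := \<zeta>)) (z j) \<partial>\<nu>) \<partial>P)"
      by (rule pair.config_exchange[OF _ Mb]) measurable
    also have "\<dots> = (\<integral>z. (\<integral>\<zeta>. G (F z) * (\<delta> j (z(j := \<zeta>)) * \<Delta> j (z(j := \<zeta>))) \<partial>\<nu>) \<partial>P)"
      by (simp add: mult_ac)
    finally show ?thesis by simp
  qed
  have iL: "integrable P ?L" by (rule P.integrable_bounded[OF _ Lb]) measurable
  have iM: "integrable P (\<lambda>z. \<integral>\<zeta>. ?M z \<zeta> \<partial>\<nu>)"
    by (rule P.integrable_bounded[OF _ pair.integral_abs_bounded[OF Mb]]) measurable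
  have im: "integrable \<nu> ?m" by (rule pair.integrable_bounded[where c = 1]) (use m01 in auto)
  have mA: "(\<integral>\<zeta>. ?m \<zeta> \<partial>\<nu>) \<le> \<kappa> * A"
  proof -
    have "(\<integral>\<zeta>. ?m \<zeta> \<partial>\<nu>) \<le> (\<integral>\<zeta>. \<kappa> * Y \<zeta> \<partial>\<nu>)" by (rule integral_mono) (use im m01 in auto)
    also have "\<dots> \<le> \<kappa> * A" using mult_left_mono[OF Y_mean kappa_nonneg] by simp
    finally show ?thesis .
  qed
  have mz[measurable]: "(\<lambda>_. z) \<in> measurable N P" for z and N :: "'x measure" by simp
  have iR: "integrable P (\<lambda>z. \<integral>\<zeta>. ?R z \<zeta> \<partial>\<nu>)"
    by (rule P.integrable_bounded[OF _ pair.integral_abs_bounded[OF Rb]]) measurable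
  have diff: "(\<integral>z. ?L z \<partial>P) - (\<integral>z. (\<integral>\<zeta>. ?M z \<zeta> \<partial>\<nu>) \<partial>P) = (\<integral>z. ?L z - (\<integral>\<zeta>. ?M z \<zeta> \<partial>\<nu>) \<partial>P)"
    using iL iM by simp
  have "\<bar>\<integral>z. ?L z - (\<integral>\<zeta>. ?M z \<zeta> \<partial>\<nu>) \<partial>P\<bar> \<le> (\<integral>z. \<bar>?L z - (\<integral>\<zeta>. ?M z \<zeta> \<partial>\<nu>)\<bar> \<partial>P)"
    by (rule integral_abs_bound)
  also have "\<dots> \<le> (\<integral>z. (\<integral>\<zeta>. ?R z \<zeta> \<partial>\<nu>) \<partial>P)"
  proof (rule integral_mono)
    fix z
    have iMz: "integrable \<nu> (\<lambda>\<zeta>. ?M z \<zeta>)" by (rule pair.integrable_bounded[OF _ Mb]) measurable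
    hence e: "?L z - (\<integral>\<zeta>. ?M z \<zeta> \<partial>\<nu>) = (\<integral>\<zeta>. ?L z - ?M z \<zeta> \<partial>\<nu>)" by simp
    show "\<bar>?L z - (\<integral>\<zeta>. ?M z \<zeta> \<partial>\<nu>)\<bar> \<le> (\<integral>\<zeta>. ?R z \<zeta> \<partial>\<nu>)"
      unfolding e
    proof (rule order_trans[OF integral_abs_bound], rule integral_mono)
      show "integrable \<nu> (\<lambda>\<zeta>. \<bar>?L z - ?M z \<zeta>\<bar>)" using iMz by simp
      show "integrable \<nu> (\<lambda>\<zeta>. ?R z \<zeta>)" by (rule pair.integrable_bounded[OF _ Rb]) measurable
    qed (rule pw)
  qed (use iL iM iR in auto)
  finally have s1: "\<bar>\<integral>z. ?L z - (\<integral>\<zeta>. ?M z \<zeta> \<partial>\<nu>) \<partial>P\<bar> \<le> (\<integral>z. (\<integral>\<zeta>. ?R z \<zeta> \<partial>\<nu>) \<partial>P)" .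
  have s2: "(\<integral>z. (\<integral>\<zeta>. ?R z \<zeta> \<partial>\<nu>) \<partial>P) = 2 * K * \<kappa>\<^sup>2 * ((\<integral>z. (load j (z j))\<^sup>2 * ?m (z j) + (load j (z j))\<^sup>2 * (\<integral>\<zeta>. ?m \<zeta> \<partial>\<nu>) \<partial>P))"
    using im by simp
  have s3: "(\<integral>z. (load j (z j))\<^sup>2 * ?m (z j) + (load j (z j))\<^sup>2 * (\<integral>\<zeta>. ?m \<zeta> \<partial>\<nu>) \<partial>P)
      = (\<integral>\<zeta>. (load j \<zeta>)\<^sup>2 * ?m \<zeta> + (load j \<zeta>)\<^sup>2 * (\<integral>\<zeta>. ?m \<zeta> \<partial>\<nu>) \<partial>\<nu>)"
  proof (rule component_integral[where b = "?n\<^sup>2 * 1 + ?n\<^sup>2 * \<bar>\<integral>\<zeta>. ?m \<zeta> \<partial>\<nu>\<bar>"])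
    fix \<zeta>
    show "\<bar>(load j \<zeta>)\<^sup>2 * ?m \<zeta> + (load j \<zeta>)\<^sup>2 * (\<integral>\<zeta>. ?m \<zeta> \<partial>\<nu>)\<bar> \<le> ?n\<^sup>2 * 1 + ?n\<^sup>2 * \<bar>\<integral>\<zeta>. ?m \<zeta> \<partial>\<nu>\<bar>"
      using lm[of \<zeta> \<zeta>] mult_right_mono[OF ls[of \<zeta>] abs_ge_zero[of "\<integral>\<zeta>. ?m \<zeta> \<partial>\<nu>"]]
      by (intro order_trans[OF abs_triangle_ineq] add_mono) (simp_all add: abs_mult)
  qed measurable
  have s4: "(\<integral>\<zeta>. (load j \<zeta>)\<^sup>2 * ?m \<zeta> + (load j \<zeta>)\<^sup>2 * (\<integral>\<zeta>. ?m \<zeta> \<partial>\<nu>) \<partial>\<nu>)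
      = (\<integral>\<zeta>. (load j \<zeta>)\<^sup>2 * ?m \<zeta> \<partial>\<nu>) + (\<integral>\<zeta>. (load j \<zeta>)\<^sup>2 \<partial>\<nu>) * (\<integral>\<zeta>. ?m \<zeta> \<partial>\<nu>)"
  proof -
    have "integrable \<nu> (\<lambda>\<zeta>. (load j \<zeta>)\<^sup>2 * ?m \<zeta>)"
      by (rule pair.integrable_bounded[where c = "?n\<^sup>2 * 1"]) (use lm in auto)
    moreover have "integrable \<nu> (\<lambda>\<zeta>. (load j \<zeta>)\<^sup>2)"
      by (rule pair.integrable_bounded[where c = "?n\<^sup>2"]) (use ls in auto)
    ultimately show ?thesis by simp
  qed
  have s5: "2 * K * \<kappa>\<^sup>2 * ((\<integral>\<zeta>. (load j \<zeta>)\<^sup>2 * ?m \<zeta> \<partial>\<nu>) + (\<integral>\<zeta>. (load j \<zeta>)\<^sup>2 \<partial>\<nu>) * (\<integral>\<zeta>. ?m \<zeta> \<partial>\<nu>))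
      \<le> 2 * K * \<kappa>\<^sup>2 * ((\<integral>\<zeta>. (load j \<zeta>)\<^sup>2 * ?m \<zeta> \<partial>\<nu>) + (\<integral>\<zeta>. (load j \<zeta>)\<^sup>2 \<partial>\<nu>) * (\<kappa> * A))"
    using mA K by (intro mult_left_mono add_left_mono) auto
  show ?thesis unfolding EM diff by (rule order_trans[OF s1[unfolded s2 s3 s4] s5])
qed

text \<open>
  Stein's method. Taking the identity for \<open>g\<close> in the Stein identity shows that the averaged
  coefficient has mean \<open>1\<close>. For the solution \<open>g\<close> of Stein's equation, the error consists of
  the fluctuation of this coefficient around \<open>1\<close>, bounded by its standard deviation, and of the
  remainders, which add up to the mean of \<open>Y\<^sup>2 * min 1 (\<kappa> * Y)\<close>.
\<close>
lemma normal_approx_smooth: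
  fixes h h' :: "real \<Rightarrow> real"
  assumes h: "1-lipschitz_on UNIV h" and h': "\<And>x. (h has_real_derivative h' x) (at x)"
    and mean: "(\<integral>z. F z \<partial>P) = 0" and var: "(\<integral>z. (F z)\<^sup>2 \<partial>P) = 1"
  shows "\<bar>(\<integral>z. h (F z) \<partial>P) - std_normal_mean h\<bar>
    \<le> 78 * (2 * \<kappa>\<^sup>2 * A\<^sup>2 * sqrt (card T)
        + \<kappa>\<^sup>2 * card T * ((\<integral>\<zeta>. (Y \<zeta>)\<^sup>2 * min 1 (\<kappa> * Y \<zeta>) \<partial>\<nu>) + \<kappa> * A\<^sup>2))"
proof -
  let ?n = "real (card T)"
  obtain g G where g: "\<And>x. (g has_real_derivative G x) (at x)" and G: "\<And>x. \<bar>G x\<bar> \<le> 78"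
    "\<And>x y. \<bar>G x - G y\<bar> \<le> 78 * \<bar>x - y\<bar>"
    and eq: "\<And>x. G x - x * g x = h x - std_normal_mean h"
    using stein_lipschitz[OF h h'] by blast
  have cg: "continuous_on UNIV g" using g by (intro DERIV_continuous_on) auto
  have gm[measurable]: "g \<in> borel_measurable borel" by (rule borel_measurable_continuous_onI[OF cg])
  have "78-lipschitz_on UNIV G" using G(2) by (auto simp: lipschitz_on_def dist_real_def)
  hence [measurable]: "G \<in> borel_measurable borel"
    using lipschitz_on_continuous_on borel_measurable_continuous_onI by blast
  have [measurable]: "h \<in> borel_measurable borel"
    using h lipschitz_on_continuous_on borel_measurable_continuous_onI by blast
  obtain b where b: "\<And>x. \<bar>g (W x)\<bar> \<le> b" using continuous_bounded_on_range[OF cg] by blast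
  define ab where "ab = (\<Sum>j=lo..hi. \<kappa>\<^sup>2 * (card T)\<^sup>2 / 2)"
  have ab: "\<bar>averaged z\<bar> \<le> ab" for z unfolding ab_def by (rule averaged_bounded)
  let ?q = "\<lambda>j z. \<integral>\<zeta>. \<delta> j (z(j := \<zeta>)) * \<Delta> j (z(j := \<zeta>)) \<partial>\<nu>"
  let ?S = "\<lambda>j. \<integral>z. \<delta> j z * (g (F z) - g (W' j z)) \<partial>P"
  let ?I = "\<lambda>j. \<integral>z. G (F z) * ?q j z \<partial>P"
  let ?l = "\<lambda>j. \<integral>\<zeta>. (load j \<zeta>)\<^sup>2 * min 1 (\<kappa> * load j \<zeta>) \<partial>\<nu>"
  let ?E3 = "\<integral>\<zeta>. (Y \<zeta>)\<^sup>2 * min 1 (\<kappa> * Y \<zeta>) \<partial>\<nu>"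
  have c0: "0 \<le> c" using W_bounded[of undefined] by linarith
  \<comment> \<open>the Stein identity for the identity function\<close>
  have mean_avg: "(\<integral>z. averaged z \<partial>P) = 1"
  proof -
    have "(\<integral>z. F z * F z \<partial>P) = (\<Sum>j=lo..hi. (\<integral>z. \<delta> j z * (F z - W' j z) \<partial>P)) / 2"
      by (rule stein_identity[where g = "\<lambda>x. x", OF _ W_bounded mean]) measurable
    thus ?thesis unfolding averaged_mean using var by (simp add: power2_eq_square \<Delta>_def)
  qed
  have sum_l: "(\<Sum>j=lo..hi. ?l j) \<le> ?n * ?E3"
  proof -
    have il: "integrable \<nu> (\<lambda>\<zeta>. (load j \<zeta>)\<^sup>2 * min 1 (\<kappa> * load j \<zeta>))" for j
    proof (rule pair.integrable_bounded[where c = "?n\<^sup>2 * 1"])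
      show "\<bar>(load j \<zeta>)\<^sup>2 * min 1 (\<kappa> * load j \<zeta>)\<bar> \<le> ?n\<^sup>2 * 1" for \<zeta>
        unfolding abs_mult using load_sq_le[of j \<zeta>] kappa_nonneg load_nonneg[of j \<zeta>] by (intro mult_mono) auto
    qed measurable
    have iY: "integrable \<nu> (\<lambda>\<zeta>. ?n * ((Y \<zeta>)\<^sup>2 * min 1 (\<kappa> * Y \<zeta>)))"
    proof (intro integrable_mult_right, rule Bochner_Integration.integrable_bound[OF Y_sq(1)])
      show "AE \<zeta> in \<nu>. norm ((Y \<zeta>)\<^sup>2 * min 1 (\<kappa> * Y \<zeta>)) \<le> norm ((Y \<zeta>)\<^sup>2)"
      proof (intro AE_I2)
        fix \<zeta>
        have "0 \<le> \<kappa> * Y \<zeta>" using kappa_nonneg Y_ge[of \<zeta>] by simp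
        hence "(Y \<zeta>)\<^sup>2 * min 1 (\<kappa> * Y \<zeta>) \<le> (Y \<zeta>)\<^sup>2 * 1" "0 \<le> (Y \<zeta>)\<^sup>2 * min 1 (\<kappa> * Y \<zeta>)"
          by (intro mult_left_mono mult_nonneg_nonneg; simp)+
        thus "norm ((Y \<zeta>)\<^sup>2 * min 1 (\<kappa> * Y \<zeta>)) \<le> norm ((Y \<zeta>)\<^sup>2)" by simp
      qed
    qed measurable
    have "(\<Sum>j=lo..hi. ?l j) = (\<integral>\<zeta>. (\<Sum>j=lo..hi. (load j \<zeta>)\<^sup>2 * min 1 (\<kappa> * load j \<zeta>)) \<partial>\<nu>)"
      using il by simp
    also have "\<dots> \<le> (\<integral>\<zeta>. ?n * ((Y \<zeta>)\<^sup>2 * min 1 (\<kappa> * Y \<zeta>)) \<partial>\<nu>)"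
    proof (rule integral_mono[OF _ iY])
      show "integrable \<nu> (\<lambda>\<zeta>. \<Sum>j=lo..hi. (load j \<zeta>)\<^sup>2 * min 1 (\<kappa> * load j \<zeta>))"
        by (intro Bochner_Integration.integrable_sum il)
      fix \<zeta>
      have m0: "0 \<le> min 1 (\<kappa> * Y \<zeta>)" using kappa_nonneg Y_ge[of \<zeta>] by simp
      have "(load j \<zeta>)\<^sup>2 * min 1 (\<kappa> * load j \<zeta>) \<le> (Y \<zeta> * min 1 (\<kappa> * Y \<zeta>)) * load j \<zeta>" for j
      proof -
        have "(load j \<zeta>)\<^sup>2 * min 1 (\<kappa> * load j \<zeta>) \<le> (Y \<zeta> * load j \<zeta>) * min 1 (\<kappa> * Y \<zeta>)"
          unfolding power2_eq_square using kappa_nonneg load_nonneg[of j \<zeta>] load_le_Y[of j \<zeta>] Y_ge[of \<zeta>]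
          by (intro mult_mono min.mono mult_left_mono order_refl) auto
        thus ?thesis by (simp add: mult_ac)
      qed
      hence "(\<Sum>j=lo..hi. (load j \<zeta>)\<^sup>2 * min 1 (\<kappa> * load j \<zeta>)) \<le> (Y \<zeta> * min 1 (\<kappa> * Y \<zeta>)) * (\<Sum>j=lo..hi. load j \<zeta>)"
        unfolding sum_distrib_left by (rule sum_mono)
      also have "\<dots> \<le> (Y \<zeta> * min 1 (\<kappa> * Y \<zeta>)) * (?n * Y \<zeta>)"
        using m0 Y_ge[of \<zeta>] by (intro mult_left_mono sum_load_le mult_nonneg_nonneg) auto
      finally show "(\<Sum>j=lo..hi. (load j \<zeta>)\<^sup>2 * min 1 (\<kappa> * load j \<zeta>)) \<le> ?n * ((Y \<zeta>)\<^sup>2 * min 1 (\<kappa> * Y \<zeta>))"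
        by (simp add: power2_eq_square mult_ac)
    qed
    finally show ?thesis by simp
  qed
  have close: "\<bar>(\<Sum>j=lo..hi. ?S j) - (\<Sum>j=lo..hi. ?I j)\<bar> \<le> 2 * 78 * \<kappa>\<^sup>2 * (?n * ?E3 + ?n * A * (\<kappa> * A))"
  proof -
    have "\<bar>(\<Sum>j=lo..hi. ?S j) - (\<Sum>j=lo..hi. ?I j)\<bar>
        \<le> (\<Sum>j=lo..hi. 2 * 78 * \<kappa>\<^sup>2 * (?l j + (\<integral>\<zeta>. (load j \<zeta>)\<^sup>2 \<partial>\<nu>) * (\<kappa> * A)))"
      unfolding sum_subtractf[symmetric]
      by (rule order_trans[OF sum_abs], rule sum_mono, rule stein_term_wasserstein[OF g G]) simp
    also have "\<dots> = 2 * 78 * \<kappa>\<^sup>2 * ((\<Sum>j=lo..hi. ?l j) + (\<Sum>j=lo..hi. \<integral>\<zeta>. (load j \<zeta>)\<^sup>2 \<partial>\<nu>) * (\<kappa> * A))"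
      by (simp only: sum_distrib_left[symmetric] sum_distrib_right[symmetric] sum.distrib)
    also have "\<dots> \<le> 2 * 78 * \<kappa>\<^sup>2 * (?n * ?E3 + ?n * A * (\<kappa> * A))"
      using kappa_nonneg A_ge by (intro mult_left_mono add_mono sum_l mult_right_mono sum_load_sq) auto
    finally show ?thesis .
  qed
  have qb: "\<bar>?q j z\<bar> \<le> \<kappa>\<^sup>2 * (card T)\<^sup>2" for j z by (intro pair.integral_abs_bounded product_bounded)
  have iq: "integrable P (\<lambda>z. G (F z) * ?q j z)" for j
    by (rule P.integrable_bounded[where c = "78 * (\<kappa>\<^sup>2 * (card T)\<^sup>2)"])
       (use G(1) qb in \<open>auto simp: abs_mult intro!: mult_mono\<close>)
  have I: "(\<Sum>j=lo..hi. ?I j) / 2 = (\<integral>z. G (F z) * averaged z \<partial>P)"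
  proof -
    have "(\<integral>z. G (F z) * averaged z \<partial>P) = (\<integral>z. (\<Sum>j=lo..hi. G (F z) * ?q j z) / 2 \<partial>P)"
      by (simp only: averaged_def sum_divide_distrib[symmetric] sum_distrib_left[symmetric] times_divide_eq_right)
    thus ?thesis using iq by simp
  qed
  have iavg: "integrable P averaged" by (rule P.integrable_bounded[OF _ ab]) measurable
  have iGa: "integrable P (\<lambda>z. G (F z) * averaged z)"
    by (rule P.integrable_bounded[where c = "78 * ab"]) (use G(1) ab in \<open>auto simp: abs_mult intro!: mult_mono\<close>)
  have iG: "integrable P (\<lambda>z. G (F z))" by (rule P.integrable_bounded[OF _ G(1)]) measurable
  have iFg: "integrable P (\<lambda>z. F z * g (F z))"
    by (rule P.integrable_bounded[where c = "c * b"]) (use W_bounded b c0 in \<open>auto simp: abs_mult intro!: mult_mono\<close>)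
  have rem: "\<bar>(\<integral>z. F z * g (F z) \<partial>P) - (\<integral>z. G (F z) * averaged z \<partial>P)\<bar> \<le> 78 * (\<kappa>\<^sup>2 * ?n * (?E3 + \<kappa> * A\<^sup>2))"
  proof -
    have half: "\<bar>s / 2 - t / 2\<bar> \<le> 78 * (\<kappa>\<^sup>2 * ?n * (e + \<kappa> * A\<^sup>2))"
      if "\<bar>s - t\<bar> \<le> 2 * 78 * \<kappa>\<^sup>2 * (?n * e + ?n * A * (\<kappa> * A))" for s t e
    proof -
      have eq2: "2 * 78 * \<kappa>\<^sup>2 * (?n * e + ?n * A * (\<kappa> * A)) = 2 * (78 * (\<kappa>\<^sup>2 * ?n * (e + \<kappa> * A\<^sup>2)))"
        by (simp add: power2_eq_square distrib_left mult_ac)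
      show ?thesis by (rule abs_half_diff_le[OF that[unfolded eq2]])
    qed
    have "(\<integral>z. F z * g (F z) \<partial>P) = (\<Sum>j=lo..hi. ?S j) / 2" by (rule stein_identity[OF gm b mean])
    thus ?thesis unfolding I[symmetric] using half[OF close] by (simp only:)
  qed
  have avg: "\<bar>\<integral>z. G (F z) * (1 - averaged z) \<partial>P\<bar> \<le> 78 * (2 * \<kappa>\<^sup>2 * A\<^sup>2 * sqrt ?n)"
  proof -
    have b1: "\<bar>1 - averaged z\<bar> \<le> 1 + ab" for z using ab[of z] by linarith
    have i1: "integrable P (\<lambda>z. 1 - averaged z)" using iavg by simp
    have "\<bar>\<integral>z. G (F z) * (1 - averaged z) \<partial>P\<bar> \<le> (\<integral>z. \<bar>G (F z) * (1 - averaged z)\<bar> \<partial>P)"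
      by (rule integral_abs_bound)
    also have "\<dots> \<le> (\<integral>z. 78 * \<bar>1 - averaged z\<bar> \<partial>P)"
    proof (rule integral_mono)
      show "integrable P (\<lambda>z. \<bar>G (F z) * (1 - averaged z)\<bar>)"
        using iG iGa by (intro integrable_abs) (simp add: right_diff_distrib)
      show "\<bar>G (F z) * (1 - averaged z)\<bar> \<le> 78 * \<bar>1 - averaged z\<bar>" for z
        unfolding abs_mult using G(1) by (intro mult_right_mono) auto
    qed (use i1 in auto)
    also have "\<dots> = 78 * (\<integral>z. \<bar>1 - averaged z\<bar> \<partial>P)" by simp
    also have "\<dots> \<le> 78 * sqrt (\<integral>z. (1 - averaged z)\<^sup>2 \<partial>P)"
      by (intro mult_left_mono P.integral_abs_le_sqrt[OF _ b1]) auto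
    also have "(\<integral>z. (1 - averaged z)\<^sup>2 \<partial>P) = (\<integral>z. (averaged z - (\<integral>z. averaged z \<partial>P))\<^sup>2 \<partial>P)"
      by (simp add: mean_avg power2_commute)
    finally have 1: "\<bar>\<integral>z. G (F z) * (1 - averaged z) \<partial>P\<bar> \<le> 78 * sqrt (\<integral>z. (averaged z - (\<integral>z. averaged z \<partial>P))\<^sup>2 \<partial>P)" .
    have "sqrt (\<integral>z. (averaged z - (\<integral>z. averaged z \<partial>P))\<^sup>2 \<partial>P) \<le> sqrt ((2 * \<kappa>\<^sup>2 * A\<^sup>2)\<^sup>2 * ?n)"
    proof (intro real_sqrt_le_mono order_trans[OF averaged_variance])
      have "A ^ 3 \<le> A ^ 4" using A_ge by (intro power_increasing) auto
      hence "4 * \<kappa> ^ 4 * ?n * A ^ 3 \<le> 4 * \<kappa> ^ 4 * ?n * A ^ 4" by (intro mult_left_mono) auto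
      thus "4 * \<kappa> ^ 4 * A ^ 3 * ?n \<le> (2 * \<kappa>\<^sup>2 * A\<^sup>2)\<^sup>2 * ?n" by (simp add: power_mult_distrib mult_ac)
    qed
    also have "\<dots> = 2 * \<kappa>\<^sup>2 * A\<^sup>2 * sqrt ?n" by (simp add: real_sqrt_mult)
    finally show ?thesis using 1 by linarith
  qed
  have "(\<integral>z. h (F z) \<partial>P) - std_normal_mean h = (\<integral>z. G (F z) - F z * g (F z) \<partial>P)"
  proof -
    have hF: "h (F z) = (G (F z) - F z * g (F z)) + std_normal_mean h" for z
      using eq[of "F z"] by simp
    have "integrable P (\<lambda>z. G (F z) - F z * g (F z))" using iG iFg by simp
    thus ?thesis unfolding hF by (simp add: P.prob_space)
  qed
  also have "\<dots> = (\<integral>z. G (F z) * (1 - averaged z) \<partial>P) + ((\<integral>z. G (F z) * averaged z \<partial>P) - (\<integral>z. F z * g (F z) \<partial>P))"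
    using iG iFg iGa by (simp add: right_diff_distrib)
  finally have eq': "(\<integral>z. h (F z) \<partial>P) - std_normal_mean h
      = (\<integral>z. G (F z) * (1 - averaged z) \<partial>P) + ((\<integral>z. G (F z) * averaged z \<partial>P) - (\<integral>z. F z * g (F z) \<partial>P))" .
  note abs_combine_le[OF avg rem]
  thus ?thesis unfolding eq' by (simp only: distrib_left)
qed

end

section \<open>Half-lines\<close>

lemma halve_bound:
  fixes s b v e :: real
  assumes "2 * s \<le> 2 * (b + v) + (2 * (2 * v) + 5 * b)" "0 \<le> b" "b \<le> e"
  shows "s \<le> 3 * v + 4 * e"
  using assms by argo

context local_functional begin

lemma square_bound: "\<bar>x\<bar> \<le> d \<Longrightarrow> x\<^sup>2 \<le> (d::real)\<^sup>2"
  using power_mono[of "\<bar>x\<bar>" d 2] by simp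

lemma cauchy_weighted:
  fixes w s :: "'x \<Rightarrow> real"
  assumes "\<And>t. t \<in> D \<Longrightarrow> 0 \<le> w t"
  shows "(\<Sum>t\<in>D. w t * s t)\<^sup>2 \<le> (\<Sum>t\<in>D. w t) * (\<Sum>t\<in>D. w t * (s t)\<^sup>2)"
proof -
  have "(\<Sum>t\<in>D. sqrt (w t) * (sqrt (w t) * s t))\<^sup>2 \<le> (\<Sum>t\<in>D. (sqrt (w t))\<^sup>2) * (\<Sum>t\<in>D. (sqrt (w t) * s t)\<^sup>2)"
    by (rule Cauchy_Schwarz_ineq_sum)
  also have "(\<Sum>t\<in>D. sqrt (w t) * (sqrt (w t) * s t)) = (\<Sum>t\<in>D. w t * s t)"
    using assms by (intro sum.cong) (simp_all add: mult.assoc[symmetric])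
  also have "(\<Sum>t\<in>D. (sqrt (w t))\<^sup>2) = (\<Sum>t\<in>D. w t)" using assms by (intro sum.cong) simp_all
  also have "(\<Sum>t\<in>D. (sqrt (w t) * s t)\<^sup>2) = (\<Sum>t\<in>D. w t * (s t)\<^sup>2)"
    using assms by (intro sum.cong) (simp_all add: power_mult_distrib)
  finally show ?thesis .
qed

text \<open>
  For half-lines the derivative in Stein's equation cannot be evaluated at a resampled
  configuration, and the products \<open>\<delta> j * \<Delta> j\<close> have to be treated without averaging. They
  are truncated to good jumps, for which \<open>Y\<close> has a fourth moment.
\<close>
context
  fixes good :: "real \<times> real \<Rightarrow> bool"
  assumes good_measurable [measurable]: "Measurable.pred \<nu> good"
    and Y4: "integrable \<nu> (\<lambda>\<zeta>. (Y \<zeta>)^4 * of_bool (good \<zeta>))"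
begin

definition ok :: "real \<times> real \<Rightarrow> real" where "ok \<zeta> = of_bool (good \<zeta>)"

lemma ok_simps [simp]: "0 \<le> ok \<zeta>" "ok \<zeta> \<le> 1" "(ok \<zeta>)\<^sup>2 = ok \<zeta>" "\<bar>ok \<zeta>\<bar> = ok \<zeta>"
  by (auto simp: ok_def)

lemma ok_measurable [measurable]: "ok \<in> borel_measurable \<nu>"
  unfolding ok_def by measurable

lemma Y4_integrable: "integrable \<nu> (\<lambda>\<zeta>. (Y \<zeta>)^4 * ok \<zeta>)"
  using Y4 by (simp add: ok_def)

definition E4 :: real where "E4 = (\<integral>\<zeta>. (Y \<zeta>)^4 * ok \<zeta> \<partial>\<nu>)"

lemma E4_nonneg: "0 \<le> E4" unfolding E4_def by (intro Bochner_Integration.integral_nonneg) simp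

text \<open>
  The contribution of the coordinate \<open>j\<close> to the second-order effect at time \<open>t\<close>; for
  fixed \<open>t\<close> these are independent nonnegative variables.
\<close>
definition hit :: "int \<Rightarrow> int \<Rightarrow> real \<times> real \<Rightarrow> real" where
  "hit t j \<zeta> = load j \<zeta> * ok \<zeta> * env t j \<zeta>"

lemma hit_measurable [measurable]: "hit t j \<in> borel_measurable \<nu>"
  unfolding hit_def by measurable

lemma hit_bounds: "0 \<le> hit t j \<zeta>" "hit t j \<zeta> \<le> card T" "hit t j \<zeta> \<le> Y \<zeta> * env t j \<zeta>"
proof -
  show "0 \<le> hit t j \<zeta>" unfolding hit_def by (intro mult_nonneg_nonneg load_nonneg env_bounds) simp
  have "hit t j \<zeta> \<le> real (card T) * 1 * 1" unfolding hit_def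
    by (intro mult_mono load_le_card env_bounds mult_nonneg_nonneg load_nonneg) auto
  thus "hit t j \<zeta> \<le> card T" by simp
  have "hit t j \<zeta> \<le> Y \<zeta> * 1 * env t j \<zeta>" unfolding hit_def
    using Y_ge[of \<zeta>] by (intro mult_mono load_le_Y env_bounds mult_nonneg_nonneg load_nonneg) auto
  thus "hit t j \<zeta> \<le> Y \<zeta> * env t j \<zeta>" by simp
qed

lemma hit_sq_bound: "(hit t j \<zeta>)\<^sup>2 \<le> (real (card T))\<^sup>2"
  using hit_bounds by (intro square_bound) auto

lemma hit_integrable: "integrable \<nu> (hit t j)" "integrable \<nu> (\<lambda>\<zeta>. (hit t j \<zeta>)\<^sup>2)"
proof -
  show "integrable \<nu> (hit t j)"
    by (rule pair.integrable_bounded[where c = "real (card T)"]) (use hit_bounds in auto)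
  show "integrable \<nu> (\<lambda>\<zeta>. (hit t j \<zeta>)\<^sup>2)"
    by (rule pair.integrable_bounded[where c = "(real (card T))\<^sup>2"]) (use hit_sq_bound in auto)
qed

text \<open>
  The mean of the sum is at most \<open>A\<close>, since the loads are at most \<open>Y\<close> and the effects at one
  time sum to at most \<open>Y\<close>. Its variance is at most twice the sum of the second moments, by
  the Efron--Stein inequality.
\<close>
lemma column_second_moment:
  assumes J: "J \<subseteq> {lo..hi}"
  shows "(\<integral>z. (\<Sum>j\<in>J. hit t j (z j))\<^sup>2 \<partial>P) \<le> 2 * E4 + A\<^sup>2"
proof -
  let ?S = "\<lambda>z. \<Sum>j\<in>J. hit t j (z j)"
  let ?n = "real (card T)"
  have fJ: "finite J" using J finite_subset by blast
  have S0: "0 \<le> ?S z" for z by (intro sum_nonneg hit_bounds)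
  have Sb: "\<bar>?S z\<bar> \<le> (\<Sum>j\<in>J. ?n)" for z
    unfolding abs_of_nonneg[OF S0] by (intro sum_mono hit_bounds)
  have mean: "(\<integral>z. ?S z \<partial>P) = (\<integral>\<zeta>. (\<Sum>j\<in>J. hit t j \<zeta>) \<partial>\<nu>)"
  proof -
    have c: "(\<integral>z. hit t j (z j) \<partial>P) = (\<integral>\<zeta>. hit t j \<zeta> \<partial>\<nu>)" for j
      by (rule component_integral[where b = ?n]) (use hit_bounds in auto)
    have i: "integrable P (\<lambda>z. hit t j (z j))" for j
      by (rule P.integrable_bounded[where c = ?n]) (use hit_bounds in auto)
    show ?thesis using i hit_integrable c by simp
  qed
  have "(\<integral>\<zeta>. (\<Sum>j\<in>J. hit t j \<zeta>) \<partial>\<nu>) \<le> (\<integral>\<zeta>. (Y \<zeta>)\<^sup>2 \<partial>\<nu>)"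
  proof (rule integral_mono)
    fix \<zeta>
    have "(\<Sum>j\<in>J. hit t j \<zeta>) \<le> (\<Sum>j=lo..hi. hit t j \<zeta>)" by (rule sum_mono2) (use J hit_bounds in auto)
    also have "\<dots> \<le> (\<Sum>j=lo..hi. Y \<zeta> * env t j \<zeta>)" by (intro sum_mono hit_bounds)
    also have "\<dots> = Y \<zeta> * (\<Sum>j=lo..hi. env t j \<zeta>)" by (simp only: sum_distrib_left)
    also have "\<dots> \<le> Y \<zeta> * Y \<zeta>" using Y_ge[of \<zeta>] by (intro mult_left_mono sum_env_le) auto
    finally show "(\<Sum>j\<in>J. hit t j \<zeta>) \<le> (Y \<zeta>)\<^sup>2" by (simp add: power2_eq_square)
  qed (use hit_integrable Y_sq in auto)
  hence m: "(\<integral>z. ?S z \<partial>P) \<le> A" unfolding mean using Y_sq by linarith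
  have m0: "0 \<le> (\<integral>z. ?S z \<partial>P)" by (intro Bochner_Integration.integral_nonneg S0)
  have "(\<integral>z. (?S z)\<^sup>2 \<partial>P) - (\<integral>z. ?S z \<partial>P)\<^sup>2
      \<le> (\<Sum>i\<in>J. \<integral>z. (\<integral>\<zeta>. (?S z - ?S (z(i := \<zeta>)))\<^sup>2 \<partial>\<nu>) \<partial>P)"
  proof (rule pair.efron_stein[OF fJ _ Sb])
    show "depends_on J ?S" unfolding depends_on_def by (intro allI impI sum.cong) auto
  qed measurable
  also have "\<dots> \<le> (\<Sum>i\<in>J. 2 * (\<integral>\<zeta>. (hit t i \<zeta>)\<^sup>2 \<partial>\<nu>))"
  proof (rule sum_mono)
    fix i assume i: "i \<in> J"
    have diff: "?S z - ?S (z(i := \<zeta>)) = hit t i (z i) - hit t i \<zeta>" for z \<zeta>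
    proof -
      have "?S z = hit t i (z i) + (\<Sum>j\<in>J - {i}. hit t j (z j))" by (rule sum.remove[OF fJ i])
      moreover have "?S (z(i := \<zeta>)) = hit t i \<zeta> + (\<Sum>j\<in>J - {i}. hit t j ((z(i := \<zeta>)) j))"
        by (subst sum.remove[OF fJ i]) simp
      moreover have "(\<Sum>j\<in>J - {i}. hit t j ((z(i := \<zeta>)) j)) = (\<Sum>j\<in>J - {i}. hit t j (z j))"
        by (intro sum.cong) auto
      ultimately show ?thesis by linarith
    qed
    have "(\<integral>z. (\<integral>\<zeta>. (?S z - ?S (z(i := \<zeta>)))\<^sup>2 \<partial>\<nu>) \<partial>P)
        \<le> (\<integral>z. (\<integral>\<zeta>. (hit t i (z i))\<^sup>2 + (hit t i \<zeta>)\<^sup>2 \<partial>\<nu>) \<partial>P)"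
      unfolding diff
    proof (rule iterated_mono[where a = "?n\<^sup>2" and b = "?n\<^sup>2 + ?n\<^sup>2"])
      fix z :: "int \<Rightarrow> real \<times> real" and \<zeta> :: "real \<times> real"
      have "\<bar>hit t i (z i) - hit t i \<zeta>\<bar> \<le> ?n"
        using hit_bounds(1,2)[of t i "z i"] hit_bounds(1,2)[of t i \<zeta>] by linarith
      from square_bound[OF this] show "\<bar>(hit t i (z i) - hit t i \<zeta>)\<^sup>2\<bar> \<le> ?n\<^sup>2" by simp
      show "\<bar>(hit t i (z i))\<^sup>2 + (hit t i \<zeta>)\<^sup>2\<bar> \<le> ?n\<^sup>2 + ?n\<^sup>2"
        using hit_sq_bound[of t i "z i"] hit_sq_bound[of t i \<zeta>] by simp
      have "0 \<le> hit t i (z i) * hit t i \<zeta>" by (intro mult_nonneg_nonneg hit_bounds)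
      thus "(hit t i (z i) - hit t i \<zeta>)\<^sup>2 \<le> (hit t i (z i))\<^sup>2 + (hit t i \<zeta>)\<^sup>2"
        unfolding power2_diff by linarith
    qed measurable
    also have "\<dots> = (\<integral>\<zeta>. (hit t i \<zeta>)\<^sup>2 \<partial>\<nu>) + (\<integral>\<zeta>. (hit t i \<zeta>)\<^sup>2 \<partial>\<nu>)"
      by (rule iterated_component[where a = "?n\<^sup>2" and b = "?n\<^sup>2"]) (use hit_sq_bound in auto)
    finally show "(\<integral>z. (\<integral>\<zeta>. (?S z - ?S (z(i := \<zeta>)))\<^sup>2 \<partial>\<nu>) \<partial>P) \<le> 2 * (\<integral>\<zeta>. (hit t i \<zeta>)\<^sup>2 \<partial>\<nu>)" by simp
  qed
  also have "\<dots> = 2 * (\<integral>\<zeta>. (\<Sum>i\<in>J. (hit t i \<zeta>)\<^sup>2) \<partial>\<nu>)"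
    using hit_integrable by (simp add: sum_distrib_left)
  also have "\<dots> \<le> 2 * E4" unfolding E4_def
  proof (intro mult_left_mono, rule integral_mono[OF _ Y4_integrable])
    fix \<zeta>
    have "(\<Sum>i\<in>J. (hit t i \<zeta>)\<^sup>2) \<le> (\<Sum>i=lo..hi. (hit t i \<zeta>)\<^sup>2)" by (rule sum_mono2) (use J in auto)
    also have "\<dots> \<le> (\<Sum>i=lo..hi. (Y \<zeta>)\<^sup>2 * ok \<zeta> * env t i \<zeta>)"
    proof (rule sum_mono)
      fix i
      have e2: "(env t i \<zeta>)\<^sup>2 \<le> env t i \<zeta>"
        using env_bounds[of t i \<zeta>] by (simp add: power2_eq_square mult_left_le)
      have "(hit t i \<zeta>)\<^sup>2 = (load i \<zeta>)\<^sup>2 * ok \<zeta> * (env t i \<zeta>)\<^sup>2"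
        by (simp add: hit_def power_mult_distrib)
      also have "\<dots> \<le> (Y \<zeta>)\<^sup>2 * ok \<zeta> * env t i \<zeta>"
        using e2 load_le_Y load_nonneg by (intro mult_mono power_mono) auto
      finally show "(hit t i \<zeta>)\<^sup>2 \<le> (Y \<zeta>)\<^sup>2 * ok \<zeta> * env t i \<zeta>" .
    qed
    also have "\<dots> = (Y \<zeta>)\<^sup>2 * ok \<zeta> * (\<Sum>i=lo..hi. env t i \<zeta>)" by (simp only: sum_distrib_left)
    also have "\<dots> \<le> (Y \<zeta>)\<^sup>2 * ok \<zeta> * (Y \<zeta>)\<^sup>2"
      using order_trans[OF sum_env_le Y_le_sq] by (intro mult_left_mono) auto
    finally show "(\<Sum>i\<in>J. (hit t i \<zeta>)\<^sup>2) \<le> (Y \<zeta>)^4 * ok \<zeta>" by (simp add: power4_eq_xxxx power2_eq_square mult_ac)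
  qed (use hit_integrable in auto)
  finally have "(\<integral>z. (?S z)\<^sup>2 \<partial>P) \<le> 2 * E4 + (\<integral>z. ?S z \<partial>P)\<^sup>2" by linarith
  also have "\<dots> \<le> 2 * E4 + A\<^sup>2" using m m0 by (intro add_left_mono power_mono) auto
  finally show ?thesis .
qed

lemma sum_load4: "(\<Sum>j=lo..hi. (\<integral>\<zeta>. (load j \<zeta>)^4 * ok \<zeta> \<partial>\<nu>)) \<le> card T * E4"
proof -
  have i: "integrable \<nu> (\<lambda>\<zeta>. (load j \<zeta>)^4 * ok \<zeta>)" for j
  proof (rule pair.integrable_bounded[where c = "(real (card T))^4 * 1"])
    show "\<bar>(load j \<zeta>)^4 * ok \<zeta>\<bar> \<le> (real (card T))^4 * 1" for \<zeta>
      using load_le_card[of j \<zeta>] load_nonneg[of j \<zeta>] unfolding abs_mult by (intro mult_mono) (auto intro!: power_mono)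
  qed measurable
  have "(\<Sum>j=lo..hi. (\<integral>\<zeta>. (load j \<zeta>)^4 * ok \<zeta> \<partial>\<nu>)) = (\<integral>\<zeta>. (\<Sum>j=lo..hi. (load j \<zeta>)^4 * ok \<zeta>) \<partial>\<nu>)"
    using i by simp
  also have "\<dots> \<le> (\<integral>\<zeta>. card T * ((Y \<zeta>)^4 * ok \<zeta>) \<partial>\<nu>)"
  proof (rule integral_mono)
    fix \<zeta>
    have "(\<Sum>j=lo..hi. (load j \<zeta>)^4 * ok \<zeta>) \<le> (\<Sum>j=lo..hi. ((Y \<zeta>)^3 * ok \<zeta>) * load j \<zeta>)"
    proof (rule sum_mono)
      fix j
      have "(load j \<zeta>)^4 * ok \<zeta> = (load j \<zeta>)^3 * ok \<zeta> * load j \<zeta>"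
        by (simp add: power4_eq_xxxx power3_eq_cube)
      also have "\<dots> \<le> (Y \<zeta>)^3 * ok \<zeta> * load j \<zeta>"
        using load_le_Y[of j \<zeta>] load_nonneg[of j \<zeta>] by (intro mult_right_mono power_mono) auto
      finally show "(load j \<zeta>)^4 * ok \<zeta> \<le> (Y \<zeta>)^3 * ok \<zeta> * load j \<zeta>" .
    qed
    also have "\<dots> = ((Y \<zeta>)^3 * ok \<zeta>) * (\<Sum>j=lo..hi. load j \<zeta>)" by (simp only: sum_distrib_left)
    also have "\<dots> \<le> ((Y \<zeta>)^3 * ok \<zeta>) * (card T * Y \<zeta>)"
      using Y_ge[of \<zeta>] by (intro mult_left_mono sum_load_le) auto
    finally show "(\<Sum>j=lo..hi. (load j \<zeta>)^4 * ok \<zeta>) \<le> card T * ((Y \<zeta>)^4 * ok \<zeta>)"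
      by (simp add: power4_eq_xxxx power3_eq_cube mult_ac)
  qed (use i Y4_integrable in auto)
  also have "\<dots> = card T * E4" by (simp add: E4_def)
  finally show ?thesis .
qed

text \<open>
  By the Efron--Stein inequality. When the coordinate \<open>i\<close> is resampled, the summand with index
  \<open>i\<close> changes by its own size, which costs a fourth moment of the load. The other summands
  change by \<open>\<Sum>t. c t * H t\<close>, where \<open>c t\<close> is the effect of the resampled coordinate
  and \<open>H t\<close> is the sum of the \<open>hit t j\<close>. The Cauchy--Schwarz inequality with weights \<open>c t\<close>
  separates the coordinate \<open>i\<close> from the others, and the latter are bounded by the
  second moment of the column sums.
\<close>
lemma sum_variance:
  fixes a :: "int \<Rightarrow> (int \<Rightarrow> real \<times> real) \<Rightarrow> real"
  assumes am [measurable]: "\<And>j. a j \<in> borel_measurable P"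
    and adep: "\<And>j. j \<in> {lo..hi} \<Longrightarrow> depends_on {lo..hi} (a j)"
    and ab: "\<And>j z. \<bar>a j z\<bar> \<le> \<kappa>\<^sup>2 * (load j (z j))\<^sup>2 * ok (z j)"
    and amix: "\<And>i j z \<zeta>. i \<noteq> j \<Longrightarrow> \<bar>a j z - a j (z(i := \<zeta>))\<bar>
        \<le> 2 * \<kappa>\<^sup>2 * load j (z j) * ok (z j) * sens j i (z j) (z i) \<zeta>"
  defines "S \<equiv> \<lambda>z. \<Sum>j=lo..hi. a j z"
  shows "(\<integral>z. (S z - (\<integral>z. S z \<partial>P))\<^sup>2 \<partial>P) \<le> \<kappa>^4 * card T * (8 * E4 + 32 * A * (2 * E4 + A\<^sup>2))"
proof -
  let ?n = "real (card T)"
  have ab1: "\<bar>a j z\<bar> \<le> \<kappa>\<^sup>2 * ?n\<^sup>2" for j z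
  proof -
    have "\<kappa>\<^sup>2 * (load j (z j))\<^sup>2 * ok (z j) \<le> \<kappa>\<^sup>2 * ?n\<^sup>2 * 1"
      using load_sq_le[of j "z j"] by (intro mult_mono mult_left_mono) auto
    thus ?thesis using ab[of j z] by linarith
  qed
  define b where "b = (\<Sum>j=lo..hi. \<kappa>\<^sup>2 * ?n\<^sup>2)"
  have Sb: "\<bar>S z\<bar> \<le> b" for z unfolding S_def b_def
    by (rule order_trans[OF sum_abs]) (intro sum_mono ab1)
  have Sm[measurable]: "S \<in> borel_measurable P" unfolding S_def by measurable
  have Sdep: "depends_on {lo..hi} S" unfolding depends_on_def S_def
  proof (intro allI impI sum.cong refl)
    fix z z' :: "int \<Rightarrow> real \<times> real" and j assume "\<forall>i\<in>{lo..hi}. z i = z' i" and j: "j \<in> {lo..hi}"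
    thus "a j z = a j z'" by (intro depends_onD[OF adep[OF j]]) auto
  qed
  have i: "integrable P S" "integrable P (\<lambda>z. (S z)\<^sup>2)"
  proof -
    show "integrable P S" by (rule P.integrable_bounded[OF _ Sb]) measurable
    show "integrable P (\<lambda>z. (S z)\<^sup>2)"
      by (rule P.integrable_bounded[where c = "b\<^sup>2"]) (use square_bound[OF Sb] in auto)
  qed
  \<comment> \<open>\<open>?c\<close> is the effect of the resampled coordinate, \<open>?H\<close> the response of the others\<close>
  let ?c = "\<lambda>i t \<xi> \<zeta>. env t i \<xi> + env t i \<zeta>"
  let ?H = "\<lambda>i t z. \<Sum>j\<in>{lo..hi} - {i}. hit t j (z j)"
  have c0: "0 \<le> ?c i t \<xi> \<zeta>" for i t \<xi> \<zeta> by (intro add_nonneg_nonneg env_bounds)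
  have c2: "?c i t \<xi> \<zeta> \<le> 2" for i t \<xi> \<zeta> using env_bounds(2)[of t i \<xi>] env_bounds(2)[of t i \<zeta>] by linarith
  have csum: "(\<Sum>t\<in>T. ?c i t \<xi> \<zeta>) = load i \<xi> + load i \<zeta>" for i \<xi> \<zeta> by (simp add: load_def sum.distrib)
  \<comment> \<open>the diagonal summand and, after the Cauchy--Schwarz inequality, the square of the others\<close>
  let ?D = "\<lambda>i \<xi>. 4 * \<kappa>^4 * ((load i \<xi>)^4 * ok \<xi>)"
  let ?R = "\<lambda>i z \<zeta>. 8 * \<kappa>^4 * (\<Sum>t\<in>T. (load i (z i) + load i \<zeta>) * ?c i t (z i) \<zeta> * (?H i t z)\<^sup>2)"
  have H0: "0 \<le> ?H i t z" for i t z by (intro sum_nonneg hit_bounds)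
  have Hb: "?H i t z \<le> (\<Sum>j\<in>{lo..hi} - {i}. ?n)" for i t z by (intro sum_mono hit_bounds)
  have pointwise: "(S z - S (z(i := \<zeta>)))\<^sup>2 \<le> (?D i (z i) + ?D i \<zeta>) + ?R i z \<zeta>" if i: "i \<in> {lo..hi}" for i z \<zeta>
  proof -
    let ?z = "z(i := \<zeta>)"
    have split: "S z - S ?z = (a i z - a i ?z) + (\<Sum>j\<in>{lo..hi} - {i}. a j z - a j ?z)"
      unfolding S_def sum_subtractf[symmetric] by (rule sum.remove) (use i in auto)
    have off: "\<bar>\<Sum>j\<in>{lo..hi} - {i}. a j z - a j ?z\<bar> \<le> 2 * \<kappa>\<^sup>2 * (\<Sum>t\<in>T. ?c i t (z i) \<zeta> * ?H i t z)"
    proof -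
      have "\<bar>\<Sum>j\<in>{lo..hi} - {i}. a j z - a j ?z\<bar>
          \<le> (\<Sum>j\<in>{lo..hi} - {i}. 2 * \<kappa>\<^sup>2 * load j (z j) * ok (z j) * sens j i (z j) (z i) \<zeta>)"
        by (rule order_trans[OF sum_abs], rule sum_mono, rule amix) auto
      also have "\<dots> = (\<Sum>j\<in>{lo..hi} - {i}. \<Sum>t\<in>T. 2 * \<kappa>\<^sup>2 * (?c i t (z i) \<zeta> * hit t j (z j)))"
        by (simp only: sens_def sum_distrib_left hit_def mult_ac)
      also have "\<dots> = (\<Sum>t\<in>T. \<Sum>j\<in>{lo..hi} - {i}. 2 * \<kappa>\<^sup>2 * (?c i t (z i) \<zeta> * hit t j (z j)))"
        by (rule sum.swap)
      also have "\<dots> = 2 * \<kappa>\<^sup>2 * (\<Sum>t\<in>T. ?c i t (z i) \<zeta> * ?H i t z)"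
        by (simp only: sum_distrib_left)
      finally show ?thesis .
    qed
    have "(\<Sum>j\<in>{lo..hi} - {i}. a j z - a j ?z)\<^sup>2 \<le> (2 * \<kappa>\<^sup>2 * (\<Sum>t\<in>T. ?c i t (z i) \<zeta> * ?H i t z))\<^sup>2"
      by (rule square_bound[OF off])
    also have "\<dots> = 4 * \<kappa>^4 * (\<Sum>t\<in>T. ?c i t (z i) \<zeta> * ?H i t z)\<^sup>2"
      by (simp add: power_mult_distrib)
    also have "\<dots> \<le> 4 * \<kappa>^4 * ((\<Sum>t\<in>T. ?c i t (z i) \<zeta>) * (\<Sum>t\<in>T. ?c i t (z i) \<zeta> * (?H i t z)\<^sup>2))"
      by (intro mult_left_mono cauchy_weighted c0) auto
    also have "(\<Sum>t\<in>T. ?c i t (z i) \<zeta>) * (\<Sum>t\<in>T. ?c i t (z i) \<zeta> * (?H i t z)\<^sup>2)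
        = (\<Sum>t\<in>T. (load i (z i) + load i \<zeta>) * ?c i t (z i) \<zeta> * (?H i t z)\<^sup>2)"
      unfolding csum by (simp only: sum_distrib_left mult.assoc)
    finally have offsq: "2 * (\<Sum>j\<in>{lo..hi} - {i}. a j z - a j ?z)\<^sup>2 \<le> ?R i z \<zeta>" by linarith
    have d1: "2 * (a i x)\<^sup>2 \<le> 2 * \<kappa>^4 * ((load i (x i))^4 * ok (x i))" for x
    proof -
      have "(a i x)\<^sup>2 \<le> (\<kappa>\<^sup>2 * (load i (x i))\<^sup>2 * ok (x i))\<^sup>2" by (rule square_bound[OF ab])
      also have "\<dots> = \<kappa>^4 * ((load i (x i))^4 * ok (x i))" by (simp add: power_mult_distrib)
      finally show ?thesis by linarith
    qed
    have "2 * (a i z - a i ?z)\<^sup>2 \<le> ?D i (z i) + ?D i \<zeta>"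
      using square_add_le[of "a i z" "- a i ?z"] d1[of z] d1[of ?z] by simp
    thus ?thesis unfolding split
      using square_add_le[of "a i z - a i ?z" "\<Sum>j\<in>{lo..hi} - {i}. a j z - a j ?z"] offsq by linarith
  qed
  have Db: "0 \<le> ?D i \<xi>" "?D i \<xi> \<le> 4 * \<kappa>^4 * ?n^4" for i \<xi>
  proof -
    have l4: "(load i \<xi>)^4 * ok \<xi> \<le> ?n^4 * 1"
      using load_le_card[of i \<xi>] load_nonneg[of i \<xi>] by (intro mult_mono power_mono) auto
    show "0 \<le> ?D i \<xi>" by simp
    show "?D i \<xi> \<le> 4 * \<kappa>^4 * ?n^4" using mult_left_mono[OF l4, of "4 * \<kappa>^4"] by simp
  qed
  define h where "h = (\<Sum>j=lo..hi. ?n)"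
  have Hh: "?H i t z \<le> h" for i t z
    unfolding h_def by (rule order_trans[OF Hb]) (rule sum_mono2, auto)
  define r where "r = 8 * \<kappa>^4 * (\<Sum>t\<in>T. (?n + ?n) * 2 * h\<^sup>2)"
  have Rb: "0 \<le> ?R i z \<zeta>" "?R i z \<zeta> \<le> r" for i z \<zeta>
  proof -
    show "0 \<le> ?R i z \<zeta>"
      by (intro mult_nonneg_nonneg sum_nonneg add_nonneg_nonneg load_nonneg env_bounds) auto
    show "?R i z \<zeta> \<le> r" unfolding r_def
      by (intro mult_left_mono sum_mono mult_mono add_mono power_mono Hh H0 load_le_card c2 c0
          mult_nonneg_nonneg add_nonneg_nonneg load_nonneg) auto
  qed
  have Rint: "(\<integral>z. (\<integral>\<zeta>. ?R i z \<zeta> \<partial>\<nu>) \<partial>P) \<le> 32 * \<kappa>^4 * (2 * E4 + A\<^sup>2) * (\<integral>\<zeta>. (load i \<zeta>)\<^sup>2 \<partial>\<nu>)" for i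
  proof -
    have Hu: "?H i t (z(i := \<eta>)) = ?H i t z" for t z \<eta> by (intro sum.cong) auto
    have mz[measurable]: "(\<lambda>_. z) \<in> measurable N P" for z and N :: "'x measure" by simp
    interpret pp: pair_prob_space \<nu> \<nu> ..
    let ?k = "\<lambda>t \<xi> \<zeta>. (load i \<xi> + load i \<zeta>) * ?c i t \<xi> \<zeta>"
    have k0: "0 \<le> ?k t \<xi> \<zeta>" for t \<xi> \<zeta>
      by (intro mult_nonneg_nonneg add_nonneg_nonneg load_nonneg env_bounds)
    have kb: "?k t \<xi> \<zeta> \<le> (?n + ?n) * 2" for t \<xi> \<zeta>
      by (intro mult_mono add_mono load_le_card c2 c0) auto
    have ik: "integrable \<nu> (\<lambda>\<zeta>. ?k t \<xi> \<zeta>)" for t \<xi>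
      by (rule pair.integrable_bounded[where c = "(?n + ?n) * 2"]) (use k0 kb in auto)
    define K where "K = (\<lambda>t \<xi>. \<integral>\<zeta>. ?k t \<xi> \<zeta> \<partial>\<nu>)"
    have [measurable]: "K t \<in> borel_measurable \<nu>" for t unfolding K_def by measurable
    have K0: "0 \<le> K t \<xi>" for t \<xi> unfolding K_def by (intro Bochner_Integration.integral_nonneg k0)
    have Kb: "\<bar>K t \<xi>\<bar> \<le> (?n + ?n) * 2" for t \<xi> unfolding K_def
      by (rule pair.integral_abs_bounded) (use k0 kb in auto)
    have inner: "(\<integral>\<zeta>. ?R i z \<zeta> \<partial>\<nu>) = 8 * \<kappa>^4 * (\<Sum>t\<in>T. K t (z i) * (?H i t z)\<^sup>2)" for z
      unfolding K_def using ik by (simp add: Bochner_Integration.integral_sum)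
    have H2b: "\<bar>(?H i t z)\<^sup>2\<bar> \<le> h\<^sup>2" for t z using power_mono[OF Hh H0] by simp
    have KH: "(\<integral>z. K t (z i) * (?H i t z)\<^sup>2 \<partial>P) = (\<integral>\<xi>. K t \<xi> \<partial>\<nu>) * (\<integral>z. (?H i t z)\<^sup>2 \<partial>P)" for t
    proof -
      have "(\<integral>z. K t (z i) * (?H i t z)\<^sup>2 \<partial>P)
          = (\<integral>z. (\<integral>\<xi>. K t ((z(i := \<xi>)) i) * (?H i t (z(i := \<xi>)))\<^sup>2 \<partial>\<nu>) \<partial>P)"
      proof (rule pair.config_resample[symmetric, where c = "(?n + ?n) * 2 * h\<^sup>2"])
        fix z show "\<bar>K t (z i) * (?H i t z)\<^sup>2\<bar> \<le> (?n + ?n) * 2 * h\<^sup>2"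
          unfolding abs_mult[of "K t (z i)"] by (intro mult_mono Kb H2b) auto
      qed measurable
      also have "\<dots> = (\<integral>z. (\<integral>\<xi>. K t \<xi> * (?H i t z)\<^sup>2 \<partial>\<nu>) \<partial>P)" unfolding Hu by simp
      finally show ?thesis by simp
    qed
    have iKH: "integrable P (\<lambda>z. K t (z i) * (?H i t z)\<^sup>2)" for t
    proof (rule P.integrable_bounded[where c = "(?n + ?n) * 2 * h\<^sup>2"])
      fix z show "\<bar>K t (z i) * (?H i t z)\<^sup>2\<bar> \<le> (?n + ?n) * 2 * h\<^sup>2"
        unfolding abs_mult[of "K t (z i)"] by (intro mult_mono Kb H2b) auto
    qed measurable
    have iK: "integrable \<nu> (K t)" for t by (rule pair.integrable_bounded[OF _ Kb]) measurable
    have "(\<integral>z. (\<integral>\<zeta>. ?R i z \<zeta> \<partial>\<nu>) \<partial>P) = 8 * \<kappa>^4 * (\<Sum>t\<in>T. (\<integral>\<xi>. K t \<xi> \<partial>\<nu>) * (\<integral>z. (?H i t z)\<^sup>2 \<partial>P))"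
      unfolding inner KH[symmetric] using iKH by (simp add: Bochner_Integration.integral_sum)
    also have "\<dots> \<le> 8 * \<kappa>^4 * (\<Sum>t\<in>T. (\<integral>\<xi>. K t \<xi> \<partial>\<nu>) * (2 * E4 + A\<^sup>2))"
      by (intro mult_left_mono sum_mono column_second_moment Bochner_Integration.integral_nonneg K0) auto
    also have "\<dots> = 8 * \<kappa>^4 * (2 * E4 + A\<^sup>2) * (\<Sum>t\<in>T. \<integral>\<xi>. K t \<xi> \<partial>\<nu>)"
      by (simp only: sum_distrib_right[symmetric] mult_ac)
    also have "(\<Sum>t\<in>T. \<integral>\<xi>. K t \<xi> \<partial>\<nu>) = (\<integral>\<xi>. (\<Sum>t\<in>T. K t \<xi>) \<partial>\<nu>)" using iK by simp
    also have "(\<lambda>\<xi>. \<Sum>t\<in>T. K t \<xi>) = (\<lambda>\<xi>. \<integral>\<zeta>. (load i \<xi> + load i \<zeta>)\<^sup>2 \<partial>\<nu>)"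
    proof
      fix \<xi>
      have "(\<Sum>t\<in>T. K t \<xi>) = (\<integral>\<zeta>. (\<Sum>t\<in>T. ?k t \<xi> \<zeta>) \<partial>\<nu>)" unfolding K_def using ik by simp
      also have "(\<lambda>\<zeta>. \<Sum>t\<in>T. ?k t \<xi> \<zeta>) = (\<lambda>\<zeta>. (load i \<xi> + load i \<zeta>)\<^sup>2)"
        by (simp only: sum_distrib_left[symmetric] csum power2_eq_square)
      finally show "(\<Sum>t\<in>T. K t \<xi>) = (\<integral>\<zeta>. (load i \<xi> + load i \<zeta>)\<^sup>2 \<partial>\<nu>)" .
    qed
    finally have 1: "(\<integral>z. (\<integral>\<zeta>. ?R i z \<zeta> \<partial>\<nu>) \<partial>P)
        \<le> 8 * \<kappa>^4 * (2 * E4 + A\<^sup>2) * (\<integral>\<xi>. (\<integral>\<zeta>. (load i \<xi> + load i \<zeta>)\<^sup>2 \<partial>\<nu>) \<partial>\<nu>)" .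
    have l2: "integrable \<nu> (\<lambda>\<zeta>. (load i \<zeta>)\<^sup>2)"
      by (rule pair.integrable_bounded[where c = "?n\<^sup>2"]) (use load_sq_le in auto)
    have lb: "\<bar>(load i \<xi> + load i \<zeta>)\<^sup>2\<bar> \<le> (?n + ?n)\<^sup>2" for \<xi> \<zeta>
      using load_le_card[of i \<xi>] load_nonneg[of i \<xi>] load_le_card[of i \<zeta>] load_nonneg[of i \<zeta>]
      by (simp only: abs_power2, intro power_mono) auto
    have "(\<integral>\<xi>. (\<integral>\<zeta>. (load i \<xi> + load i \<zeta>)\<^sup>2 \<partial>\<nu>) \<partial>\<nu>) \<le> (\<integral>\<xi>. 2 * (load i \<xi>)\<^sup>2 + 2 * (\<integral>\<zeta>. (load i \<zeta>)\<^sup>2 \<partial>\<nu>) \<partial>\<nu>)"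
    proof (rule integral_mono)
      show "integrable \<nu> (\<lambda>\<xi>. \<integral>\<zeta>. (load i \<xi> + load i \<zeta>)\<^sup>2 \<partial>\<nu>)"
        by (rule pair.integrable_bounded[OF _ pair.integral_abs_bounded[OF lb]]) measurable
      fix \<xi>
      have "(\<integral>\<zeta>. (load i \<xi> + load i \<zeta>)\<^sup>2 \<partial>\<nu>) \<le> (\<integral>\<zeta>. 2 * (load i \<xi>)\<^sup>2 + 2 * (load i \<zeta>)\<^sup>2 \<partial>\<nu>)"
      proof (rule integral_mono)
        show "integrable \<nu> (\<lambda>\<zeta>. (load i \<xi> + load i \<zeta>)\<^sup>2)" by (rule pair.integrable_bounded[OF _ lb]) measurable
      qed (use l2 square_add_le in auto)
      thus "(\<integral>\<zeta>. (load i \<xi> + load i \<zeta>)\<^sup>2 \<partial>\<nu>) \<le> 2 * (load i \<xi>)\<^sup>2 + 2 * (\<integral>\<zeta>. (load i \<zeta>)\<^sup>2 \<partial>\<nu>)"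
        using l2 by simp
    qed (use l2 in auto)
    also have "\<dots> = 4 * (\<integral>\<zeta>. (load i \<zeta>)\<^sup>2 \<partial>\<nu>)" using l2 by simp
    finally have "8 * \<kappa>^4 * (2 * E4 + A\<^sup>2) * (\<integral>\<xi>. (\<integral>\<zeta>. (load i \<xi> + load i \<zeta>)\<^sup>2 \<partial>\<nu>) \<partial>\<nu>)
        \<le> 8 * \<kappa>^4 * (2 * E4 + A\<^sup>2) * (4 * (\<integral>\<zeta>. (load i \<zeta>)\<^sup>2 \<partial>\<nu>))"
      using E4_nonneg by (intro mult_left_mono) auto
    with 1 have "(\<integral>z. (\<integral>\<zeta>. ?R i z \<zeta> \<partial>\<nu>) \<partial>P) \<le> 8 * \<kappa>^4 * (2 * E4 + A\<^sup>2) * (4 * (\<integral>\<zeta>. (load i \<zeta>)\<^sup>2 \<partial>\<nu>))"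
      by (rule order_trans)
    thus ?thesis by simp
  qed
  have "(\<integral>z. (S z - (\<integral>z. S z \<partial>P))\<^sup>2 \<partial>P) = (\<integral>z. (S z)\<^sup>2 \<partial>P) - (\<integral>z. S z \<partial>P)\<^sup>2"
    by (rule P.variance_eq[OF i])
  also have "\<dots> \<le> (\<Sum>i=lo..hi. \<integral>z. (\<integral>\<zeta>. (S z - S (z(i := \<zeta>)))\<^sup>2 \<partial>\<nu>) \<partial>P)"
    by (rule pair.efron_stein[OF _ Sm Sb Sdep]) simp
  also have "\<dots> \<le> (\<Sum>i=lo..hi. 8 * \<kappa>^4 * (\<integral>\<zeta>. (load i \<zeta>)^4 * ok \<zeta> \<partial>\<nu>)
      + 32 * \<kappa>^4 * (2 * E4 + A\<^sup>2) * (\<integral>\<zeta>. (load i \<zeta>)\<^sup>2 \<partial>\<nu>))"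
  proof (rule sum_mono)
    fix i assume i: "i \<in> {lo..hi}"
    have mz[measurable]: "(\<lambda>_. z) \<in> measurable N P" for z and N :: "'x measure" by simp
    have DRb: "\<bar>?D i (z i) + ?D i \<zeta>\<bar> \<le> 8 * \<kappa>^4 * ?n^4" "\<bar>?R i z \<zeta>\<bar> \<le> r" for z \<zeta>
      using Db[of i "z i"] Db[of i \<zeta>] Rb[of i z \<zeta>] by (simp_all add: abs_of_nonneg)
    have "(\<integral>z. (\<integral>\<zeta>. (S z - S (z(i := \<zeta>)))\<^sup>2 \<partial>\<nu>) \<partial>P) \<le> (\<integral>z. (\<integral>\<zeta>. (?D i (z i) + ?D i \<zeta>) + ?R i z \<zeta> \<partial>\<nu>) \<partial>P)"
    proof (rule iterated_mono[where a = "(2 * b)\<^sup>2" and b = "8 * \<kappa>^4 * ?n^4 + r"])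
      fix z \<zeta>
      have "\<bar>S z - S (z(i := \<zeta>))\<bar> \<le> 2 * b" using Sb[of z] Sb[of "z(i := \<zeta>)"] by linarith
      from square_bound[OF this] show "\<bar>(S z - S (z(i := \<zeta>)))\<^sup>2\<bar> \<le> (2 * b)\<^sup>2" by simp
      show "\<bar>(?D i (z i) + ?D i \<zeta>) + ?R i z \<zeta>\<bar> \<le> 8 * \<kappa>^4 * ?n^4 + r"
        using DRb[of z \<zeta>] by (rule order_trans[OF abs_triangle_ineq add_mono])
      show "(S z - S (z(i := \<zeta>)))\<^sup>2 \<le> (?D i (z i) + ?D i \<zeta>) + ?R i z \<zeta>" by (rule pointwise[OF i])
    qed measurable
    also have "\<dots> = (\<integral>z. (\<integral>\<zeta>. ?D i (z i) + ?D i \<zeta> \<partial>\<nu>) \<partial>P) + (\<integral>z. (\<integral>\<zeta>. ?R i z \<zeta> \<partial>\<nu>) \<partial>P)"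
    proof -
      have "integrable \<nu> (\<lambda>\<zeta>. ?D i (z i) + ?D i \<zeta>)" "integrable \<nu> (\<lambda>\<zeta>. ?R i z \<zeta>)" for z
        by (rule pair.integrable_bounded[OF _ DRb(1)], measurable) (rule pair.integrable_bounded[OF _ DRb(2)], measurable)
      moreover have "integrable P (\<lambda>z. \<integral>\<zeta>. ?D i (z i) + ?D i \<zeta> \<partial>\<nu>)" "integrable P (\<lambda>z. \<integral>\<zeta>. ?R i z \<zeta> \<partial>\<nu>)"
        by (rule P.integrable_bounded[OF _ pair.integral_abs_bounded[OF DRb(1)]], measurable)
           (rule P.integrable_bounded[OF _ pair.integral_abs_bounded[OF DRb(2)]], measurable)
      ultimately show ?thesis
        by (subst Bochner_Integration.integral_add[symmetric]) (simp_all only: Bochner_Integration.integral_add)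
    qed
    also have "(\<integral>z. (\<integral>\<zeta>. ?D i (z i) + ?D i \<zeta> \<partial>\<nu>) \<partial>P) = (\<integral>\<zeta>. ?D i \<zeta> \<partial>\<nu>) + (\<integral>\<zeta>. ?D i \<zeta> \<partial>\<nu>)"
      by (rule iterated_component[where a = "4 * \<kappa>^4 * ?n^4" and b = "4 * \<kappa>^4 * ?n^4"])
         (measurable, simp_all only: abs_of_nonneg[OF Db(1)] Db(2))
    also have "\<dots> = 8 * \<kappa>^4 * (\<integral>\<zeta>. (load i \<zeta>)^4 * ok \<zeta> \<partial>\<nu>)" by simp
    finally show "(\<integral>z. (\<integral>\<zeta>. (S z - S (z(i := \<zeta>)))\<^sup>2 \<partial>\<nu>) \<partial>P) \<le> 8 * \<kappa>^4 * (\<integral>\<zeta>. (load i \<zeta>)^4 * ok \<zeta> \<partial>\<nu>)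
      + 32 * \<kappa>^4 * (2 * E4 + A\<^sup>2) * (\<integral>\<zeta>. (load i \<zeta>)\<^sup>2 \<partial>\<nu>)"
      using Rint[of i] by linarith
  qed
  also have "\<dots> = 8 * \<kappa>^4 * (\<Sum>i=lo..hi. \<integral>\<zeta>. (load i \<zeta>)^4 * ok \<zeta> \<partial>\<nu>)
      + 32 * \<kappa>^4 * (2 * E4 + A\<^sup>2) * (\<Sum>i=lo..hi. \<integral>\<zeta>. (load i \<zeta>)\<^sup>2 \<partial>\<nu>)"
    by (simp only: sum.distrib sum_distrib_left)
  also have "\<dots> \<le> 8 * \<kappa>^4 * (?n * E4) + 32 * \<kappa>^4 * (2 * E4 + A\<^sup>2) * (?n * A)"
    using E4_nonneg by (intro add_mono mult_left_mono sum_load4 sum_load_sq) auto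
  also have "\<dots> = \<kappa>^4 * ?n * (8 * E4 + 32 * A * (2 * E4 + A\<^sup>2))" by (simp add: distrib_left mult_ac)
  finally show ?thesis .
qed

lemma bad_sum:
  "(\<Sum>j=lo..hi. \<integral>z. \<bar>\<delta> j z * \<Delta> j z\<bar> * (1 - ok (z j)) \<partial>P) \<le> \<kappa>\<^sup>2 * card T * (\<integral>\<zeta>. (Y \<zeta>)\<^sup>2 * (1 - ok \<zeta>) \<partial>\<nu>)"
proof -
  let ?n = "real (card T)"
  let ?l = "\<lambda>j \<zeta>. (load j \<zeta>)\<^sup>2 * (1 - ok \<zeta>)"
  have lb: "\<bar>?l j \<zeta>\<bar> \<le> ?n\<^sup>2 * 1" for j \<zeta>
    unfolding abs_mult using load_sq_le[of j \<zeta>] by (intro mult_mono) auto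
  have il: "integrable \<nu> (?l j)" for j by (rule pair.integrable_bounded[OF _ lb]) measurable
  have pb: "\<bar>\<delta> j z * \<Delta> j z\<bar> * (1 - ok (z j)) \<le> \<kappa>\<^sup>2 * ?l j (z j)" for j z
    using mult_right_mono[OF product_le[of j z], of "1 - ok (z j)"] by (simp add: mult.assoc)
  have iP: "integrable P (\<lambda>z. \<kappa>\<^sup>2 * ?l j (z j))" for j
    by (intro integrable_mult_right, rule P.integrable_bounded[OF _ lb]) measurable
  have "(\<Sum>j=lo..hi. \<integral>z. \<bar>\<delta> j z * \<Delta> j z\<bar> * (1 - ok (z j)) \<partial>P) \<le> (\<Sum>j=lo..hi. \<kappa>\<^sup>2 * (\<integral>\<zeta>. ?l j \<zeta> \<partial>\<nu>))"
  proof (rule sum_mono)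
    fix j
    have "(\<integral>z. \<bar>\<delta> j z * \<Delta> j z\<bar> * (1 - ok (z j)) \<partial>P) \<le> (\<integral>z. \<kappa>\<^sup>2 * ?l j (z j) \<partial>P)"
    proof (rule integral_mono[OF _ iP pb])
      show "integrable P (\<lambda>z. \<bar>\<delta> j z * \<Delta> j z\<bar> * (1 - ok (z j)))"
      proof (rule P.integrable_bounded[where c = "\<kappa>\<^sup>2 * (?n\<^sup>2 * 1)"])
        fix z
        have "0 \<le> \<bar>\<delta> j z * \<Delta> j z\<bar> * (1 - ok (z j))" by (intro mult_nonneg_nonneg) auto
        moreover have "\<kappa>\<^sup>2 * ?l j (z j) \<le> \<kappa>\<^sup>2 * (?n\<^sup>2 * 1)"
          using lb[of j "z j"] by (intro mult_left_mono) auto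
        ultimately show "\<bar>\<bar>\<delta> j z * \<Delta> j z\<bar> * (1 - ok (z j))\<bar> \<le> \<kappa>\<^sup>2 * (?n\<^sup>2 * 1)" using pb[of j z] by linarith
      qed measurable
    qed
    also have "\<dots> = \<kappa>\<^sup>2 * (\<integral>z. ?l j (z j) \<partial>P)" by (rule integral_mult_right_zero)
    also have "(\<integral>z. ?l j (z j) \<partial>P) = (\<integral>\<zeta>. ?l j \<zeta> \<partial>\<nu>)" by (rule component_integral[OF _ lb]) measurable
    finally show "(\<integral>z. \<bar>\<delta> j z * \<Delta> j z\<bar> * (1 - ok (z j)) \<partial>P) \<le> \<kappa>\<^sup>2 * (\<integral>\<zeta>. ?l j \<zeta> \<partial>\<nu>)" .
  qed
  also have "\<dots> = \<kappa>\<^sup>2 * (\<integral>\<zeta>. (\<Sum>j=lo..hi. ?l j \<zeta>) \<partial>\<nu>)" using il by (simp add: sum_distrib_left)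
  also have "\<dots> \<le> \<kappa>\<^sup>2 * (\<integral>\<zeta>. ?n * ((Y \<zeta>)\<^sup>2 * (1 - ok \<zeta>)) \<partial>\<nu>)"
  proof (intro mult_left_mono, rule integral_mono)
    show "integrable \<nu> (\<lambda>\<zeta>. ?n * ((Y \<zeta>)\<^sup>2 * (1 - ok \<zeta>)))"
    proof (intro integrable_mult_right, rule Bochner_Integration.integrable_bound[OF Y_sq(1)])
      show "AE \<zeta> in \<nu>. norm ((Y \<zeta>)\<^sup>2 * (1 - ok \<zeta>)) \<le> norm ((Y \<zeta>)\<^sup>2)"
        by (intro AE_I2) (auto simp: abs_mult intro: mult_left_le)
    qed measurable
    fix \<zeta>
    have "(\<Sum>j=lo..hi. ?l j \<zeta>) \<le> (\<Sum>j=lo..hi. (Y \<zeta> * (1 - ok \<zeta>)) * load j \<zeta>)"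
    proof (rule sum_mono)
      fix j
      have "(load j \<zeta> * load j \<zeta>) * (1 - ok \<zeta>) \<le> (Y \<zeta> * load j \<zeta>) * (1 - ok \<zeta>)"
        by (intro mult_right_mono load_le_Y load_nonneg) auto
      thus "?l j \<zeta> \<le> (Y \<zeta> * (1 - ok \<zeta>)) * load j \<zeta>" by (simp add: power2_eq_square mult_ac)
    qed
    also have "\<dots> = (Y \<zeta> * (1 - ok \<zeta>)) * (\<Sum>j=lo..hi. load j \<zeta>)" by (simp only: sum_distrib_left)
    also have "\<dots> \<le> (Y \<zeta> * (1 - ok \<zeta>)) * (?n * Y \<zeta>)"
      using Y_ge[of \<zeta>] by (intro mult_left_mono sum_load_le mult_nonneg_nonneg) auto
    finally show "(\<Sum>j=lo..hi. ?l j \<zeta>) \<le> ?n * ((Y \<zeta>)\<^sup>2 * (1 - ok \<zeta>))" by (simp add: power2_eq_square mult_ac)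
  qed (use il in auto)
  finally show ?thesis by (simp add: mult_ac)
qed

text \<open>
  Stein's method for half-lines. The truncated products sum to \<open>2\<close> in the mean, up to the bad
  jumps, and their fluctuation is bounded by the variance of the sum. The Taylor error is
  \<open>\<bar>\<delta> j * \<Delta> j\<bar>\<close> times increments of monotone functions between \<open>W' j\<close> and \<open>F\<close>. By
  monotonicity, \<open>\<bar>\<Delta> j\<bar>\<close> times the absolute increment is \<open>\<Delta> j\<close> times the signed
  increment. The factor \<open>\<bar>\<delta> j\<bar> * \<Delta> j\<close> changes sign when the two copies of the
  coordinate \<open>j\<close> are exchanged. Hence the sum of the factors is centred, and the sum of the
  errors is twice the mean of that sum times a bounded function, which is bounded by the
  standard deviation of the sum.
\<close>
lemma normal_approx_halfline:
  assumes good_swap: "\<And>\<zeta>. good (snd \<zeta>, fst \<zeta>) = good \<zeta>"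
    and mean: "(\<integral>z. F z \<partial>P) = 0" and var: "(\<integral>z. (F z)\<^sup>2 \<partial>P) = 1"
  shows "\<bar>(\<integral>z. indicator {..x} (F z) \<partial>P) - std_normal_cdf x\<bar>
    \<le> 3 * sqrt (\<kappa>^4 * card T * (8 * E4 + 32 * A * (2 * E4 + A\<^sup>2)))
      + 4 * (\<kappa>\<^sup>2 * card T * (\<integral>\<zeta>. (Y \<zeta>)\<^sup>2 * (1 - ok \<zeta>) \<partial>\<nu>))"
proof -
  let ?n = "real (card T)"
  define V where "V = \<kappa>^4 * ?n * (8 * E4 + 32 * A * (2 * E4 + A\<^sup>2))"
  define bad where "bad = (\<Sum>j=lo..hi. \<integral>z. \<bar>\<delta> j z * \<Delta> j z\<bar> * (1 - ok (z j)) \<partial>P)"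
  define p where "p = std_normal_cdf x"
  obtain g \<phi> :: "real \<Rightarrow> real" where cg: "continuous_on UNIV g" and mono: "mono \<phi>" and \<phi>1: "\<And>s. \<bar>\<phi> s\<bar> \<le> 1"
    and \<phi>g: "\<And>s. \<phi> s = s * g s" and taylor: "\<And>s t. \<bar>g t - g s - (\<phi> s + indicator {..x} s - p) * (t - s)\<bar>
        \<le> \<bar>t - s\<bar> * (\<bar>\<phi> t - \<phi> s\<bar> + \<bar>indicator {..x} t - indicator {..x} s\<bar>)"
    unfolding p_def by (rule stein_halfline[of x]) blast
  have gm[measurable]: "g \<in> borel_measurable borel" by (rule borel_measurable_continuous_onI[OF cg])
  have \<phi>m[measurable]: "\<phi> \<in> borel_measurable borel" using borel_measurable_mono[OF mono] by simp
  obtain b where b: "\<And>y. \<bar>g (W y)\<bar> \<le> b" using continuous_bounded_on_range[OF cg] by blast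
  define ind :: "real \<Rightarrow> real" where "ind = indicator {..x}"
  have indm[measurable]: "ind \<in> borel_measurable borel" unfolding ind_def by measurable
  have ind01: "0 \<le> ind s" "ind s \<le> 1" "\<bar>ind s\<bar> \<le> 1" for s by (auto simp: ind_def indicator_def)
  have p01: "0 \<le> p" "p \<le> 1" unfolding p_def by (rule std_normal_cdf_bounds)+
  define \<psi> where "\<psi> = (\<lambda>s. \<phi> s + ind s - p)"
  have [measurable]: "\<psi> \<in> borel_measurable borel" unfolding \<psi>_def by measurable
  have \<psi>2: "\<bar>\<psi> s\<bar> \<le> 2" for s using \<phi>1[of s] ind01[of s] p01 unfolding \<psi>_def by linarith
  define a where "a = (\<lambda>j z. \<delta> j z * \<Delta> j z * ok (z j))"
  define cc where "cc = (\<lambda>j z. \<bar>\<delta> j z\<bar> * \<Delta> j z * ok (z j))"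
  define Ta where "Ta = (\<lambda>z. \<Sum>j=lo..hi. a j z)"
  define Tc where "Tc = (\<lambda>z. \<Sum>j=lo..hi. cc j z)"
  have am[measurable]: "a j \<in> borel_measurable P" and cm[measurable]: "cc j \<in> borel_measurable P" for j
    unfolding a_def cc_def by measurable
  have [measurable]: "Ta \<in> borel_measurable P" "Tc \<in> borel_measurable P" unfolding Ta_def Tc_def by measurable
  have okz: "ok ((z(i := \<zeta>)) j) = ok (z j)" if "i \<noteq> j" for i j \<zeta> and z :: "int \<Rightarrow> real \<times> real" using that by simp
  have bounds: "\<bar>a j z\<bar> \<le> \<kappa>\<^sup>2 * (load j (z j))\<^sup>2 * ok (z j)" "\<bar>cc j z\<bar> \<le> \<kappa>\<^sup>2 * (load j (z j))\<^sup>2 * ok (z j)" for j z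
    using mult_right_mono[OF product_le[of j z], of "ok (z j)"] by (simp_all add: a_def cc_def abs_mult)
  have dep: "depends_on {lo..hi} (a j)" "depends_on {lo..hi} (cc j)" if "j \<in> {lo..hi}" for j
  proof -
    have "\<delta> j z = \<delta> j z'" "\<Delta> j z = \<Delta> j z'" "z j = z' j" if "\<forall>i\<in>{lo..hi}. z i = z' i" for z z'
      using that \<open>j \<in> {lo..hi}\<close> by (auto intro!: depends_onD[OF \<delta>_depends] depends_onD[OF \<Delta>_depends])
    thus "depends_on {lo..hi} (a j)" "depends_on {lo..hi} (cc j)"
      unfolding depends_on_def a_def cc_def by metis+
  qed
  have mix: "\<bar>a j z - a j (z(i := \<zeta>))\<bar> \<le> 2 * \<kappa>\<^sup>2 * load j (z j) * ok (z j) * sens j i (z j) (z i) \<zeta>"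
            "\<bar>cc j z - cc j (z(i := \<zeta>))\<bar> \<le> 2 * \<kappa>\<^sup>2 * load j (z j) * ok (z j) * sens j i (z j) (z i) \<zeta>"
    if "i \<noteq> j" for i j z \<zeta>
  proof -
    have "a j z - a j (z(i := \<zeta>)) = (\<delta> j z * \<Delta> j z - \<delta> j (z(i := \<zeta>)) * \<Delta> j (z(i := \<zeta>))) * ok (z j)"
      unfolding a_def okz[OF that] by (simp only: left_diff_distrib)
    thus "\<bar>a j z - a j (z(i := \<zeta>))\<bar> \<le> 2 * \<kappa>\<^sup>2 * load j (z j) * ok (z j) * sens j i (z j) (z i) \<zeta>"
      using mult_right_mono[OF product_mixed(1)[OF that, of z \<zeta>], of "ok (z j)"] by (simp add: abs_mult mult_ac)
    have "cc j z - cc j (z(i := \<zeta>)) = (\<bar>\<delta> j z\<bar> * \<Delta> j z - \<bar>\<delta> j (z(i := \<zeta>))\<bar> * \<Delta> j (z(i := \<zeta>))) * ok (z j)"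
      unfolding cc_def okz[OF that] by (simp only: left_diff_distrib)
    thus "\<bar>cc j z - cc j (z(i := \<zeta>))\<bar> \<le> 2 * \<kappa>\<^sup>2 * load j (z j) * ok (z j) * sens j i (z j) (z i) \<zeta>"
      using mult_right_mono[OF product_mixed(2)[OF that, of z \<zeta>], of "ok (z j)"] by (simp add: abs_mult mult_ac)
  qed
  have varT: "(\<integral>z. (Ta z - (\<integral>z. Ta z \<partial>P))\<^sup>2 \<partial>P) \<le> V" "(\<integral>z. (Tc z - (\<integral>z. Tc z \<partial>P))\<^sup>2 \<partial>P) \<le> V"
    unfolding Ta_def Tc_def V_def by (rule sum_variance[OF am dep(1) bounds(1) mix(1)] sum_variance[OF cm dep(2) bounds(2) mix(2)]; assumption)+
  have kn: "\<kappa>\<^sup>2 * (load j (z j))\<^sup>2 * ok (z j) \<le> \<kappa>\<^sup>2 * ?n\<^sup>2" for j z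
  proof -
    have "\<kappa>\<^sup>2 * (load j (z j))\<^sup>2 * ok (z j) \<le> \<kappa>\<^sup>2 * ?n\<^sup>2 * 1"
      using load_sq_le[of j "z j"] by (intro mult_mono mult_left_mono) auto
    thus ?thesis by simp
  qed
  have acb: "\<bar>a j z\<bar> \<le> \<kappa>\<^sup>2 * ?n\<^sup>2" "\<bar>cc j z\<bar> \<le> \<kappa>\<^sup>2 * ?n\<^sup>2" for j z
    using bounds[of j z] kn[of j z] by linarith+
  define tb where "tb = (\<Sum>j=lo..hi. \<kappa>\<^sup>2 * ?n\<^sup>2)"
  have Tb: "\<bar>Ta z\<bar> \<le> tb" "\<bar>Tc z\<bar> \<le> tb" for z
    unfolding Ta_def Tc_def tb_def by (rule order_trans[OF sum_abs], intro sum_mono acb)+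
  have ia: "integrable P (a j)" "integrable P (cc j)" for j
    by (rule P.integrable_bounded[OF _ acb(1)], measurable) (rule P.integrable_bounded[OF _ acb(2)], measurable)
  have iT: "integrable P Ta" "integrable P Tc"
    by (rule P.integrable_bounded[OF _ Tb(1)], measurable) (rule P.integrable_bounded[OF _ Tb(2)], measurable)
  \<comment> \<open>the centred sums are small in \<open>L\<^sup>1\<close>\<close>
  have L1: "(\<integral>z. \<bar>H z - (\<integral>z. H z \<partial>P)\<bar> \<partial>P) \<le> sqrt V"
    if [measurable]: "H \<in> borel_measurable P" and Hb: "\<And>z. \<bar>H z\<bar> \<le> tb"
      and HV: "(\<integral>z. (H z - (\<integral>z. H z \<partial>P))\<^sup>2 \<partial>P) \<le> V" for H
  proof -
    have bd: "\<bar>H z - (\<integral>z. H z \<partial>P)\<bar> \<le> tb + tb" for z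
      using Hb[of z] P.integral_abs_bounded[of H tb, OF Hb] by linarith
    have "(\<integral>z. \<bar>H z - (\<integral>z. H z \<partial>P)\<bar> \<partial>P) \<le> sqrt (\<integral>z. (H z - (\<integral>z. H z \<partial>P))\<^sup>2 \<partial>P)"
      by (rule P.integral_abs_le_sqrt[OF _ bd]) measurable
    also have "\<dots> \<le> sqrt V" by (rule real_sqrt_le_mono[OF HV])
    finally show ?thesis .
  qed
  have ccflip: "cc j (flip j z) = - cc j z" for j z
  proof -
    have "ok (flip j z j) = ok (z j)" using good_swap[of "z j"] by (simp add: flip_def ok_def)
    thus ?thesis by (simp add: cc_def \<delta>_flip \<Delta>_flip)
  qed
  have cmean: "(\<integral>z. Tc z \<partial>P) = 0"
  proof -
    have "(\<integral>z. cc j z \<partial>P) = 0" for j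
    proof -
      have "(\<integral>z. cc j (flip j z) \<partial>P) = (\<integral>z. cc j z \<partial>P)" by (rule integral_flip[OF cm acb(2)])
      thus ?thesis by (simp add: ccflip)
    qed
    thus ?thesis unfolding Tc_def using ia by simp
  qed
  have cL1: "(\<integral>z. \<bar>Tc z\<bar> \<partial>P) \<le> sqrt V"
    using L1[OF _ Tb(2) varT(2)] by (simp add: cmean)
  \<comment> \<open>\<open>cc j\<close> is antisymmetric under \<open>flip j\<close>, so each term is twice the mean of \<open>cc j z * f (F z)\<close>\<close>
  have monobound: "(\<Sum>j=lo..hi. \<integral>z. cc j z * (f (F z) - f (W' j z)) \<partial>P) \<le> 2 * sqrt V"
    if fm[measurable]: "f \<in> borel_measurable borel" and f1: "\<And>s. \<bar>f s\<bar> \<le> 1" for f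
  proof -
    have i1: "integrable P (\<lambda>z. cc j z * f (F z))" for j
      by (rule P.integrable_bounded[where c = "\<kappa>\<^sup>2 * ?n\<^sup>2 * 1"], measurable) (unfold abs_mult, intro mult_mono acb f1, auto)
    have i2: "integrable P (\<lambda>z. cc j z * f (W' j z))" for j
      by (rule P.integrable_bounded[where c = "\<kappa>\<^sup>2 * ?n\<^sup>2 * 1"], measurable) (unfold abs_mult, intro mult_mono acb f1, auto)
    have "(\<integral>z. cc j z * (f (F z) - f (W' j z)) \<partial>P) = 2 * (\<integral>z. cc j z * f (F z) \<partial>P)" for j
    proof -
      have "(\<integral>z. cc j z * f (F z) \<partial>P) = (\<integral>z. cc j (flip j z) * f (F (flip j z)) \<partial>P)"
      proof (rule integral_flip[symmetric, where b = "\<kappa>\<^sup>2 * ?n\<^sup>2 * 1"])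
        show "\<bar>cc j z * f (F z)\<bar> \<le> \<kappa>\<^sup>2 * ?n\<^sup>2 * 1" for z unfolding abs_mult by (intro mult_mono acb f1) auto
      qed measurable
      also have "\<dots> = - (\<integral>z. cc j z * f (W' j z) \<partial>P)" by (simp add: ccflip F_flip)
      finally show ?thesis using i1[of j] i2[of j] by (simp add: right_diff_distrib)
    qed
    hence "(\<Sum>j=lo..hi. \<integral>z. cc j z * (f (F z) - f (W' j z)) \<partial>P) = 2 * (\<Sum>j=lo..hi. \<integral>z. cc j z * f (F z) \<partial>P)"
      by (simp only: sum_distrib_left)
    also have "(\<Sum>j=lo..hi. \<integral>z. cc j z * f (F z) \<partial>P) = (\<integral>z. Tc z * f (F z) \<partial>P)"
      unfolding Tc_def sum_distrib_right using i1 by simp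
    also have "\<dots> \<le> (\<integral>z. \<bar>Tc z\<bar> \<partial>P)"
    proof (rule integral_mono)
      show "integrable P (\<lambda>z. Tc z * f (F z))" unfolding Tc_def sum_distrib_right using i1 by simp
      fix z
      have "\<bar>Tc z * f (F z)\<bar> \<le> \<bar>Tc z\<bar> * 1" unfolding abs_mult by (intro mult_left_mono f1) auto
      thus "Tc z * f (F z) \<le> \<bar>Tc z\<bar>" by linarith
    qed (use iT in auto)
    finally show ?thesis using cL1 by linarith
  qed
  let ?bj = "\<lambda>j z. \<bar>\<delta> j z * \<Delta> j z\<bar> * (1 - ok (z j))"
  let ?L = "\<lambda>j z. \<delta> j z * (g (F z) - g (W' j z))"
  let ?R = "\<lambda>j z. cc j z * (\<phi> (F z) - \<phi> (W' j z)) + cc j z * (- ind (F z) - - ind (W' j z)) + 5 * ?bj j z"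
  \<comment> \<open>on bad jumps the increment of \<open>g\<close> is at most \<open>5 \<bar>\<Delta> j z\<bar>\<close>\<close>
  have pointwise: "\<bar>?L j z - a j z * \<psi> (F z)\<bar> \<le> ?R j z" for j z
  proof -
    define D where "D = \<Delta> j z"
    define J where "J = \<bar>\<phi> (W' j z) - \<phi> (F z)\<bar> + \<bar>ind (W' j z) - ind (F z)\<bar>"
    have J3: "0 \<le> J" "J \<le> 3"
      using \<phi>1[of "W' j z"] \<phi>1[of "F z"] ind01[of "W' j z"] ind01[of "F z"] unfolding J_def by linarith+
    have D: "W' j z - F z = - D" by (simp add: D_def \<Delta>_def)
    have t: "\<bar>g (F z) - g (W' j z) - \<psi> (F z) * D\<bar> \<le> \<bar>D\<bar> * J"
    proof -
      have "\<bar>g (W' j z) - g (F z) - \<psi> (F z) * (- D)\<bar> \<le> \<bar>- D\<bar> * J"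
        using taylor[of "W' j z" "F z"] unfolding D ind_def[symmetric] \<psi>_def J_def by simp
      thus ?thesis by (simp add: abs_le_iff)
    qed
    have DJ: "\<bar>\<delta> j z\<bar> * \<bar>D\<bar> * J * ok (z j)
        = cc j z * (\<phi> (F z) - \<phi> (W' j z)) + cc j z * (- ind (F z) - - ind (W' j z))"
    proof -
      have "\<bar>D\<bar> * J = D * (\<phi> (F z) - \<phi> (W' j z)) + D * (- ind (F z) - - ind (W' j z))"
      proof (cases "W' j z \<le> F z")
        case True
        hence "D \<ge> 0" "\<phi> (W' j z) \<le> \<phi> (F z)" "ind (F z) \<le> ind (W' j z)"
          using monoD[OF mono True] D by (auto simp: ind_def indicator_def)
        thus ?thesis by (simp add: J_def algebra_simps)
      next
        case False
        hence F: "F z \<le> W' j z" by simp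
        hence "D \<le> 0" "\<phi> (F z) \<le> \<phi> (W' j z)" "ind (W' j z) \<le> ind (F z)"
          using monoD[OF mono F] D by (auto simp: ind_def indicator_def)
        thus ?thesis by (simp add: J_def algebra_simps abs_of_nonpos)
      qed
      hence "\<bar>\<delta> j z\<bar> * (\<bar>D\<bar> * J) * ok (z j) = \<bar>\<delta> j z\<bar> * (D * (\<phi> (F z) - \<phi> (W' j z)) + D * (- ind (F z) - - ind (W' j z))) * ok (z j)"
        by simp
      thus ?thesis unfolding cc_def D_def[symmetric] by (simp add: algebra_simps)
    qed
    consider "ok (z j) = 1" | "ok (z j) = 0" by (auto simp: ok_def)
    thus ?thesis
    proof cases
      case 1
      have "?L j z - a j z * \<psi> (F z) = \<delta> j z * (g (F z) - g (W' j z) - \<psi> (F z) * D)"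
        using 1 by (simp add: a_def D_def algebra_simps)
      hence "\<bar>?L j z - a j z * \<psi> (F z)\<bar> \<le> \<bar>\<delta> j z\<bar> * (\<bar>D\<bar> * J)"
        using mult_left_mono[OF t, of "\<bar>\<delta> j z\<bar>"] by (simp only: abs_mult abs_ge_zero)
      thus ?thesis using DJ 1 by (simp add: mult.assoc)
    next
      case 2
      have "\<bar>g (F z) - g (W' j z)\<bar> \<le> \<bar>\<psi> (F z) * D\<bar> + \<bar>D\<bar> * J" using t by linarith
      also have "\<dots> \<le> 2 * \<bar>D\<bar> + \<bar>D\<bar> * 3" unfolding abs_mult
        using \<psi>2[of "F z"] J3 by (intro add_mono mult_mono) auto
      finally have "\<bar>\<delta> j z\<bar> * \<bar>g (F z) - g (W' j z)\<bar> \<le> \<bar>\<delta> j z\<bar> * (5 * \<bar>D\<bar>)" by (intro mult_left_mono) auto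
      thus ?thesis using 2 by (simp add: a_def cc_def abs_mult D_def mult_ac)
    qed
  qed
  have bjb: "\<bar>?bj j z\<bar> \<le> \<kappa>\<^sup>2 * ?n\<^sup>2 * 1" for j z
    unfolding abs_mult[of "\<bar>\<delta> j z * \<Delta> j z\<bar>"] using product_bounded[of j z] by (intro mult_mono) auto
  have ibj: "integrable P (?bj j)" for j by (rule P.integrable_bounded[OF _ bjb]) measurable
  have k0: "0 \<le> \<kappa> * ?n" using kappa_nonneg by simp
  have gW: "\<bar>g (F z) - g (W' j z)\<bar> \<le> b + b" for j z
    using b[of "first z"] b[of "(first z)(j := snd (z j))"] unfolding W'_def by linarith
  have iL: "integrable P (?L j)" for j
    by (rule P.integrable_bounded[where c = "\<kappa> * ?n * (b + b)"], measurable) (unfold abs_mult, intro mult_mono \<delta>_bounded gW, use k0 in auto)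
  have ia\<psi>: "integrable P (\<lambda>z. a j z * \<psi> (F z))" for j
    by (rule P.integrable_bounded[where c = "\<kappa>\<^sup>2 * ?n\<^sup>2 * 2"], measurable) (unfold abs_mult, intro mult_mono acb \<psi>2, auto)
  have ic: "integrable P (\<lambda>z. cc j z * (f (F z) - f (W' j z)))"
    if [measurable]: "f \<in> borel_measurable borel" and f1: "\<And>s. \<bar>f s\<bar> \<le> 1" for f j
  proof (rule P.integrable_bounded[where c = "\<kappa>\<^sup>2 * ?n\<^sup>2 * 2"])
    fix z
    have "\<bar>f (F z) - f (W' j z)\<bar> \<le> 2" using f1[of "F z"] f1[of "W' j z"] by linarith
    thus "\<bar>cc j z * (f (F z) - f (W' j z))\<bar> \<le> \<kappa>\<^sup>2 * ?n\<^sup>2 * 2" unfolding abs_mult by (intro mult_mono acb) auto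
  qed measurable
  have mind: "(\<lambda>s. - ind s) \<in> borel_measurable borel" "\<And>s. \<bar>- ind s\<bar> \<le> 1" using ind01 by auto
  have sumdiff: "\<bar>(\<Sum>j=lo..hi. \<integral>z. ?L j z \<partial>P) - (\<Sum>j=lo..hi. \<integral>z. a j z * \<psi> (F z) \<partial>P)\<bar> \<le> 2 * (2 * sqrt V) + 5 * bad"
  proof -
    have "\<bar>(\<integral>z. ?L j z \<partial>P) - (\<integral>z. a j z * \<psi> (F z) \<partial>P)\<bar>
        \<le> (\<integral>z. cc j z * (\<phi> (F z) - \<phi> (W' j z)) \<partial>P) + (\<integral>z. cc j z * (- ind (F z) - - ind (W' j z)) \<partial>P) + 5 * (\<integral>z. ?bj j z \<partial>P)" for j
    proof -
      have e1: "(\<integral>z. ?L j z \<partial>P) - (\<integral>z. a j z * \<psi> (F z) \<partial>P) = (\<integral>z. ?L j z - a j z * \<psi> (F z) \<partial>P)"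
        by (rule Bochner_Integration.integral_diff[OF iL ia\<psi>, symmetric])
      note i3 = ic[OF \<phi>m \<phi>1, of j] ic[OF mind, of j] integrable_mult_right[OF ibj[of j], of 5]
      have e2: "(\<integral>z. ?R j z \<partial>P) = (\<integral>z. cc j z * (\<phi> (F z) - \<phi> (W' j z)) \<partial>P) + (\<integral>z. cc j z * (- ind (F z) - - ind (W' j z)) \<partial>P) + 5 * (\<integral>z. ?bj j z \<partial>P)"
        unfolding Bochner_Integration.integral_add[OF Bochner_Integration.integrable_add[OF i3(1,2)] i3(3)]
          Bochner_Integration.integral_add[OF i3(1,2)] by simp
      have iR: "integrable P (?R j)" by (intro Bochner_Integration.integrable_add i3)
      have "\<bar>\<integral>z. ?L j z - a j z * \<psi> (F z) \<partial>P\<bar> \<le> (\<integral>z. \<bar>?L j z - a j z * \<psi> (F z)\<bar> \<partial>P)" by (rule integral_abs_bound)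
      also have "\<dots> \<le> (\<integral>z. ?R j z \<partial>P)"
        by (rule integral_mono[OF _ iR pointwise]) (intro integrable_abs Bochner_Integration.integrable_diff iL ia\<psi>)
      finally show ?thesis unfolding e1 e2 .
    qed
    hence "(\<Sum>j=lo..hi. \<bar>(\<integral>z. ?L j z \<partial>P) - (\<integral>z. a j z * \<psi> (F z) \<partial>P)\<bar>)
        \<le> (\<Sum>j=lo..hi. (\<integral>z. cc j z * (\<phi> (F z) - \<phi> (W' j z)) \<partial>P) + (\<integral>z. cc j z * (- ind (F z) - - ind (W' j z)) \<partial>P) + 5 * (\<integral>z. ?bj j z \<partial>P))"
      by (intro sum_mono)
    also have "\<dots> = (\<Sum>j=lo..hi. \<integral>z. cc j z * (\<phi> (F z) - \<phi> (W' j z)) \<partial>P) + (\<Sum>j=lo..hi. \<integral>z. cc j z * (- ind (F z) - - ind (W' j z)) \<partial>P) + 5 * bad"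
      unfolding bad_def by (simp only: sum.distrib sum_distrib_left)
    also have "\<dots> \<le> 2 * sqrt V + 2 * sqrt V + 5 * bad"
      by (intro add_mono monobound[OF \<phi>m \<phi>1] monobound[OF mind] order_refl)
    finally have s: "(\<Sum>j=lo..hi. \<bar>(\<integral>z. ?L j z \<partial>P) - (\<integral>z. a j z * \<psi> (F z) \<partial>P)\<bar>) \<le> 2 * (2 * sqrt V) + 5 * bad" by simp
    show ?thesis unfolding sum_subtractf[symmetric] by (rule order_trans[OF sum_abs s])
  qed
  have suma: "(\<Sum>j=lo..hi. \<integral>z. a j z * \<psi> (F z) \<partial>P) = (\<integral>z. Ta z * \<psi> (F z) \<partial>P)"
    unfolding Ta_def sum_distrib_right using ia\<psi> by simp
  have stein: "(\<integral>z. F z * g (F z) \<partial>P) = (\<Sum>j=lo..hi. \<integral>z. ?L j z \<partial>P) / 2"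
    by (rule stein_identity[OF gm b mean])
  have c0: "0 \<le> c" using W_bounded[of undefined] by linarith
  have dDb: "\<bar>\<delta> j z * \<Delta> j z\<bar> \<le> \<kappa>\<^sup>2 * ?n\<^sup>2" for j z using product_bounded[of j z] by simp
  have idD: "integrable P (\<lambda>z. \<delta> j z * \<Delta> j z)" for j by (rule P.integrable_bounded[OF _ dDb]) measurable
  \<comment> \<open>the Stein identity for the identity function: all products sum to \<open>2\<close> in the mean\<close>
  have meanT: "\<bar>2 - (\<integral>z. Ta z \<partial>P)\<bar> \<le> bad"
  proof -
    have "(\<integral>z. F z * F z \<partial>P) = (\<Sum>j=lo..hi. (\<integral>z. \<delta> j z * (F z - W' j z) \<partial>P)) / 2"
      by (rule stein_identity[where g = "\<lambda>x. x", OF _ W_bounded mean]) measurable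
    hence 2: "(\<Sum>j=lo..hi. \<integral>z. \<delta> j z * \<Delta> j z \<partial>P) = 2" using var by (simp add: power2_eq_square \<Delta>_def)
    have "(\<integral>z. Ta z \<partial>P) = (\<Sum>j=lo..hi. \<integral>z. a j z \<partial>P)" unfolding Ta_def using ia by simp
    hence "2 - (\<integral>z. Ta z \<partial>P) = (\<Sum>j=lo..hi. (\<integral>z. \<delta> j z * \<Delta> j z \<partial>P) - (\<integral>z. a j z \<partial>P))"
      using 2 by (simp add: sum_subtractf)
    moreover have "\<bar>\<Sum>j=lo..hi. (\<integral>z. \<delta> j z * \<Delta> j z \<partial>P) - (\<integral>z. a j z \<partial>P)\<bar> \<le> bad" unfolding bad_def
    proof (rule order_trans[OF sum_abs], rule sum_mono)
      fix j
      have e: "(\<integral>z. \<delta> j z * \<Delta> j z \<partial>P) - (\<integral>z. a j z \<partial>P) = (\<integral>z. \<delta> j z * \<Delta> j z - a j z \<partial>P)"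
        by (rule Bochner_Integration.integral_diff[OF idD ia(1), symmetric])
      have "\<bar>\<delta> j z * \<Delta> j z - a j z\<bar> = ?bj j z" for z
      proof -
        have "\<delta> j z * \<Delta> j z - a j z = (\<delta> j z * \<Delta> j z) * (1 - ok (z j))" by (simp add: a_def right_diff_distrib)
        thus ?thesis by (simp only: abs_mult[of _ "1 - ok (z j)"]) simp
      qed
      thus "\<bar>(\<integral>z. \<delta> j z * \<Delta> j z \<partial>P) - (\<integral>z. a j z \<partial>P)\<bar> \<le> (\<integral>z. ?bj j z \<partial>P)"
        unfolding e using integral_abs_bound[of P "\<lambda>z. \<delta> j z * \<Delta> j z - a j z"] by simp
    qed
    ultimately show ?thesis by (simp only:)
  qed
  have i\<psi>: "integrable P (\<lambda>z. \<psi> (F z))" by (rule P.integrable_bounded[OF _ \<psi>2]) measurable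
  have iT\<psi>: "integrable P (\<lambda>z. Ta z * \<psi> (F z))" unfolding Ta_def sum_distrib_right using ia\<psi> by simp
  have main: "\<bar>2 * (\<integral>z. \<psi> (F z) \<partial>P) - (\<integral>z. Ta z * \<psi> (F z) \<partial>P)\<bar> \<le> 2 * (bad + sqrt V)"
  proof -
    let ?ET = "\<integral>z. Ta z \<partial>P"
    have e: "2 * (\<integral>z. \<psi> (F z) \<partial>P) - (\<integral>z. Ta z * \<psi> (F z) \<partial>P) = (\<integral>z. 2 * \<psi> (F z) - Ta z * \<psi> (F z) \<partial>P)"
      using i\<psi> iT\<psi> by simp
    have "\<bar>\<integral>z. 2 * \<psi> (F z) - Ta z * \<psi> (F z) \<partial>P\<bar> \<le> (\<integral>z. \<bar>2 * \<psi> (F z) - Ta z * \<psi> (F z)\<bar> \<partial>P)"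
      by (rule integral_abs_bound)
    also have "\<dots> \<le> (\<integral>z. 2 * (bad + \<bar>Ta z - ?ET\<bar>) \<partial>P)"
    proof (rule integral_mono)
      show "integrable P (\<lambda>z. \<bar>2 * \<psi> (F z) - Ta z * \<psi> (F z)\<bar>)" using i\<psi> iT\<psi> by simp
      show "integrable P (\<lambda>z. 2 * (bad + \<bar>Ta z - ?ET\<bar>))" using iT by simp
      fix z
      have "2 * \<psi> (F z) - Ta z * \<psi> (F z) = (2 - Ta z) * \<psi> (F z)" by (simp only: left_diff_distrib)
      hence "\<bar>2 * \<psi> (F z) - Ta z * \<psi> (F z)\<bar> \<le> \<bar>2 - Ta z\<bar> * 2"
        using \<psi>2[of "F z"] by (simp add: abs_mult mult_left_mono)
      also have "\<bar>2 - Ta z\<bar> \<le> bad + \<bar>Ta z - ?ET\<bar>" using meanT by linarith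
      finally show "\<bar>2 * \<psi> (F z) - Ta z * \<psi> (F z)\<bar> \<le> 2 * (bad + \<bar>Ta z - ?ET\<bar>)" by linarith
    qed
    also have "\<dots> = 2 * (bad + (\<integral>z. \<bar>Ta z - ?ET\<bar> \<partial>P))" using iT by simp
    also have "\<dots> \<le> 2 * (bad + sqrt V)" using L1[OF _ Tb(1) varT(1)] by simp
    finally show ?thesis unfolding e .
  qed
  have "(\<integral>z. ind (F z) \<partial>P) - p = (\<integral>z. \<psi> (F z) \<partial>P) - (\<integral>z. F z * g (F z) \<partial>P)"
  proof -
    have iind: "integrable P (\<lambda>z. ind (F z))" by (rule P.integrable_bounded[OF _ ind01(3)]) measurable
    have i\<phi>: "integrable P (\<lambda>z. \<phi> (F z))" by (rule P.integrable_bounded[OF _ \<phi>1]) measurable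
    have "(\<integral>z. \<psi> (F z) \<partial>P) = (\<integral>z. \<phi> (F z) \<partial>P) + (\<integral>z. ind (F z) \<partial>P) - p"
      unfolding \<psi>_def using iind i\<phi> by simp
    thus ?thesis by (simp add: \<phi>g)
  qed
  hence "2 * ((\<integral>z. ind (F z) \<partial>P) - p) = 2 * (\<integral>z. \<psi> (F z) \<partial>P) - (\<Sum>j=lo..hi. \<integral>z. ?L j z \<partial>P)"
    unfolding stein by (simp add: right_diff_distrib)
  hence "2 * \<bar>(\<integral>z. ind (F z) \<partial>P) - p\<bar> \<le> 2 * (bad + sqrt V) + (2 * (2 * sqrt V) + 5 * bad)"
    using main sumdiff[unfolded suma] by linarith
  moreover have "0 \<le> bad"
    unfolding bad_def by (intro sum_nonneg Bochner_Integration.integral_nonneg mult_nonneg_nonneg) auto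
  moreover have "bad \<le> \<kappa>\<^sup>2 * card T * (\<integral>\<zeta>. (Y \<zeta>)\<^sup>2 * (1 - ok \<zeta>) \<partial>\<nu>)" unfolding bad_def by (rule bad_sum)
  ultimately have "\<bar>(\<integral>z. ind (F z) \<partial>P) - p\<bar>
      \<le> 3 * sqrt V + 4 * (\<kappa>\<^sup>2 * card T * (\<integral>\<zeta>. (Y \<zeta>)\<^sup>2 * (1 - ok \<zeta>) \<partial>\<nu>))"
    by (rule halve_bound)
  thus ?thesis unfolding V_def[symmetric] p_def ind_def .
qed

end
end

section \<open>Decay of the moving average coefficients\<close>

lemma fps_binomial_minus_nth:
  "fps_nth (fps_binomial a oo (- fps_X)) n = (-1) ^ n * (a gchoose n)" for a :: real
proof -
  have X: "- fps_X = (fps_const (- 1) * fps_X :: real fps)" by (rule fps_ext) simp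
  show ?thesis unfolding X fps_compose_linear by simp
qed

text \<open>
  From the asymptotics of the binomial coefficients; \<open>n\<close> is replaced by \<open>n + 1\<close> to include
  \<open>n = 0\<close>.
\<close>
lemma binomial_coeff_decay:
  fixes d :: real
  obtains M where "M > 0" "\<And>n. \<bar>fps_nth (fps_binomial (- d) oo (- fps_X)) n\<bar> \<le> M * (real n + 1) powr (- (1 - d))"
proof -
  let ?c = "\<lambda>n. (- d gchoose n) / ((-1)^n / exp ((- d + 1) * of_real (ln (real n))))"
  have "convergent ?c" using gbinomial_asymptotic[of "- d"] by (auto simp: convergent_def)
  hence "Bseq ?c" by (rule convergent_imp_Bseq)
  then obtain M where M: "M > 0" "\<And>n. norm (?c n) \<le> M" by (auto elim: BseqE)
  define K where "K = 1 + M * (2 powr (1 - d) + 1)"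
  have K: "K > 0" unfolding K_def using M by (intro add_pos_nonneg mult_nonneg_nonneg) auto
  have "\<bar>- d gchoose n\<bar> \<le> K * (real n + 1) powr (- (1 - d))" for n
  proof (cases "n = 0")
    case True
    thus ?thesis using M by (simp add: K_def)
  next
    case False
    have e: "exp ((- d + 1) * of_real (ln (real n))) = real n powr (1 - d)" using False by (simp add: powr_def)
    have 0: "\<bar>- d gchoose n\<bar> * real n powr (1 - d) \<le> M"
      using M(2)[of n] unfolding e by (simp add: abs_mult power_abs)
    hence 1: "\<bar>- d gchoose n\<bar> \<le> M * real n powr (- (1 - d))"
    proof -
      have "\<bar>- d gchoose n\<bar> = \<bar>- d gchoose n\<bar> * real n powr (1 - d) * real n powr (- (1 - d))"
        using False by (simp only: mult.assoc powr_add[symmetric]) simp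
      also have "\<dots> \<le> M * real n powr (- (1 - d))" by (intro mult_right_mono) (use 0 in auto)
      finally show ?thesis .
    qed
    have 2: "real n powr (- (1 - d)) \<le> (2 powr (1 - d) + 1) * (real n + 1) powr (- (1 - d))"
    proof (cases "1 - d \<ge> 0")
      case True
      have "real n powr (- (1 - d)) \<le> ((real n + 1) / 2) powr (- (1 - d))"
        using True False by (intro powr_mono2') auto
      also have "\<dots> = 2 powr (1 - d) * (real n + 1) powr (- (1 - d))"
      proof -
        have "((real n + 1) / 2) powr (- (1 - d)) = (real n + 1) powr (- (1 - d)) / 2 powr (- (1 - d))"
          by (rule powr_divide)
        also have "2 powr (- (1 - d)) = inverse (2 powr (1 - d))" by (rule powr_minus)
        finally show ?thesis by (simp only: divide_inverse inverse_inverse_eq mult.commute)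
      qed
      also have "\<dots> \<le> (2 powr (1 - d) + 1) * (real n + 1) powr (- (1 - d))" by (intro mult_right_mono) auto
      finally show ?thesis .
    next
      case f: False
      have "real n powr (- (1 - d)) \<le> 1 * (real n + 1) powr (- (1 - d))"
        using f by (simp, intro powr_mono2) auto
      also have "\<dots> \<le> (2 powr (1 - d) + 1) * (real n + 1) powr (- (1 - d))" by (intro mult_right_mono) auto
      finally show ?thesis .
    qed
    have "M * real n powr (- (1 - d)) \<le> M * ((2 powr (1 - d) + 1) * (real n + 1) powr (- (1 - d)))"
      using M 2 by (intro mult_left_mono) auto
    also have "\<dots> \<le> K * (real n + 1) powr (- (1 - d))" unfolding K_def mult.assoc[symmetric] by (intro mult_right_mono) auto
    finally show ?thesis using 1 by linarith
  qed
  thus ?thesis using that[OF K] by (simp add: fps_binomial_minus_nth abs_mult power_abs)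
qed

text \<open>
  By compactness the quotient of the polynomials is holomorphic on a disk of radius greater
  than \<open>1\<close>, so its coefficients times the powers of a radius \<open>s > 1\<close> are bounded.
\<close>
lemma rational_coeff_geometric:
  fixes \<Phi> \<Theta> :: "real poly"
  assumes \<Phi>: "\<And>z. cmod z \<le> 1 \<Longrightarrow> cpoly \<Phi> z \<noteq> 0"
  obtains s M where "s > 1" "M > 0" "\<And>n. \<bar>fps_nth (fps_of_poly \<Theta> / fps_of_poly \<Phi>) n\<bar> \<le> M * (1 / s) ^ n"
proof -
  let ?E = "fps_of_poly \<Theta> / fps_of_poly \<Phi>"
  have nz: "coeff \<Phi> 0 \<noteq> 0" using \<Phi>[of 0] by (simp add: poly_0_coeff_0 coeff_map_poly)
  have "open (- {z. cpoly \<Phi> z = 0})"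
    by (intro open_Compl closed_Collect_eq continuous_intros)
  moreover have "cball 0 1 \<subseteq> - {z. cpoly \<Phi> z = 0}" using \<Phi> by auto
  ultimately obtain e where e0: "e > 0" "(\<Union>w\<in>cball 0 1. cball w e) \<subseteq> - {z. cpoly \<Phi> z = 0}"
    by (rule compact_subset_open_imp_cball_epsilon_subset[OF compact_cball])
  have e: "e > 0" "\<And>w. w \<in> cball 0 1 \<Longrightarrow> cball w e \<subseteq> - {z. cpoly \<Phi> z = 0}" using e0 by blast+
  have nz': "cpoly \<Phi> z \<noteq> 0" if "cmod z \<le> 1 + e" for z
  proof (cases "cmod z \<le> 1")
    case True thus ?thesis by (rule \<Phi>)
  next
    case False
    define w where "w = z / of_real (cmod z)"
    have z0: "z \<noteq> 0" using False by (metis norm_zero zero_le_one)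
    have w: "cmod w = 1" using z0 by (simp add: w_def norm_divide)
    have "w * of_real (cmod z) = z" using z0 by (simp add: w_def)
    hence "z - w = w * of_real (cmod z - 1)" by (simp add: right_diff_distrib)
    hence "cmod (z - w) = \<bar>cmod z - 1\<bar>" by (simp add: norm_mult w del: of_real_diff)
    hence "dist w z \<le> e" using that False by (simp add: dist_norm norm_minus_commute)
    hence "z \<in> cball w e" "w \<in> cball 0 1" using w by simp_all
    thus ?thesis using e(2)[of w] by blast
  qed
  have exp: "(\<lambda>z. cpoly \<Theta> z / cpoly \<Phi> z) has_fps_expansion fps_cor (fps_of_poly \<Theta>) / fps_cor (fps_of_poly \<Phi>)"
    by (intro has_fps_expansion_divide' has_fps_expansion_cpoly) (use nz in auto)
  also have "fps_cor (fps_of_poly \<Theta>) / fps_cor (fps_of_poly \<Phi>) = fps_cor ?E"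
  proof -
    have "fps_of_poly \<Phi> \<noteq> 0" "fps_nth (fps_of_poly \<Phi>) 0 \<noteq> 0" using nz by auto
    hence "?E * fps_of_poly \<Phi> = fps_of_poly \<Theta>" by (simp add: fps_divide_unit inverse_mult_eq_1 mult.assoc)
    hence "fps_cor ?E * fps_cor (fps_of_poly \<Phi>) = fps_cor (fps_of_poly \<Theta>)" by (metis fps_cor_mult)
    moreover have "fps_cor (fps_of_poly \<Phi>) \<noteq> 0"
      using nz by (metis fps_cor_nth fps_of_poly_nth fps_zero_nth of_real_eq_0_iff)
    ultimately show ?thesis by (metis nonzero_mult_div_cancel_right)
  qed
  finally have exp: "(\<lambda>z. cpoly \<Theta> z / cpoly \<Phi> z) has_fps_expansion fps_cor ?E" .
  have hol: "(\<lambda>z. cpoly \<Theta> z / cpoly \<Phi> z) holomorphic_on eball 0 (ereal (1 + e))"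
    using nz' by (intro holomorphic_intros) (auto simp: in_eball_iff less_imp_le)
  define s where "s = 1 + e / 2"
  have s: "s > 1" "s < 1 + e" using e by (simp_all add: s_def)
  have "(\<lambda>n. fps_nth (fps_cor ?E) n * complex_of_real s ^ n) sums (cpoly \<Theta> s / cpoly \<Phi> s)"
    using has_fps_expansion_imp_sums_complex[OF exp hol, of "complex_of_real s"] s by simp
  hence "(\<lambda>n. fps_nth (fps_cor ?E) n * complex_of_real s ^ n) \<longlonglongrightarrow> 0"
    using sums_summable summable_LIMSEQ_zero by blast
  hence "Bseq (\<lambda>n. fps_nth (fps_cor ?E) n * complex_of_real s ^ n)"
    using convergent_imp_Bseq convergentI by blast
  then obtain M where M: "M > 0" "\<And>n. norm (fps_nth (fps_cor ?E) n * complex_of_real s ^ n) \<le> M" by (auto elim: BseqE)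
  show ?thesis
  proof (rule that[OF s(1) M(1)])
    fix n
    have "\<bar>fps_nth ?E n\<bar> * s ^ n \<le> M" using M(2)[of n] s by (simp add: norm_mult norm_power)
    thus "\<bar>fps_nth ?E n\<bar> \<le> M * (1 / s) ^ n" using s by (simp add: power_one_over field_simps)
  qed
qed

lemma summable_powr_geometric:
  fixes \<gamma> s :: real
  assumes s: "s > 1"
  shows "summable (\<lambda>i. (real i + 1) powr \<gamma> * (1 / s) ^ i)"
proof -
  let ?f = "\<lambda>i. (real i + 1) powr \<gamma> * (1 / s) ^ i"
  have "(\<lambda>i. (real i + 2) / (real i + 1)) \<longlonglongrightarrow> 1" by real_asymp
  hence "(\<lambda>i. ((real i + 2) / (real i + 1)) powr \<gamma> * (1 / s)) \<longlonglongrightarrow> 1 powr \<gamma> * (1 / s)"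
    by (intro tendsto_mult tendsto_powr tendsto_const) auto
  moreover have "1 powr \<gamma> * (1 / s) < (1 + 1 / s) / 2" using s by (simp add: field_simps)
  ultimately have "\<forall>\<^sub>F i in sequentially. ((real i + 2) / (real i + 1)) powr \<gamma> * (1 / s) < (1 + 1 / s) / 2"
    by (rule order_tendstoD)
  then obtain N where N: "\<And>i. i \<ge> N \<Longrightarrow> ((real i + 2) / (real i + 1)) powr \<gamma> * (1 / s) < (1 + 1 / s) / 2"
    unfolding eventually_sequentially by blast
  show ?thesis
  proof (rule summable_ratio_test[of "(1 + 1 / s) / 2" N])
    show "(1 + 1 / s) / 2 < 1" using s by (simp add: field_simps)
    fix i assume i: "i \<ge> N"
    have f0: "0 \<le> ?f i" using s by simp
    have "?f (Suc i) = ((real i + 2) / (real i + 1)) powr \<gamma> * (1 / s) * ?f i"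
    proof -
      have "(real i + 2) powr \<gamma> = ((real i + 2) / (real i + 1)) powr \<gamma> * (real i + 1) powr \<gamma>"
        by (subst powr_mult[symmetric]) auto
      moreover have "real (Suc i) + 1 = real i + 2" by simp
      ultimately show ?thesis by (simp only: power_Suc mult_ac)
    qed
    also have "\<dots> \<le> (1 + 1 / s) / 2 * ?f i" using N[OF i] f0 by (intro mult_right_mono) auto
    finally show "norm (?f (Suc i)) \<le> (1 + 1 / s) / 2 * norm (?f i)" using s f0 by simp
  qed
qed

text \<open>
  The coefficients are the convolution of a geometrically decaying sequence with the binomial
  coefficients. As \<open>n + 1 \<le> (n - i + 1) * (i + 1)\<close>, the power of \<open>n - i + 1\<close> can be replaced
  by that of \<open>n + 1\<close> at the cost of a power of \<open>i + 1\<close>, which the geometric factor absorbs.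
\<close>
lemma arima_coeff_decay:
  fixes \<Phi> \<Theta> :: "real poly"
  assumes \<Phi>: "\<And>z. cmod z \<le> 1 \<Longrightarrow> cpoly \<Phi> z \<noteq> 0" and d: "d < 1"
  obtains K where "K > 0" "\<And>n. \<bar>arima_coeff \<Phi> \<Theta> d n\<bar> \<le> K * (real n + 1) powr (- (1 - d))"
proof -
  let ?E = "fps_of_poly \<Theta> / fps_of_poly \<Phi>" and ?g = "fps_binomial (- d) oo (- fps_X)"
  define \<gamma> where "\<gamma> = 1 - d"
  obtain s M where s: "s > 1" and M: "M > 0" "\<And>n. \<bar>fps_nth ?E n\<bar> \<le> M * (1 / s) ^ n"
    using rational_coeff_geometric[OF \<Phi>] by blast
  obtain L where L: "L > 0" "\<And>n. \<bar>fps_nth ?g n\<bar> \<le> L * (real n + 1) powr (- \<gamma>)"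
    unfolding \<gamma>_def using binomial_coeff_decay[of d] by blast
  have nz: "coeff \<Phi> 0 \<noteq> 0" using \<Phi>[of 0] by (simp add: poly_0_coeff_0 coeff_map_poly)
  have eq: "fps_of_poly \<Theta> * ?g / fps_of_poly \<Phi> = ?E * ?g"
    using nz by (simp add: fps_divide_unit mult_ac)
  define S where "S = (\<Sum>i. (real i + 1) powr \<gamma> * (1 / s) ^ i)"
  have sm: "summable (\<lambda>i. (real i + 1) powr \<gamma> * (1 / s) ^ i)" by (rule summable_powr_geometric[OF s])
  have S: "(\<Sum>i\<in>{0..n}. (real i + 1) powr \<gamma> * (1 / s) ^ i) \<le> S" for n
    unfolding S_def using s by (intro sum_le_suminf sm) auto
  have S1: "S \<ge> 1" using S[of 0] by simp
  have "\<bar>arima_coeff \<Phi> \<Theta> d n\<bar> \<le> M * L * S * (real n + 1) powr (- \<gamma>)" for n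
  proof -
    have "arima_coeff \<Phi> \<Theta> d n = (\<Sum>i=0..n. fps_nth ?E i * fps_nth ?g (n - i))"
      unfolding arima_coeff_def eq fps_mult_nth ..
    hence "\<bar>arima_coeff \<Phi> \<Theta> d n\<bar> \<le> (\<Sum>i=0..n. \<bar>fps_nth ?E i * fps_nth ?g (n - i)\<bar>)" by simp
    also have "\<dots> \<le> (\<Sum>i=0..n. M * L * (real n + 1) powr (- \<gamma>) * ((real i + 1) powr \<gamma> * (1 / s) ^ i))"
    proof (rule sum_mono)
      fix i assume i: "i \<in> {0..n}"
      have "real n + 1 \<le> (real (n - i) + 1) * (real i + 1)"
      proof -
        have "(real (n - i) + 1) * (real i + 1) = real n + 1 + real i * real (n - i)"
          using i by (simp add: of_nat_diff algebra_simps)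
        thus ?thesis by simp
      qed
      hence "((real (n - i) + 1) * (real i + 1)) powr (- \<gamma>) \<le> (real n + 1) powr (- \<gamma>)"
        using d by (intro powr_mono2') (auto simp: \<gamma>_def)
      hence "(real (n - i) + 1) powr (- \<gamma>) * (real i + 1) powr (- \<gamma>) \<le> (real n + 1) powr (- \<gamma>)"
        by (subst (asm) powr_mult) auto
      hence "(real (n - i) + 1) powr (- \<gamma>) * ((real i + 1) powr (- \<gamma>) * (real i + 1) powr \<gamma>) \<le> (real n + 1) powr (- \<gamma>) * (real i + 1) powr \<gamma>"
        unfolding mult.assoc[symmetric] by (intro mult_right_mono) auto
      hence p: "(real (n - i) + 1) powr (- \<gamma>) \<le> (real n + 1) powr (- \<gamma>) * (real i + 1) powr \<gamma>"
        by (simp add: powr_add[symmetric])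
      have "\<bar>fps_nth ?E i * fps_nth ?g (n - i)\<bar> \<le> (M * (1 / s) ^ i) * (L * (real (n - i) + 1) powr (- \<gamma>))"
        unfolding abs_mult using M L s by (intro mult_mono) auto
      also have "\<dots> \<le> (M * (1 / s) ^ i) * (L * ((real n + 1) powr (- \<gamma>) * (real i + 1) powr \<gamma>))"
        using M L s p by (intro mult_left_mono) auto
      finally show "\<bar>fps_nth ?E i * fps_nth ?g (n - i)\<bar> \<le> M * L * (real n + 1) powr (- \<gamma>) * ((real i + 1) powr \<gamma> * (1 / s) ^ i)"
        by (simp add: mult_ac)
    qed
    also have "\<dots> = M * L * (real n + 1) powr (- \<gamma>) * (\<Sum>i=0..n. (real i + 1) powr \<gamma> * (1 / s) ^ i)"
      by (simp only: sum_distrib_left)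
    also have "\<dots> \<le> M * L * (real n + 1) powr (- \<gamma>) * S" using M L S by (intro mult_left_mono) auto
    finally show ?thesis by (simp add: mult_ac)
  qed
  moreover have "M * L * S > 0" using M L S1 by simp
  ultimately show ?thesis using that[of "M * L * S"] by (simp add: \<gamma>_def)
qed

section \<open>Bounded functions of moving averages\<close>

text \<open>
  Both sides agree on cylinder sets. Thus an integral over the innovations is one over the first
  copies in a doubled configuration.
\<close>
lemma PiM_map_fst:
  fixes \<mu> :: "real measure"
  assumes "prob_space \<mu>"
  shows "distr (Pi\<^sub>M UNIV (\<lambda>_::int. \<mu> \<Otimes>\<^sub>M \<mu>)) (Pi\<^sub>M UNIV (\<lambda>_. \<mu>)) (\<lambda>z i. fst (z i)) = Pi\<^sub>M UNIV (\<lambda>_. \<mu>)"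
proof -
  interpret prob_space \<mu> by fact
  interpret pr: pair_prob_space \<mu> \<mu> ..
  interpret Q: product_prob_space "\<lambda>_::int. \<mu>" UNIV ..
  interpret N: product_prob_space "\<lambda>_::int. \<mu> \<Otimes>\<^sub>M \<mu>" UNIV ..
  let ?P = "Pi\<^sub>M UNIV (\<lambda>_::int. \<mu> \<Otimes>\<^sub>M \<mu>)"
  have m[measurable]: "(\<lambda>z i. fst (z i)) \<in> measurable ?P (Pi\<^sub>M UNIV (\<lambda>_. \<mu>))"
    by (rule measurable_PiM_single') (auto simp: space_PiM space_pair_measure PiE_iff mem_Times_iff)
  show ?thesis
  proof (rule measure_eqI_PiM_infinite)
    show "finite_measure (distr ?P (Pi\<^sub>M UNIV (\<lambda>_. \<mu>)) (\<lambda>z i. fst (z i)))"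
      using N.prob_space_distr[OF m] by (simp add: prob_space_def)
    fix A :: "int \<Rightarrow> real set" and J :: "int set"
    assume J: "finite J" "J \<subseteq> UNIV" and A: "\<And>i. i \<in> J \<Longrightarrow> A i \<in> sets \<mu>"
    have em: "prod_emb UNIV (\<lambda>_. \<mu>) J (Pi\<^sub>E J A) \<in> sets (Pi\<^sub>M UNIV (\<lambda>_. \<mu>))"
      using J A by (intro sets_PiM_I) auto
    have "emeasure (distr ?P (Pi\<^sub>M UNIV (\<lambda>_. \<mu>)) (\<lambda>z i. fst (z i))) (prod_emb UNIV (\<lambda>_. \<mu>) J (Pi\<^sub>E J A))
        = emeasure ?P (prod_emb UNIV (\<lambda>_. \<mu> \<Otimes>\<^sub>M \<mu>) J (Pi\<^sub>E J (\<lambda>i. A i \<times> space \<mu>)))"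
      unfolding emeasure_distr[OF m em]
    proof (rule arg_cong[of _ _ "emeasure ?P"])
      have "A i \<subseteq> space \<mu>" if "i \<in> J" for i using A[OF that] sets.sets_into_space by blast
      thus "(\<lambda>z i. fst (z i)) -` prod_emb UNIV (\<lambda>_. \<mu>) J (Pi\<^sub>E J A) \<inter> space ?P
          = prod_emb UNIV (\<lambda>_. \<mu> \<Otimes>\<^sub>M \<mu>) J (Pi\<^sub>E J (\<lambda>i. A i \<times> space \<mu>))"
        by (auto simp: prod_emb_def space_PiM space_pair_measure PiE_iff mem_Times_iff)
    qed
    also have "\<dots> = (\<Prod>i\<in>J. emeasure (\<mu> \<Otimes>\<^sub>M \<mu>) (A i \<times> space \<mu>))"
      using J A by (intro N.emeasure_PiM_emb) auto
    also have "\<dots> = (\<Prod>i\<in>J. emeasure \<mu> (A i))"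
      using A by (intro prod.cong refl) (simp add: emeasure_pair_measure_Times emeasure_space_1)
    also have "\<dots> = emeasure (Pi\<^sub>M UNIV (\<lambda>_. \<mu>)) (prod_emb UNIV (\<lambda>_. \<mu>) J (Pi\<^sub>E J A))"
      using J A by (intro Q.emeasure_PiM_emb[symmetric]) auto
    finally show "emeasure (distr ?P (Pi\<^sub>M UNIV (\<lambda>_. \<mu>)) (\<lambda>z i. fst (z i))) (prod_emb UNIV (\<lambda>_. \<mu>) J (Pi\<^sub>E J A))
        = emeasure (Pi\<^sub>M UNIV (\<lambda>_. \<mu>)) (prod_emb UNIV (\<lambda>_. \<mu>) J (Pi\<^sub>E J A))" .
  qed simp_all
qed

locale moving_average = prob_space M for M :: "'a measure" +
  fixes \<epsilon> X :: "int \<Rightarrow> 'a \<Rightarrow> real" and \<mu> :: "real measure" and b :: "nat \<Rightarrow> real"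
  assumes indep: "indep_vars (\<lambda>_. borel) \<epsilon> UNIV"
    and law: "distr M borel (\<epsilon> i) = \<mu>"
    and X_measurable [measurable]: "X t \<in> borel_measurable M"
    and X_sums: "AE \<omega> in M. (\<lambda>j. b j * \<epsilon> (t - int j) \<omega>) sums X t \<omega>"
begin

lemma \<epsilon>_measurable [measurable]: "\<epsilon> i \<in> borel_measurable M"
  using indep_vars_def2[of "\<lambda>_. borel" \<epsilon> UNIV] indep by auto

lemma sets_\<mu> [measurable_cong]: "sets \<mu> = sets borel" using law[of 0] by auto

lemma space_\<mu> [simp]: "space \<mu> = UNIV" using sets_eq_imp_space_eq[OF sets_\<mu>] by simp

lemma prob_space_\<mu>: "prob_space \<mu>" using prob_space_distr[OF \<epsilon>_measurable] law by metis

abbreviation Q :: "(int \<Rightarrow> real) measure" where "Q \<equiv> Pi\<^sub>M UNIV (\<lambda>_. \<mu>)"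

lemma sets_Q: "sets Q = sets (Pi\<^sub>M UNIV (\<lambda>_. borel))" by (intro sets_PiM_cong refl sets_\<mu>)

lemma Q_measurable: "borel_measurable Q = borel_measurable (Pi\<^sub>M UNIV (\<lambda>_. borel))"
  by (rule measurable_cong_sets[OF sets_Q refl])

lemma noise_law: "distr M Q (\<lambda>\<omega> i. \<epsilon> i \<omega>) = Q"
proof -
  have "distr M (Pi\<^sub>M UNIV (\<lambda>_. borel)) (\<lambda>\<omega>. \<lambda>i\<in>UNIV. \<epsilon> i \<omega>) = Pi\<^sub>M UNIV (\<lambda>i. distr M borel (\<epsilon> i))"
    using indep by (subst (asm) indep_vars_iff_distr_eq_PiM) auto
  hence "distr M (Pi\<^sub>M UNIV (\<lambda>_. borel)) (\<lambda>\<omega> i. \<epsilon> i \<omega>) = Q" by (simp add: law restrict_def)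
  moreover have "distr M Q (\<lambda>\<omega> i. \<epsilon> i \<omega>) = distr M (Pi\<^sub>M UNIV (\<lambda>_. borel)) (\<lambda>\<omega> i. \<epsilon> i \<omega>)"
    by (rule distr_cong[OF refl sets_Q refl])
  ultimately show ?thesis by simp
qed

lemma noise_integral:
  fixes H :: "(int \<Rightarrow> real) \<Rightarrow> real"
  assumes "H \<in> borel_measurable (Pi\<^sub>M UNIV (\<lambda>_. borel))"
  shows "(\<integral>\<omega>. H (\<lambda>i. \<epsilon> i \<omega>) \<partial>M) = (\<integral>x. H x \<partial>Q)"
proof -
  have m: "(\<lambda>\<omega> i. \<epsilon> i \<omega>) \<in> measurable M Q" by (rule measurable_PiM_single') auto
  have "(\<integral>x. H x \<partial>Q) = (\<integral>x. H x \<partial>distr M Q (\<lambda>\<omega> i. \<epsilon> i \<omega>))" by (simp only: noise_law)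
  also have "\<dots> = (\<integral>\<omega>. H (\<lambda>i. \<epsilon> i \<omega>) \<partial>M)" by (rule integral_distr[OF m]) (use assms Q_measurable in auto)
  finally show ?thesis by simp
qed

lemma doubled_integral:
  fixes H :: "(int \<Rightarrow> real) \<Rightarrow> real"
  assumes "H \<in> borel_measurable (Pi\<^sub>M UNIV (\<lambda>_. borel))"
  shows "(\<integral>z. H (\<lambda>i. fst (z i)) \<partial>Pi\<^sub>M UNIV (\<lambda>_. \<mu> \<Otimes>\<^sub>M \<mu>)) = (\<integral>\<omega>. H (\<lambda>i. \<epsilon> i \<omega>) \<partial>M)"
proof -
  have m: "(\<lambda>z i. fst (z i)) \<in> measurable (Pi\<^sub>M UNIV (\<lambda>_::int. \<mu> \<Otimes>\<^sub>M \<mu>)) Q"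
    by (rule measurable_PiM_single') (auto simp: space_PiM space_pair_measure PiE_iff mem_Times_iff)
  have "(\<integral>x. H x \<partial>Q) = (\<integral>x. H x \<partial>distr (Pi\<^sub>M UNIV (\<lambda>_::int. \<mu> \<Otimes>\<^sub>M \<mu>)) Q (\<lambda>z i. fst (z i)))"
    by (simp only: PiM_map_fst[OF prob_space_\<mu>])
  also have "\<dots> = (\<integral>z. H (\<lambda>i. fst (z i)) \<partial>Pi\<^sub>M UNIV (\<lambda>_. \<mu> \<Otimes>\<^sub>M \<mu>))"
    by (rule integral_distr[OF m]) (use assms Q_measurable in auto)
  finally show ?thesis using noise_integral[OF assms] by simp
qed

lemma shift_integral:
  fixes H :: "(int \<Rightarrow> real) \<Rightarrow> real"
  assumes "H \<in> borel_measurable (Pi\<^sub>M UNIV (\<lambda>_. borel))"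
  shows "(\<integral>\<omega>. H (\<lambda>i. \<epsilon> (i + s) \<omega>) \<partial>M) = (\<integral>\<omega>. H (\<lambda>i. \<epsilon> i \<omega>) \<partial>M)"
proof -
  have sm: "(\<lambda>x i. x (i + s)) \<in> measurable (Pi\<^sub>M UNIV (\<lambda>_::int. borel :: real measure)) (Pi\<^sub>M UNIV (\<lambda>_. borel))"
    by (rule measurable_PiM_single') auto
  hence smQ: "(\<lambda>x i. x (i + s)) \<in> measurable Q Q" by (simp add: measurable_cong_sets[OF sets_Q sets_Q])
  have "distr Q (Pi\<^sub>M UNIV (\<lambda>i::int. \<mu>)) (\<lambda>x. \<lambda>i\<in>UNIV. x (i + s)) = Pi\<^sub>M UNIV (\<lambda>i. \<mu>)"
    by (rule distr_PiM_reindex[of UNIV "\<lambda>_. \<mu>" "\<lambda>i. i + s" UNIV]) (auto simp: prob_space_\<mu>)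
  hence d: "distr Q Q (\<lambda>x i. x (i + s)) = Q" by (simp add: restrict_def)
  have "(\<integral>\<omega>. H (\<lambda>i. \<epsilon> (i + s) \<omega>) \<partial>M) = (\<integral>x. H (\<lambda>i. x (i + s)) \<partial>Q)"
    by (rule noise_integral[where H = "\<lambda>x. H (\<lambda>i. x (i + s))"]) (rule measurable_compose[OF sm assms])
  also have "\<dots> = (\<integral>x. H x \<partial>distr Q Q (\<lambda>x i. x (i + s)))"
    by (rule integral_distr[symmetric, OF smQ]) (use assms Q_measurable in auto)
  also have "\<dots> = (\<integral>\<omega>. H (\<lambda>i. \<epsilon> i \<omega>) \<partial>M)" unfolding d by (rule noise_integral[OF assms, symmetric])
  finally show ?thesis .
qed

definition trunc :: "nat \<Rightarrow> int \<Rightarrow> (int \<Rightarrow> real) \<Rightarrow> real" where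
  "trunc m t x = (\<Sum>j<m. b j * x (t - int j))"

lemma trunc_measurable [measurable]: "trunc m t \<in> borel_measurable (Pi\<^sub>M UNIV (\<lambda>_. borel))"
  unfolding trunc_def by measurable

lemma trunc_noise_measurable [measurable]: "(\<lambda>\<omega>. trunc m t (\<lambda>i. \<epsilon> i \<omega>)) \<in> borel_measurable M"
  unfolding trunc_def by measurable

lemma trunc_shift: "trunc m t (\<lambda>i. x (i + s)) = trunc m (t + s) x"
  unfolding trunc_def by (simp add: algebra_simps)

lemma trunc_tendsto: "AE \<omega> in M. \<forall>t. (\<lambda>m. trunc m t (\<lambda>i. \<epsilon> i \<omega>)) \<longlonglongrightarrow> X t \<omega>"
proof -
  have "AE \<omega> in M. \<forall>t. (\<lambda>j. b j * \<epsilon> (t - int j) \<omega>) sums X t \<omega>"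
    unfolding AE_all_countable using X_sums by blast
  thus ?thesis unfolding trunc_def sums_def .
qed

lemma bounded_limit:
  fixes G :: "nat \<Rightarrow> 'a \<Rightarrow> real"
  assumes "\<And>m. G m \<in> borel_measurable M" "H \<in> borel_measurable M"
    and "\<And>m \<omega>. \<bar>G m \<omega>\<bar> \<le> c" and "AE \<omega> in M. (\<lambda>m. G m \<omega>) \<longlonglongrightarrow> H \<omega>"
  shows "(\<lambda>m. \<integral>\<omega>. G m \<omega> \<partial>M) \<longlonglongrightarrow> (\<integral>\<omega>. H \<omega> \<partial>M)"
  by (rule integral_dominated_convergence[where w = "\<lambda>_. c"]) (use assms in auto)

text \<open>
  Truncated moving averages at shifted times are the same function of the shifted innovations,
  which have the same law; the truncation is removed by dominated convergence.
\<close>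
lemma stationary:
  fixes f g :: "real \<Rightarrow> real"
  assumes f: "continuous_on UNIV f" "\<And>x. \<bar>f x\<bar> \<le> c" and g: "continuous_on UNIV g" "\<And>x. \<bar>g x\<bar> \<le> c'"
  shows "(\<integral>\<omega>. f (X (t + s) \<omega>) * g (X (u + s) \<omega>) \<partial>M) = (\<integral>\<omega>. f (X t \<omega>) * g (X u \<omega>) \<partial>M)"
proof -
  have [measurable]: "f \<in> borel_measurable borel" "g \<in> borel_measurable borel"
    using f g by (auto intro: borel_measurable_continuous_onI)
  have c0: "0 \<le> c" "0 \<le> c'" using f(2)[of 0] g(2)[of 0] by linarith+
  have fc: "isCont f x" "isCont g x" for x using f(1) g(1) by (auto simp: continuous_on_eq_continuous_at)
  let ?G = "\<lambda>m t u x. f (trunc m t x) * g (trunc m u x)"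
  have lim: "(\<lambda>m. \<integral>\<omega>. ?G m t u (\<lambda>i. \<epsilon> i \<omega>) \<partial>M) \<longlonglongrightarrow> (\<integral>\<omega>. f (X t \<omega>) * g (X u \<omega>) \<partial>M)" for t u
  proof (rule bounded_limit[where c = "c * c'"])
    show "AE \<omega> in M. (\<lambda>m. ?G m t u (\<lambda>i. \<epsilon> i \<omega>)) \<longlonglongrightarrow> f (X t \<omega>) * g (X u \<omega>)"
      using trunc_tendsto
    proof eventually_elim
      case (elim \<omega>)
      show ?case
        by (intro tendsto_mult isCont_tendsto_compose[OF fc(1)] isCont_tendsto_compose[OF fc(2)])
           (use elim in auto)
    qed
    show "\<bar>?G m t u (\<lambda>i. \<epsilon> i \<omega>)\<bar> \<le> c * c'" for m \<omega> unfolding abs_mult by (intro mult_mono f g c0) auto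
  qed measurable
  have "(\<integral>\<omega>. ?G m (t + s) (u + s) (\<lambda>i. \<epsilon> i \<omega>) \<partial>M) = (\<integral>\<omega>. ?G m t u (\<lambda>i. \<epsilon> i \<omega>) \<partial>M)" for m
  proof -
    have "(\<integral>\<omega>. ?G m t u (\<lambda>i. \<epsilon> (i + s) \<omega>) \<partial>M) = (\<integral>\<omega>. ?G m t u (\<lambda>i. \<epsilon> i \<omega>) \<partial>M)"
      by (rule shift_integral) measurable
    thus ?thesis by (simp add: trunc_shift[of m _ "\<lambda>i. \<epsilon> i _"])
  qed
  hence "(\<lambda>m. \<integral>\<omega>. ?G m t u (\<lambda>i. \<epsilon> i \<omega>) \<partial>M) \<longlonglongrightarrow> (\<integral>\<omega>. f (X (t + s) \<omega>) * g (X (u + s) \<omega>) \<partial>M)"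
    using lim[of "t + s" "u + s"] by simp
  from LIMSEQ_unique[OF this lim] show ?thesis .
qed

lemma stationary_mean:
  fixes f :: "real \<Rightarrow> real"
  assumes "continuous_on UNIV f" "\<And>x. \<bar>f x\<bar> \<le> c"
  shows "(\<integral>\<omega>. f (X t \<omega>) \<partial>M) = (\<integral>\<omega>. f (X u \<omega>) \<partial>M)"
  using stationary[of f c "\<lambda>_. 1" 1 u "t - u" 0, OF assms] by simp

context
  fixes f :: "real \<Rightarrow> real" and c :: real
  assumes f_cont: "continuous_on UNIV f" and f_bound: "\<And>x. \<bar>f x\<bar> \<le> c"
begin

lemma f_measurable [measurable]: "f \<in> borel_measurable borel"
  using f_cont by (rule borel_measurable_continuous_onI)

lemma f_integrable: "integrable M (\<lambda>\<omega>. f (X t \<omega>))"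
  by (rule integrable_const_bound[where B = c]) (use f_bound in auto)

lemma f_prod_integrable: "integrable M (\<lambda>\<omega>. f (X s \<omega>) * f (X t \<omega>))"
proof (rule integrable_const_bound[where B = "c * c"])
  have "\<bar>f (X s \<omega>) * f (X t \<omega>)\<bar> \<le> c * c" for \<omega>
    unfolding abs_mult using order_trans[OF abs_ge_zero f_bound[of 0]] by (intro mult_mono f_bound) auto
  thus "AE \<omega> in M. norm (f (X s \<omega>) * f (X t \<omega>)) \<le> c * c" by simp
qed measurable

definition partial_sum :: "nat \<Rightarrow> 'a \<Rightarrow> real" where
  "partial_sum n \<omega> = (\<Sum>t=1..n. f (X (int t) \<omega>) - (\<integral>\<omega>'. f (X 1 \<omega>') \<partial>M))"

lemma partial_sum_measurable [measurable]: "partial_sum n \<in> borel_measurable M"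
  unfolding partial_sum_def by measurable

lemma partial_sum_mean: "(\<integral>\<omega>. partial_sum n \<omega> \<partial>M) = 0"
proof -
  have "(\<integral>\<omega>. f (X (int t) \<omega>) \<partial>M) = (\<integral>\<omega>'. f (X 1 \<omega>') \<partial>M)" for t
    by (rule stationary_mean[OF f_cont f_bound])
  hence "(\<integral>\<omega>. f (X (int t) \<omega>) - (\<integral>\<omega>'. f (X 1 \<omega>') \<partial>M) \<partial>M) = 0" for t
    using f_integrable[of "int t"] by (simp add: prob_space)
  thus ?thesis unfolding partial_sum_def using f_integrable by (subst Bochner_Integration.integral_sum) simp_all
qed

lemma cov_stationary: "cov M (\<lambda>\<omega>. f (X s \<omega>)) (\<lambda>\<omega>. f (X t \<omega>)) = cov M (\<lambda>\<omega>. f (X 0 \<omega>)) (\<lambda>\<omega>. f (X (t - s) \<omega>))"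
proof -
  define m where "m = (\<integral>\<omega>'. f (X 1 \<omega>') \<partial>M)"
  have m: "(\<integral>\<omega>. f (X t \<omega>) \<partial>M) = m" for t unfolding m_def by (rule stationary_mean[OF f_cont f_bound])
  have "cov M (\<lambda>\<omega>. f (X s \<omega>)) (\<lambda>\<omega>. f (X t \<omega>)) = (\<integral>\<omega>. f (X s \<omega>) * f (X t \<omega>) \<partial>M) - m * m" for s t
  proof -
    have "cov M (\<lambda>\<omega>. f (X s \<omega>)) (\<lambda>\<omega>. f (X t \<omega>))
        = (\<integral>\<omega>. f (X s \<omega>) * f (X t \<omega>) - m * f (X s \<omega>) - m * f (X t \<omega>) + m * m \<partial>M)"
      unfolding cov_def m by (simp add: algebra_simps)
    thus ?thesis using f_integrable f_prod_integrable m by (simp add: prob_space)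
  qed
  moreover have "(\<integral>\<omega>. f (X s \<omega>) * f (X t \<omega>) \<partial>M) = (\<integral>\<omega>. f (X 0 \<omega>) * f (X (t - s) \<omega>) \<partial>M)"
    using stationary[of f c f c 0 s "t - s", OF f_cont f_bound f_cont f_bound] by simp
  ultimately show ?thesis by simp
qed

lemma partial_sum_second_moment:
  "(\<integral>\<omega>. (partial_sum n \<omega>)\<^sup>2 \<partial>M) = (\<Sum>s=1..n. \<Sum>t=1..n. cov M (\<lambda>\<omega>. f (X 0 \<omega>)) (\<lambda>\<omega>. f (X (int t - int s) \<omega>)))"
proof -
  define m where "m = (\<integral>\<omega>'. f (X 1 \<omega>') \<partial>M)"
  have m: "(\<integral>\<omega>. f (X t \<omega>) \<partial>M) = m" for t unfolding m_def by (rule stationary_mean[OF f_cont f_bound])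
  have i: "integrable M (\<lambda>\<omega>. (f (X s \<omega>) - m) * (f (X t \<omega>) - m))" for s t
    using f_integrable f_prod_integrable by (simp add: algebra_simps)
  have "(\<integral>\<omega>. (partial_sum n \<omega>)\<^sup>2 \<partial>M)
      = (\<integral>\<omega>. (\<Sum>s=1..n. \<Sum>t=1..n. (f (X (int s) \<omega>) - m) * (f (X (int t) \<omega>) - m)) \<partial>M)"
    unfolding partial_sum_def m_def[symmetric] power2_eq_square sum_product ..
  also have "\<dots> = (\<Sum>s=1..n. \<Sum>t=1..n. \<integral>\<omega>. (f (X (int s) \<omega>) - m) * (f (X (int t) \<omega>) - m) \<partial>M)"
    using i by simp
  also have "\<dots> = (\<Sum>s=1..n. \<Sum>t=1..n. cov M (\<lambda>\<omega>. f (X (int s) \<omega>)) (\<lambda>\<omega>. f (X (int t) \<omega>)))"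
    unfolding cov_def m ..
  finally show ?thesis unfolding cov_stationary[of "int _"] .
qed

text \<open>
  The second moment is the sum over \<open>s\<close> of \<open>\<Sum>t. cov (f X\<^sub>0, f X\<^sub>t\<^sub>-\<^sub>s)\<close>. For all but a bounded
  number of \<open>s\<close> the inner sum covers a finite set of lags outside which the covariances
  sum to at most half of the long-run variance; the remaining inner sums are bounded.
\<close>
lemma variance_lower_bound:
  assumes lrv: "(\<Sum>\<^sub>\<infinity>j\<in>UNIV. cov M (\<lambda>\<omega>. f (X 0 \<omega>)) (\<lambda>\<omega>. f (X j \<omega>))) > 0"
  obtains v0 n0 where "v0 > 0" "\<And>n. n \<ge> n0 \<Longrightarrow> v0 * real n \<le> (\<integral>\<omega>. (partial_sum n \<omega>)\<^sup>2 \<partial>M)"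
proof -
  define r where "r = (\<lambda>j. cov M (\<lambda>\<omega>. f (X 0 \<omega>)) (\<lambda>\<omega>. f (X j \<omega>)))"
  define w where "w = infsum r UNIV"
  have w: "w > 0" using lrv by (simp add: w_def r_def)
  \<comment> \<open>a positive sum is not the default value \<open>0\<close>\<close>
  have sm: "r summable_on UNIV" using w unfolding w_def by (metis infsum_not_exists less_irrefl)
  hence abs: "(\<lambda>j. \<bar>r j\<bar>) summable_on UNIV" using summable_on_iff_abs_summable_on_real[of r UNIV] by simp
  define a where "a = infsum (\<lambda>j. \<bar>r j\<bar>) UNIV"
  have "(r has_sum w) UNIV" unfolding w_def using sm by simp
  hence "(sum r \<longlongrightarrow> w) (finite_subsets_at_top UNIV)" by (simp add: has_sum_def)
  hence "\<forall>\<^sub>F F in finite_subsets_at_top UNIV. dist (sum r F) w < w / 2"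
    using w by (intro tendstoD) auto
  then obtain F0 where F0: "finite F0" "\<And>F. finite F \<Longrightarrow> F0 \<subseteq> F \<Longrightarrow> dist (sum r F) w < w / 2"
    unfolding eventually_finite_subsets_at_top by auto
  obtain L :: nat where L: "\<And>j. j \<in> F0 \<Longrightarrow> \<bar>j\<bar> \<le> int L"
  proof -
    define L where "L = nat (Max (insert 0 (abs ` F0)))"
    have "\<bar>j\<bar> \<le> int L" if "j \<in> F0" for j
    proof -
      have "\<bar>j\<bar> \<le> Max (insert 0 (abs ` F0))" using that F0 by (intro Max_ge) auto
      moreover have "0 \<le> Max (insert 0 (abs ` F0))" using F0 by (intro Max_ge) auto
      ultimately show ?thesis by (simp add: L_def)
    qed
    thus ?thesis by (rule that)
  qed
  have a_ge: "\<bar>sum r F\<bar> \<le> a" if "finite F" for F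
  proof -
    have "\<bar>sum r F\<bar> \<le> (\<Sum>j\<in>F. \<bar>r j\<bar>)" by (rule sum_abs)
    also have "\<dots> \<le> a" unfolding a_def using abs that by (intro finite_sum_le_infsum) auto
    finally show ?thesis .
  qed
  have a0: "0 \<le> a" using a_ge[of "{}"] by simp
  define row where "row = (\<lambda>n s. \<Sum>t=1..n. r (int t - int s))"
  have row: "row n s = sum r ((\<lambda>t. int t - int s) ` {1..n})" for n s
    unfolding row_def by (subst sum.reindex) (auto simp: inj_on_def)
  have row_all: "row n s \<ge> - a" for n s using a_ge[of "(\<lambda>t. int t - int s) ` {1..n}"] unfolding row by simp
  have row_mid: "row n s \<ge> w / 2" if "L < s" "s + L \<le> n" for n s
  proof -
    have "F0 \<subseteq> (\<lambda>t. int t - int s) ` {1..n}"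
    proof
      fix j assume "j \<in> F0"
      hence "\<bar>j\<bar> \<le> int L" by (rule L)
      hence "nat (j + int s) \<in> {1..n}" "j = int (nat (j + int s)) - int s" using that by auto
      thus "j \<in> (\<lambda>t. int t - int s) ` {1..n}" by blast
    qed
    hence "dist (row n s) w < w / 2" unfolding row by (intro F0) auto
    thus ?thesis unfolding dist_real_def by linarith
  qed
  have bound: "(\<integral>\<omega>. (partial_sum n \<omega>)\<^sup>2 \<partial>M) \<ge> (real n - 2 * real L) * (w / 2) - 2 * real L * a" if n: "n \<ge> 2 * L" for n
  proof -
    let ?A = "{L + 1..n - L}"
    have A: "?A \<subseteq> {1..n}" by auto
    have "(\<integral>\<omega>. (partial_sum n \<omega>)\<^sup>2 \<partial>M) = (\<Sum>s=1..n. row n s)"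
      unfolding partial_sum_second_moment row_def r_def ..
    also have "\<dots> = (\<Sum>s\<in>{1..n} - ?A. row n s) + (\<Sum>s\<in>?A. row n s)" by (rule sum.subset_diff[OF A]) simp
    also have "\<dots> \<ge> (\<Sum>s\<in>{1..n} - ?A. - a) + (\<Sum>s\<in>?A. w / 2)"
      using n by (intro add_mono sum_mono row_all row_mid) auto
    also have "(\<Sum>s\<in>{1..n} - ?A. - a) + (\<Sum>s\<in>?A. w / 2) = (real n - 2 * real L) * (w / 2) - 2 * real L * a"
    proof -
      have "card ?A = n - 2 * L" "card ({1..n} - ?A) = 2 * L"
        using n A by (simp_all add: card_Diff_subset)
      thus ?thesis using n by (simp add: of_nat_diff)
    qed
    finally show ?thesis .
  qed
  define n0 where "n0 = nat \<lceil>4 * (real L * w + 2 * real L * a) / w\<rceil> + 2 * L"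
  have "w / 4 * real n \<le> (\<integral>\<omega>. (partial_sum n \<omega>)\<^sup>2 \<partial>M)" if n: "n \<ge> n0" for n
  proof -
    have "4 * (real L * w + 2 * real L * a) / w \<le> real n" using n unfolding n0_def by linarith
    hence "real L * w + 2 * real L * a \<le> w / 4 * real n" using w by (simp add: field_simps)
    moreover have "n \<ge> 2 * L" using n by (simp add: n0_def)
    ultimately show ?thesis using bound[of n] by (simp add: algebra_simps)
  qed
  thus ?thesis using that[of "w / 4" n0] w by simp
qed

definition trunc_mean :: "nat \<Rightarrow> real" where
  "trunc_mean m = (\<integral>\<omega>. f (trunc m 1 (\<lambda>i. \<epsilon> i \<omega>)) \<partial>M)"

definition trunc_sum :: "nat \<Rightarrow> nat \<Rightarrow> (int \<Rightarrow> real) \<Rightarrow> real" where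
  "trunc_sum m n x = (\<Sum>t=1..n. f (trunc m (int t) x) - trunc_mean m)"

lemma trunc_sum_measurable [measurable]:
  "trunc_sum m n \<in> borel_measurable (Pi\<^sub>M UNIV (\<lambda>_. borel))"
  "(\<lambda>\<omega>. trunc_sum m n (\<lambda>i. \<epsilon> i \<omega>)) \<in> borel_measurable M"
  unfolding trunc_sum_def by measurable

lemma trunc_mean_bound: "\<bar>trunc_mean m\<bar> \<le> c"
proof -
  have i: "integrable M (\<lambda>\<omega>. f (trunc m 1 (\<lambda>i. \<epsilon> i \<omega>)))"
    by (rule integrable_const_bound[where B = c]) (use f_bound in auto)
  have "\<bar>trunc_mean m\<bar> \<le> (\<integral>\<omega>. \<bar>f (trunc m 1 (\<lambda>i. \<epsilon> i \<omega>))\<bar> \<partial>M)"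
    unfolding trunc_mean_def by (rule integral_abs_bound)
  also have "\<dots> \<le> (\<integral>\<omega>. c \<partial>M)" by (rule integral_mono) (use i f_bound in auto)
  finally show ?thesis by (simp add: prob_space)
qed

lemma trunc_sum_bound: "\<bar>trunc_sum m n x\<bar> \<le> 2 * c * real n"
proof -
  have "\<bar>trunc_sum m n x\<bar> \<le> (\<Sum>t=1..n. \<bar>f (trunc m (int t) x) - trunc_mean m\<bar>)"
    unfolding trunc_sum_def by (rule sum_abs)
  also have "\<dots> \<le> (\<Sum>t=1..n. 2 * c)"
  proof (rule sum_mono)
    fix t show "\<bar>f (trunc m (int t) x) - trunc_mean m\<bar> \<le> 2 * c"
      using f_bound[of "trunc m (int t) x"] trunc_mean_bound[of m] by linarith
  qed
  finally show ?thesis by (simp add: mult.commute)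
qed

lemma trunc_sum_mean: "(\<integral>\<omega>. trunc_sum m n (\<lambda>i. \<epsilon> i \<omega>) \<partial>M) = 0"
proof -
  have i: "integrable M (\<lambda>\<omega>. f (trunc m t (\<lambda>i. \<epsilon> i \<omega>)))" for t
    by (rule integrable_const_bound[where B = c]) (use f_bound in auto)
  have "(\<integral>\<omega>. f (trunc m t (\<lambda>i. \<epsilon> i \<omega>)) \<partial>M) = trunc_mean m" for t
  proof -
    have "(\<integral>\<omega>. f (trunc m 1 (\<lambda>i. \<epsilon> (i + (t - 1)) \<omega>)) \<partial>M) = trunc_mean m"
      unfolding trunc_mean_def by (rule shift_integral) measurable
    thus ?thesis by (simp add: trunc_shift[of m _ "\<lambda>i. \<epsilon> i _"])
  qed
  thus ?thesis unfolding trunc_sum_def using i by (simp add: prob_space)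
qed

lemma trunc_sum_tendsto: "AE \<omega> in M. (\<lambda>m. trunc_sum m n (\<lambda>i. \<epsilon> i \<omega>)) \<longlonglongrightarrow> partial_sum n \<omega>"
proof -
  have fc: "isCont f x" for x using f_cont by (auto simp: continuous_on_eq_continuous_at)
  have lim: "AE \<omega> in M. \<forall>t. (\<lambda>m. f (trunc m t (\<lambda>i. \<epsilon> i \<omega>))) \<longlonglongrightarrow> f (X t \<omega>)"
    using trunc_tendsto
  proof eventually_elim
    case (elim \<omega>)
    thus ?case using isCont_tendsto_compose[OF fc] by blast
  qed
  have mean: "trunc_mean \<longlonglongrightarrow> (\<integral>\<omega>. f (X 1 \<omega>) \<partial>M)"
    unfolding trunc_mean_def[abs_def]
    by (intro bounded_limit[where c = c]) (use lim in \<open>auto simp: f_bound elim: eventually_mono\<close>)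
  from lim show ?thesis
  proof eventually_elim
    case (elim \<omega>)
    thus ?case unfolding trunc_sum_def partial_sum_def by (intro tendsto_intros mean) auto
  qed
qed

lemma trunc_second_moment_tendsto:
  "(\<lambda>m. \<integral>\<omega>. (trunc_sum m n (\<lambda>i. \<epsilon> i \<omega>))\<^sup>2 \<partial>M) \<longlonglongrightarrow> (\<integral>\<omega>. (partial_sum n \<omega>)\<^sup>2 \<partial>M)"
proof (rule bounded_limit[where c = "(2 * c * real n)\<^sup>2"])
  show "\<bar>(trunc_sum m n (\<lambda>i. \<epsilon> i \<omega>))\<^sup>2\<bar> \<le> (2 * c * real n)\<^sup>2" for m \<omega>
    using power_mono[OF trunc_sum_bound abs_ge_zero, of m n "\<lambda>i. \<epsilon> i \<omega>" 2] by simp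
  show "AE \<omega> in M. (\<lambda>m. (trunc_sum m n (\<lambda>i. \<epsilon> i \<omega>))\<^sup>2) \<longlonglongrightarrow> (partial_sum n \<omega>)\<^sup>2"
    using trunc_sum_tendsto by eventually_elim (rule tendsto_power)
qed measurable

end

end

section \<open>Normal approximation of the partial sums\<close>

text \<open>
  In this and the next lemma \<open>N\<close> is the square root of the number of summands, and the scale
  \<open>\<kappa>\<close> is at most \<open>k / N\<close>.
\<close>
lemma scaled_smooth_bound:
  fixes \<kappa> k A N e s l :: real
  assumes \<kappa>: "\<kappa> \<ge> 0" "\<kappa> * N \<le> k" and N: "N \<ge> 1" and e: "0 \<le> e" "e \<le> s" and l: "1 / N \<le> l"
  shows "78 * (2 * \<kappa>\<^sup>2 * A\<^sup>2 * N + \<kappa>\<^sup>2 * N\<^sup>2 * (e + \<kappa> * A\<^sup>2)) \<le> 78 * k\<^sup>2 * (2 * A\<^sup>2 * l + (s + k * A\<^sup>2 * l))"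
proof -
  have k: "0 \<le> k" using \<kappa> N mult_nonneg_nonneg[of \<kappa> N] by linarith
  have l0: "0 \<le> l" using l N order_trans[of 0 "1 / N" l] by simp
  have "(\<kappa> * N)\<^sup>2 \<le> k\<^sup>2" using \<kappa> N by (intro power_mono mult_nonneg_nonneg) auto
  hence sq: "\<kappa>\<^sup>2 * N\<^sup>2 \<le> k\<^sup>2" by (simp add: power_mult_distrib)
  have "\<kappa> = \<kappa> * N * (1 / N)" using N by simp
  also have "\<dots> \<le> k * l" using \<kappa> N l k by (intro mult_mono) auto
  finally have \<kappa>l: "\<kappa> \<le> k * l" .
  have "\<kappa>\<^sup>2 * N = \<kappa>\<^sup>2 * N\<^sup>2 * (1 / N)" using N by (simp add: power2_eq_square)
  also have "\<dots> \<le> k\<^sup>2 * l" using sq l N by (intro mult_mono) auto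
  finally have a: "\<kappa>\<^sup>2 * N \<le> k\<^sup>2 * l" .
  have "e + \<kappa> * A\<^sup>2 \<le> s + k * l * A\<^sup>2" using e \<kappa>l by (intro add_mono mult_right_mono) auto
  hence "\<kappa>\<^sup>2 * N\<^sup>2 * (e + \<kappa> * A\<^sup>2) \<le> k\<^sup>2 * (s + k * l * A\<^sup>2)" using sq e \<kappa> by (intro mult_mono) auto
  moreover have "2 * A\<^sup>2 * (\<kappa>\<^sup>2 * N) \<le> 2 * A\<^sup>2 * (k\<^sup>2 * l)" by (intro mult_left_mono a) auto
  ultimately show ?thesis by (simp add: algebra_simps)
qed

lemma scaled_halfline_bound:
  fixes \<kappa> k A N e t a b q x :: real
  assumes \<kappa>: "\<kappa> \<ge> 0" "\<kappa> * N \<le> k" and N: "N \<ge> 1" and A: "A \<ge> 0" and e: "0 \<le> e" "e \<le> q * x" and q: "q \<ge> 0" and x: "x \<ge> 0"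
    and t: "0 \<le> t" "t \<le> a * b" and a: "a \<ge> 0" and b: "b \<ge> 0"
  shows "3 * sqrt (\<kappa> ^ 4 * N\<^sup>2 * (8 * e + 32 * A * (2 * e + A\<^sup>2))) + 4 * (\<kappa>\<^sup>2 * N\<^sup>2 * t)
    \<le> (3 * k\<^sup>2 * sqrt ((8 + 64 * A) * q + 32 * A ^ 3) + 4 * k\<^sup>2 * a) * (sqrt ((1 + x) / N\<^sup>2) + b)"
proof -
  let ?D = "(8 + 64 * A) * q + 32 * A ^ 3"
  have D: "0 \<le> ?D" using A q by simp
  have "(\<kappa> * N)\<^sup>2 \<le> k\<^sup>2" using \<kappa> N by (intro power_mono mult_nonneg_nonneg) auto
  hence sq: "\<kappa>\<^sup>2 * N\<^sup>2 \<le> k\<^sup>2" by (simp add: power_mult_distrib)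
  have "8 * e + 32 * A * (2 * e + A\<^sup>2) = (8 + 64 * A) * e + 32 * A ^ 3"
    by (simp add: algebra_simps power2_eq_square power3_eq_cube)
  also have "\<dots> \<le> (8 + 64 * A) * (q * x) + 32 * A ^ 3" using e A by (intro add_right_mono mult_left_mono) auto
  also have "\<dots> \<le> (8 + 64 * A) * (q * x) + 32 * A ^ 3 + ((8 + 64 * A) * q + 32 * A ^ 3 * x)"
    using A q x by simp
  also have "\<dots> = ?D * (1 + x)" by (simp add: algebra_simps)
  finally have m: "8 * e + 32 * A * (2 * e + A\<^sup>2) \<le> ?D * (1 + x)" .
  have p: "\<kappa> ^ 4 * N\<^sup>2 = (\<kappa>\<^sup>2 * N\<^sup>2)\<^sup>2 / N\<^sup>2"
    using N by (simp add: power2_eq_square power4_eq_xxxx)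
  have "\<kappa> ^ 4 * N\<^sup>2 * (8 * e + 32 * A * (2 * e + A\<^sup>2)) \<le> ((k\<^sup>2)\<^sup>2 / N\<^sup>2) * (?D * (1 + x))"
    unfolding p using sq m e A by (intro mult_mono divide_right_mono power_mono) auto
  hence "sqrt (\<kappa> ^ 4 * N\<^sup>2 * (8 * e + 32 * A * (2 * e + A\<^sup>2))) \<le> sqrt ((k\<^sup>2)\<^sup>2 * (?D * ((1 + x) / N\<^sup>2)))"
    by (intro real_sqrt_le_mono) simp
  also have "\<dots> = k\<^sup>2 * sqrt ?D * sqrt ((1 + x) / N\<^sup>2)" by (simp only: real_sqrt_mult real_sqrt_abs abs_power2 mult.assoc)
  finally have 1: "3 * sqrt (\<kappa> ^ 4 * N\<^sup>2 * (8 * e + 32 * A * (2 * e + A\<^sup>2))) \<le> 3 * k\<^sup>2 * sqrt ?D * sqrt ((1 + x) / N\<^sup>2)" by simp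
  have 2: "4 * (\<kappa>\<^sup>2 * N\<^sup>2 * t) \<le> 4 * (k\<^sup>2 * (a * b))" using sq t by (intro mult_left_mono mult_mono) auto
  define S where "S = sqrt ((1 + x) / N\<^sup>2)"
  have S: "0 \<le> S" unfolding S_def using x by simp
  have "0 \<le> 3 * k\<^sup>2 * sqrt ?D * b" "0 \<le> 4 * k\<^sup>2 * a * S" using D a b S by simp_all
  moreover have "(3 * k\<^sup>2 * sqrt ?D + 4 * k\<^sup>2 * a) * (S + b)
      = 3 * k\<^sup>2 * sqrt ?D * S + 3 * k\<^sup>2 * sqrt ?D * b + (4 * k\<^sup>2 * a * S + 4 * (k\<^sup>2 * (a * b)))"
    unfolding distrib_left distrib_right by simp
  ultimately show ?thesis using 1 2 unfolding S_def[symmetric] by linarith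
qed

text \<open>
  Increments by less than \<open>1\<close> are estimated by the mean value theorem, applied once for each
  increment; larger ones by the bounds for the functions themselves.
\<close>
lemma C_b2_increments:
  assumes "f \<in> C_b2"
  obtains c where "c > 0" "continuous_on UNIV f" "\<And>x. \<bar>f x\<bar> \<le> c"
    "\<And>u p. \<bar>f u - f (u + p)\<bar> \<le> c * min 1 \<bar>p\<bar>"
    "\<And>u p q. \<bar>f u - f (u + p) - (f (u + q) - f (u + q + p))\<bar> \<le> c * (min 1 \<bar>p\<bar> * min 1 \<bar>q\<bar>)"
proof -
  from assms obtain f' f'' where bf: "bounded (range f)" and f': "\<And>x. (f has_real_derivative f' x) (at x)"
    and f'': "\<And>x. (f' has_real_derivative f'' x) (at x)" and bf': "bounded (range f')" and bf'': "bounded (range f'')"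
    unfolding C_b2_def by blast
  obtain F0 F1 F2 where F: "\<And>x. \<bar>f x\<bar> \<le> F0" "\<And>x. \<bar>f' x\<bar> \<le> F1" "\<And>x. \<bar>f'' x\<bar> \<le> F2"
    using bf bf' bf'' unfolding bounded_iff by (auto simp: image_iff)
  have F_nonneg: "0 \<le> F0" "0 \<le> F1" "0 \<le> F2" using F[of 0] by linarith+
  have mvt: "\<bar>g b - g a\<bar> \<le> K * \<bar>b - a\<bar>"
    if g: "\<And>x. (g has_real_derivative g' x) (at x)" and K: "\<And>x. \<bar>g' x\<bar> \<le> K" for g g' :: "real \<Rightarrow> real" and a b K
  proof -
    have *: "\<bar>g y - g x\<bar> \<le> K * (y - x)" if xy: "x < y" for x y :: real
    proof -
      obtain t where t: "g y - g x = (y - x) * g' t" using MVT2[OF xy, of g g'] g by blast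
      have "(y - x) * \<bar>g' t\<bar> \<le> (y - x) * K" using xy K by (intro mult_left_mono) auto
      thus ?thesis unfolding t using xy by (simp add: abs_mult mult.commute)
    qed
    show ?thesis using *[of a b] *[of b a] by (cases a b rule: linorder_cases) (auto simp: abs_minus_commute)
  qed
  define c where "c = 4 * F0 + 2 * F1 + F2 + 1"
  have c: "4 * F0 \<le> c" "2 * F1 \<le> c" "F2 \<le> c" "c > 0" "F0 \<le> c" "F1 \<le> c" "2 * F0 \<le> c" using F_nonneg by (simp_all add: c_def)
  have first: "\<bar>f u - f (u + p)\<bar> \<le> c * min 1 \<bar>p\<bar>" for u p
  proof (cases "\<bar>p\<bar> \<le> 1")
    case True
    have "\<bar>f u - f (u + p)\<bar> \<le> F1 * \<bar>p\<bar>" using mvt[OF f' F(2), of "u + p" u] by simp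
    also have "\<dots> \<le> c * \<bar>p\<bar>" using c by (intro mult_right_mono) auto
    finally show ?thesis using True by (simp add: min_absorb2)
  next
    case False
    thus ?thesis using F(1)[of u] F(1)[of "u + p"] c by (simp add: min_absorb1)
  qed
  have second: "\<bar>f u - f (u + p) - (f (u + q) - f (u + q + p))\<bar> \<le> c * (min 1 \<bar>p\<bar> * min 1 \<bar>q\<bar>)" for u p q
  proof -
    let ?d = "f u - f (u + p) - (f (u + q) - f (u + q + p))"
    have d1: "\<bar>f v - f (v + p)\<bar> \<le> F1 * \<bar>p\<bar>" for v using mvt[OF f' F(2), of "v + p" v] by simp
    have d2: "\<bar>f v - f (v + q)\<bar> \<le> F1 * \<bar>q\<bar>" for v using mvt[OF f' F(2), of "v + q" v] by simp
    consider "\<bar>p\<bar> \<le> 1" "\<bar>q\<bar> \<le> 1" | "\<bar>p\<bar> \<le> 1" "\<bar>q\<bar> > 1" | "\<bar>p\<bar> > 1" "\<bar>q\<bar> \<le> 1" | "\<bar>p\<bar> > 1" "\<bar>q\<bar> > 1" by linarith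
    thus ?thesis
    proof cases
      case 1
      have g: "((\<lambda>s. f s - f (s + p)) has_real_derivative f' x - f' (x + p)) (at x)" for x
      proof -
        have "((\<lambda>s. f (s + p)) has_real_derivative f' (x + p)) (at x)" using f'[of "x + p"] by (simp only: DERIV_shift)
        thus ?thesis by (intro DERIV_diff f')
      qed
      have "\<bar>f' x - f' (x + p)\<bar> \<le> F2 * \<bar>p\<bar>" for x using mvt[OF f'' F(3), of "x + p" x] by simp
      from mvt[OF g this, of "u + q" u] have "\<bar>?d\<bar> \<le> F2 * \<bar>p\<bar> * \<bar>q\<bar>" by (simp add: abs_minus_commute)
      also have "\<dots> \<le> c * \<bar>p\<bar> * \<bar>q\<bar>" using c by (intro mult_right_mono) auto
      finally show ?thesis using 1 by (simp add: min_absorb2 mult.assoc)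
    next
      case 2
      have "\<bar>?d\<bar> \<le> 2 * F1 * \<bar>p\<bar>" using d1[of u] d1[of "u + q"] by linarith
      also have "\<dots> \<le> c * \<bar>p\<bar>" using c by (intro mult_right_mono) auto
      finally show ?thesis using 2 by (simp add: min_absorb2 min_absorb1)
    next
      case 3
      have "\<bar>f (u + p) - f (u + q + p)\<bar> \<le> F1 * \<bar>q\<bar>" using d2[of "u + p"] by (simp add: add_ac)
      hence "\<bar>?d\<bar> \<le> 2 * F1 * \<bar>q\<bar>" using d2[of u] by linarith
      also have "\<dots> \<le> c * \<bar>q\<bar>" using c by (intro mult_right_mono) auto
      finally show ?thesis using 3 by (simp add: min_absorb2 min_absorb1)
    next
      case 4
      thus ?thesis using F(1)[of u] F(1)[of "u + p"] F(1)[of "u + q"] F(1)[of "u + q + p"] c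
        by (simp add: min_absorb1)
    qed
  qed
  have "continuous_on UNIV f" using f' by (intro DERIV_continuous_on) auto
  moreover have "\<bar>f x\<bar> \<le> c" for x using F(1)[of x] c by linarith
  ultimately show ?thesis using that[OF c(4)] first second by blast
qed

lemma min_ratio_le:
  fixes k R N :: real
  assumes "k \<ge> 0" "R \<ge> 0" "N > 0" "s \<le> k * (R / N)"
  shows "min 1 s \<le> (1 + k) * min 1 (R / N)"
proof -
  have "0 \<le> R / N" using assms by simp
  show ?thesis
  proof (cases "R / N \<le> 1")
    case True
    have "s \<le> (1 + k) * (R / N)" unfolding distrib_right using assms(4) \<open>0 \<le> R / N\<close> by linarith
    thus ?thesis unfolding min_absorb2[OF True] by (rule min.coboundedI2)
  next
    case False
    hence "min 1 (R / N) = 1" by (simp add: min_absorb1)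
    thus ?thesis using assms(1) min.cobounded1[of 1 s] by simp
  qed
qed

lemma (in moving_average) trunc_update:
  "trunc m t (x(j := a)) = trunc m t x + (if 0 \<le> t - j \<and> t - j < int m then b (nat (t - j)) else 0) * (a - x j)"
proof (cases "0 \<le> t - j \<and> t - j < int m")
  case True
  define k where "k = nat (t - j)"
  have k: "k \<in> {..<m}" "t - int k = j" using True by (auto simp: k_def)
  have split: "trunc m t y = b k * y j + (\<Sum>i\<in>{..<m} - {k}. b i * y (t - int i))" for y
    unfolding trunc_def by (subst sum.remove[OF _ k(1)]) (simp_all add: k(2))
  have "(\<Sum>i\<in>{..<m} - {k}. b i * (x(j := a)) (t - int i)) = (\<Sum>i\<in>{..<m} - {k}. b i * x (t - int i))"
    using k(2) by (intro sum.cong) auto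
  hence "trunc m t (x(j := a)) = trunc m t x + b k * (a - x j)"
    unfolding split[of "x(j := a)"] split[of x] fun_upd_same by (simp add: right_diff_distrib del: fun_upd_apply)
  thus ?thesis unfolding if_P[OF True] k_def .
next
  case False
  have "trunc m t (x(j := a)) = trunc m t x" unfolding trunc_def
  proof (intro sum.cong refl)
    fix i assume "i \<in> {..<m}"
    hence "t - int i \<noteq> j" using False by auto
    thus "b i * (x(j := a)) (t - int i) = b i * x (t - int i)" by simp
  qed
  thus ?thesis unfolding if_not_P[OF False] by (simp del: fun_upd_apply)
qed

text \<open>
  The partial sums of a truncated moving average are local functionals of the innovations.
  A jump of size \<open>u\<close> has a total effect of order \<open>R = 1 + u powr (1 / \<gamma>)\<close> with
  \<open>\<gamma> = 1 - d\<close>, and \<open>R\<close> has tails of order \<open>\<alpha> = \<gamma> * \<beta> > 2\<close>. Jumps with \<open>R \<le> sqrt n\<close> are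
  good. The constant depends neither on the number \<open>m\<close> of retained coefficients nor on \<open>n\<close>.
\<close>
lemma (in moving_average) uniform_bounds:
  fixes f :: "real \<Rightarrow> real" and c K K\<^sub>b K2 \<beta> d :: real
  assumes f_cont: "continuous_on UNIV f" and f_bound: "\<And>x. \<bar>f x\<bar> \<le> c" and c: "c > 0"
    and f_first: "\<And>u p. \<bar>f u - f (u + p)\<bar> \<le> c * min 1 \<bar>p\<bar>"
    and f_second: "\<And>u p q. \<bar>f u - f (u + p) - (f (u + q) - f (u + q + p))\<bar> \<le> c * (min 1 \<bar>p\<bar> * min 1 \<bar>q\<bar>)"
    and tail: "K \<ge> 0" "\<And>u. u > 0 \<Longrightarrow> measure \<mu> {x. u \<le> \<bar>x\<bar>} \<le> K * u powr (- \<beta>)"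
    and decay: "K\<^sub>b > 0" "\<And>n. \<bar>b n\<bar> \<le> K\<^sub>b * (real n + 1) powr (- (1 - d))"
    and \<beta>: "0 < \<beta>" "\<beta> < 2" and d: "d < 1 - 2 / \<beta>" and K2: "K2 > 0"
  obtains C where "C > 0"
    "\<And>n m \<rho> h h'. n \<ge> 1 \<Longrightarrow> 0 \<le> \<rho> \<Longrightarrow> \<rho> * sqrt (real n) \<le> K2 \<Longrightarrow>
       (\<integral>\<omega>. (\<rho> * trunc_sum f m n (\<lambda>i. \<epsilon> i \<omega>))\<^sup>2 \<partial>M) = 1 \<Longrightarrow> n \<ge> 2 \<or> d \<noteq> 1 - 3 / \<beta> \<Longrightarrow>
       1-lipschitz_on UNIV h \<Longrightarrow> (\<And>x. (h has_real_derivative h' x) (at x)) \<Longrightarrow>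
       \<bar>(\<integral>\<omega>. h (\<rho> * trunc_sum f m n (\<lambda>i. \<epsilon> i \<omega>)) \<partial>M) - std_normal_mean h\<bar>
         \<le> C * wasserstein_rate \<beta> d n"
    "\<And>n m \<rho> x. n \<ge> 1 \<Longrightarrow> 0 \<le> \<rho> \<Longrightarrow> \<rho> * sqrt (real n) \<le> K2 \<Longrightarrow>
       (\<integral>\<omega>. (\<rho> * trunc_sum f m n (\<lambda>i. \<epsilon> i \<omega>))\<^sup>2 \<partial>M) = 1 \<Longrightarrow> n \<ge> 2 \<or> d \<noteq> 1 - 4 / \<beta> \<Longrightarrow>
       \<bar>(\<integral>\<omega>. indicator {..x} (\<rho> * trunc_sum f m n (\<lambda>i. \<epsilon> i \<omega>)) \<partial>M) - std_normal_cdf x\<bar>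
         \<le> C * kolmogorov_rate \<beta> d n"
proof -
  define \<gamma> where "\<gamma> = 1 - d"
  define \<alpha> where "\<alpha> = (1 - d) * \<beta>"
  have \<alpha>: "\<alpha> > 2" "\<alpha> = \<gamma> * \<beta>" using d \<beta> by (simp_all add: \<alpha>_def \<gamma>_def field_simps)
  have \<gamma>: "\<gamma> > 1"
  proof (rule ccontr)
    assume "\<not> \<gamma> > 1"
    hence "\<gamma> * \<beta> \<le> 1 * \<beta>" using \<beta> by (intro mult_right_mono) auto
    thus False using \<alpha> \<beta> by linarith
  qed
  let ?\<nu> = "\<mu> \<Otimes>\<^sub>M \<mu>"
  interpret mu: prob_space \<mu> by (rule prob_space_\<mu>)
  interpret pm: pair_prob_space \<mu> \<mu> ..
  define R where "R = (\<lambda>\<zeta>. 1 + jump_size \<zeta> powr (1 / \<gamma>))"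
  have R1: "1 \<le> R \<zeta>" for \<zeta> by (simp add: R_def)
  have Rm[measurable]: "R \<in> borel_measurable ?\<nu>" unfolding R_def jump_size_def by measurable
  have \<gamma>0: "\<gamma> > 0" using \<gamma> by linarith
  have R_fold: "1 + jump_size \<zeta> powr (1 / \<gamma>) = R \<zeta>" for \<zeta> by (simp add: R_def)
  obtain K' where K': "K' \<ge> 0" "\<And>s. s > 0 \<Longrightarrow> measure ?\<nu> {\<zeta> \<in> space ?\<nu>. s \<le> R \<zeta>} \<le> K' * s powr (- \<alpha>)"
    by (rule pair_tail[OF prob_space_\<mu> sets_\<mu> tail(2,1) \<beta>(1) \<gamma>0, unfolded R_fold \<alpha>(2)[symmetric]], assumption, rule that; blast)
  obtain C2 where C2: "C2 > 0" and R2int: "\<And>N. N \<ge> 1 \<Longrightarrow> integrable ?\<nu> (\<lambda>\<zeta>. (R \<zeta>)\<^sup>2 * indicator {\<zeta>. N < R \<zeta>} \<zeta>)"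
    and R2: "\<And>N. N \<ge> 1 \<Longrightarrow> (\<integral>\<zeta>. (R \<zeta>)\<^sup>2 * indicator {\<zeta>. N < R \<zeta>} \<zeta> \<partial>?\<nu>) \<le> C2 * N powr (2 - \<alpha>)"
    by (rule pm.P.tail_second_moment[OF Rm R1 K'(2,1) \<alpha>(1)], assumption, rule that; blast)
  obtain C3 where C3: "C3 > 0" and R3: "\<And>N. N \<ge> 1 \<Longrightarrow> (\<integral>\<zeta>. R \<zeta> ^ 3 * indicator {\<zeta>. R \<zeta> \<le> N} \<zeta> \<partial>?\<nu>)
      \<le> C3 * (if real 3 < \<alpha> then 1 else if real 3 = \<alpha> then 1 + ln N else N powr (real 3 - \<alpha>))"
    by (rule pm.P.truncated_moment[OF Rm R1 K'(2,1), where p = 3], assumption, rule that; blast)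
  obtain C4 where C4: "C4 > 0" and R4: "\<And>N. N \<ge> 1 \<Longrightarrow> (\<integral>\<zeta>. R \<zeta> ^ 4 * indicator {\<zeta>. R \<zeta> \<le> N} \<zeta> \<partial>?\<nu>)
      \<le> C4 * (if real 4 < \<alpha> then 1 else if real 4 = \<alpha> then 1 + ln N else N powr (real 4 - \<alpha>))"
    by (rule pm.P.truncated_moment[OF Rm R1 K'(2,1), where p = 4], assumption, rule that; blast)
  have trunc_int: "integrable ?\<nu> (\<lambda>\<zeta>. R \<zeta> ^ p * indicator {\<zeta>. R \<zeta> \<le> N} \<zeta>)" for p N
  proof (rule pm.P.integrable_const_bound[where B = "\<bar>N\<bar> ^ p"])
    show "AE \<zeta> in ?\<nu>. norm (R \<zeta> ^ p * indicator {\<zeta>. R \<zeta> \<le> N} \<zeta>) \<le> \<bar>N\<bar> ^ p"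
    proof (intro AE_I2)
      fix \<zeta> show "norm (R \<zeta> ^ p * indicator {\<zeta>. R \<zeta> \<le> N} \<zeta>) \<le> \<bar>N\<bar> ^ p"
        using R1[of \<zeta>] by (auto simp: indicator_def abs_mult intro!: power_mono)
    qed
  qed (unfold indicator_def, measurable)
  have Rsq: "integrable ?\<nu> (\<lambda>\<zeta>. (R \<zeta>)\<^sup>2)"
  proof -
    have "(R \<zeta>)\<^sup>2 = R \<zeta> ^ 2 * indicator {\<zeta>. R \<zeta> \<le> 1} \<zeta> + (R \<zeta>)\<^sup>2 * indicator {\<zeta>. 1 < R \<zeta>} \<zeta>" for \<zeta>
      by (auto simp: indicator_def)
    thus ?thesis using Bochner_Integration.integrable_add[OF trunc_int[of 2 1] R2int[of 1]] by simp
  qed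
  define bb where "bb = (\<lambda>k. if k \<ge> 0 then K\<^sub>b * (real_of_int k + 1) powr (- \<gamma>) else 0)"
  obtain C0' where C0': "C0' > 0" "\<And>D u. finite D \<Longrightarrow> u \<ge> 0 \<Longrightarrow> (\<Sum>k\<in>D. min 1 (bb k * u)) \<le> C0' * (1 + u powr (1 / \<gamma>))"
    by (rule sum_clip_le[OF \<gamma> decay(1), of bb]) (auto simp: bb_def)
  define C0 where "C0 = C0' + 1"
  have C0: "C0 \<ge> 1" using C0' by (simp add: C0_def)
  define Y where "Y = (\<lambda>\<zeta>. C0 * R \<zeta>)"
  have Ym[measurable]: "Y \<in> borel_measurable ?\<nu>" unfolding Y_def by measurable
  define A where "A = (\<integral>\<zeta>. (Y \<zeta>)\<^sup>2 \<partial>?\<nu>)"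
  have Ysq: "integrable ?\<nu> (\<lambda>\<zeta>. (Y \<zeta>)\<^sup>2)" unfolding Y_def power_mult_distrib using Rsq by simp
  have A0: "0 \<le> A" unfolding A_def by (intro Bochner_Integration.integral_nonneg) simp
  have Ysum: "(\<Sum>k\<in>D. min 1 (bb k * jump_size \<zeta>)) \<le> Y \<zeta>" if "finite D" for D \<zeta>
  proof -
    have "(\<Sum>k\<in>D. min 1 (bb k * jump_size \<zeta>)) \<le> C0' * R \<zeta>"
      unfolding R_def by (rule C0'(2)[OF that]) (simp add: jump_size_def)
    also have "\<dots> \<le> Y \<zeta>" unfolding Y_def C0_def using R1[of \<zeta>] by (intro mult_right_mono) auto
    finally show ?thesis .
  qed
  define k where "k = K2 * c"
  have k0: "k > 0" using K2 c by (simp add: k_def)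
  have LF: "local_functional \<mu> (\<lambda>x. \<rho> * trunc_sum f m n x) (1 - int m) (int n) {1..int n}
      (\<lambda>k. if 0 \<le> k \<and> k < int m then \<bar>b (nat k)\<bar> else 0) (\<rho> * c) (\<rho> * (2 * c * real n)) A Y"
    if \<rho>: "\<rho> \<ge> 0" for \<rho> m n
  proof -
    let ?W = "\<lambda>x. \<rho> * trunc_sum f m n x"
    let ?B = "\<lambda>k. if 0 \<le> k \<and> k < int m then \<bar>b (nat k)\<bar> else 0"
    let ?bt = "\<lambda>t j. if 0 \<le> t - j \<and> t - j < int m then b (nat (t - j)) else 0"
    have abs_bt: "\<bar>?bt t j\<bar> = ?B (t - j)" for t j by simp
    have Bbb: "?B k \<le> bb k" for k
      using decay(2)[of "nat k"] decay(1) by (auto simp: bb_def \<gamma>_def intro!: mult_nonneg_nonneg)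
    have reindex: "(\<Sum>t=1..n. g (int t)) = (\<Sum>t\<in>{1..int n}. g t)" for g :: "int \<Rightarrow> real"
      by (rule sum.reindex_bij_witness[of _ nat int]) auto
    have clip_sum: "(\<Sum>k\<in>D. clip (?B k) (jump_size \<zeta>)) \<le> Y \<zeta>" if "finite D" for D \<zeta>
    proof -
      have "clip (?B k) (jump_size \<zeta>) \<le> min 1 (bb k * jump_size \<zeta>)" for k
        unfolding clip_def by (intro min.mono mult_right_mono Bbb) (auto simp: jump_size_def)
      thus ?thesis using Ysum[OF that, of \<zeta>] by (meson order_trans sum_mono)
    qed
    show ?thesis
    proof (unfold_locales)
      show "sets \<mu> = sets borel" by (rule sets_\<mu>)
      show "?W \<in> borel_measurable (Pi\<^sub>M UNIV (\<lambda>_. borel))"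
        using trunc_sum_measurable(1)[OF f_cont f_bound] by measurable
      show "\<bar>?W x\<bar> \<le> \<rho> * (2 * c * real n)" for x
        using trunc_sum_bound[OF f_cont f_bound, of m n x] \<rho> by (simp add: abs_mult mult_left_mono)
      show "depends_on {1 - int m..int n} ?W" unfolding depends_on_def
      proof (intro allI impI)
        fix x x' :: "int \<Rightarrow> real" assume *: "\<forall>i\<in>{1 - int m..int n}. x i = x' i"
        have "trunc m (int t) x = trunc m (int t) x'" if "t \<in> {1..n}" for t
          unfolding trunc_def using * that by (intro sum.cong) auto
        thus "?W x = ?W x'" unfolding trunc_sum_def[OF f_cont f_bound] by simp
      qed
      show "finite {1..int n}" by simp
      show "0 \<le> ?B k" for k by simp
      show "0 \<le> \<rho> * c" using \<rho> c by simp
      show "\<bar>?W x - ?W (x(j := a))\<bar> \<le> \<rho> * c * (\<Sum>t\<in>{1..int n}. clip (?B (t - j)) \<bar>x j - a\<bar>)" for x j a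
      proof -
        have "\<bar>trunc_sum f m n x - trunc_sum f m n (x(j := a))\<bar>
            \<le> (\<Sum>t=1..n. \<bar>f (trunc m (int t) x) - f (trunc m (int t) (x(j := a)))\<bar>)"
          unfolding trunc_sum_def[OF f_cont f_bound] sum_subtractf[symmetric] by (rule order_trans[OF sum_abs]) simp
        also have "\<dots> \<le> (\<Sum>t=1..n. c * clip (?B (int t - j)) \<bar>x j - a\<bar>)"
        proof (rule sum_mono)
          fix t
          have "min 1 \<bar>?bt (int t) j * (a - x j)\<bar> = clip (?B (int t - j)) \<bar>x j - a\<bar>"
            unfolding abs_mult abs_bt clip_def by (simp only: abs_minus_commute)
          thus "\<bar>f (trunc m (int t) x) - f (trunc m (int t) (x(j := a)))\<bar> \<le> c * clip (?B (int t - j)) \<bar>x j - a\<bar>"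
            unfolding trunc_update using f_first[of "trunc m (int t) x" "?bt (int t) j * (a - x j)"] by (simp only:)
        qed
        also have "\<dots> = c * (\<Sum>t\<in>{1..int n}. clip (?B (t - j)) \<bar>x j - a\<bar>)"
          unfolding sum_distrib_left[symmetric] reindex[of "\<lambda>t. clip (?B (t - j)) \<bar>x j - a\<bar>"] ..
        finally have "\<rho> * \<bar>trunc_sum f m n x - trunc_sum f m n (x(j := a))\<bar> \<le> \<rho> * (c * (\<Sum>t\<in>{1..int n}. clip (?B (t - j)) \<bar>x j - a\<bar>))"
          using \<rho> by (intro mult_left_mono)
        thus ?thesis using \<rho> by (simp only: right_diff_distrib[symmetric] abs_mult abs_of_nonneg mult.assoc)
      qed
      show "\<bar>?W x - ?W (x(j := a)) - (?W (x(i := a')) - ?W (x(i := a', j := a)))\<bar>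
        \<le> \<rho> * c * (\<Sum>t\<in>{1..int n}. clip (?B (t - j)) \<bar>x j - a\<bar> * clip (?B (t - i)) \<bar>x i - a'\<bar>)"
        if ij: "i \<noteq> j" for i j x a a'
      proof -
        let ?s = "\<lambda>x. trunc_sum f m n x"
        let ?g = "\<lambda>t x. f (trunc m (int t) x)"
        have "\<bar>?s x - ?s (x(j := a)) - (?s (x(i := a')) - ?s (x(i := a', j := a)))\<bar>
            \<le> (\<Sum>t=1..n. \<bar>?g t x - ?g t (x(j := a)) - (?g t (x(i := a')) - ?g t (x(i := a', j := a)))\<bar>)"
          unfolding trunc_sum_def[OF f_cont f_bound] sum_subtractf[symmetric] by (rule order_trans[OF sum_abs]) simp
        also have "\<dots> \<le> (\<Sum>t=1..n. c * (clip (?B (int t - j)) \<bar>x j - a\<bar> * clip (?B (int t - i)) \<bar>x i - a'\<bar>))"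
        proof (rule sum_mono)
          fix t
          have m: "min 1 \<bar>?bt (int t) j * (a - x j)\<bar> = clip (?B (int t - j)) \<bar>x j - a\<bar>"
                  "min 1 \<bar>?bt (int t) i * (a' - x i)\<bar> = clip (?B (int t - i)) \<bar>x i - a'\<bar>"
            unfolding abs_mult abs_bt clip_def by (simp_all only: abs_minus_commute)
          have xj: "(x(i := a')) j = x j" using ij by simp
          show "\<bar>?g t x - ?g t (x(j := a)) - (?g t (x(i := a')) - ?g t (x(i := a', j := a)))\<bar>
              \<le> c * (clip (?B (int t - j)) \<bar>x j - a\<bar> * clip (?B (int t - i)) \<bar>x i - a'\<bar>)"
            unfolding trunc_update[where x = "x(i := a')"] xj
            unfolding trunc_update m[symmetric] by (rule f_second)
        qed
        also have "\<dots> = c * (\<Sum>t\<in>{1..int n}. clip (?B (t - j)) \<bar>x j - a\<bar> * clip (?B (t - i)) \<bar>x i - a'\<bar>)"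
          unfolding sum_distrib_left[symmetric] reindex[of "\<lambda>t. clip (?B (t - j)) \<bar>x j - a\<bar> * clip (?B (t - i)) \<bar>x i - a'\<bar>"] ..
        finally have "\<rho> * \<bar>?s x - ?s (x(j := a)) - (?s (x(i := a')) - ?s (x(i := a', j := a)))\<bar>
            \<le> \<rho> * (c * (\<Sum>t\<in>{1..int n}. clip (?B (t - j)) \<bar>x j - a\<bar> * clip (?B (t - i)) \<bar>x i - a'\<bar>))"
          using \<rho> by (intro mult_left_mono)
        thus ?thesis using \<rho> by (simp only: right_diff_distrib[symmetric] abs_mult abs_of_nonneg mult.assoc)
      qed
      show "Y \<in> borel_measurable ?\<nu>" by (rule Ym)
      show "1 \<le> Y \<zeta>" for \<zeta> unfolding Y_def using mult_mono[of 1 C0 1 "R \<zeta>"] C0 R1[of \<zeta>] by simp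
      show "(\<Sum>t\<in>{1..int n}. clip (?B (t - j)) (jump_size \<zeta>)) \<le> Y \<zeta>" for j \<zeta>
      proof -
        have "(\<Sum>t\<in>{1..int n}. clip (?B (t - j)) (jump_size \<zeta>)) = (\<Sum>k\<in>(\<lambda>t. t - j) ` {1..int n}. clip (?B k) (jump_size \<zeta>))"
          by (subst sum.reindex) (auto simp: inj_on_def)
        also have "\<dots> \<le> Y \<zeta>" by (rule clip_sum) simp
        finally show ?thesis .
      qed
      show "(\<Sum>j = 1 - int m..int n. clip (?B (t - j)) (jump_size \<zeta>)) \<le> Y \<zeta>" for t \<zeta>
      proof -
        have "(\<Sum>j = 1 - int m..int n. clip (?B (t - j)) (jump_size \<zeta>)) = (\<Sum>k\<in>(\<lambda>j. t - j) ` {1 - int m..int n}. clip (?B k) (jump_size \<zeta>))"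
          by (subst sum.reindex) (auto simp: inj_on_def)
        also have "\<dots> \<le> Y \<zeta>" by (rule clip_sum) simp
        finally show ?thesis .
      qed
      show "integrable ?\<nu> (\<lambda>\<zeta>. (Y \<zeta>)\<^sup>2)" by (rule Ysq)
      show "(\<integral>\<zeta>. (Y \<zeta>)\<^sup>2 \<partial>?\<nu>) \<le> A" by (simp add: A_def)
    qed
  qed
  define N where "N = (\<lambda>n. sqrt (real n))"
  have N: "N n \<ge> 1" "(N n)\<^sup>2 = real n" "1 / N n = real n powr (- 1 / 2)" if "n \<ge> 1" for n
  proof -
    show "N n \<ge> 1" "(N n)\<^sup>2 = real n" using that by (simp_all add: N_def)
    have "real n powr (- 1 / 2) = inverse (real n powr (1 / 2))" by (simp only: powr_minus[symmetric]) simp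
    also have "real n powr (1 / 2) = N n" unfolding N_def by (rule powr_half_sqrt) simp
    finally show "1 / N n = real n powr (- 1 / 2)" by (simp add: inverse_eq_divide)
  qed
  have N_fold: "sqrt (real n) = N n" for n by (simp add: N_def)
  have scaled: "\<rho> * c \<ge> 0" "\<rho> * c * N n \<le> k" if "0 \<le> \<rho>" "\<rho> * sqrt (real n) \<le> K2" for \<rho> n
    using that c mult_right_mono[OF that(2), of c] by (simp_all add: N_def k_def mult_ac)
  have moments: "(\<integral>z. H (\<rho> * trunc_sum f m n (\<lambda>i. fst (z i))) \<partial>Pi\<^sub>M UNIV (\<lambda>_::int. ?\<nu>))
      = (\<integral>\<omega>. H (\<rho> * trunc_sum f m n (\<lambda>i. \<epsilon> i \<omega>)) \<partial>M)"
    if [measurable]: "H \<in> borel_measurable borel" for H :: "real \<Rightarrow> real" and \<rho> m n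
  proof -
    have [measurable]: "trunc_sum f m n \<in> borel_measurable (Pi\<^sub>M UNIV (\<lambda>_. borel))"
      by (rule trunc_sum_measurable(1)[OF f_cont f_bound])
    show ?thesis by (rule doubled_integral[where H = "\<lambda>x. H (\<rho> * trunc_sum f m n x)"]) measurable
  qed
  have ident: "(\<lambda>u::real. u) \<in> borel_measurable borel" by measurable
  have centred: "(\<integral>\<omega>. \<rho> * trunc_sum f m n (\<lambda>i. \<epsilon> i \<omega>) \<partial>M) = 0" for \<rho> m n
    using trunc_sum_mean[OF f_cont f_bound, of m n] by simp
  define S where "S = (\<lambda>N. (\<integral>\<zeta>. R \<zeta> ^ 3 * indicator {\<zeta>. R \<zeta> \<le> N} \<zeta> \<partial>?\<nu>) / N + (\<integral>\<zeta>. (R \<zeta>)\<^sup>2 * indicator {\<zeta>. N < R \<zeta>} \<zeta> \<partial>?\<nu>))"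
  have third: "(\<integral>\<zeta>. (Y \<zeta>)\<^sup>2 * min 1 (\<kappa> * Y \<zeta>) \<partial>?\<nu>) \<le> C0\<^sup>2 * (1 + k * C0) * S N"
    if \<kappa>: "0 \<le> \<kappa>" "\<kappa> * N \<le> k" and N: "N \<ge> 1" for \<kappa> N
  proof -
    let ?u = "\<lambda>\<zeta>. R \<zeta> ^ 3 * indicator {\<zeta>. R \<zeta> \<le> N} \<zeta> / N + (R \<zeta>)\<^sup>2 * indicator {\<zeta>. N < R \<zeta>} \<zeta>"
    have iu: "integrable ?\<nu> ?u" using trunc_int[of 3 N] R2int[OF N] by simp
    have pw: "(Y \<zeta>)\<^sup>2 * min 1 (\<kappa> * Y \<zeta>) \<le> C0\<^sup>2 * (1 + k * C0) * ?u \<zeta>" for \<zeta>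
    proof -
      have "\<kappa> * Y \<zeta> = \<kappa> * N * (C0 * (R \<zeta> / N))" using N by (simp add: Y_def)
      also have "\<dots> \<le> k * (C0 * (R \<zeta> / N))" using \<kappa> N C0 R1[of \<zeta>] by (intro mult_right_mono) auto
      finally have "min 1 (\<kappa> * Y \<zeta>) \<le> (1 + k * C0) * min 1 (R \<zeta> / N)"
        using N R1[of \<zeta>] k0 C0 by (intro min_ratio_le) auto
      hence "(R \<zeta>)\<^sup>2 * min 1 (\<kappa> * Y \<zeta>) \<le> (R \<zeta>)\<^sup>2 * ((1 + k * C0) * min 1 (R \<zeta> / N))" by (intro mult_left_mono) auto
      also have "\<dots> = (1 + k * C0) * ((R \<zeta>)\<^sup>2 * min 1 (R \<zeta> / N))" by (rule mult.left_commute)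
      also have "(R \<zeta>)\<^sup>2 * min 1 (R \<zeta> / N) = ?u \<zeta>"
      proof (cases "R \<zeta> \<le> N")
        case True
        hence "min 1 (R \<zeta> / N) = R \<zeta> / N" using N by (intro min_absorb2) simp
        thus ?thesis using True by (simp add: power2_eq_square power3_eq_cube)
      next
        case False
        hence "min 1 (R \<zeta> / N) = 1" using N by (intro min_absorb1) simp
        thus ?thesis using False by simp
      qed
      finally have "C0\<^sup>2 * ((R \<zeta>)\<^sup>2 * min 1 (\<kappa> * Y \<zeta>)) \<le> C0\<^sup>2 * ((1 + k * C0) * ?u \<zeta>)" by (intro mult_left_mono) auto
      moreover have "(Y \<zeta>)\<^sup>2 * min 1 (\<kappa> * Y \<zeta>) = C0\<^sup>2 * ((R \<zeta>)\<^sup>2 * min 1 (\<kappa> * Y \<zeta>))" by (simp only: Y_def power_mult_distrib mult.assoc)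
      ultimately show ?thesis by (simp only: mult.assoc)
    qed
    have il: "integrable ?\<nu> (\<lambda>\<zeta>. (Y \<zeta>)\<^sup>2 * min 1 (\<kappa> * Y \<zeta>))"
    proof (rule Bochner_Integration.integrable_bound[OF Ysq])
      have "\<bar>min 1 (\<kappa> * Y \<zeta>)\<bar> \<le> 1" for \<zeta>
      proof -
        have "0 \<le> \<kappa> * Y \<zeta>" unfolding Y_def using \<kappa> C0 R1[of \<zeta>] by (intro mult_nonneg_nonneg) auto
        thus ?thesis by (simp add: min_def)
      qed
      hence "norm ((Y \<zeta>)\<^sup>2 * min 1 (\<kappa> * Y \<zeta>)) \<le> norm ((Y \<zeta>)\<^sup>2)" for \<zeta>
        using mult_left_mono[of "\<bar>min 1 (\<kappa> * Y \<zeta>)\<bar>" 1 "(Y \<zeta>)\<^sup>2"] by (simp add: abs_mult)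
      thus "AE \<zeta> in ?\<nu>. norm ((Y \<zeta>)\<^sup>2 * min 1 (\<kappa> * Y \<zeta>)) \<le> norm ((Y \<zeta>)\<^sup>2)" by simp
    qed measurable
    have "(\<integral>\<zeta>. (Y \<zeta>)\<^sup>2 * min 1 (\<kappa> * Y \<zeta>) \<partial>?\<nu>) \<le> (\<integral>\<zeta>. C0\<^sup>2 * (1 + k * C0) * ?u \<zeta> \<partial>?\<nu>)"
      by (rule integral_mono[OF il _ pw]) (intro integrable_mult_right iu)
    also have "\<dots> = C0\<^sup>2 * (1 + k * C0) * (\<integral>\<zeta>. ?u \<zeta> \<partial>?\<nu>)" by simp
    also have "(\<integral>\<zeta>. ?u \<zeta> \<partial>?\<nu>) = S N"
      unfolding S_def using trunc_int[of 3 N] R2int[OF N] by simp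
    finally show ?thesis .
  qed
  define L where "L = 1 / ln 2 + (1::real)"
  define L1 where "L1 = C3 * L + C2 / ln 2 + C2"
  define L3 where "L3 = sqrt (1 + C4) * L + C2 / ln 2 + C2"
  define D where "D = (8 + 64 * A) * C0 ^ 4 + 32 * A ^ 3"
  define CW where "CW = 78 * k\<^sup>2 * (2 * A\<^sup>2 * L + (C0\<^sup>2 * (1 + k * C0) * L1 + k * A\<^sup>2 * L))"
  define CK where "CK = (3 * k\<^sup>2 * sqrt D + 4 * k\<^sup>2 * C0\<^sup>2) * L3"
  have ln2: "0 < ln (2::real)" by simp
  have pos: "L \<ge> 1" "L1 > 0" "L3 > 0" "D \<ge> 0"
  proof -
    show "L \<ge> 1" using ln2 by (simp add: L_def)
    thus "L1 > 0" "L3 > 0" unfolding L1_def L3_def using C2 C3 C4 ln2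
      by (intro add_nonneg_pos add_nonneg_nonneg mult_nonneg_nonneg; simp)+
    show "D \<ge> 0" unfolding D_def using A0 C0 by simp
  qed
  have Cpos: "CW > 0" "CK > 0"
  proof -
    have "0 < C0\<^sup>2 * (1 + k * C0) * L1" using C0 k0 pos by (intro mult_pos_pos add_pos_pos) auto
    moreover have "0 \<le> 2 * A\<^sup>2 * L" "0 \<le> k * A\<^sup>2 * L" using k0 pos by simp_all
    ultimately have "0 < 2 * A\<^sup>2 * L + (C0\<^sup>2 * (1 + k * C0) * L1 + k * A\<^sup>2 * L)" by linarith
    moreover have "0 < 78 * k\<^sup>2" using k0 by simp
    ultimately show "CW > 0" unfolding CW_def by (rule mult_pos_pos[rotated])
    have "0 \<le> 3 * k\<^sup>2 * sqrt D" "0 < 4 * k\<^sup>2 * C0\<^sup>2" using k0 C0 pos by simp_all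
    hence "0 < 3 * k\<^sup>2 * sqrt D + 4 * k\<^sup>2 * C0\<^sup>2" by linarith
    thus "CK > 0" unfolding CK_def using pos(3) by (rule mult_pos_pos)
  qed
  show ?thesis
  proof (rule that[of "CW + CK"])
    show "CW + CK > 0" using Cpos by simp
  next
    fix n m :: nat and \<rho> :: real and h h' :: "real \<Rightarrow> real"
    assume n: "n \<ge> 1" and \<rho>: "0 \<le> \<rho>" "\<rho> * sqrt (real n) \<le> K2"
      and var: "(\<integral>\<omega>. (\<rho> * trunc_sum f m n (\<lambda>i. \<epsilon> i \<omega>))\<^sup>2 \<partial>M) = 1" and crit: "n \<ge> 2 \<or> d \<noteq> 1 - 3 / \<beta>"
      and h: "1-lipschitz_on UNIV h" "\<And>x. (h has_real_derivative h' x) (at x)"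
    interpret lf: local_functional \<mu> "\<lambda>x. \<rho> * trunc_sum f m n x" "1 - int m" "int n" "{1..int n}"
      "\<lambda>k. if 0 \<le> k \<and> k < int m then \<bar>b (nat k)\<bar> else 0" "\<rho> * c" "\<rho> * (2 * c * real n)" A Y by (rule LF[OF \<rho>(1)])
    let ?r = "wasserstein_rate \<beta> d n"
    have [measurable]: "h \<in> borel_measurable borel"
      using lipschitz_on_continuous_on[OF h(1)] by (rule borel_measurable_continuous_onI)
    note rb = wasserstein_rate_bound[OF \<beta>(1) \<alpha>_def \<alpha>(1) less_imp_le[OF C2] less_imp_le[OF C3] n crit, unfolded N_fold L_def[symmetric] L1_def[symmetric]]
    have s: "S (N n) \<le> L1 * ?r"
    proof -
      have "S (N n) \<le> C3 * (if real 3 < \<alpha> then 1 else if real 3 = \<alpha> then 1 + ln (N n) else N n powr (real 3 - \<alpha>)) / N n + C2 * N n powr (2 - \<alpha>)"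
        unfolding S_def using N(1)[OF n] by (intro add_mono divide_right_mono R3 R2) auto
      also have "\<dots> \<le> L1 * ?r" using rb(1) .
      finally show ?thesis .
    qed
    have cd: "real (card {1..int n}) = (N n)\<^sup>2" "sqrt (real (card {1..int n})) = N n" using N(2)[OF n] by (simp_all add: N_def)
    have e: "(\<integral>\<zeta>. (Y \<zeta>)\<^sup>2 * min 1 (\<rho> * c * Y \<zeta>) \<partial>?\<nu>) \<le> C0\<^sup>2 * (1 + k * C0) * (L1 * ?r)"
    proof -
      have "C0\<^sup>2 * (1 + k * C0) * S (N n) \<le> C0\<^sup>2 * (1 + k * C0) * (L1 * ?r)"
        using s k0 C0 by (intro mult_left_mono) auto
      thus ?thesis using third[OF scaled[OF \<rho>] N(1)[OF n]] by linarith
    qed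
    have e0: "0 \<le> (\<integral>\<zeta>. (Y \<zeta>)\<^sup>2 * min 1 (\<rho> * c * Y \<zeta>) \<partial>?\<nu>)"
    proof (intro Bochner_Integration.integral_nonneg mult_nonneg_nonneg)
      fix \<zeta>
      have "0 \<le> Y \<zeta>" using lf.Y_ge[of \<zeta>] by linarith
      thus "0 \<le> min 1 (\<rho> * c * Y \<zeta>)" by (intro min.boundedI mult_nonneg_nonneg[OF scaled(1)[OF \<rho>]]) auto
    qed simp
    have "\<bar>(\<integral>z. h (\<rho> * trunc_sum f m n (lf.first z)) \<partial>lf.P) - std_normal_mean h\<bar>
        \<le> 78 * (2 * (\<rho> * c)\<^sup>2 * A\<^sup>2 * sqrt (real (card {1..int n}))
          + (\<rho> * c)\<^sup>2 * real (card {1..int n}) * ((\<integral>\<zeta>. (Y \<zeta>)\<^sup>2 * min 1 (\<rho> * c * Y \<zeta>) \<partial>?\<nu>) + \<rho> * c * A\<^sup>2))"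
    proof (rule lf.normal_approx_smooth[OF h])
      show "(\<integral>z. \<rho> * trunc_sum f m n (lf.first z) \<partial>lf.P) = 0"
        unfolding lf.first_def using moments[OF ident, of \<rho> m n] unfolding centred .
      show "(\<integral>z. (\<rho> * trunc_sum f m n (lf.first z))\<^sup>2 \<partial>lf.P) = 1"
        unfolding lf.first_def using moments[of "\<lambda>u. u\<^sup>2" \<rho> m n] var by simp
    qed
    also have "\<dots> \<le> 78 * k\<^sup>2 * (2 * A\<^sup>2 * (L * ?r) + (C0\<^sup>2 * (1 + k * C0) * (L1 * ?r) + k * A\<^sup>2 * (L * ?r)))"
      unfolding cd(2) unfolding cd(1)
    proof (rule scaled_smooth_bound[OF scaled[OF \<rho>] N(1)[OF n] e0 e])
      show "1 / N n \<le> L * ?r" using rb(2) unfolding N(3)[OF n] .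
    qed
    also have "\<dots> = CW * ?r" unfolding CW_def by (simp only: distrib_right distrib_left mult.assoc)
    also have "\<dots> \<le> (CW + CK) * ?r"
      using Cpos n by (intro mult_right_mono) (auto simp: wasserstein_rate_def)
    finally show "\<bar>(\<integral>\<omega>. h (\<rho> * trunc_sum f m n (\<lambda>i. \<epsilon> i \<omega>)) \<partial>M) - std_normal_mean h\<bar> \<le> (CW + CK) * ?r"
      unfolding lf.first_def using moments[of h \<rho> m n] by simp
  next
    fix n m :: nat and \<rho> x :: real
    assume n: "n \<ge> 1" and \<rho>: "0 \<le> \<rho>" "\<rho> * sqrt (real n) \<le> K2"
      and var: "(\<integral>\<omega>. (\<rho> * trunc_sum f m n (\<lambda>i. \<epsilon> i \<omega>))\<^sup>2 \<partial>M) = 1" and crit: "n \<ge> 2 \<or> d \<noteq> 1 - 4 / \<beta>"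
    interpret lf: local_functional \<mu> "\<lambda>x. \<rho> * trunc_sum f m n x" "1 - int m" "int n" "{1..int n}"
      "\<lambda>k. if 0 \<le> k \<and> k < int m then \<bar>b (nat k)\<bar> else 0" "\<rho> * c" "\<rho> * (2 * c * real n)" A Y by (rule LF[OF \<rho>(1)])
    let ?r = "kolmogorov_rate \<beta> d n"
    define good where "good = (\<lambda>\<zeta>. R \<zeta> \<le> N n)"
    have gm: "Measurable.pred ?\<nu> good" unfolding good_def by measurable
    have Y4: "(Y \<zeta>) ^ 4 * of_bool (good \<zeta>) = C0 ^ 4 * (R \<zeta> ^ 4 * indicator {\<zeta>. R \<zeta> \<le> N n} \<zeta>)" for \<zeta>
      by (simp add: Y_def good_def power_mult_distrib indicator_def)
    have Y2: "(Y \<zeta>)\<^sup>2 * (1 - of_bool (good \<zeta>)) = C0\<^sup>2 * ((R \<zeta>)\<^sup>2 * indicator {\<zeta>. N n < R \<zeta>} \<zeta>)" for \<zeta>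
      by (auto simp: Y_def good_def power_mult_distrib indicator_def)
    have Y4i: "integrable ?\<nu> (\<lambda>\<zeta>. (Y \<zeta>) ^ 4 * of_bool (good \<zeta>))" unfolding Y4 using trunc_int by simp
    define e t where "e = (\<integral>\<zeta>. (Y \<zeta>) ^ 4 * of_bool (good \<zeta>) \<partial>?\<nu>)" and "t = (\<integral>\<zeta>. (Y \<zeta>)\<^sup>2 * (1 - of_bool (good \<zeta>)) \<partial>?\<nu>)"
    define g where "g = (if real 4 < \<alpha> then 1 else if real 4 = \<alpha> then 1 + ln (N n) else N n powr (real 4 - \<alpha>))"
    have g0: "0 \<le> g" using N(1)[OF n] by (simp add: g_def)
    have e0: "0 \<le> e" unfolding e_def by (intro Bochner_Integration.integral_nonneg) simp
    have t0: "0 \<le> t" unfolding t_def by (intro Bochner_Integration.integral_nonneg) simp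
    have e: "e \<le> C0 ^ 4 * (C4 * g)"
    proof -
      have "e = C0 ^ 4 * (\<integral>\<zeta>. R \<zeta> ^ 4 * indicator {\<zeta>. R \<zeta> \<le> N n} \<zeta> \<partial>?\<nu>)" unfolding e_def Y4 by simp
      also have "\<dots> \<le> C0 ^ 4 * (C4 * g)" unfolding g_def using C0 by (intro mult_left_mono R4 N n) auto
      finally show ?thesis .
    qed
    have t: "t \<le> C0\<^sup>2 * (C2 * N n powr (2 - \<alpha>))"
    proof -
      have "t = C0\<^sup>2 * (\<integral>\<zeta>. (R \<zeta>)\<^sup>2 * indicator {\<zeta>. N n < R \<zeta>} \<zeta> \<partial>?\<nu>)" unfolding t_def Y2 by simp
      also have "\<dots> \<le> C0\<^sup>2 * (C2 * N n powr (2 - \<alpha>))" using C0 by (intro mult_left_mono R2 N n) auto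
      finally show ?thesis .
    qed
    have cd: "real (card {1..int n}) = (N n)\<^sup>2" using N(2)[OF n] by (simp add: N_def)
    have swap: "good (snd \<zeta>, fst \<zeta>) = good \<zeta>" for \<zeta> by (simp add: good_def R_def jump_size_def add.commute)
    have ok: "lf.ok good \<zeta> = of_bool (good \<zeta>)" for \<zeta> by (rule lf.ok_def[OF gm Y4i])
    have E4: "lf.E4 good = e" unfolding lf.E4_def[OF gm Y4i] ok e_def ..
    have T: "(\<integral>\<zeta>. (Y \<zeta>)\<^sup>2 * (1 - lf.ok good \<zeta>) \<partial>?\<nu>) = t" unfolding ok t_def ..
    have "\<bar>(\<integral>z. indicator {..x} (\<rho> * trunc_sum f m n (lf.first z)) \<partial>lf.P) - std_normal_cdf x\<bar>
        \<le> 3 * sqrt ((\<rho> * c) ^ 4 * real (card {1..int n}) * (8 * e + 32 * A * (2 * e + A\<^sup>2)))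
          + 4 * ((\<rho> * c)\<^sup>2 * real (card {1..int n}) * t)"
      unfolding E4[symmetric] T[symmetric]
    proof (rule lf.normal_approx_halfline[where good = good])
      show "Measurable.pred ?\<nu> good" by (rule gm)
      show "integrable ?\<nu> (\<lambda>\<zeta>. (Y \<zeta>) ^ 4 * of_bool (good \<zeta>))" by (rule Y4i)
      show "good (snd \<zeta>, fst \<zeta>) = good \<zeta>" for \<zeta> by (rule swap)
      show "(\<integral>z. \<rho> * trunc_sum f m n (lf.first z) \<partial>lf.P) = 0"
        unfolding lf.first_def using moments[OF ident, of \<rho> m n] unfolding centred .
      show "(\<integral>z. (\<rho> * trunc_sum f m n (lf.first z))\<^sup>2 \<partial>lf.P) = 1"
        unfolding lf.first_def using moments[of "\<lambda>u. u\<^sup>2" \<rho> m n] var by simp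
    qed
    also have "\<dots> \<le> (3 * k\<^sup>2 * sqrt D + 4 * k\<^sup>2 * C0\<^sup>2) * (sqrt ((1 + C4 * g) / (N n)\<^sup>2) + C2 * N n powr (2 - \<alpha>))"
      unfolding cd D_def using C0 C4 C2 g0
      by (intro scaled_halfline_bound[OF scaled[OF \<rho>] N(1)[OF n]] A0 e e0 t t0) auto
    also have "\<dots> \<le> (3 * k\<^sup>2 * sqrt D + 4 * k\<^sup>2 * C0\<^sup>2) * (L3 * ?r)"
    proof (intro mult_left_mono)
      show "sqrt ((1 + C4 * g) / (N n)\<^sup>2) + C2 * N n powr (2 - \<alpha>) \<le> L3 * ?r"
        unfolding N(2)[OF n] g_def L3_def L_def
        using kolmogorov_rate_bound[OF \<beta>(1) \<alpha>_def \<alpha>(1) less_imp_le[OF C2] less_imp_le[OF C4] n crit, unfolded N_fold] .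
    qed (use pos k0 in simp)
    also have "\<dots> = CK * ?r" unfolding CK_def by (simp only: mult.assoc)
    also have "\<dots> \<le> (CW + CK) * ?r"
      using Cpos n by (intro mult_right_mono) (auto simp: kolmogorov_rate_def)
    finally show "\<bar>(\<integral>\<omega>. indicator {..x} (\<rho> * trunc_sum f m n (\<lambda>i. \<epsilon> i \<omega>)) \<partial>M) - std_normal_cdf x\<bar> \<le> (CW + CK) * ?r"
      unfolding lf.first_def using moments[of "indicator {..x}" \<rho> m n] by simp
  qed
qed

context prob_space begin

text \<open>
  The bound for differentiable functions passes to the limit by dominated convergence, and
  then to all Lipschitz functions by smoothing.
\<close>
lemma lipschitz_limit_bound:
  fixes W :: "'a \<Rightarrow> real" and Wm :: "nat \<Rightarrow> 'a \<Rightarrow> real" and h :: "real \<Rightarrow> real"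
  assumes [measurable]: "W \<in> borel_measurable M" "\<And>m. Wm m \<in> borel_measurable M"
    and bound: "\<And>m \<omega>. \<bar>Wm m \<omega>\<bar> \<le> B" "\<And>\<omega>. \<bar>W \<omega>\<bar> \<le> B"
    and lim: "AE \<omega> in M. (\<lambda>m. Wm m \<omega>) \<longlonglongrightarrow> W \<omega>"
    and smooth: "\<And>k k'. 1-lipschitz_on UNIV k \<Longrightarrow> (\<And>x. (k has_real_derivative k' x) (at x)) \<Longrightarrow>
      \<forall>\<^sub>F m in sequentially. \<bar>(\<integral>\<omega>. k (Wm m \<omega>) \<partial>M) - std_normal_mean k\<bar> \<le> e"
    and h: "1-lipschitz_on UNIV h"
  shows "\<bar>(\<integral>\<omega>. h (W \<omega>) \<partial>M) - std_normal_mean h\<bar> \<le> e"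
proof (rule field_le_epsilon)
  fix \<eta> :: real assume "\<eta> > 0"
  hence \<eta>: "\<eta> / 2 > 0" by simp
  obtain k k' where k: "1-lipschitz_on UNIV k" and k': "\<And>x. (k has_real_derivative k' x) (at x)"
    and kh: "\<And>x. \<bar>k x - h x\<bar> \<le> \<eta> / 2" by (rule lipschitz_smoothing[OF h \<eta>]) (rule that; blast)
  have cont: "continuous_on UNIV k" "continuous_on UNIV h" using k h lipschitz_on_continuous_on by blast+
  hence [measurable]: "k \<in> borel_measurable borel" "h \<in> borel_measurable borel" by (auto intro: borel_measurable_continuous_onI)
  have kc: "isCont k x" for x using cont by (simp add: continuous_on_eq_continuous_at)
  have growth: "\<bar>g x\<bar> \<le> \<bar>g 0\<bar> + B" if "1-lipschitz_on UNIV g" "\<bar>x\<bar> \<le> B" for g :: "real \<Rightarrow> real" and x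
    using lipschitz_onD[OF that(1), of x 0] that(2) by (simp add: dist_real_def)
  have "(\<lambda>m. \<integral>\<omega>. k (Wm m \<omega>) \<partial>M) \<longlonglongrightarrow> (\<integral>\<omega>. k (W \<omega>) \<partial>M)"
  proof (rule integral_dominated_convergence[where w = "\<lambda>_. \<bar>k 0\<bar> + B"])
    show "AE \<omega> in M. (\<lambda>m. k (Wm m \<omega>)) \<longlonglongrightarrow> k (W \<omega>)"
      using lim by eventually_elim (rule isCont_tendsto_compose[OF kc])
    show "AE \<omega> in M. norm (k (Wm m \<omega>)) \<le> \<bar>k 0\<bar> + B" for m using growth[OF k bound(1)] by simp
  qed simp_all
  hence "(\<lambda>m. \<bar>(\<integral>\<omega>. k (Wm m \<omega>) \<partial>M) - std_normal_mean k\<bar>)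
      \<longlonglongrightarrow> \<bar>(\<integral>\<omega>. k (W \<omega>) \<partial>M) - std_normal_mean k\<bar>" by (intro tendsto_intros)
  hence a: "\<bar>(\<integral>\<omega>. k (W \<omega>) \<partial>M) - std_normal_mean k\<bar> \<le> e"
    by (rule tendsto_upperbound[OF _ smooth[OF k k']]) simp
  have iW: "integrable M (\<lambda>\<omega>. g (W \<omega>))" if "1-lipschitz_on UNIV g" "g \<in> borel_measurable borel" for g :: "real \<Rightarrow> real"
    by (rule integrable_const_bound[where B = "\<bar>g 0\<bar> + B"]) (use that growth[OF that(1) bound(2)] in auto)
  have b: "\<bar>(\<integral>\<omega>. k (W \<omega>) \<partial>M) - (\<integral>\<omega>. h (W \<omega>) \<partial>M)\<bar> \<le> \<eta> / 2"
  proof -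
    have "\<bar>\<integral>\<omega>. k (W \<omega>) - h (W \<omega>) \<partial>M\<bar> \<le> \<eta> / 2" by (rule integral_abs_bounded) (use kh in auto)
    thus ?thesis using iW[OF k] iW[OF h] by simp
  qed
  have c: "\<bar>std_normal_mean k - std_normal_mean h\<bar> \<le> \<eta> / 2"
  proof -
    have i: "integrable lborel (\<lambda>t. std_normal_density t * k t)" "integrable lborel (\<lambda>t. std_normal_density t * h t)"
      using lipschitz_integrable_std_normal(1) k h by blast+
    have "\<bar>\<integral>t. std_normal_density t * k t - std_normal_density t * h t \<partial>lborel\<bar>
        \<le> (\<integral>t. std_normal_density t * (\<eta> / 2) \<partial>lborel)"
    proof (rule order_trans[OF integral_abs_bound integral_mono])
      show "integrable lborel (\<lambda>t. \<bar>std_normal_density t * k t - std_normal_density t * h t\<bar>)" using i by simp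
      show "integrable lborel (\<lambda>t. std_normal_density t * (\<eta> / 2))" by simp
      fix t show "\<bar>std_normal_density t * k t - std_normal_density t * h t\<bar> \<le> std_normal_density t * (\<eta> / 2)"
        unfolding right_diff_distrib[symmetric] abs_mult using mult_left_mono[OF kh[of t], of "std_normal_density t"] by simp
    qed
    also have "\<dots> = \<eta> / 2" by simp
    finally show ?thesis using i by simp
  qed
  show "\<bar>(\<integral>\<omega>. h (W \<omega>) \<partial>M) - std_normal_mean h\<bar> \<le> e + \<eta>"
    using a b c by linarith
qed

text \<open>
  Indicators of half-lines are squeezed between continuous ramps \<open>r\<close> of width \<open>\<eta>\<close>, for which
  the means converge; then \<open>\<eta>\<close> tends to \<open>0\<close>, as the normal distribution function is
  continuous.
\<close>
lemma halfline_limit_bound: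
  fixes W :: "'a \<Rightarrow> real" and Wm :: "nat \<Rightarrow> 'a \<Rightarrow> real"
  assumes [measurable]: "W \<in> borel_measurable M" "\<And>m. Wm m \<in> borel_measurable M"
    and lim: "AE \<omega> in M. (\<lambda>m. Wm m \<omega>) \<longlonglongrightarrow> W \<omega>"
    and cdf: "\<And>x. \<forall>\<^sub>F m in sequentially. \<bar>(\<integral>\<omega>. indicator {..x} (Wm m \<omega>) \<partial>M) - std_normal_cdf x\<bar> \<le> e"
  shows "\<bar>(\<integral>\<omega>. indicator {..x} (W \<omega>) \<partial>M) - std_normal_cdf x\<bar> \<le> e"
proof -
  define r where "r = (\<lambda>a \<eta> u. max 0 (min 1 ((a + \<eta> - u) / \<eta>)) :: real)"
  have r_cont: "isCont (r a \<eta>) u" if "\<eta> > 0" for a \<eta> u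
    unfolding r_def using that by (intro continuous_intros) auto
  have [measurable]: "r a \<eta> \<in> borel_measurable borel" for a \<eta> unfolding r_def by measurable
  have r_bounds: "indicator {..a} u \<le> r a \<eta> u" "r a \<eta> u \<le> indicator {..a + \<eta>} u" "\<bar>r a \<eta> u\<bar> \<le> 1" if "\<eta> > 0" for a \<eta> u
    using that by (auto simp: r_def indicator_def le_divide_eq min_def max_def divide_le_eq)
  have r_lim: "(\<lambda>m. \<integral>\<omega>. r a \<eta> (Wm m \<omega>) \<partial>M) \<longlonglongrightarrow> (\<integral>\<omega>. r a \<eta> (W \<omega>) \<partial>M)" if \<eta>: "\<eta> > 0" for a \<eta>
  proof (rule integral_dominated_convergence[where w = "\<lambda>_. 1"])
    show "AE \<omega> in M. (\<lambda>m. r a \<eta> (Wm m \<omega>)) \<longlonglongrightarrow> r a \<eta> (W \<omega>)"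
      using lim by eventually_elim (rule isCont_tendsto_compose[OF r_cont[OF \<eta>]])
  qed (use r_bounds(3)[OF \<eta>] in simp_all)
  have int: "integrable M (\<lambda>\<omega>. r a \<eta> (U \<omega>))" "integrable M (\<lambda>\<omega>. indicator {..a} (U \<omega>) :: real)"
    if [measurable]: "U \<in> borel_measurable M" and \<eta>: "\<eta> > 0" for U a \<eta>
    by (rule integrable_const_bound[where B = 1], use r_bounds(3)[OF \<eta>] in \<open>auto simp: indicator_def\<close>)+
  have upper: "(\<integral>\<omega>. indicator {..x} (W \<omega>) \<partial>M) \<le> std_normal_cdf (x + \<eta>) + e" if \<eta>: "\<eta> > 0" for \<eta>
  proof -
    have "(\<integral>\<omega>. indicator {..x} (W \<omega>) \<partial>M) \<le> (\<integral>\<omega>. r x \<eta> (W \<omega>) \<partial>M)"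
      by (rule integral_mono) (use \<eta> int r_bounds in auto)
    also have "\<dots> \<le> std_normal_cdf (x + \<eta>) + e"
    proof (rule tendsto_upperbound[OF r_lim[OF \<eta>]])
      show "\<forall>\<^sub>F m in sequentially. (\<integral>\<omega>. r x \<eta> (Wm m \<omega>) \<partial>M) \<le> std_normal_cdf (x + \<eta>) + e"
        using cdf[of "x + \<eta>"]
      proof eventually_elim
        case (elim m)
        have "(\<integral>\<omega>. r x \<eta> (Wm m \<omega>) \<partial>M) \<le> (\<integral>\<omega>. indicator {..x + \<eta>} (Wm m \<omega>) \<partial>M)"
          by (rule integral_mono) (use \<eta> int r_bounds in auto)
        thus ?case using elim by linarith
      qed
    qed simp
    finally show ?thesis .
  qed
  have lower: "std_normal_cdf (x - \<eta>) - e \<le> (\<integral>\<omega>. indicator {..x} (W \<omega>) \<partial>M)" if \<eta>: "\<eta> > 0" for \<eta>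
  proof -
    have "std_normal_cdf (x - \<eta>) - e \<le> (\<integral>\<omega>. r (x - \<eta>) \<eta> (W \<omega>) \<partial>M)"
    proof (rule tendsto_lowerbound[OF r_lim[OF \<eta>]])
      show "\<forall>\<^sub>F m in sequentially. std_normal_cdf (x - \<eta>) - e \<le> (\<integral>\<omega>. r (x - \<eta>) \<eta> (Wm m \<omega>) \<partial>M)"
        using cdf[of "x - \<eta>"]
      proof eventually_elim
        case (elim m)
        have "(\<integral>\<omega>. indicator {..x - \<eta>} (Wm m \<omega>) \<partial>M) \<le> (\<integral>\<omega>. r (x - \<eta>) \<eta> (Wm m \<omega>) \<partial>M)"
          by (rule integral_mono) (use \<eta> int r_bounds in auto)
        thus ?case using elim by linarith
      qed
    qed simp
    also have "\<dots> \<le> (\<integral>\<omega>. indicator {..x} (W \<omega>) \<partial>M)"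
      by (rule integral_mono) (use \<eta> int r_bounds(2)[OF \<eta>, of "x - \<eta>"] in auto)
    finally show ?thesis .
  qed
  have cc: "isCont std_normal_cdf x" by (rule DERIV_isCont[OF std_normal_cdf_deriv])
  have "((\<lambda>\<eta>. std_normal_cdf (x + \<eta>) + e) \<longlongrightarrow> std_normal_cdf (x + 0) + e) (at_right 0)"
    using cc by (intro tendsto_intros isCont_tendsto_compose[of "x + 0" std_normal_cdf]) auto
  hence "(\<integral>\<omega>. indicator {..x} (W \<omega>) \<partial>M) \<le> std_normal_cdf (x + 0) + e"
    by (rule tendsto_lowerbound) (use upper in \<open>auto simp: eventually_at_filter\<close>)
  moreover have "((\<lambda>\<eta>. std_normal_cdf (x - \<eta>) - e) \<longlongrightarrow> std_normal_cdf (x - 0) - e) (at_right 0)"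
    using cc by (intro tendsto_intros isCont_tendsto_compose[of "x - 0" std_normal_cdf]) auto
  hence "std_normal_cdf (x - 0) - e \<le> (\<integral>\<omega>. indicator {..x} (W \<omega>) \<partial>M)"
    by (rule tendsto_upperbound) (use lower in \<open>auto simp: eventually_at_filter\<close>)
  ultimately show ?thesis by (simp add: abs_le_iff)
qed

end

lemma (in moving_average) partial_sum_bound:
  assumes "continuous_on UNIV f" and f: "\<And>x. \<bar>f x\<bar> \<le> c"
  shows "\<bar>partial_sum f n \<omega>\<bar> \<le> 2 * c * real n"
proof -
  have "\<bar>\<integral>\<omega>'. f (X 1 \<omega>') \<partial>M\<bar> \<le> c"
    by (rule integral_abs_bounded) (use assms in \<open>auto intro: borel_measurable_continuous_onI measurable_compose[OF X_measurable]\<close>)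
  hence "\<bar>f y - (\<integral>\<omega>'. f (X 1 \<omega>') \<partial>M)\<bar> \<le> 2 * c" for y using f[of y] by linarith
  hence "\<bar>partial_sum f n \<omega>\<bar> \<le> (\<Sum>t=1..n. 2 * c)"
    unfolding partial_sum_def[OF assms] by (intro order_trans[OF sum_abs] sum_mono)
  thus ?thesis by (simp add: mult.commute)
qed

text \<open>
  The bounds are applied to the truncated sums, divided by their own standard deviations, and
  the truncation is removed. For large \<open>n\<close>, the variance is at least a multiple of \<open>n\<close>.
\<close>
lemma (in moving_average) normal_approximation:
  fixes f :: "real \<Rightarrow> real" and K K\<^sub>b \<beta> d :: real
  assumes f: "f \<in> C_b2"
    and tail: "K \<ge> 0" "\<And>u. u > 0 \<Longrightarrow> measure \<mu> {x. u \<le> \<bar>x\<bar>} \<le> K * u powr (- \<beta>)"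
    and decay: "K\<^sub>b > 0" "\<And>n. \<bar>b n\<bar> \<le> K\<^sub>b * (real n + 1) powr (- (1 - d))"
    and \<beta>: "0 < \<beta>" "\<beta> < 2" and d: "d < 1 - 2 / \<beta>"
    and lrv: "(\<Sum>\<^sub>\<infinity>j\<in>UNIV. cov M (\<lambda>\<omega>. f (X 0 \<omega>)) (\<lambda>\<omega>. f (X j \<omega>))) > 0"
  obtains C n0 where "C > 0"
    "\<And>n h. n \<ge> n0 \<Longrightarrow> n \<ge> 1 \<Longrightarrow> n \<ge> 2 \<or> d \<noteq> 1 - 3 / \<beta> \<Longrightarrow> 1-lipschitz_on UNIV h \<Longrightarrow>
       \<bar>(\<integral>\<omega>. h (partial_sum f n \<omega> / sqrt (\<integral>\<omega>'. (partial_sum f n \<omega>')\<^sup>2 \<partial>M)) \<partial>M) - std_normal_mean h\<bar>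
         \<le> C * wasserstein_rate \<beta> d n"
    "\<And>n x. n \<ge> n0 \<Longrightarrow> n \<ge> 1 \<Longrightarrow> n \<ge> 2 \<or> d \<noteq> 1 - 4 / \<beta> \<Longrightarrow>
       \<bar>(\<integral>\<omega>. indicator {..x} (partial_sum f n \<omega> / sqrt (\<integral>\<omega>'. (partial_sum f n \<omega>')\<^sup>2 \<partial>M)) \<partial>M) - std_normal_cdf x\<bar>
         \<le> C * kolmogorov_rate \<beta> d n"
proof -
  obtain c where c: "c > 0" and f_cont: "continuous_on UNIV f" and f_bound: "\<And>x. \<bar>f x\<bar> \<le> c"
    and f1: "\<And>u p. \<bar>f u - f (u + p)\<bar> \<le> c * min 1 \<bar>p\<bar>"
    and f2: "\<And>u p q. \<bar>f u - f (u + p) - (f (u + q) - f (u + q + p))\<bar> \<le> c * (min 1 \<bar>p\<bar> * min 1 \<bar>q\<bar>)"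
    using C_b2_increments[OF f] by metis
  obtain v0 n0 where v0: "v0 > 0" and n0: "\<And>n. n \<ge> n0 \<Longrightarrow> v0 * real n \<le> (\<integral>\<omega>. (partial_sum f n \<omega>)\<^sup>2 \<partial>M)"
    by (rule variance_lower_bound[OF f_cont f_bound lrv]) (rule that; blast)
  define K2 where "K2 = sqrt (2 / v0)"
  have K2: "K2 > 0" using v0 by (simp add: K2_def)
  obtain C where C: "C > 0" and
    W: "\<And>n m \<rho> h h'. n \<ge> 1 \<Longrightarrow> 0 \<le> \<rho> \<Longrightarrow> \<rho> * sqrt (real n) \<le> K2 \<Longrightarrow>
       (\<integral>\<omega>. (\<rho> * trunc_sum f m n (\<lambda>i. \<epsilon> i \<omega>))\<^sup>2 \<partial>M) = 1 \<Longrightarrow> n \<ge> 2 \<or> d \<noteq> 1 - 3 / \<beta> \<Longrightarrow>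
       1-lipschitz_on UNIV h \<Longrightarrow> (\<And>x. (h has_real_derivative h' x) (at x)) \<Longrightarrow>
       \<bar>(\<integral>\<omega>. h (\<rho> * trunc_sum f m n (\<lambda>i. \<epsilon> i \<omega>)) \<partial>M) - std_normal_mean h\<bar>
         \<le> C * wasserstein_rate \<beta> d n" and
    Kol: "\<And>n m \<rho> x. n \<ge> 1 \<Longrightarrow> 0 \<le> \<rho> \<Longrightarrow> \<rho> * sqrt (real n) \<le> K2 \<Longrightarrow>
       (\<integral>\<omega>. (\<rho> * trunc_sum f m n (\<lambda>i. \<epsilon> i \<omega>))\<^sup>2 \<partial>M) = 1 \<Longrightarrow> n \<ge> 2 \<or> d \<noteq> 1 - 4 / \<beta> \<Longrightarrow>
       \<bar>(\<integral>\<omega>. indicator {..x} (\<rho> * trunc_sum f m n (\<lambda>i. \<epsilon> i \<omega>)) \<partial>M) - std_normal_cdf x\<bar>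
         \<le> C * kolmogorov_rate \<beta> d n"
    by (rule uniform_bounds[OF f_cont f_bound c f1 f2 tail decay \<beta> d K2]; blast)
  define \<sigma> where "\<sigma> = (\<lambda>n. sqrt (\<integral>\<omega>. (partial_sum f n \<omega>)\<^sup>2 \<partial>M))"
  define s where "s = (\<lambda>n m. \<integral>\<omega>. (trunc_sum f m n (\<lambda>i. \<epsilon> i \<omega>))\<^sup>2 \<partial>M)"
  \<comment> \<open>the maximum keeps the factors bounded for all \<open>m\<close>; for large \<open>m\<close> it is the first argument\<close>
  define \<rho> where "\<rho> = (\<lambda>n m. 1 / sqrt (max (s n m) (v0 / 2 * real n)))"
  let ?Wm = "\<lambda>n m \<omega>. \<rho> n m * trunc_sum f m n (\<lambda>i. \<epsilon> i \<omega>)"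
  let ?W = "\<lambda>n \<omega>. partial_sum f n \<omega> / \<sigma> n"
  have [measurable]: "(\<lambda>\<omega>. trunc_sum f m n (\<lambda>i. \<epsilon> i \<omega>)) \<in> borel_measurable M" "partial_sum f n \<in> borel_measurable M" for m n
    by (rule trunc_sum_measurable(2)[OF f_cont f_bound], rule partial_sum_measurable[OF f_cont f_bound])
  have meas: "?W n \<in> borel_measurable M" "?Wm n m \<in> borel_measurable M" for n m by measurable
  have approx: "AE \<omega> in M. (\<lambda>m. ?Wm n m \<omega>) \<longlonglongrightarrow> ?W n \<omega>" (is ?lim)
    "\<forall>\<^sub>F m in sequentially. (\<integral>\<omega>. (?Wm n m \<omega>)\<^sup>2 \<partial>M) = 1" (is ?var)
    "0 \<le> \<rho> n m" "\<rho> n m * sqrt (real n) \<le> K2" "\<bar>?Wm n m \<omega>\<bar> \<le> K2 * (2 * c * real n)" "\<bar>?W n \<omega>\<bar> \<le> K2 * (2 * c * real n)"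
    if n: "n \<ge> n0" "n \<ge> 1" for n m \<omega>
  proof -
    have \<sigma>2: "(\<sigma> n)\<^sup>2 \<ge> v0 * real n" using n0[OF n(1)] unfolding \<sigma>_def by (subst real_sqrt_pow2) auto
    have vn: "v0 / 2 * real n > 0" "v0 / 2 * real n < v0 * real n" using v0 n by auto
    have \<sigma>0: "\<sigma> n > 0"
    proof -
      have "\<sigma> n \<noteq> 0" using \<sigma>2 vn by auto
      moreover have "\<sigma> n \<ge> 0" unfolding \<sigma>_def by (intro real_sqrt_ge_zero Bochner_Integration.integral_nonneg) simp
      ultimately show ?thesis by simp
    qed
    have slim: "s n \<longlonglongrightarrow> (\<sigma> n)\<^sup>2"
    proof -
      have "(\<sigma> n)\<^sup>2 = (\<integral>\<omega>. (partial_sum f n \<omega>)\<^sup>2 \<partial>M)" unfolding \<sigma>_def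
        by (rule real_sqrt_pow2) (intro Bochner_Integration.integral_nonneg, simp)
      thus ?thesis unfolding s_def using trunc_second_moment_tendsto[OF f_cont f_bound, of n] by simp
    qed
    have "(\<lambda>m. max (s n m) (v0 / 2 * real n)) \<longlonglongrightarrow> max ((\<sigma> n)\<^sup>2) (v0 / 2 * real n)"
      by (intro tendsto_intros slim)
    moreover have mx: "max ((\<sigma> n)\<^sup>2) (v0 / 2 * real n) = (\<sigma> n)\<^sup>2" using \<sigma>2 vn by (intro max_absorb1) linarith
    ultimately have "(\<lambda>m. sqrt (max (s n m) (v0 / 2 * real n))) \<longlonglongrightarrow> sqrt ((\<sigma> n)\<^sup>2)" by (intro tendsto_real_sqrt) simp
    hence "(\<lambda>m. sqrt (max (s n m) (v0 / 2 * real n))) \<longlonglongrightarrow> \<sigma> n" using \<sigma>0 by simp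
    hence \<rho>lim: "\<rho> n \<longlonglongrightarrow> 1 / \<sigma> n" unfolding \<rho>_def using \<sigma>0 by (intro tendsto_divide) auto
    show ?lim using trunc_sum_tendsto[OF f_cont f_bound, of n]
    proof eventually_elim
      case (elim \<omega>)
      have "(\<lambda>m. ?Wm n m \<omega>) \<longlonglongrightarrow> 1 / \<sigma> n * partial_sum f n \<omega>" by (intro tendsto_mult \<rho>lim elim)
      thus ?case by simp
    qed
    have "\<forall>\<^sub>F m in sequentially. v0 / 2 * real n < s n m" using slim \<sigma>2 vn by (intro order_tendstoD(1)[OF slim]) linarith
    thus ?var
    proof eventually_elim
      case (elim m)
      hence "\<rho> n m = 1 / sqrt (s n m)" "s n m > 0" using vn by (simp_all add: \<rho>_def max_absorb1)
      hence "(\<rho> n m)\<^sup>2 * s n m = 1" by (simp add: power_divide)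
      thus ?case unfolding power_mult_distrib s_def by simp
    qed
    show \<rho>0: "0 \<le> \<rho> n m" using vn by (simp add: \<rho>_def max_def)
    have "sqrt (v0 / 2) * sqrt (real n) \<le> sqrt (max (s n m) (v0 / 2 * real n))" unfolding real_sqrt_mult[symmetric] by simp
    moreover have pos: "sqrt (max (s n m) (v0 / 2 * real n)) > 0" using vn by (simp add: less_max_iff_disj)
    moreover have K2v: "K2 * sqrt (v0 / 2) = 1" unfolding K2_def real_sqrt_mult[symmetric] using v0 by simp
    ultimately have "K2 * (sqrt (v0 / 2) * sqrt (real n)) \<le> K2 * sqrt (max (s n m) (v0 / 2 * real n))"
      using K2 by (intro mult_left_mono) auto
    hence "sqrt (real n) \<le> K2 * sqrt (max (s n m) (v0 / 2 * real n))" using K2v by (simp add: mult.assoc[symmetric])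
    thus \<rho>n: "\<rho> n m * sqrt (real n) \<le> K2" unfolding \<rho>_def using pos by (simp add: divide_le_eq)
    have n1: "1 \<le> sqrt (real n)" using n by simp
    have \<rho>K: "\<rho> n m \<le> K2" using mult_left_mono[OF n1 \<rho>0] \<rho>n by linarith
    show "\<bar>?Wm n m \<omega>\<bar> \<le> K2 * (2 * c * real n)" unfolding abs_mult
      using \<rho>0 \<rho>K K2 trunc_sum_bound[OF f_cont f_bound] by (intro mult_mono) auto
    have \<sigma>n: "sqrt v0 * sqrt (real n) \<le> \<sigma> n" using \<sigma>2 \<sigma>0 unfolding real_sqrt_mult[symmetric] by (intro real_le_lsqrt) auto
    have "sqrt (v0 / 2) \<le> \<sigma> n"
    proof -
      have "sqrt (v0 / 2) \<le> sqrt v0 * 1" using v0 by simp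
      also have "\<dots> \<le> sqrt v0 * sqrt (real n)" using n1 v0 by (intro mult_left_mono) auto
      finally show ?thesis using \<sigma>n by linarith
    qed
    hence "1 \<le> K2 * \<sigma> n" using K2v K2 mult_left_mono[of "sqrt (v0 / 2)" "\<sigma> n" K2] by simp
    hence \<sigma>K: "1 / \<sigma> n \<le> K2" using \<sigma>0 by (simp add: divide_le_eq)
    have "\<bar>1 / \<sigma> n\<bar> * \<bar>partial_sum f n \<omega>\<bar> \<le> K2 * (2 * c * real n)"
      using \<sigma>0 \<sigma>K K2 partial_sum_bound[OF f_cont f_bound] by (intro mult_mono) auto
    thus "\<bar>?W n \<omega>\<bar> \<le> K2 * (2 * c * real n)" by (simp add: abs_mult[symmetric])
  qed
  show ?thesis
  proof (rule that[OF C, of n0])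
    fix n :: nat and h :: "real \<Rightarrow> real"
    assume n: "n \<ge> n0" "n \<ge> 1" and crit: "n \<ge> 2 \<or> d \<noteq> 1 - 3 / \<beta>" and h: "1-lipschitz_on UNIV h"
    have "\<bar>(\<integral>\<omega>. h (?W n \<omega>) \<partial>M) - std_normal_mean h\<bar> \<le> C * wasserstein_rate \<beta> d n"
    proof (rule lipschitz_limit_bound[OF meas(1) meas(2) approx(5)[OF n] approx(6)[OF n] approx(1)[OF n] _ h])
      fix k k' :: "real \<Rightarrow> real"
      assume k: "1-lipschitz_on UNIV k" "\<And>x. (k has_real_derivative k' x) (at x)"
      show "\<forall>\<^sub>F m in sequentially. \<bar>(\<integral>\<omega>. k (?Wm n m \<omega>) \<partial>M) - std_normal_mean k\<bar> \<le> C * wasserstein_rate \<beta> d n"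
        using approx(2)[OF n] by eventually_elim (rule W[OF n(2) approx(3,4)[OF n] _ crit k])
    qed
    thus "\<bar>(\<integral>\<omega>. h (partial_sum f n \<omega> / sqrt (\<integral>\<omega>'. (partial_sum f n \<omega>')\<^sup>2 \<partial>M)) \<partial>M) - std_normal_mean h\<bar>
        \<le> C * wasserstein_rate \<beta> d n" unfolding \<sigma>_def .
  next
    fix n :: nat and x :: real
    assume n: "n \<ge> n0" "n \<ge> 1" and crit: "n \<ge> 2 \<or> d \<noteq> 1 - 4 / \<beta>"
    have "\<bar>(\<integral>\<omega>. indicator {..x} (?W n \<omega>) \<partial>M) - std_normal_cdf x\<bar> \<le> C * kolmogorov_rate \<beta> d n"
    proof (rule halfline_limit_bound[OF meas(1) meas(2) approx(1)[OF n]])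
      fix x
      show "\<forall>\<^sub>F m in sequentially. \<bar>(\<integral>\<omega>. indicator {..x} (?Wm n m \<omega>) \<partial>M) - std_normal_cdf x\<bar> \<le> C * kolmogorov_rate \<beta> d n"
        using approx(2)[OF n] by eventually_elim (rule Kol[OF n(2) approx(3,4)[OF n] _ crit])
    qed
    thus "\<bar>(\<integral>\<omega>. indicator {..x} (partial_sum f n \<omega> / sqrt (\<integral>\<omega>'. (partial_sum f n \<omega>')\<^sup>2 \<partial>M)) \<partial>M) - std_normal_cdf x\<bar>
        \<le> C * kolmogorov_rate \<beta> d n" unfolding \<sigma>_def .
  qed
qed

section \<open>Stable fractional ARIMA processes\<close>

lemma rate_pos:
  assumes "n \<ge> 1"
  shows "n \<ge> 2 \<or> d \<noteq> 1 - 3 / \<beta> \<Longrightarrow> wasserstein_rate \<beta> d n > 0"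
    and "n \<ge> 2 \<or> d \<noteq> 1 - 4 / \<beta> \<Longrightarrow> kolmogorov_rate \<beta> d n > 0"
  using assms by (auto simp: wasserstein_rate_def kolmogorov_rate_def)

theorem corollary1p5:
  fixes M :: "'a measure" and N :: "'b measure"
    and \<epsilon> X :: "int \<Rightarrow> 'a \<Rightarrow> real" and Z :: "'b \<Rightarrow> real"
    and \<beta> d :: real and p q :: nat and \<phi> \<theta> :: "nat \<Rightarrow> real"
    and f :: "real \<Rightarrow> real" and V :: "nat \<Rightarrow> 'a \<Rightarrow> real" and v :: "nat \<Rightarrow> real"
  assumes "prob_space M" and "prob_space N"
    and "0 < \<beta>" and "\<beta> < 2"
    and "d \<notin> \<int>" and "d < 1 - 2 / \<beta>"
    and no_common_root:
      "\<not> (\<exists>z. cpoly (ar_poly p \<phi>) z = 0 \<and> cpoly (ma_poly q \<theta>) z = 0)"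
    and no_root_in_disk: "\<And>z. cmod z \<le> 1 \<Longrightarrow> cpoly (ar_poly p \<phi>) z \<noteq> 0"
    and "iid_symmetric_stable M \<beta> \<epsilon>"
    and "fractional_arima M (ar_poly p \<phi>) (ma_poly q \<theta>) d \<epsilon> X"
    and "f \<in> C_b2"
    and V: "\<And>n \<omega>. V n \<omega> = real n powr (- 1 / 2) *
      (\<Sum>t=1..n. (f (X (int t) \<omega>) - prob_space.expectation M (\<lambda>\<omega>'. f (X 1 \<omega>'))))"
    and v: "\<And>n. v n = sqrt (prob_space.variance M (V n))"
    and long_run_variance:
      "(\<Sum>\<^sub>\<infinity>j\<in>UNIV. cov M (\<lambda>\<omega>. f (X 0 \<omega>)) (\<lambda>\<omega>. f (X j \<omega>))) > 0"
    and "distributed N lborel Z std_normal_density"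
  shows "\<exists>C>0. \<forall>n\<ge>1.
     (n \<ge> 2 \<or> d \<noteq> 1 - 3 / \<beta> \<longrightarrow>
        wasserstein_dist M (\<lambda>\<omega>. inverse (v n) * V n \<omega>) N Z \<le> ereal (C * wasserstein_rate \<beta> d n)) \<and>
     (n \<ge> 2 \<or> d \<noteq> 1 - 4 / \<beta> \<longrightarrow>
        kolmogorov_dist M (\<lambda>\<omega>. inverse (v n) * V n \<omega>) N Z \<le> ereal (C * kolmogorov_rate \<beta> d n))"
proof -
  interpret prob_space M by fact
  interpret N: prob_space N by fact
  note \<beta> = \<open>0 < \<beta>\<close> \<open>\<beta> < 2\<close> and d = \<open>d < 1 - 2 / \<beta>\<close> and f = \<open>f \<in> C_b2\<close> and Z = \<open>distributed N lborel Z std_normal_density\<close>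
  define \<mu> where "\<mu> = distr M borel (\<epsilon> 0)"
  define b where "b = arima_coeff (ar_poly p \<phi>) (ma_poly q \<theta>) d"
  have stable: "symmetric_stable \<beta> \<mu>" and law: "distr M borel (\<epsilon> i) = \<mu>" for i
    using \<open>iid_symmetric_stable M \<beta> \<epsilon>\<close> unfolding iid_symmetric_stable_def \<mu>_def by blast+
  interpret moving_average M \<epsilon> X \<mu> b
  proof
    show "indep_vars (\<lambda>_. borel) \<epsilon> UNIV"
      using \<open>iid_symmetric_stable M \<beta> \<epsilon>\<close> unfolding iid_symmetric_stable_def by blast
    show "X t \<in> borel_measurable M" "AE \<omega> in M. (\<lambda>j. b j * \<epsilon> (t - int j) \<omega>) sums X t \<omega>" for t
      using \<open>fractional_arima M (ar_poly p \<phi>) (ma_poly q \<theta>) d \<epsilon> X\<close> unfolding fractional_arima_def b_def by blast+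
  qed (rule law)
  obtain K where K: "K \<ge> 0" "\<And>u. u > 0 \<Longrightarrow> measure \<mu> {x. u \<le> \<bar>x\<bar>} \<le> K * u powr (- \<beta>)"
    by (rule stable_tail[OF stable \<beta>]) (rule that; blast)
  have d1: "d < 1"
  proof -
    have "2 / \<beta> > 0" using \<beta> by simp
    thus ?thesis using d by linarith
  qed
  obtain Kb where Kb: "Kb > 0" "\<And>n. \<bar>b n\<bar> \<le> Kb * (real n + 1) powr (- (1 - d))"
    by (rule arima_coeff_decay[OF no_root_in_disk d1, of "ma_poly q \<theta>", folded b_def], assumption) (rule that; blast)
  obtain c where c: "c > 0" and f_cont: "continuous_on UNIV f" and f_bound: "\<And>x. \<bar>f x\<bar> \<le> c"
    using C_b2_increments[OF f] by metis
  define U where "U = (\<lambda>n \<omega>. partial_sum f n \<omega> / sqrt (\<integral>\<omega>'. (partial_sum f n \<omega>')\<^sup>2 \<partial>M))"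
  have U_fold: "partial_sum f n \<omega> / sqrt (\<integral>\<omega>'. (partial_sum f n \<omega>')\<^sup>2 \<partial>M) = U n \<omega>" for n \<omega>
    by (simp add: U_def)
  obtain C n0 where C: "C > 0" and
    large_W: "\<And>n h. n \<ge> n0 \<Longrightarrow> n \<ge> 1 \<Longrightarrow> n \<ge> 2 \<or> d \<noteq> 1 - 3 / \<beta> \<Longrightarrow> 1-lipschitz_on UNIV h \<Longrightarrow>
       \<bar>(\<integral>\<omega>. h (U n \<omega>) \<partial>M) - std_normal_mean h\<bar> \<le> C * wasserstein_rate \<beta> d n" and
    large_K: "\<And>n x. n \<ge> n0 \<Longrightarrow> n \<ge> 1 \<Longrightarrow> n \<ge> 2 \<or> d \<noteq> 1 - 4 / \<beta> \<Longrightarrow>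
       \<bar>(\<integral>\<omega>. indicator {..x} (U n \<omega>) \<partial>M) - std_normal_cdf x\<bar> \<le> C * kolmogorov_rate \<beta> d n"
    by (rule normal_approximation[OF f K Kb \<beta> d long_run_variance, unfolded U_fold], assumption) (rule that; blast)
  have Um[measurable]: "U n \<in> borel_measurable M" for n
    unfolding U_def using partial_sum_measurable[OF f_cont f_bound] by measurable
  have eq: "inverse (v n) * V n \<omega> = U n \<omega>" if n: "n \<ge> 1" for n \<omega>
  proof -
    let ?s = "real n powr (- 1 / 2)"
    have Vn: "V n = (\<lambda>\<omega>. ?s * partial_sum f n \<omega>)" by (simp add: V partial_sum_def[OF f_cont f_bound] fun_eq_iff)
    have "variance (V n) = ?s\<^sup>2 * (\<integral>\<omega>. (partial_sum f n \<omega>)\<^sup>2 \<partial>M)"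
      unfolding Vn using partial_sum_mean[OF f_cont f_bound, of n] by (simp add: power_mult_distrib)
    hence "v n = ?s * sqrt (\<integral>\<omega>. (partial_sum f n \<omega>)\<^sup>2 \<partial>M)" unfolding v by (simp add: real_sqrt_mult)
    thus ?thesis unfolding Vn U_def using n by (simp add: field_simps)
  qed
  have Zh: "(\<integral>\<omega>. h (Z \<omega>) \<partial>N) = std_normal_mean h"
    if "h \<in> borel_measurable borel" for h :: "real \<Rightarrow> real"
    by (rule distributed_integral[OF Z, symmetric]) (use that in auto)
  have Zm[measurable]: "Z \<in> borel_measurable N" using distributed_measurable[OF Z] by simp
  have prob_eq: "measure M' {\<omega> \<in> space M'. G \<omega> \<le> x} = (\<integral>\<omega>. indicator {..x} (G \<omega>) \<partial>M')"
    if "prob_space M'" and [measurable]: "G \<in> borel_measurable M'" for M' :: "'c measure" and G x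
  proof -
    interpret M': prob_space M' by fact
    have "(\<integral>\<omega>. indicator {..x} (G \<omega>) \<partial>M') = (\<integral>\<omega>. indicator {\<omega> \<in> space M'. G \<omega> \<le> x} \<omega> \<partial>M' :: real)"
      by (rule Bochner_Integration.integral_cong) (auto simp: indicator_def)
    moreover have "{\<omega> \<in> space M'. G \<omega> \<le> x} \<inter> space M' = {\<omega> \<in> space M'. G \<omega> \<le> x}" by blast
    ultimately show ?thesis by simp
  qed
  have ZK: "measure N {\<omega> \<in> space N. Z \<omega> \<le> x} = std_normal_cdf x" for x
    unfolding prob_eq[OF \<open>prob_space N\<close> Zm] Zh[OF borel_measurable_indicator[OF borel_closed[OF closed_atMost]]] std_normal_cdf_def by (simp only: mult.commute)
  define B where "B = (\<lambda>n. 2 * c * real n / \<bar>sqrt (\<integral>\<omega>'. (partial_sum f n \<omega>')\<^sup>2 \<partial>M)\<bar>)"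
  have B: "\<bar>U n \<omega>\<bar> \<le> B n" for n \<omega>
    unfolding U_def B_def abs_divide by (intro divide_right_mono partial_sum_bound[OF f_cont f_bound] abs_ge_zero)
  have B0: "0 \<le> B n" for n using c unfolding B_def by (intro divide_nonneg_nonneg abs_ge_zero) simp
  \<comment> \<open>the sum serves \<open>n < n0\<close>, where the distances are at most \<open>B n + 1\<close>; if a rate is \<open>0\<close>, so is the quotient\<close>
  define C' where "C' = C + (\<Sum>n<n0. (B n + 1) / \<bar>wasserstein_rate \<beta> d n\<bar> + (B n + 1) / \<bar>kolmogorov_rate \<beta> d n\<bar>)"
  have terms: "(B n + 1) / \<bar>wasserstein_rate \<beta> d n\<bar> \<le> C'" "(B n + 1) / \<bar>kolmogorov_rate \<beta> d n\<bar> \<le> C'" if "n < n0" for n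
  proof -
    have B1: "0 \<le> B n + 1" for n using B0[of n] by linarith
    have "(B n + 1) / \<bar>wasserstein_rate \<beta> d n\<bar> + (B n + 1) / \<bar>kolmogorov_rate \<beta> d n\<bar>
        \<le> (\<Sum>n<n0. (B n + 1) / \<bar>wasserstein_rate \<beta> d n\<bar> + (B n + 1) / \<bar>kolmogorov_rate \<beta> d n\<bar>)"
      using that B1 by (intro member_le_sum) auto
    moreover have "0 \<le> (B n + 1) / \<bar>wasserstein_rate \<beta> d n\<bar>" "0 \<le> (B n + 1) / \<bar>kolmogorov_rate \<beta> d n\<bar>"
      using B1[of n] by simp_all
    ultimately show "(B n + 1) / \<bar>wasserstein_rate \<beta> d n\<bar> \<le> C'" "(B n + 1) / \<bar>kolmogorov_rate \<beta> d n\<bar> \<le> C'"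
      unfolding C'_def using C by linarith+
  qed
  have CC: "C \<le> C'" unfolding C'_def using B0 by (auto intro!: sum_nonneg add_nonneg_nonneg divide_nonneg_nonneg)
  show ?thesis
  proof (intro exI[of _ C'] conjI allI impI)
    show "C' > 0" using C CC by linarith
  next
    fix n :: nat assume n: "n \<ge> 1" and crit: "n \<ge> 2 \<or> d \<noteq> 1 - 3 / \<beta>"
    note r = rate_pos(1)[OF n crit]
    have "\<bar>(\<integral>\<omega>. h (U n \<omega>) \<partial>M) - std_normal_mean h\<bar> \<le> C' * wasserstein_rate \<beta> d n"
      if h: "1-lipschitz_on UNIV h" for h
    proof (cases "n < n0")
      case True
      have hm: "h \<in> borel_measurable borel"
        using lipschitz_on_continuous_on[OF h] by (rule borel_measurable_continuous_onI)
      let ?\<kappa> = "\<integral>t. std_normal_density t * h t \<partial>lborel"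
      have pw: "\<bar>h (U n \<omega>) - ?\<kappa>\<bar> \<le> B n + 1" for \<omega>
        using lipschitz_integrable_std_normal(2)[OF h, of "U n \<omega>"] B[of n \<omega>] by linarith
      have "\<bar>h (U n \<omega>)\<bar> \<le> B n + 1 + \<bar>?\<kappa>\<bar>" for \<omega> using pw[of \<omega>] by linarith
      hence "integrable M (\<lambda>\<omega>. h (U n \<omega>))"
        by (intro integrable_bounded[where c = "B n + 1 + \<bar>?\<kappa>\<bar>"] measurable_compose[OF Um hm])
      hence "(\<integral>\<omega>. h (U n \<omega>) - ?\<kappa> \<partial>M) = (\<integral>\<omega>. h (U n \<omega>) \<partial>M) - ?\<kappa>" by (simp add: prob_space)
      hence "\<bar>(\<integral>\<omega>. h (U n \<omega>) \<partial>M) - ?\<kappa>\<bar> \<le> B n + 1" using integral_abs_bounded[of "\<lambda>\<omega>. h (U n \<omega>) - ?\<kappa>" "B n + 1"] pw by simp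
      also have "B n + 1 = (B n + 1) / \<bar>wasserstein_rate \<beta> d n\<bar> * wasserstein_rate \<beta> d n" using r by simp
      also have "\<dots> \<le> C' * wasserstein_rate \<beta> d n" using terms(1)[OF True] r by (intro mult_right_mono) auto
      finally show ?thesis .
    next
      case False
      hence "\<bar>(\<integral>\<omega>. h (U n \<omega>) \<partial>M) - std_normal_mean h\<bar> \<le> C * wasserstein_rate \<beta> d n"
        by (intro large_W n crit h) simp
      also have "\<dots> \<le> C' * wasserstein_rate \<beta> d n" using CC r by (intro mult_right_mono) auto
      finally show ?thesis .
    qed
    thus "wasserstein_dist M (\<lambda>\<omega>. inverse (v n) * V n \<omega>) N Z \<le> ereal (C' * wasserstein_rate \<beta> d n)"
      unfolding wasserstein_dist_def eq[OF n]
    proof (intro SUP_least)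
      fix h :: "real \<Rightarrow> real" assume "h \<in> {h. 1-lipschitz_on UNIV h}"
      hence h: "1-lipschitz_on UNIV h" by simp
      have hm: "h \<in> borel_measurable borel"
        using lipschitz_on_continuous_on[OF h] by (rule borel_measurable_continuous_onI)
      assume "\<And>h. 1-lipschitz_on UNIV h \<Longrightarrow>
        \<bar>(\<integral>\<omega>. h (U n \<omega>) \<partial>M) - std_normal_mean h\<bar> \<le> C' * wasserstein_rate \<beta> d n"
      from this[OF h] show "ereal \<bar>(\<integral>\<omega>. h (U n \<omega>) \<partial>M) - (\<integral>\<omega>. h (Z \<omega>) \<partial>N)\<bar> \<le> ereal (C' * wasserstein_rate \<beta> d n)"
        unfolding Zh[OF hm] by simp
    qed
  next
    fix n :: nat assume n: "n \<ge> 1" and crit: "n \<ge> 2 \<or> d \<noteq> 1 - 4 / \<beta>"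
    note r = rate_pos(2)[OF n crit]
    have "\<bar>(\<integral>\<omega>. indicator {..x} (U n \<omega>) \<partial>M) - std_normal_cdf x\<bar> \<le> C' * kolmogorov_rate \<beta> d n" for x
    proof (cases "n < n0")
      case True
      have "\<bar>(\<integral>\<omega>. indicator {..x} (U n \<omega>) \<partial>M) - std_normal_cdf x\<bar> \<le> B n + 1"
      proof -
        have "0 \<le> (\<integral>\<omega>. indicator {..x} (U n \<omega>) \<partial>M :: real)" "(\<integral>\<omega>. indicator {..x} (U n \<omega>) \<partial>M :: real) \<le> 1"
          unfolding prob_eq[OF \<open>prob_space M\<close> Um, symmetric] by simp_all
        thus ?thesis using std_normal_cdf_bounds[of x] B0[of n] by linarith
      qed
      also have "B n + 1 = (B n + 1) / \<bar>kolmogorov_rate \<beta> d n\<bar> * kolmogorov_rate \<beta> d n" using r by simp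
      also have "\<dots> \<le> C' * kolmogorov_rate \<beta> d n" using terms(2)[OF True] r by (intro mult_right_mono) auto
      finally show ?thesis .
    next
      case False
      hence "\<bar>(\<integral>\<omega>. indicator {..x} (U n \<omega>) \<partial>M) - std_normal_cdf x\<bar> \<le> C * kolmogorov_rate \<beta> d n"
        by (intro large_K n crit) simp
      also have "\<dots> \<le> C' * kolmogorov_rate \<beta> d n" using CC r by (intro mult_right_mono) auto
      finally show ?thesis .
    qed
    thus "kolmogorov_dist M (\<lambda>\<omega>. inverse (v n) * V n \<omega>) N Z \<le> ereal (C' * kolmogorov_rate \<beta> d n)"
      unfolding kolmogorov_dist_def eq[OF n] ZK prob_eq[OF \<open>prob_space M\<close> Um] by (intro SUP_least) simp
  qed
qed

end
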